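(* Let $X$ be a totally disconnected compact metrizable space, $\sigma:X\to X$ a surjective local homeomorphism, and $\{\mathcal P_n\}_{n\ge0}$ a $\sigma$-refined sequence of partitions of $X$ with associated diagram $(F,D)$. Take $K=\mathbb C$ and let $\varphi:\mathcal A_\infty\to A_{\mathbb C}(\mathcal G(X,\sigma))$ be the canonical $*$-isomorphism. Then there is a unique $*$-isomorphism $\overline\varphi:\mathcal B_\infty\to C^*(\mathcal G(X,\sigma))$ such that the diagram $$\begin{array}{ccc}\mathcal A_\infty&\xrightarrow{\ \varphi\ }&A_{\mathbb C}(\mathcal G(X,\sigma))\\ \downarrow&&\downarrow\\ \mathcal B_\infty&\xrightarrow{\ \overline\varphi\ }&C^*(\mathcal G(X,\sigma))\end{array}$$ is commutative, where the vertical maps are the canonical ones.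
   Context: **Refined partitions.** A partition of $X$ is a finite family of nonempty pairwise disjoint clopen sets with union $X$. $\mathcal P_1\precsim\mathcal P_2$: every element of $\mathcal P_2$ is contained in an element of $\mathcal P_1$; $\mathcal P_1\vee\mathcal P_2$: nonempty intersections; $\operatorname{diam}(\mathcal P)$: maximal diameter of an element. Let $N(\sigma)=\sup_x|\sigma^{-1}(\{x\})|<\infty$, $\mathcal U_{\ge k}=\{x:|\sigma^{-1}(\{x\})|\ge k\}$, $\mathcal P^\sigma=\bigcup_{k=1}^{N(\sigma)}\{\sigma(Z_1)\cap\dots\cap\sigma(Z_k)\setminus\mathcal U_{\ge k+1}\ne\emptyset\mid Z_i\in\mathcal P\text{ all different}\}$ and $\sigma^{-1}(\mathcal P)=\{\sigma^{-1}(Z)\mid Z\in\mathcal P\}$. $\{\mathcal P_n\}$ is $\sigma$-refined if $\sigma|_Z$ is a homeomorphism onto its image for $Z\in\mathcal P_0$; $\mathcal P_n\precsim\mathcal P_{n+1}$; $\bigcup_n\mathcal P_n$ generates the topology; $\operatorname{diam}(\mathcal P_n)\to0$; $\mathcal P_{2j}\vee\mathcal P_{2j}^\sigma\precsim\mathcal P_{2j+1}$ and $\mathcal P_{2j+1}\vee\sigma^{-1}(\mathcal P_{2j+1})\precsim\mathcal P_{2j+2}$ for $j\ge0$. **The diagram $(F,D)$.** A separated graph is a directed graph $(E^0,E^1,r,s)$ with partitions $C_v$ of the sets $r^{-1}(v)$ into nonempty subsets. Put $F^{0,n}=\mathcal P_n$. Blue edges in $F^{1,n}$: one edge with source $Z'\in\mathcal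 P_{n+1}$ and range $Z\in\mathcal P_n$ whenever $Z'\subseteq Z$. Red edges in $F^{1,2j}$: one edge with source $Z'\in\mathcal P_{2j+1}$, range $Z\in\mathcal P_{2j}$ whenever $Z'\subseteq\sigma(Z)$. Red edges in $F^{1,2j+1}$: one edge with source $Z''\in\mathcal P_{2j+2}$, range $Z'\in\mathcal P_{2j+1}$ whenever $\sigma(Z'')\subseteq Z'$. $B_Z,R_Z$: sets of blue, red edges with range $Z$. $D_Z=\{B_Z,R_Z\}$ for $Z\in\mathcal P_{2j}$; $D_Z=\{B_Z\}\cup\{R(f)\mid f\text{ red},s(f)=Z\}$ for $Z\in\mathcal P_{2j+1}$, where $R(f)=\{g\in R_Z\mid s(g)\subseteq r(f)\}$. **Algebras.** $(F_n,D^n)$ is the finite separated graph with $F_n^0=F^{0,n}\sqcup F^{0,n+1}$, $F_n^1=F^{1,n}$, $D^n_v=D_v$ for $v\in F^{0,n}$. The Leavitt path algebra $L_{\mathbb C}(E,C)$ is the complex $*$-algebra generated by $E^0\sqcup E^1\sqcup(E^1)^*$ with relations: $vw=\delta_{v,w}v$, $v=v^*$ ($v,w\in E^0$); $r(e)e=es(e)=e$; $e^*f=\delta_{e,f}s(e)$ for $e,f\in Y$, $Y\in C$; $v=\sum_{e\in Y}ee^*$ for every finite $Y\in C_v$. $C^*(E,C)$ is the universal $C^*$-algebra with the same generators and relations. Put $L_n=L_{\mathbb C}(F_n,D^n)$, $C_n=C^*(F_n,D^n)$, $p_n=\sum_{v\in F^{0,n}}v$, $\mathcal A_n=p_nL_np_n$,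 $\mathcal B_{n}=p_nC_np_n$. The $*$-homomorphism $\widetilde\phi_n:L_n\to L_{n+1}$ is given by $w\mapsto w$ for $w\in F^{0,n+1}$; $v\mapsto\sum_{e\in B_v}\sum_{e'\in B_{s(e)}}s(e')$ for $v\in F^{0,n}$; $e\mapsto\sum_{\bar e\in X(e)}\bar e^*$ for $e\in F^{1,n}$, where $X(e)=B_{s(e)}$ if $e$ is blue, $X(e)=R(e)$ if $e$ is red and $n$ even, $X(e)=R_{s(e)}$ if $e$ is red and $n$ odd. It induces $\widetilde\phi_n:C_n\to C_{n+1}$. $\phi_n$ denotes the restriction of $\widetilde\phi_{2n+1}\circ\widetilde\phi_{2n}$ to $\mathcal A_{2n}\to\mathcal A_{2n+2}$, and also to $\mathcal B_{2n}\to\mathcal B_{2n+2}$. $\mathcal A_\infty=\varinjlim(\mathcal A_{2n},\phi_n)$ ($*$-algebras), $\mathcal B_\infty=\varinjlim(\mathcal B_{2n},\phi_n)$ ($C^*$-algebras); the canonical map $\mathcal A_\infty\to\mathcal B_\infty$ is induced by the canonical maps $L_n\to C_n$. **Groupoid.** $\mathcal G(X,\sigma)=\bigcup_{m,n\ge0}\{(x,m-n,y)\mid\sigma^m(x)=\sigma^n(y)\}$ with product $(x,p,y)(y,q,z)=(x,p+q,z)$, inverse $(y,-p,x)$, $r(x,p,y)=x$, $s(x,p,y)=y$, topology with basis $Z(U,m,n,V)=\{(x,m-n,y)\mid x\in U,y\in V,\sigma^m(x)=\sigma^n(y)\}$ ($U,V$ open). $A_{\mathbb C}(\mathcal G)$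 is the $*$-algebra of locally constant compactly supported functions with convolution $(f*g)(\gamma)=\sum_{s(\alpha)=s(\gamma)}f(\gamma\alpha^{-1})g(\alpha)$ and $f^*(\gamma)=\overline{f(\gamma^{-1})}$. $C^*(\mathcal G)$ is the full groupoid $C^*$-algebra, which is the enveloping $C^*$-algebra of $A_{\mathbb C}(\mathcal G)$; the right vertical map is the canonical inclusion. **The map $\varphi$.** $\mathcal A_{2n}$ is generated by $F^{0,2n}$ and the elements $ef^*$ with $e,f\in F^{1,2n}$, $s(e)=s(f)$. $\varphi_n:\mathcal A_{2n}\to A_{\mathbb C}(\mathcal G(X,\sigma))$ is the $*$-homomorphism with $\varphi_n(U)=\mathds 1_U$ for $U\in\mathcal P_{2n}$ (identifying $U$ with $Z(U,0,0,U)$) and, for $s(e)=s(f)=W$, $r(e)=U$, $r(f)=V$: $\varphi_n(ef^* )=\mathds 1_W$ if $e,f$ blue; $\mathds 1_{Z((\sigma|_U)^{-1}(W),1,1,(\sigma|_V)^{-1}(W))}$ if both red; $\mathds 1_{Z((\sigma|_U)^{-1}(W),1,0,W)}$ if $e$ red, $f$ blue; $\mathds 1_{Z(W,0,1,(\sigma|_V)^{-1}(W))}$ if $e$ blue, $f$ red. These are compatible with the $\phi_n$, and $\varphi$ is the induced map on $\mathcal A_\infty$ (a $*$-isomorphism). *)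

theory Defs
  imports "HOL-Analysis.Analysis"
begin

section \<open>Complex \<open>*\<close>-algebras and \<open>C\<^sup>*\<close>-algebras with explicit carrier\<close>

text \<open>
  The algebras below depend on terms (the map \<open>\<sigma>\<close>, the partitions, the level), so they are records
  with a carrier. No unit is recorded: homomorphisms are not required to be unital.
\<close>

record 'a star_alg =
  acarrier :: "'a set"
  azero :: 'a
  aadd :: "'a \<Rightarrow> 'a \<Rightarrow> 'a"
  amul :: "'a \<Rightarrow> 'a \<Rightarrow> 'a"
  ascale :: "complex \<Rightarrow> 'a \<Rightarrow> 'a"
  astar :: "'a \<Rightarrow> 'a"

record 'a cstar_alg = "'a star_alg" +
  cnorm :: "'a \<Rightarrow> real"

definition asub :: "('a, 'm) star_alg_scheme \<Rightarrow> 'a \<Rightarrow> 'a \<Rightarrow> 'a" where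
  "asub A a b = aadd A a (ascale A (-1) b)"

definition asum :: "('a, 'm) star_alg_scheme \<Rightarrow> ('i \<Rightarrow> 'a) \<Rightarrow> 'i set \<Rightarrow> 'a" where
  "asum A f I = Finite_Set.fold (\<lambda>i. aadd A (f i)) (azero A) I"

text \<open>
  Homomorphisms are extensional (\<open>undefined\<close> off the carrier), so that equality of functions is
  equality on the carrier and \<open>\<exists>!\<close> and \<open>THE\<close> have their usual meaning.
\<close>

definition star_hom :: "('a, 'm) star_alg_scheme \<Rightarrow> ('b, 'n) star_alg_scheme \<Rightarrow> ('a \<Rightarrow> 'b) set" where
  "star_hom A B = {h \<in> acarrier A \<rightarrow>\<^sub>E acarrier B.
     (\<forall>a\<in>acarrier A. \<forall>b\<in>acarrier A. h (aadd A a b) = aadd B (h a) (h b)) \<and>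
     (\<forall>a\<in>acarrier A. \<forall>b\<in>acarrier A. h (amul A a b) = amul B (h a) (h b)) \<and>
     (\<forall>c. \<forall>a\<in>acarrier A. h (ascale A c a) = ascale B c (h a)) \<and>
     (\<forall>a\<in>acarrier A. h (astar A a) = astar B (h a))}"

definition star_iso :: "('a, 'm) star_alg_scheme \<Rightarrow> ('b, 'n) star_alg_scheme \<Rightarrow> ('a \<Rightarrow> 'b) set" where
  "star_iso A B = {h \<in> star_hom A B. bij_betw h (acarrier A) (acarrier B)}"

definition corner :: "('a, 'm) star_alg_scheme \<Rightarrow> 'a \<Rightarrow> ('a, 'm) star_alg_scheme" where
  "corner A p = A\<lparr>acarrier := (\<lambda>a. amul A (amul A p a) p) ` acarrier A\<rparr>"


subsection \<open>Presented \<open>*\<close>-algebras\<close>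

datatype 'g sterm =
    Gen 'g
  | Zero
  | Add "'g sterm" "'g sterm"
  | Mul "'g sterm" "'g sterm"
  | Scale complex "'g sterm"
  | Star "'g sterm"

text \<open>
  The least congruence on terms that contains the relations \<open>R\<close> and the axioms of complex
  \<open>*\<close>-algebras. The rule \<open>outside\<close> discards the letters of the type that are not in \<open>G\<close>; killing
  such letters is the same as not having them.
\<close>

inductive pres_eq :: "'g set \<Rightarrow> ('g sterm \<times> 'g sterm) set \<Rightarrow> 'g sterm \<Rightarrow> 'g sterm \<Rightarrow> bool"
  for G R where
  rel: "(s, t) \<in> R \<Longrightarrow> pres_eq G R s t"
| outside: "g \<notin> G \<Longrightarrow> pres_eq G R (Gen g) Zero"
| refl: "pres_eq G R s s"
| sym: "pres_eq G R s t \<Longrightarrow> pres_eq G R t s"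
| trans: "pres_eq G R s t \<Longrightarrow> pres_eq G R t u \<Longrightarrow> pres_eq G R s u"
| cong_add: "pres_eq G R s s' \<Longrightarrow> pres_eq G R t t' \<Longrightarrow> pres_eq G R (Add s t) (Add s' t')"
| cong_mul: "pres_eq G R s s' \<Longrightarrow> pres_eq G R t t' \<Longrightarrow> pres_eq G R (Mul s t) (Mul s' t')"
| cong_scale: "pres_eq G R s s' \<Longrightarrow> pres_eq G R (Scale c s) (Scale c s')"
| cong_star: "pres_eq G R s s' \<Longrightarrow> pres_eq G R (Star s) (Star s')"
| add_assoc: "pres_eq G R (Add (Add s t) u) (Add s (Add t u))"
| add_comm: "pres_eq G R (Add s t) (Add t s)"
| add_zero: "pres_eq G R (Add s Zero) s"
| add_neg: "pres_eq G R (Add s (Scale (-1) s)) Zero"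
| scale_add: "pres_eq G R (Scale c (Add s t)) (Add (Scale c s) (Scale c t))"
| add_scale: "pres_eq G R (Scale (c + d) s) (Add (Scale c s) (Scale d s))"
| scale_scale: "pres_eq G R (Scale c (Scale d s)) (Scale (c * d) s)"
| scale_one: "pres_eq G R (Scale 1 s) s"
| mul_assoc: "pres_eq G R (Mul (Mul s t) u) (Mul s (Mul t u))"
| mul_add: "pres_eq G R (Mul s (Add t u)) (Add (Mul s t) (Mul s u))"
| add_mul: "pres_eq G R (Mul (Add s t) u) (Add (Mul s u) (Mul t u))"
| scale_mul: "pres_eq G R (Mul (Scale c s) t) (Scale c (Mul s t))"
| mul_scale: "pres_eq G R (Mul s (Scale c t)) (Scale c (Mul s t))"
| star_star: "pres_eq G R (Star (Star s)) s"
| star_add: "pres_eq G R (Star (Add s t)) (Add (Star s) (Star t))"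
| star_scale: "pres_eq G R (Star (Scale c s)) (Scale (cnj c) (Star s))"
| star_mul: "pres_eq G R (Star (Mul s t)) (Mul (Star t) (Star s))"

definition pres_class :: "'g set \<Rightarrow> ('g sterm \<times> 'g sterm) set \<Rightarrow> 'g sterm \<Rightarrow> 'g sterm set" where
  "pres_class G R s = {t. pres_eq G R s t}"

definition presented :: "'g set \<Rightarrow> ('g sterm \<times> 'g sterm) set \<Rightarrow> 'g sterm set star_alg" where
  "presented G R = \<lparr>
     acarrier = range (pres_class G R),
     azero = pres_class G R Zero,
     aadd = (\<lambda>S T. \<Union>s\<in>S. \<Union>t\<in>T. pres_class G R (Add s t)),
     amul = (\<lambda>S T. \<Union>s\<in>S. \<Union>t\<in>T. pres_class G R (Mul s t)),
     ascale = (\<lambda>c S. \<Union>s\<in>S. pres_class G R (Scale c s)),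
     astar = (\<lambda>S. \<Union>s\<in>S. pres_class G R (Star s))\<rparr>"


subsection \<open>Completions and enveloping \<open>C\<^sup>*\<close>-algebras\<close>

definition cauchy_seqs :: "('a, 'm) star_alg_scheme \<Rightarrow> ('a \<Rightarrow> real) \<Rightarrow> (nat \<Rightarrow> 'a) set" where
  "cauchy_seqs A p = {s. range s \<subseteq> acarrier A \<and>
     (\<forall>\<epsilon>>0. \<exists>N. \<forall>m\<ge>N. \<forall>n\<ge>N. p (asub A (s m) (s n)) < \<epsilon>)}"

definition null_rel :: "('a, 'm) star_alg_scheme \<Rightarrow> ('a \<Rightarrow> real) \<Rightarrow> ((nat \<Rightarrow> 'a) \<times> (nat \<Rightarrow> 'a)) set" where
  "null_rel A p = {(s, t). s \<in> cauchy_seqs A p \<and> t \<in> cauchy_seqs A p \<and>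
     (\<lambda>n. p (asub A (s n) (t n))) \<longlonglongrightarrow> 0}"

text \<open>
  Hausdorff completion of a \<open>*\<close>-algebra with respect to a \<open>C\<^sup>*\<close>-seminorm \<open>p\<close>: Cauchy sequences
  modulo null sequences.
\<close>

definition completion :: "('a, 'm) star_alg_scheme \<Rightarrow> ('a \<Rightarrow> real) \<Rightarrow> (nat \<Rightarrow> 'a) set cstar_alg" where
  "completion A p = \<lparr>
     acarrier = cauchy_seqs A p // null_rel A p,
     azero = null_rel A p `` {\<lambda>_. azero A},
     aadd = (\<lambda>S T. \<Union>s\<in>S. \<Union>t\<in>T. null_rel A p `` {\<lambda>n. aadd A (s n) (t n)}),
     amul = (\<lambda>S T. \<Union>s\<in>S. \<Union>t\<in>T. null_rel A p `` {\<lambda>n. amul A (s n) (t n)}),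
     ascale = (\<lambda>c S. \<Union>s\<in>S. null_rel A p `` {\<lambda>n. ascale A c (s n)}),
     astar = (\<lambda>S. \<Union>s\<in>S. null_rel A p `` {\<lambda>n. astar A (s n)}),
     cnorm = (\<lambda>S. THE r. \<forall>s\<in>S. (\<lambda>n. p (s n)) \<longlonglongrightarrow> r)\<rparr>"

definition to_completion :: "('a, 'm) star_alg_scheme \<Rightarrow> ('a \<Rightarrow> real) \<Rightarrow> 'a \<Rightarrow> (nat \<Rightarrow> 'a) set" where
  "to_completion A p a = null_rel A p `` {\<lambda>_. a}"

definition cstar_seminorm :: "('a, 'm) star_alg_scheme \<Rightarrow> ('a \<Rightarrow> real) \<Rightarrow> bool" where
  "cstar_seminorm A p \<longleftrightarrow>
     (\<forall>a\<in>acarrier A. 0 \<le> p a) \<and>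
     (\<forall>a\<in>acarrier A. \<forall>b\<in>acarrier A. p (aadd A a b) \<le> p a + p b) \<and>
     (\<forall>c. \<forall>a\<in>acarrier A. p (ascale A c a) = cmod c * p a) \<and>
     (\<forall>a\<in>acarrier A. \<forall>b\<in>acarrier A. p (amul A a b) \<le> p a * p b) \<and>
     (\<forall>a\<in>acarrier A. p (amul A (astar A a) a) = (p a)\<^sup>2)"

text \<open>
  The \<open>C\<^sup>*\<close>-seminorms on \<open>A\<close> are the functions \<open>\<lambda>a. norm (\<pi> a)\<close> for \<open>\<pi>\<close> a \<open>*\<close>-homomorphism into a
  \<open>C\<^sup>*\<close>-algebra, so the supremum below is the enveloping norm \<open>sup\<^sub>\<pi> norm (\<pi> a)\<close>. It is finite for
  all algebras considered here, since they are spanned by products of partial isometries.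
\<close>

definition env_norm :: "('a, 'm) star_alg_scheme \<Rightarrow> 'a \<Rightarrow> real" where
  "env_norm A a = (SUP p \<in> {p. cstar_seminorm A p}. p a)"

definition enveloping :: "('a, 'm) star_alg_scheme \<Rightarrow> (nat \<Rightarrow> 'a) set cstar_alg" where
  "enveloping A = completion A (env_norm A)"

definition to_enveloping :: "('a, 'm) star_alg_scheme \<Rightarrow> 'a \<Rightarrow> (nat \<Rightarrow> 'a) set" where
  "to_enveloping A = to_completion A (env_norm A)"


subsection \<open>Direct limits of sequences\<close>

text \<open>\<open>transit f m k\<close> is \<open>f\<^sub>k\<^sub>-\<^sub>1 \<circ> \<dots> \<circ> f\<^sub>m\<close> for \<open>k \<ge> m\<close>.\<close>

primrec transit :: "(nat \<Rightarrow> 'a \<Rightarrow> 'a) \<Rightarrow> nat \<Rightarrow> nat \<Rightarrow> 'a \<Rightarrow> 'a" where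
  "transit f m 0 a = a"
| "transit f m (Suc k) a = (if m \<le> k then f k (transit f m k a) else a)"

definition lim_rel :: "(nat \<Rightarrow> ('a, 'm) star_alg_scheme) \<Rightarrow> (nat \<Rightarrow> 'a \<Rightarrow> 'a) \<Rightarrow>
    ((nat \<times> 'a) \<times> (nat \<times> 'a)) set" where
  "lim_rel A f = {((m, a), (n, b)). a \<in> acarrier (A m) \<and> b \<in> acarrier (A n) \<and>
     (\<exists>k. m \<le> k \<and> n \<le> k \<and> transit f m k a = transit f n k b)}"

definition star_lim :: "(nat \<Rightarrow> ('a, 'm) star_alg_scheme) \<Rightarrow> (nat \<Rightarrow> 'a \<Rightarrow> 'a) \<Rightarrow>
    (nat \<times> 'a) set star_alg" where
  "star_lim A f = \<lparr>
     acarrier = (SIGMA n:UNIV. acarrier (A n)) // lim_rel A f,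
     azero = lim_rel A f `` {(0, azero (A 0))},
     aadd = (\<lambda>S T. \<Union>(m, a)\<in>S. \<Union>(n, b)\<in>T. let k = max m n in
        lim_rel A f `` {(k, aadd (A k) (transit f m k a) (transit f n k b))}),
     amul = (\<lambda>S T. \<Union>(m, a)\<in>S. \<Union>(n, b)\<in>T. let k = max m n in
        lim_rel A f `` {(k, amul (A k) (transit f m k a) (transit f n k b))}),
     ascale = (\<lambda>c S. \<Union>(n, a)\<in>S. lim_rel A f `` {(n, ascale (A n) c a)}),
     astar = (\<lambda>S. \<Union>(n, a)\<in>S. lim_rel A f `` {(n, astar (A n) a)})\<rparr>"

definition to_star_lim :: "(nat \<Rightarrow> ('a, 'm) star_alg_scheme) \<Rightarrow> (nat \<Rightarrow> 'a \<Rightarrow> 'a) \<Rightarrow>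
    nat \<Rightarrow> 'a \<Rightarrow> (nat \<times> 'a) set" where
  "to_star_lim A f n a = lim_rel A f `` {(n, a)}"

text \<open>
  The direct limit of \<open>C\<^sup>*\<close>-algebras is the completion of the algebraic direct limit in the
  seminorm \<open>[n, a] \<mapsto> lim\<^sub>k norm (transit f n k a)\<close>.
\<close>

definition lim_norm :: "(nat \<Rightarrow> 'a cstar_alg) \<Rightarrow> (nat \<Rightarrow> 'a \<Rightarrow> 'a) \<Rightarrow> (nat \<times> 'a) set \<Rightarrow> real" where
  "lim_norm A f S = (THE r. \<forall>(n, a)\<in>S. (\<lambda>k. cnorm (A k) (transit f n k a)) \<longlonglongrightarrow> r)"

definition cstar_lim :: "(nat \<Rightarrow> 'a cstar_alg) \<Rightarrow> (nat \<Rightarrow> 'a \<Rightarrow> 'a) \<Rightarrow>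
    (nat \<Rightarrow> (nat \<times> 'a) set) set cstar_alg" where
  "cstar_lim A f = completion (star_lim A f) (lim_norm A f)"

definition to_cstar_lim :: "(nat \<Rightarrow> 'a cstar_alg) \<Rightarrow> (nat \<Rightarrow> 'a \<Rightarrow> 'a) \<Rightarrow>
    nat \<Rightarrow> 'a \<Rightarrow> (nat \<Rightarrow> (nat \<times> 'a) set) set" where
  "to_cstar_lim A f n a = to_completion (star_lim A f) (lim_norm A f) (to_star_lim A f n a)"


section \<open>Separated graphs and their algebras\<close>

record ('v, 'e) sep_graph =
  gverts :: "'v set"
  gedges :: "'e set"
  grange :: "'e \<Rightarrow> 'v"
  gsource :: "'e \<Rightarrow> 'v"
  gsep :: "'v \<Rightarrow> 'e set set"

definition separated_graph :: "('v, 'e) sep_graph \<Rightarrow> bool" where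
  "separated_graph E \<longleftrightarrow> (\<forall>e\<in>gedges E. grange E e \<in> gverts E \<and> gsource E e \<in> gverts E) \<and>
     (\<forall>v\<in>gverts E. partition_on {e \<in> gedges E. grange E e = v} (gsep E v))"

datatype ('v, 'e) letter = Vtx 'v | Edg 'e

definition letters :: "('v, 'e) sep_graph \<Rightarrow> ('v, 'e) letter set" where
  "letters E = Vtx ` gverts E \<union> Edg ` gedges E"

primrec sum_term :: "'g sterm list \<Rightarrow> 'g sterm" where
  "sum_term [] = Zero"
| "sum_term (t # ts) = Add t (sum_term ts)"

text \<open>The letters \<open>e\<^sup>*\<close> are the terms \<open>Star (Gen (Edg e))\<close>.\<close>

inductive_set leavitt_rels :: "('v, 'e) sep_graph \<Rightarrow>
    (('v, 'e) letter sterm \<times> ('v, 'e) letter sterm) set" for E where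
  "v \<in> gverts E \<Longrightarrow> w \<in> gverts E \<Longrightarrow>
     (Mul (Gen (Vtx v)) (Gen (Vtx w)), if v = w then Gen (Vtx v) else Zero) \<in> leavitt_rels E"
| "v \<in> gverts E \<Longrightarrow> (Gen (Vtx v), Star (Gen (Vtx v))) \<in> leavitt_rels E"
| "e \<in> gedges E \<Longrightarrow> (Mul (Gen (Vtx (grange E e))) (Gen (Edg e)), Gen (Edg e)) \<in> leavitt_rels E"
| "e \<in> gedges E \<Longrightarrow> (Mul (Gen (Edg e)) (Gen (Vtx (gsource E e))), Gen (Edg e)) \<in> leavitt_rels E"
| "v \<in> gverts E \<Longrightarrow> Y \<in> gsep E v \<Longrightarrow> e \<in> Y \<Longrightarrow> f \<in> Y \<Longrightarrow>
     (Mul (Star (Gen (Edg e))) (Gen (Edg f)), if e = f then Gen (Vtx (gsource E e)) else Zero)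
       \<in> leavitt_rels E"
| "v \<in> gverts E \<Longrightarrow> Y \<in> gsep E v \<Longrightarrow> distinct es \<Longrightarrow> set es = Y \<Longrightarrow>
     (Gen (Vtx v), sum_term (map (\<lambda>e. Mul (Gen (Edg e)) (Star (Gen (Edg e)))) es))
       \<in> leavitt_rels E"

definition leavitt :: "('v, 'e) sep_graph \<Rightarrow> ('v, 'e) letter sterm set star_alg" where
  "leavitt E = presented (letters E) (leavitt_rels E)"

definition leavitt_vtx :: "('v, 'e) sep_graph \<Rightarrow> 'v \<Rightarrow> ('v, 'e) letter sterm set" where
  "leavitt_vtx E v = pres_class (letters E) (leavitt_rels E) (Gen (Vtx v))"

definition leavitt_edg :: "('v, 'e) sep_graph \<Rightarrow> 'e \<Rightarrow> ('v, 'e) letter sterm set" where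
  "leavitt_edg E e = pres_class (letters E) (leavitt_rels E) (Gen (Edg e))"

text \<open>
  The \<open>C\<^sup>*\<close>-algebra with the generators and relations of \<open>leavitt E\<close>: a representation of these
  in a \<open>C\<^sup>*\<close>-algebra is a \<open>*\<close>-homomorphism on \<open>leavitt E\<close>.
\<close>

definition graph_cstar ::
    "('v, 'e) sep_graph \<Rightarrow> (nat \<Rightarrow> ('v, 'e) letter sterm set) set cstar_alg" where
  "graph_cstar E = enveloping (leavitt E)"


section \<open>Local homeomorphisms and refined sequences of partitions\<close>

definition surj_local_homeo :: "'a::metric_space set \<Rightarrow> ('a \<Rightarrow> 'a) \<Rightarrow> bool" where
  "surj_local_homeo X \<sigma> \<longleftrightarrow> \<sigma> ` X = X \<and>
     (\<forall>x\<in>X. \<exists>U g. x \<in> U \<and> openin (top_of_set X) U \<and> openin (top_of_set X) (\<sigma> ` U) \<and>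
        homeomorphism U (\<sigma> ` U) \<sigma> g)"

definition clopen_partition :: "'a::metric_space set \<Rightarrow> 'a set set \<Rightarrow> bool" where
  "clopen_partition X Q \<longleftrightarrow> finite Q \<and> partition_on X Q \<and>
     (\<forall>Z\<in>Q. openin (top_of_set X) Z \<and> closedin (top_of_set X) Z)"

definition coarser :: "'a set set \<Rightarrow> 'a set set \<Rightarrow> bool" (infix \<open>\<precsim>\<close> 50) where
  "Q1 \<precsim> Q2 \<longleftrightarrow> (\<forall>Z\<in>Q2. \<exists>W\<in>Q1. Z \<subseteq> W)"

definition pjoin :: "'a set set \<Rightarrow> 'a set set \<Rightarrow> 'a set set" where
  "pjoin Q1 Q2 = {Z \<inter> W | Z W. Z \<in> Q1 \<and> W \<in> Q2 \<and> Z \<inter> W \<noteq> {}}"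

text \<open>The element \<open>0\<close> only matters for the empty partition of the empty space.\<close>

definition pdiam :: "'a::metric_space set set \<Rightarrow> real" where
  "pdiam Q = Max (insert 0 (diameter ` Q))"

definition fibre :: "'a set \<Rightarrow> ('a \<Rightarrow> 'a) \<Rightarrow> 'a \<Rightarrow> 'a set" where
  "fibre X \<sigma> x = {y \<in> X. \<sigma> y = x}"

definition max_fibre :: "'a set \<Rightarrow> ('a \<Rightarrow> 'a) \<Rightarrow> nat" where
  "max_fibre X \<sigma> = (SUP x\<in>X. card (fibre X \<sigma> x))"

definition fibre_ge :: "'a set \<Rightarrow> ('a \<Rightarrow> 'a) \<Rightarrow> nat \<Rightarrow> 'a set" where
  "fibre_ge X \<sigma> k = {x \<in> X. k \<le> card (fibre X \<sigma> x)}"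

text \<open>The family \<open>Z\<^sub>1, \<dots>, Z\<^sub>k\<close> of distinct elements of \<open>Q\<close> is given as the subset \<open>S\<close> of \<open>Q\<close>.\<close>

definition image_partition :: "'a set \<Rightarrow> ('a \<Rightarrow> 'a) \<Rightarrow> 'a set set \<Rightarrow> 'a set set" where
  "image_partition X \<sigma> Q = (\<Union>k\<in>{1..max_fibre X \<sigma>}.
     {(\<Inter>Z\<in>S. \<sigma> ` Z) - fibre_ge X \<sigma> (k + 1) | S. S \<subseteq> Q \<and> card S = k \<and>
        (\<Inter>Z\<in>S. \<sigma> ` Z) - fibre_ge X \<sigma> (k + 1) \<noteq> {}})"

definition preimage_partition :: "'a set \<Rightarrow> ('a \<Rightarrow> 'a) \<Rightarrow> 'a set set \<Rightarrow> 'a set set" where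
  "preimage_partition X \<sigma> Q = (\<lambda>Z. X \<inter> \<sigma> -` Z) ` Q"

definition sigma_refined :: "'a::metric_space set \<Rightarrow> ('a \<Rightarrow> 'a) \<Rightarrow> (nat \<Rightarrow> 'a set set) \<Rightarrow> bool" where
  "sigma_refined X \<sigma> P \<longleftrightarrow>
     (\<forall>n. clopen_partition X (P n)) \<and>
     (\<forall>Z\<in>P 0. \<exists>g. homeomorphism Z (\<sigma> ` Z) \<sigma> g) \<and>
     (\<forall>n. P n \<precsim> P (n + 1)) \<and>
     topology_generated_by (\<Union>n. P n) = top_of_set X \<and>
     (\<lambda>n. pdiam (P n)) \<longlonglongrightarrow> 0 \<and>
     (\<forall>j. pjoin (P (2*j)) (image_partition X \<sigma> (P (2*j))) \<precsim> P (2*j + 1)) \<and>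
     (\<forall>j. pjoin (P (2*j + 1)) (preimage_partition X \<sigma> (P (2*j + 1))) \<precsim> P (2*j + 2))"


section \<open>The diagram \<open>(F, D)\<close>\<close>

datatype colour = Blue | Red

text \<open>
  A vertex is a pair of a level and an element of the partition of that level, because the same set
  may belong to several partitions. \<open>Edge c n Z Z'\<close> is the edge of colour \<open>c\<close> in \<open>F\<^sup>1\<^sup>,\<^sup>n\<close> with range
  \<open>Z\<close> (on level \<open>n\<close>) and source \<open>Z'\<close> (on level \<open>n + 1\<close>).
\<close>

type_synonym 'a vertex = "nat \<times> 'a set"

datatype 'a edge = Edge (ecol: colour) (elevel: nat) (ersetof: "'a set") (essetof: "'a set")

definition erange :: "'a edge \<Rightarrow> 'a vertex" where
  "erange e = (elevel e, ersetof e)"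

definition esource :: "'a edge \<Rightarrow> 'a vertex" where
  "esource e = (elevel e + 1, essetof e)"

definition F0 :: "(nat \<Rightarrow> 'a set set) \<Rightarrow> nat \<Rightarrow> 'a vertex set" where
  "F0 P n = {n} \<times> P n"

definition F1 :: "('a \<Rightarrow> 'a) \<Rightarrow> (nat \<Rightarrow> 'a set set) \<Rightarrow> nat \<Rightarrow> 'a edge set" where
  "F1 \<sigma> P n =
     {Edge Blue n Z Z' | Z Z'. Z \<in> P n \<and> Z' \<in> P (n + 1) \<and> Z' \<subseteq> Z} \<union>
     {Edge Red n Z Z' | Z Z'. Z \<in> P n \<and> Z' \<in> P (n + 1) \<and>
        (if even n then Z' \<subseteq> \<sigma> ` Z else \<sigma> ` Z' \<subseteq> Z)}"

definition coloured_edges ::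
    "('a \<Rightarrow> 'a) \<Rightarrow> (nat \<Rightarrow> 'a set set) \<Rightarrow> colour \<Rightarrow> 'a vertex \<Rightarrow> 'a edge set" where
  "coloured_edges \<sigma> P c v = {e \<in> F1 \<sigma> P (fst v). ecol e = c \<and> erange e = v}"

text \<open>The set \<open>R(f)\<close>, used for red \<open>f\<close> in \<open>F\<^sup>1\<^sup>,\<^sup>2\<^sup>j\<close>.\<close>

definition red_fork :: "('a \<Rightarrow> 'a) \<Rightarrow> (nat \<Rightarrow> 'a set set) \<Rightarrow> 'a edge \<Rightarrow> 'a edge set" where
  "red_fork \<sigma> P f = {g \<in> coloured_edges \<sigma> P Red (esource f). essetof g \<subseteq> ersetof f}"

definition D_sep :: "('a \<Rightarrow> 'a) \<Rightarrow> (nat \<Rightarrow> 'a set set) \<Rightarrow> 'a vertex \<Rightarrow> 'a edge set set" where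
  "D_sep \<sigma> P v =
     (if even (fst v) then {coloured_edges \<sigma> P Blue v, coloured_edges \<sigma> P Red v}
      else {coloured_edges \<sigma> P Blue v} \<union>
           {red_fork \<sigma> P f | f. f \<in> F1 \<sigma> P (fst v - 1) \<and> ecol f = Red \<and> esource f = v})"

definition F_graph ::
    "('a \<Rightarrow> 'a) \<Rightarrow> (nat \<Rightarrow> 'a set set) \<Rightarrow> nat \<Rightarrow> ('a vertex, 'a edge) sep_graph" where
  "F_graph \<sigma> P n = \<lparr>
     gverts = F0 P n \<union> F0 P (n + 1),
     gedges = F1 \<sigma> P n,
     grange = erange,
     gsource = esource,
     gsep = (\<lambda>v. if v \<in> F0 P n then D_sep \<sigma> P v else {})\<rparr>"


lemma refine_step:
  assumes "sigma_refined X \<sigma> P" "Z \<in> P n" "m \<le> n"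
  shows "\<exists>W\<in>P m. Z \<subseteq> W"
  using assms(3,2)
proof (induction n arbitrary: Z rule: dec_induct)
  case base
  then show ?case by blast
next
  case (step n)
  have "P n \<precsim> P (Suc n)"
    using assms(1) by (simp add: sigma_refined_def)
  then show ?case
    using step unfolding coarser_def by (meson subset_trans)
qed

lemma part_props:
  assumes "sigma_refined X \<sigma> P"
  shows "\<Union>(P n) = X" "Z \<in> P n \<Longrightarrow> Z \<noteq> {}" "finite (P n)"
    "Z \<in> P n \<Longrightarrow> W \<in> P n \<Longrightarrow> x \<in> Z \<Longrightarrow> x \<in> W \<Longrightarrow> Z = W"
proof -
  have "finite (P n) \<and> \<Union>(P n) = X \<and> (\<forall>a\<in>P n. \<forall>b\<in>P n. a \<noteq> b \<longrightarrow> a \<inter> b = {}) \<and> {} \<notin> P n"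
  proof -
    have "clopen_partition X (P n)" using assms unfolding sigma_refined_def by blast
    then show ?thesis unfolding clopen_partition_def partition_on_def disjoint_def by simp
  qed
  then show "\<Union>(P n) = X" "Z \<in> P n \<Longrightarrow> Z \<noteq> {}" "finite (P n)"
    "Z \<in> P n \<Longrightarrow> W \<in> P n \<Longrightarrow> x \<in> Z \<Longrightarrow> x \<in> W \<Longrightarrow> Z = W" by fast+
qed

lemma part_sub:
  assumes "sigma_refined X \<sigma> P" "Z' \<in> P n" "m \<le> n" "Z \<in> P m" "x \<in> Z'" "x \<in> Z"
  shows "Z' \<subseteq> Z"
  using refine_step[OF assms(1,2,3)] part_props(4)[OF assms(1)] assms by blast

lemma inj_on_part:
  assumes "sigma_refined X \<sigma> P" "Z \<in> P n"
  shows "inj_on \<sigma> Z"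
proof -
  obtain W where W: "W \<in> P 0" "Z \<subseteq> W" using refine_step[OF assms, of 0] by auto
  then obtain g where "homeomorphism W (\<sigma> ` W) \<sigma> g"
    using assms(1) unfolding sigma_refined_def by blast
  then have "inj_on \<sigma> W" by (metis homeomorphism_apply1 inj_onI)
  then show ?thesis using W inj_on_subset by blast
qed

lemma finite_fibre:
  assumes "sigma_refined X \<sigma> P"
  shows "finite (fibre X \<sigma> x)"
proof -
  have "fibre X \<sigma> x = (\<Union>Z\<in>P 0. {y \<in> Z. \<sigma> y = x})"
    using part_props(1)[OF assms, of 0] by (auto simp: fibre_def)
  moreover have "finite {y \<in> Z. \<sigma> y = x}" if "Z \<in> P 0" for Z
  proof -
    have "finite (\<sigma> ` {y \<in> Z. \<sigma> y = x})" by (rule finite_subset[of _ "{x}"]) auto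
    moreover have "inj_on \<sigma> {y \<in> Z. \<sigma> y = x}"
      using inj_on_part[OF assms that] by (rule inj_on_subset) auto
    ultimately show ?thesis using finite_imageD by blast
  qed
  ultimately show ?thesis using part_props(3)[OF assms] by auto
qed

lemma image_sub:
  assumes "sigma_refined X \<sigma> P" "Z \<in> P (2*j)" "Z' \<in> P (2*j+1)" "x \<in> Z'" "x \<in> \<sigma> ` Z"
  shows "Z' \<subseteq> \<sigma> ` Z"
proof -
  have "pjoin (P (2*j)) (image_partition X \<sigma> (P (2*j))) \<precsim> P (2*j + 1)"
    using assms(1) unfolding sigma_refined_def by blast
  then obtain W where W: "W \<in> image_partition X \<sigma> (P (2*j))" "Z' \<subseteq> W"
    using assms(3) unfolding coarser_def pjoin_def by (smt (verit) le_inf_iff mem_Collect_eq)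
  from W(1) obtain k S where k: "k \<in> {1..max_fibre X \<sigma>}"
    and S: "W = (\<Inter>Z\<in>S. \<sigma> ` Z) - fibre_ge X \<sigma> (k+1)" "S \<subseteq> P (2*j)" "card S = k"
    unfolding image_partition_def UN_iff mem_Collect_eq by (elim bexE exE conjE)
  have "k \<ge> 1" using k by simp
  with S have fS: "finite S" by (metis card.infinite not_one_le_zero)
  have "Z \<in> S"
  proof (rule ccontr)
    assume nZ: "Z \<notin> S"
    let ?T = "insert Z S"
    have T: "?T \<subseteq> P (2*j)" "\<forall>V\<in>?T. x \<in> \<sigma> ` V" using S W assms by auto
    define c where "c V = (SOME y. y \<in> V \<and> \<sigma> y = x)" for V
    have c: "c V \<in> V \<and> \<sigma> (c V) = x" if "V \<in> ?T" for V
    proof -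
      have "\<exists>y. y \<in> V \<and> \<sigma> y = x" using T(2) that by (metis imageE)
      then show ?thesis unfolding c_def by (rule someI_ex)
    qed
    have "inj_on c ?T"
    proof (rule inj_onI)
      fix V V' assume VV: "V \<in> ?T" "V' \<in> ?T" "c V = c V'"
      show "V = V'"
        by (rule part_props(4)[OF assms(1), of _ "2*j" _ "c V"]) (use VV T(1) c[OF VV(1)] c[OF VV(2)] in auto)
    qed
    moreover have "c ` ?T \<subseteq> fibre X \<sigma> x"
    proof
      fix y assume "y \<in> c ` ?T"
      then obtain V where V: "V \<in> ?T" "y = c V" by blast
      then have "V \<subseteq> X" using T(1) part_props(1)[OF assms(1), of "2*j"] by blast
      then show "y \<in> fibre X \<sigma> x" using c[OF V(1)] V(2) by (auto simp: fibre_def)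
    qed
    ultimately have "card ?T \<le> card (fibre X \<sigma> x)"
      by (rule card_inj_on_le) (rule finite_fibre[OF assms(1)])
    then have "k + 1 \<le> card (fibre X \<sigma> x)" using nZ fS S(3) by simp
    moreover have "x \<in> X" using assms(3,4) part_props(1)[OF assms(1), of "2*j+1"] by auto
    ultimately have "x \<in> fibre_ge X \<sigma> (k+1)" by (simp add: fibre_ge_def)
    then show False using assms(4) W S by auto
  qed
  then show ?thesis using W S by blast
qed

lemma image_into:
  assumes "sigma_refined X \<sigma> P" "Z' \<in> P (2*j+1)" "Z'' \<in> P (2*j+2)" "x \<in> Z''" "\<sigma> x \<in> Z'"
  shows "\<sigma> ` Z'' \<subseteq> Z'"
proof -
  have "pjoin (P (2*j+1)) (preimage_partition X \<sigma> (P (2*j+1))) \<precsim> P (2*j + 2)"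
    using assms(1) unfolding sigma_refined_def by blast
  then obtain W where W: "W \<in> P (2*j+1)" "Z'' \<subseteq> X \<inter> \<sigma> -` W"
    using assms(3) unfolding coarser_def pjoin_def preimage_partition_def
    by (smt (verit) le_inf_iff mem_Collect_eq imageE)
  then have "\<sigma> x \<in> W" using assms(4) by auto
  then have "W = Z'" using part_props(4)[OF assms(1) W(1) assms(2)] assms(5) by blast
  then show ?thesis using W by auto
qed

lemma F_graph_separated:
  assumes ref: "sigma_refined X \<sigma> P" and "\<sigma> ` X = X"
  shows "separated_graph (F_graph \<sigma> P n)"
proof -
  have ends: "erange e \<in> F0 P n \<and> esource e \<in> F0 P (n+1)" if "e \<in> F1 \<sigma> P n" for e
    using that by (auto simp: F1_def F0_def erange_def esource_def)
  have main: "partition_on {e \<in> F1 \<sigma> P n. erange e = v} (D_sep \<sigma> P v)" if v: "v \<in> F0 P n" for v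
  proof -
    obtain Z where Z: "v = (n, Z)" "Z \<in> P n" using v by (auto simp: F0_def)
    then obtain x where x: "x \<in> Z" "x \<in> X" using part_props(1,2)[OF ref] by blast
    have split: "{e \<in> F1 \<sigma> P n. erange e = v} = coloured_edges \<sigma> P Blue v \<union> coloured_edges \<sigma> P Red v"
      unfolding coloured_edges_def Z by (auto, metis colour.exhaust)
    have disj: "coloured_edges \<sigma> P Blue v \<inter> coloured_edges \<sigma> P Red v = {}"
      unfolding coloured_edges_def by auto
    have "\<exists>Z'\<in>P (n+1). x \<in> Z'" using x part_props(1)[OF ref] by blast
    then obtain Z' where "Z' \<in> P (n+1)" "x \<in> Z'" by blast
    then have "Edge Blue n Z Z' \<in> coloured_edges \<sigma> P Blue v"
      using part_sub[OF ref, of Z' "n+1" n Z] Z x by (auto simp: coloured_edges_def F1_def erange_def)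
    then have Bne: "coloured_edges \<sigma> P Blue v \<noteq> {}" by blast
    show ?thesis
    proof (cases "even n")
      case True
      then obtain j where j: "n = 2*j" by auto
      have "\<sigma> x \<in> X" using x assms(2) by blast
      then obtain W where W: "W \<in> P (n+1)" "\<sigma> x \<in> W" using part_props(1)[OF ref] by blast
      then have "W \<subseteq> \<sigma> ` Z" using image_sub[OF ref, of Z j W "\<sigma> x"] Z x j by auto
      then have "Edge Red n Z W \<in> coloured_edges \<sigma> P Red v"
        using W Z True by (auto simp: coloured_edges_def F1_def erange_def)
      then have Rne: "coloured_edges \<sigma> P Red v \<noteq> {}" by blast
      show ?thesis
        unfolding split partition_on_def using Bne Rne disj Z True
        by (auto simp: D_sep_def disjoint_def)
    next
      case False
      then obtain j where j: "n = 2*j+1" using oddE by blast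
      define \<R> where "\<R> = {red_fork \<sigma> P f | f. f \<in> F1 \<sigma> P (n - 1) \<and> ecol f = Red \<and> esource f = v}"
      have D: "D_sep \<sigma> P v = insert (coloured_edges \<sigma> P Blue v) \<R>"
        using False Z by (auto simp: D_sep_def \<R>_def)
      have redE: "\<exists>Y. f = Edge Red (2*j) Y Z \<and> Y \<in> P (2*j) \<and> Z \<subseteq> \<sigma> ` Y"
        if "f \<in> F1 \<sigma> P (n - 1) \<and> ecol f = Red \<and> esource f = v" for f
        using that Z j by (auto simp: F1_def esource_def)
      have fork: "g \<in> red_fork \<sigma> P (Edge Red (2*j) Y Z) \<longleftrightarrow>
          (\<exists>Z''\<in>P (2*j+2). g = Edge Red n Z Z'' \<and> \<sigma> ` Z'' \<subseteq> Z \<and> Z'' \<subseteq> Y)" for g Y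
        using Z j by (auto simp: red_fork_def coloured_edges_def F1_def erange_def esource_def)
      have ne: "red_fork \<sigma> P (Edge Red (2*j) Y Z) \<noteq> {}" if Y: "Y \<in> P (2*j)" "Z \<subseteq> \<sigma> ` Y" for Y
      proof -
        obtain y where y: "y \<in> Y" "\<sigma> y = x" using Y x by auto
        then have "y \<in> X" using Y part_props(1)[OF ref] by blast
        then obtain Z'' where Z'': "Z'' \<in> P (2*j+2)" "y \<in> Z''"
          using part_props(1)[OF ref] by blast
        have "\<sigma> ` Z'' \<subseteq> Z" using image_into[OF ref _ Z''] Z j y x by auto
        moreover have "Z'' \<subseteq> Y" using part_sub[OF ref Z''(1) _ Y(1) Z''(2) y(1)] by auto
        ultimately show ?thesis using fork Z'' by blast
      qed
      have dis: "Y = Y'" if g: "g \<in> red_fork \<sigma> P (Edge Red (2*j) Y Z)" "g \<in> red_fork \<sigma> P (Edge Red (2*j) Y' Z)"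
        and Y: "Y \<in> P (2*j)" "Y' \<in> P (2*j)" for g Y Y'
      proof -
        obtain Z'' where "Z'' \<in> P (2*j+2)" "Z'' \<subseteq> Y" "Z'' \<subseteq> Y'"
          using g unfolding fork by auto
        then show ?thesis
          using part_props(2)[OF ref, of Z''] part_props(4)[OF ref Y] by blast
      qed
      have cover: "\<exists>Y\<in>P (2*j). Z \<subseteq> \<sigma> ` Y \<and> g \<in> red_fork \<sigma> P (Edge Red (2*j) Y Z)"
        if g: "g \<in> coloured_edges \<sigma> P Red v" for g
      proof -
        obtain Z'' where Z'': "Z'' \<in> P (2*j+2)" "g = Edge Red n Z Z''" "\<sigma> ` Z'' \<subseteq> Z"
          using g Z j False by (auto simp: coloured_edges_def F1_def erange_def)
        obtain Y where Y: "Y \<in> P (2*j)" "Z'' \<subseteq> Y" using refine_step[OF ref Z''(1), of "2*j"] by auto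
        obtain y where y: "y \<in> Z''" using part_props(2)[OF ref Z''(1)] by blast
        have "Z \<subseteq> \<sigma> ` Y" using image_sub[OF ref Y(1), of Z "\<sigma> y"] Z j y Z'' Y by auto
        then show ?thesis using fork Z'' Y by blast
      qed
      have UR: "\<Union>\<R> = coloured_edges \<sigma> P Red v"
      proof
        show "\<Union>\<R> \<subseteq> coloured_edges \<sigma> P Red v" unfolding \<R>_def red_fork_def by auto
        show "coloured_edges \<sigma> P Red v \<subseteq> \<Union>\<R>"
        proof
          fix g assume "g \<in> coloured_edges \<sigma> P Red v"
          then obtain Y where Y: "Y \<in> P (2*j)" "Z \<subseteq> \<sigma> ` Y" "g \<in> red_fork \<sigma> P (Edge Red (2*j) Y Z)"
            using cover by blast
          have "Edge Red (2*j) Y Z \<in> F1 \<sigma> P (n - 1)" "esource (Edge Red (2*j) Y Z) = v"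
            using Y Z j by (auto simp: F1_def esource_def)
          then show "g \<in> \<Union>\<R>" unfolding \<R>_def using Y by fastforce
        qed
      qed
      have Rne: "{} \<notin> \<R>" unfolding \<R>_def using redE ne by fastforce
      have Rdis: "disjoint \<R>"
        unfolding disjoint_def \<R>_def using redE dis by (smt (verit) disjoint_iff mem_Collect_eq)
      show ?thesis
        unfolding split partition_on_def D
        using Bne Rne Rdis UR disj by (auto simp: disjoint_def)
    qed
  qed
  have src: "{e \<in> F1 \<sigma> P n. erange e = v} = {}" if "v \<notin> F0 P n" for v
    using ends that by blast
  show ?thesis
    unfolding separated_graph_def F_graph_def
    using ends main src by (auto simp: partition_on_def disjoint_def)
qed


section \<open>The algebras of the diagram\<close>

type_synonym 'a lelem = "('a vertex, 'a edge) letter sterm set"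

abbreviation L_alg :: "('a \<Rightarrow> 'a) \<Rightarrow> (nat \<Rightarrow> 'a set set) \<Rightarrow> nat \<Rightarrow> 'a lelem star_alg" where
  "L_alg \<sigma> P n \<equiv> leavitt (F_graph \<sigma> P n)"

abbreviation C_alg :: "('a \<Rightarrow> 'a) \<Rightarrow> (nat \<Rightarrow> 'a set set) \<Rightarrow> nat \<Rightarrow> (nat \<Rightarrow> 'a lelem) set cstar_alg" where
  "C_alg \<sigma> P n \<equiv> graph_cstar (F_graph \<sigma> P n)"

abbreviation vtx :: "('a \<Rightarrow> 'a) \<Rightarrow> (nat \<Rightarrow> 'a set set) \<Rightarrow> nat \<Rightarrow> 'a vertex \<Rightarrow> 'a lelem" where
  "vtx \<sigma> P n \<equiv> leavitt_vtx (F_graph \<sigma> P n)"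

abbreviation edg :: "('a \<Rightarrow> 'a) \<Rightarrow> (nat \<Rightarrow> 'a set set) \<Rightarrow> nat \<Rightarrow> 'a edge \<Rightarrow> 'a lelem" where
  "edg \<sigma> P n \<equiv> leavitt_edg (F_graph \<sigma> P n)"

abbreviation L_to_C :: "('a \<Rightarrow> 'a) \<Rightarrow> (nat \<Rightarrow> 'a set set) \<Rightarrow> nat \<Rightarrow> 'a lelem \<Rightarrow> (nat \<Rightarrow> 'a lelem) set" where
  "L_to_C \<sigma> P n \<equiv> to_enveloping (L_alg \<sigma> P n)"

definition A_alg :: "('a \<Rightarrow> 'a) \<Rightarrow> (nat \<Rightarrow> 'a set set) \<Rightarrow> nat \<Rightarrow> 'a lelem star_alg" where
  "A_alg \<sigma> P n = corner (L_alg \<sigma> P n) (asum (L_alg \<sigma> P n) (vtx \<sigma> P n) (F0 P n))"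

definition B_alg :: "('a \<Rightarrow> 'a) \<Rightarrow> (nat \<Rightarrow> 'a set set) \<Rightarrow> nat \<Rightarrow> (nat \<Rightarrow> 'a lelem) set cstar_alg" where
  "B_alg \<sigma> P n =
     corner (C_alg \<sigma> P n) (asum (C_alg \<sigma> P n) (\<lambda>v. L_to_C \<sigma> P n (vtx \<sigma> P n v)) (F0 P n))"

definition X_set :: "('a \<Rightarrow> 'a) \<Rightarrow> (nat \<Rightarrow> 'a set set) \<Rightarrow> 'a edge \<Rightarrow> 'a edge set" where
  "X_set \<sigma> P e =
     (if ecol e = Blue then coloured_edges \<sigma> P Blue (esource e)
      else if even (elevel e) then red_fork \<sigma> P e
      else coloured_edges \<sigma> P Red (esource e))"

definition phi_tilde :: "('a \<Rightarrow> 'a) \<Rightarrow> (nat \<Rightarrow> 'a set set) \<Rightarrow> nat \<Rightarrow> 'a lelem \<Rightarrow> 'a lelem" where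
  "phi_tilde \<sigma> P n = (THE h. h \<in> star_hom (L_alg \<sigma> P n) (L_alg \<sigma> P (n + 1)) \<and>
     (\<forall>w\<in>F0 P (n + 1). h (vtx \<sigma> P n w) = vtx \<sigma> P (n + 1) w) \<and>
     (\<forall>v\<in>F0 P n. h (vtx \<sigma> P n v) =
        asum (L_alg \<sigma> P (n + 1)) (\<lambda>e.
          asum (L_alg \<sigma> P (n + 1)) (\<lambda>e'. vtx \<sigma> P (n + 1) (esource e'))
            (coloured_edges \<sigma> P Blue (esource e)))
          (coloured_edges \<sigma> P Blue v)) \<and>
     (\<forall>e\<in>F1 \<sigma> P n. h (edg \<sigma> P n e) =
        asum (L_alg \<sigma> P (n + 1)) (\<lambda>g. astar (L_alg \<sigma> P (n + 1)) (edg \<sigma> P (n + 1) g))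
          (X_set \<sigma> P e)))"

definition phi_tilde_C :: "('a \<Rightarrow> 'a) \<Rightarrow> (nat \<Rightarrow> 'a set set) \<Rightarrow> nat \<Rightarrow>
    (nat \<Rightarrow> 'a lelem) set \<Rightarrow> (nat \<Rightarrow> 'a lelem) set" where
  "phi_tilde_C \<sigma> P n = (THE h. h \<in> star_hom (C_alg \<sigma> P n) (C_alg \<sigma> P (n + 1)) \<and>
     (\<forall>a\<in>acarrier (L_alg \<sigma> P n).
        h (L_to_C \<sigma> P n a) = L_to_C \<sigma> P (n + 1) (phi_tilde \<sigma> P n a)))"

definition phi_A :: "('a \<Rightarrow> 'a) \<Rightarrow> (nat \<Rightarrow> 'a set set) \<Rightarrow> nat \<Rightarrow> 'a lelem \<Rightarrow> 'a lelem" where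
  "phi_A \<sigma> P n = restrict (phi_tilde \<sigma> P (2*n + 1) \<circ> phi_tilde \<sigma> P (2*n)) (acarrier (A_alg \<sigma> P (2*n)))"

definition phi_B :: "('a \<Rightarrow> 'a) \<Rightarrow> (nat \<Rightarrow> 'a set set) \<Rightarrow> nat \<Rightarrow>
    (nat \<Rightarrow> 'a lelem) set \<Rightarrow> (nat \<Rightarrow> 'a lelem) set" where
  "phi_B \<sigma> P n = restrict (phi_tilde_C \<sigma> P (2*n + 1) \<circ> phi_tilde_C \<sigma> P (2*n)) (acarrier (B_alg \<sigma> P (2*n)))"

definition A_inf :: "('a \<Rightarrow> 'a) \<Rightarrow> (nat \<Rightarrow> 'a set set) \<Rightarrow> (nat \<times> 'a lelem) set star_alg" where
  "A_inf \<sigma> P = star_lim (\<lambda>n. A_alg \<sigma> P (2*n)) (phi_A \<sigma> P)"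

definition B_inf :: "('a \<Rightarrow> 'a) \<Rightarrow> (nat \<Rightarrow> 'a set set) \<Rightarrow>
    (nat \<Rightarrow> (nat \<times> (nat \<Rightarrow> 'a lelem) set) set) set cstar_alg" where
  "B_inf \<sigma> P = cstar_lim (\<lambda>n. B_alg \<sigma> P (2*n)) (phi_B \<sigma> P)"

definition to_A_inf :: "('a \<Rightarrow> 'a) \<Rightarrow> (nat \<Rightarrow> 'a set set) \<Rightarrow> nat \<Rightarrow> 'a lelem \<Rightarrow> (nat \<times> 'a lelem) set" where
  "to_A_inf \<sigma> P = to_star_lim (\<lambda>n. A_alg \<sigma> P (2*n)) (phi_A \<sigma> P)"

definition to_B_inf :: "('a \<Rightarrow> 'a) \<Rightarrow> (nat \<Rightarrow> 'a set set) \<Rightarrow> nat \<Rightarrow> (nat \<Rightarrow> 'a lelem) set \<Rightarrow>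
    (nat \<Rightarrow> (nat \<times> (nat \<Rightarrow> 'a lelem) set) set) set" where
  "to_B_inf \<sigma> P = to_cstar_lim (\<lambda>n. B_alg \<sigma> P (2*n)) (phi_B \<sigma> P)"

definition A_to_B :: "('a \<Rightarrow> 'a) \<Rightarrow> (nat \<Rightarrow> 'a set set) \<Rightarrow> (nat \<times> 'a lelem) set \<Rightarrow>
    (nat \<Rightarrow> (nat \<times> (nat \<Rightarrow> 'a lelem) set) set) set" where
  "A_to_B \<sigma> P = (THE h. h \<in> star_hom (A_inf \<sigma> P) (B_inf \<sigma> P) \<and>
     (\<forall>n. \<forall>a\<in>acarrier (A_alg \<sigma> P (2*n)).
        h (to_A_inf \<sigma> P n a) = to_B_inf \<sigma> P n (L_to_C \<sigma> P (2*n) a)))"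


section \<open>The groupoid of \<open>\<sigma>\<close> and its algebras\<close>

type_synonym 'a arrow = "'a \<times> int \<times> 'a"

definition Zset :: "('a \<Rightarrow> 'a) \<Rightarrow> 'a set \<Rightarrow> nat \<Rightarrow> nat \<Rightarrow> 'a set \<Rightarrow> 'a arrow set" where
  "Zset \<sigma> U m n V = {(x, int m - int n, y) | x y. x \<in> U \<and> y \<in> V \<and> (\<sigma> ^^ m) x = (\<sigma> ^^ n) y}"

definition groupoid :: "'a set \<Rightarrow> ('a \<Rightarrow> 'a) \<Rightarrow> 'a arrow set" where
  "groupoid X \<sigma> = (\<Union>m n. Zset \<sigma> X m n X)"

fun arr_mul :: "'a arrow \<Rightarrow> 'a arrow \<Rightarrow> 'a arrow" where
  "arr_mul (x, p, y) (y', q, z) = (x, p + q, z)"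

fun arr_inv :: "'a arrow \<Rightarrow> 'a arrow" where
  "arr_inv (x, p, y) = (y, - p, x)"

fun arr_source :: "'a arrow \<Rightarrow> 'a" where
  "arr_source (x, p, y) = y"

definition groupoid_top :: "'a::metric_space set \<Rightarrow> ('a \<Rightarrow> 'a) \<Rightarrow> 'a arrow topology" where
  "groupoid_top X \<sigma> = topology_generated_by
     {Zset \<sigma> U m n V | U m n V. openin (top_of_set X) U \<and> openin (top_of_set X) V}"

text \<open>
  The elements of \<open>A\<^sub>\<complex>(\<G>)\<close> are extended by \<open>0\<close> to all triples. In the convolution only the
  finitely many nonzero summands are kept, as a sum over an infinite set is \<open>0\<close> by convention.
\<close>

definition steinberg :: "'a::metric_space set \<Rightarrow> ('a \<Rightarrow> 'a) \<Rightarrow> ('a arrow \<Rightarrow> complex) star_alg" where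
  "steinberg X \<sigma> = \<lparr>
     acarrier = {f. (\<forall>\<gamma>. \<gamma> \<notin> groupoid X \<sigma> \<longrightarrow> f \<gamma> = 0) \<and>
       (\<forall>\<gamma>\<in>groupoid X \<sigma>. \<exists>W. openin (groupoid_top X \<sigma>) W \<and> \<gamma> \<in> W \<and> (\<forall>\<eta>\<in>W. f \<eta> = f \<gamma>)) \<and>
       compactin (groupoid_top X \<sigma>) (groupoid_top X \<sigma> closure_of {\<gamma>. f \<gamma> \<noteq> 0})},
     azero = (\<lambda>\<gamma>. 0),
     aadd = (\<lambda>f g \<gamma>. f \<gamma> + g \<gamma>),
     amul = (\<lambda>f g \<gamma>. if \<gamma> \<in> groupoid X \<sigma> then
        \<Sum>\<alpha> | \<alpha> \<in> groupoid X \<sigma> \<and> arr_source \<alpha> = arr_source \<gamma> \<and>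
               f (arr_mul \<gamma> (arr_inv \<alpha>)) * g \<alpha> \<noteq> 0.
          f (arr_mul \<gamma> (arr_inv \<alpha>)) * g \<alpha> else 0),
     ascale = (\<lambda>c f \<gamma>. c * f \<gamma>),
     astar = (\<lambda>f \<gamma>. cnj (f (arr_inv \<gamma>)))\<rparr>"

definition groupoid_cstar ::
    "'a::metric_space set \<Rightarrow> ('a \<Rightarrow> 'a) \<Rightarrow> (nat \<Rightarrow> 'a arrow \<Rightarrow> complex) set cstar_alg" where
  "groupoid_cstar X \<sigma> = enveloping (steinberg X \<sigma>)"

abbreviation to_groupoid_cstar ::
    "'a::metric_space set \<Rightarrow> ('a \<Rightarrow> 'a) \<Rightarrow> ('a arrow \<Rightarrow> complex) \<Rightarrow> (nat \<Rightarrow> 'a arrow \<Rightarrow> complex) set" where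
  "to_groupoid_cstar X \<sigma> \<equiv> to_enveloping (steinberg X \<sigma>)"


section \<open>The canonical isomorphism \<open>\<phi>\<close>\<close>

fun phi_support :: "('a \<Rightarrow> 'a) \<Rightarrow> 'a edge \<Rightarrow> 'a edge \<Rightarrow> 'a arrow set" where
  "phi_support \<sigma> (Edge Blue _ U W) (Edge Blue _ V _) = Zset \<sigma> W 0 0 W"
| "phi_support \<sigma> (Edge Red _ U W) (Edge Red _ V _) = Zset \<sigma> (U \<inter> \<sigma> -` W) 1 1 (V \<inter> \<sigma> -` W)"
| "phi_support \<sigma> (Edge Red _ U W) (Edge Blue _ V _) = Zset \<sigma> (U \<inter> \<sigma> -` W) 1 0 W"
| "phi_support \<sigma> (Edge Blue _ U W) (Edge Red _ V _) = Zset \<sigma> W 0 1 (V \<inter> \<sigma> -` W)"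

text \<open>
  A \<open>*\<close>-homomorphism on \<open>A_inf\<close> is determined by the values prescribed here, because the vertices
  in \<open>F\<^sup>0\<^sup>,\<^sup>2\<^sup>n\<close> and the elements \<open>ef\<^sup>*\<close> generate \<open>A_alg \<sigma> P (2*n)\<close>.
\<close>

definition canonical_values ::
    "('a \<Rightarrow> 'a) \<Rightarrow> (nat \<Rightarrow> 'a set set) \<Rightarrow> ((nat \<times> 'a lelem) set \<Rightarrow> 'a arrow \<Rightarrow> complex) \<Rightarrow> bool" where
  "canonical_values \<sigma> P \<phi> \<longleftrightarrow> (\<forall>n.
     (\<forall>U\<in>P (2*n). \<phi> (to_A_inf \<sigma> P n (vtx \<sigma> P (2*n) (2*n, U))) = indicator (Zset \<sigma> U 0 0 U)) \<and>
     (\<forall>e\<in>F1 \<sigma> P (2*n). \<forall>f\<in>F1 \<sigma> P (2*n). esource e = esource f \<longrightarrow>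
        \<phi> (to_A_inf \<sigma> P n (amul (L_alg \<sigma> P (2*n)) (edg \<sigma> P (2*n) e)
              (astar (L_alg \<sigma> P (2*n)) (edg \<sigma> P (2*n) f)))) = indicator (phi_support \<sigma> e f)))"

end

theory Submission
  imports Defs
begin

text \<open>
  Both \<open>B_inf\<close> and \<open>C\<^sup>*(\<G>)\<close> are Hausdorff completions of the \<open>*\<close>-algebra \<open>A_inf\<close>: the first one along
  \<open>A_to_B\<close>, the second one along \<open>\<phi>\<close> followed by the canonical map. So the theorem says that the two
  \<open>C\<^sup>*\<close>-seminorms that these maps induce on \<open>A_inf\<close> are equal (\<open>env_norm_phi\<close>). Given this, the
  identity of \<open>A_inf\<close> extends to an isometric isomorphism of the completions, and it extends in one way
  only because \<open>*\<close>-homomorphisms of \<open>C\<^sup>*\<close>-algebras are contractive (\<open>completions_unique_iso\<close>).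

  On the class of \<open>a\<close> in \<open>A\<^sub>2\<^sub>n\<close> the seminorm of \<open>B_inf\<close> is the limit of the norms of the images of \<open>a\<close>
  in the algebras \<open>C\<^sub>2\<^sub>k\<close>. It is a \<open>C\<^sup>*\<close>-seminorm on \<open>A_inf\<close>, and hence, by \<open>\<phi>\<close>, one on the algebra of the
  groupoid, where the norm of \<open>C\<^sup>*(\<G>)\<close> is the largest one. The other inequality is the content of the
  theorem: each \<open>C\<^sup>*\<close>-seminorm \<open>q\<close> on the algebra of the groupoid is at most the norm of \<open>C\<^sub>2\<^sub>n\<close> on
  \<open>A\<^sub>2\<^sub>n\<close> (\<open>seminorm_le_EN\<close>). It does not follow from the definition of the latter as a supremum, since
  \<open>q \<circ> \<phi>\<close> is a seminorm on the corner \<open>A\<^sub>2\<^sub>n\<close> only and the supremum is over seminorms on \<open>L\<^sub>2\<^sub>n\<close>.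

  The bridge is a concrete representation \<open>rep n\<close> of \<open>L\<^sub>2\<^sub>n\<close> by operators on functions on
  \<open>X \<times> \<int> \<times> bool\<close>. Its restriction to \<open>A\<^sub>2\<^sub>n\<close> acts like convolution by \<open>\<phi>(a)\<close>: the entry at \<open>(x, k)\<close>,
  \<open>(y, l)\<close> of the matrix of \<open>rep n a\<close> is \<open>\<phi>(a)(x, k - l, y)\<close> (\<open>represented_all\<close>). The norm of \<open>rep n a\<close> is
  at most the norm of \<open>a\<close> in \<open>C\<^sub>2\<^sub>n\<close>, so what remains is \<open>q f \<le> opnorm T\<close> for each operator \<open>T\<close> with the
  matrix of \<open>f\<close> (\<open>q_le_opnorm\<close>). This says that the full norm of the groupoid is a reduced norm. It is
  proved by a growth argument. The entries of \<open>T\<close> are bounded by \<open>opnorm T\<close>, and \<open>q f\<close> is bounded by the supremum of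
  \<open>|f|\<close> times a constant that counts bisections. The inequality is applied to the powers \<open>(f\<^sup>*f)^(2^m)\<close>.
  The constants grow at most linearly in \<open>2^m\<close>, so they disappear in the limit of the \<open>2^(m+1)\<close>-th roots
  (\<open>spectral_compare\<close>): functions on one equivalence relation \<open>\<sigma>\<^sup>n x = \<sigma>\<^sup>n y\<close> need a bounded number of
  pieces (\<open>q_level\<close>), functions of one degree reduce to these by \<open>f\<^sup>*f\<close> (\<open>q_homogeneous\<close>), and the
  number of degrees of \<open>(f\<^sup>*f)^(2^m)\<close> is linear in \<open>2^m\<close> (\<open>q_degree\<close>).

  The maps \<open>\<phi>\<^sub>n\<close> and \<open>A_to_B\<close> are given by descriptions, so one has to know that they exist and are
  unique. On \<open>L\<^sub>n\<close> existence is the universal property of a presented algebra, where the relations hold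
  because two-step paths from \<open>v\<close> in one member of its partition of edges correspond to the vertices two
  levels below \<open>v\<close> (\<open>two_step_bij\<close>). On \<open>C\<^sub>n\<close> uniqueness needs again that \<open>*\<close>-homomorphisms are contractive.
\<close>


section \<open>Complex \<open>*\<close>-algebras with a carrier\<close>

text \<open>
  The record of a \<open>*\<close>-algebra does not contain its axioms; the locale below supplies them. Its
  equations are those of \<open>pres_eq\<close>, so that presented algebras satisfy them by construction.
\<close>

notation aadd (infixl \<open>\<oplus>\<index>\<close> 65)
notation amul (infixl \<open>\<otimes>\<index>\<close> 70)
notation azero (\<open>\<zero>\<index>\<close>)
notation ascale (infixr \<open>\<cdot>\<index>\<close> 75)
notation asub (infixl \<open>\<ominus>\<index>\<close> 65)
notation astar (\<open>star\<index> _\<close> [90] 90)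

locale star_algebra =
  fixes A :: "('a, 'm) star_alg_scheme" (structure)
  assumes zero_in [simp]: "\<zero> \<in> acarrier A"
    and add_in [simp]: "a \<in> acarrier A \<Longrightarrow> b \<in> acarrier A \<Longrightarrow> a \<oplus> b \<in> acarrier A"
    and mul_in [simp]: "a \<in> acarrier A \<Longrightarrow> b \<in> acarrier A \<Longrightarrow> a \<otimes> b \<in> acarrier A"
    and scale_in [simp]: "a \<in> acarrier A \<Longrightarrow> k \<cdot> a \<in> acarrier A"
    and star_in [simp]: "a \<in> acarrier A \<Longrightarrow> star a \<in> acarrier A"
    and add_assoc: "\<lbrakk>a \<in> acarrier A; b \<in> acarrier A; c \<in> acarrier A\<rbrakk> \<Longrightarrow> a \<oplus> b \<oplus> c = a \<oplus> (b \<oplus> c)"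
    and add_comm: "\<lbrakk>a \<in> acarrier A; b \<in> acarrier A\<rbrakk> \<Longrightarrow> a \<oplus> b = b \<oplus> a"
    and add_zero [simp]: "a \<in> acarrier A \<Longrightarrow> a \<oplus> \<zero> = a"
    and add_neg: "a \<in> acarrier A \<Longrightarrow> a \<oplus> (-1) \<cdot> a = \<zero>"
    and scale_add: "\<lbrakk>a \<in> acarrier A; b \<in> acarrier A\<rbrakk> \<Longrightarrow> k \<cdot> (a \<oplus> b) = k \<cdot> a \<oplus> k \<cdot> b"
    and add_scale: "a \<in> acarrier A \<Longrightarrow> (k + l) \<cdot> a = k \<cdot> a \<oplus> l \<cdot> a"
    and scale_scale [simp]: "a \<in> acarrier A \<Longrightarrow> k \<cdot> l \<cdot> a = (k * l) \<cdot> a"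
    and scale_one [simp]: "a \<in> acarrier A \<Longrightarrow> 1 \<cdot> a = a"
    and mul_assoc: "\<lbrakk>a \<in> acarrier A; b \<in> acarrier A; c \<in> acarrier A\<rbrakk> \<Longrightarrow> a \<otimes> b \<otimes> c = a \<otimes> (b \<otimes> c)"
    and mul_add: "\<lbrakk>a \<in> acarrier A; b \<in> acarrier A; c \<in> acarrier A\<rbrakk> \<Longrightarrow> a \<otimes> (b \<oplus> c) = a \<otimes> b \<oplus> a \<otimes> c"
    and add_mul: "\<lbrakk>a \<in> acarrier A; b \<in> acarrier A; c \<in> acarrier A\<rbrakk> \<Longrightarrow> (a \<oplus> b) \<otimes> c = a \<otimes> c \<oplus> b \<otimes> c"
    and scale_mul [simp]: "\<lbrakk>a \<in> acarrier A; b \<in> acarrier A\<rbrakk> \<Longrightarrow> (k \<cdot> a) \<otimes> b = k \<cdot> (a \<otimes> b)"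
    and mul_scale [simp]: "\<lbrakk>a \<in> acarrier A; b \<in> acarrier A\<rbrakk> \<Longrightarrow> a \<otimes> (k \<cdot> b) = k \<cdot> (a \<otimes> b)"
    and star_star [simp]: "a \<in> acarrier A \<Longrightarrow> star (star a) = a"
    and star_add: "\<lbrakk>a \<in> acarrier A; b \<in> acarrier A\<rbrakk> \<Longrightarrow> star (a \<oplus> b) = star a \<oplus> star b"
    and star_scale: "a \<in> acarrier A \<Longrightarrow> star (k \<cdot> a) = cnj k \<cdot> star a"
    and star_mul: "\<lbrakk>a \<in> acarrier A; b \<in> acarrier A\<rbrakk> \<Longrightarrow> star (a \<otimes> b) = star b \<otimes> star a"
begin

lemma add_lcomm:
  "\<lbrakk>a \<in> acarrier A; b \<in> acarrier A; c \<in> acarrier A\<rbrakk> \<Longrightarrow> a \<oplus> (b \<oplus> c) = b \<oplus> (a \<oplus> c)"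
  by (metis add_assoc add_comm)

lemmas add_ac = add_assoc add_comm add_lcomm

lemma zero_add [simp]: "a \<in> acarrier A \<Longrightarrow> \<zero> \<oplus> a = a"
  by (metis add_comm add_zero zero_in)

lemma sub_in [simp]: "a \<in> acarrier A \<Longrightarrow> b \<in> acarrier A \<Longrightarrow> a \<ominus> b \<in> acarrier A"
  by (simp add: asub_def)

lemma neg_add: "a \<in> acarrier A \<Longrightarrow> (-1) \<cdot> a \<oplus> a = \<zero>"
  by (metis add_comm add_neg scale_in)

lemma add_left_imp: "\<lbrakk>a \<in> acarrier A; b \<in> acarrier A; c \<in> acarrier A; a \<oplus> b = a \<oplus> c\<rbrakk> \<Longrightarrow> b = c"
  by (metis add_assoc neg_add scale_in zero_add)

lemma scale_zero_left [simp]: "a \<in> acarrier A \<Longrightarrow> 0 \<cdot> a = \<zero>"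
  by (metis add.right_neutral add_left_imp add_scale add_zero scale_in zero_in)

lemma scale_zero [simp]: "k \<cdot> \<zero> = \<zero>"
  by (metis mult_zero_right scale_scale scale_zero_left zero_in)

lemma mul_zero [simp]: "a \<in> acarrier A \<Longrightarrow> a \<otimes> \<zero> = \<zero>"
  by (metis mul_in mul_scale scale_zero_left zero_in)

lemma zero_mul [simp]: "a \<in> acarrier A \<Longrightarrow> \<zero> \<otimes> a = \<zero>"
  by (metis mul_in scale_mul scale_zero_left zero_in)

lemma star_zero [simp]: "star \<zero> = \<zero>"
  by (metis complex_cnj_zero scale_zero scale_zero_left star_in star_scale zero_in)

lemma sub_self [simp]: "a \<in> acarrier A \<Longrightarrow> a \<ominus> a = \<zero>"
  by (simp add: asub_def add_neg)

lemma sub_zero [simp]: "a \<in> acarrier A \<Longrightarrow> a \<ominus> \<zero> = a"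
  by (simp add: asub_def)

lemma sub_eq_zero: "\<lbrakk>a \<in> acarrier A; b \<in> acarrier A\<rbrakk> \<Longrightarrow> a \<ominus> b = \<zero> \<longleftrightarrow> a = b"
  by (metis asub_def add_assoc add_zero neg_add scale_in sub_self zero_add)

lemma sub_swap: "\<lbrakk>a \<in> acarrier A; b \<in> acarrier A\<rbrakk> \<Longrightarrow> b \<ominus> a = (-1) \<cdot> (a \<ominus> b)"
  by (simp add: asub_def scale_add add_comm)

lemma sub_trans: "\<lbrakk>a \<in> acarrier A; b \<in> acarrier A; c \<in> acarrier A\<rbrakk> \<Longrightarrow> a \<ominus> c = (a \<ominus> b) \<oplus> (b \<ominus> c)"
  unfolding asub_def
  by (metis add_assoc add_in add_neg add_comm scale_in zero_add)

lemma sub_add_cancel: "\<lbrakk>a \<in> acarrier A; b \<in> acarrier A\<rbrakk> \<Longrightarrow> (a \<ominus> b) \<oplus> b = a"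
  by (simp add: asub_def add_assoc neg_add)

lemma add_sub_add: "\<lbrakk>a \<in> acarrier A; b \<in> acarrier A; c \<in> acarrier A; d \<in> acarrier A\<rbrakk>
    \<Longrightarrow> (a \<oplus> b) \<ominus> (c \<oplus> d) = (a \<ominus> c) \<oplus> (b \<ominus> d)"
  by (simp add: asub_def scale_add add_ac)

lemma mul_sub: "\<lbrakk>a \<in> acarrier A; b \<in> acarrier A; c \<in> acarrier A\<rbrakk> \<Longrightarrow> a \<otimes> (b \<ominus> c) = a \<otimes> b \<ominus> a \<otimes> c"
  by (simp add: asub_def mul_add)

lemma sub_mul: "\<lbrakk>a \<in> acarrier A; b \<in> acarrier A; c \<in> acarrier A\<rbrakk> \<Longrightarrow> (a \<ominus> b) \<otimes> c = a \<otimes> c \<ominus> b \<otimes> c"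
  by (simp add: asub_def add_mul)

lemma mul_sub_mul: "\<lbrakk>a \<in> acarrier A; b \<in> acarrier A; c \<in> acarrier A; d \<in> acarrier A\<rbrakk>
    \<Longrightarrow> a \<otimes> b \<ominus> c \<otimes> d = (a \<ominus> c) \<otimes> b \<oplus> c \<otimes> (b \<ominus> d)"
  by (simp add: mul_sub sub_mul sub_trans[of "a \<otimes> b" "c \<otimes> b" "c \<otimes> d"])

lemma scale_sub: "\<lbrakk>a \<in> acarrier A; b \<in> acarrier A\<rbrakk> \<Longrightarrow> k \<cdot> a \<ominus> k \<cdot> b = k \<cdot> (a \<ominus> b)"
  by (simp add: asub_def scale_add mult.commute)

lemma star_sub: "\<lbrakk>a \<in> acarrier A; b \<in> acarrier A\<rbrakk> \<Longrightarrow> star a \<ominus> star b = star (a \<ominus> b)"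
  by (simp add: asub_def star_add star_scale)


subsection \<open>Finite sums\<close>

lemma asum_empty [simp]: "asum A f {} = \<zero>"
  by (simp add: asum_def)

text \<open>
  \<open>asum\<close> folds the addition over a set, but addition is commutative on the carrier only. Replacing the
  folded function by one that ignores everything outside the carrier makes it commute everywhere.
\<close>

lemma asum_alt:
  assumes "f \<in> I \<rightarrow> acarrier A"
  shows "asum A f I = Finite_Set.fold (\<lambda>i z. if z \<in> acarrier A \<and> f i \<in> acarrier A then f i \<oplus> z else z) \<zero> I"
  unfolding asum_def
  by (rule fold_closed_eq[where B = "acarrier A"]) (use assms in auto)

lemma asum_insert [simp]:
  assumes "finite I" "i \<notin> I" "f i \<in> acarrier A" "f \<in> I \<rightarrow> acarrier A"
  shows "asum A f (insert i I) = f i \<oplus> asum A f I"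
proof -
  interpret comp_fun_commute "\<lambda>i z. if z \<in> acarrier A \<and> f i \<in> acarrier A then f i \<oplus> z else z"
    by unfold_locales (auto simp: fun_eq_iff add_ac)
  have *: "asum A f I \<in> acarrier A"
    unfolding asum_alt[OF assms(4)] using assms(1) by (induction I) auto
  have ins: "f \<in> insert i I \<rightarrow> acarrier A" using assms by auto
  show ?thesis using * assms(1-3) unfolding asum_alt[OF assms(4)] asum_alt[OF ins] by simp
qed

lemma asum_in [simp]: "f \<in> I \<rightarrow> acarrier A \<Longrightarrow> asum A f I \<in> acarrier A"
proof (induction I rule: infinite_finite_induct)
  case (insert i I)
  then have "f i \<in> acarrier A" "f \<in> I \<rightarrow> acarrier A" by auto
  with insert show ?case by simp
qed (auto simp: asum_def)

lemma asum_cong: "I = J \<Longrightarrow> (\<And>i. i \<in> J \<Longrightarrow> f i = g i) \<Longrightarrow> g \<in> J \<rightarrow> acarrier A \<Longrightarrow> asum A f I = asum A g J"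
proof -
  assume *: "I = J" "\<And>i. i \<in> J \<Longrightarrow> f i = g i" "g \<in> J \<rightarrow> acarrier A"
  have "asum A f J = asum A g J" using *(2,3)
  proof (induction J rule: infinite_finite_induct)
    case (insert i J)
    then have "f \<in> J \<rightarrow> acarrier A" by auto
    with insert show ?case by (simp add: Pi_iff)
  qed (auto simp: asum_def)
  then show ?thesis using *(1) by simp
qed

lemma asum_zero: "(\<And>i. i \<in> I \<Longrightarrow> f i = \<zero>) \<Longrightarrow> asum A f I = \<zero>"
proof (induction I rule: infinite_finite_induct)
  case (insert i I)
  then have "f \<in> I \<rightarrow> acarrier A" by auto
  with insert show ?case by simp
qed (auto simp: asum_def)

lemma asum_neutral:
  assumes "finite I" "J \<subseteq> I" "\<And>i. i \<in> I - J \<Longrightarrow> f i = \<zero>" "f \<in> J \<rightarrow> acarrier A"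
  shows "asum A f I = asum A f J"
proof -
  have fJ: "finite J" using assms finite_subset by blast
  have "finite K \<Longrightarrow> K \<inter> J = {} \<Longrightarrow> (\<And>i. i \<in> K \<Longrightarrow> f i = \<zero>) \<Longrightarrow> asum A f (K \<union> J) = asum A f J" for K
  proof (induction K rule: finite_induct)
    case (insert i K)
    then have "f \<in> K \<union> J \<rightarrow> acarrier A" using assms(4) by auto
    with insert fJ assms(4) show ?case by auto
  qed simp
  from this[of "I - J"] assms show ?thesis
    by (metis Diff_disjoint Diff_partition Int_commute finite_Diff inf_commute Un_commute)
qed

lemma asum_single:
  assumes "finite I" "i \<in> I" "f i \<in> acarrier A" "\<And>j. j \<in> I \<Longrightarrow> j \<noteq> i \<Longrightarrow> f j = \<zero>"
  shows "asum A f I = f i"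
  by (subst asum_neutral[of _ "{i}"]) (use assms in auto)

lemma asum_reindex:
  assumes "inj_on k I" "f \<in> k ` I \<rightarrow> acarrier A"
  shows "asum A f (k ` I) = asum A (\<lambda>i. f (k i)) I"
  using assms
proof (induction I rule: infinite_finite_induct)
  case (infinite I)
  then show ?case by (simp add: asum_def finite_image_iff)
qed (auto simp: Pi_iff)

lemma asum_Un:
  assumes "finite I" "finite J" "I \<inter> J = {}" "f \<in> I \<union> J \<rightarrow> acarrier A"
  shows "asum A f (I \<union> J) = asum A f I \<oplus> asum A f J"
  using assms(1,3,4)
proof (induction I rule: finite_induct)
  case (insert i I)
  then have "asum A f (insert i I \<union> J) = f i \<oplus> asum A f (I \<union> J)"
    using assms(2) by (simp add: Pi_iff)
  then show ?case using insert by (simp add: Pi_iff add_assoc)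
qed (use assms in auto)

lemma asum_Sigma:
  assumes "finite I" "\<And>i. i \<in> I \<Longrightarrow> finite (J i)" "\<And>i j. i \<in> I \<Longrightarrow> j \<in> J i \<Longrightarrow> f i j \<in> acarrier A"
  shows "asum A (\<lambda>i. asum A (f i) (J i)) I = asum A (\<lambda>(i, j). f i j) (SIGMA i:I. J i)"
  using assms
proof (induction I rule: finite_induct)
  case (insert i I)
  have *: "(SIGMA i:insert i I. J i) = Pair i ` J i \<union> (SIGMA i:I. J i)" by auto
  have "asum A (\<lambda>(i, j). f i j) (Pair i ` J i) = asum A (f i) (J i)"
    using insert by (subst asum_reindex) (auto simp: inj_on_def)
  moreover have "asum A (\<lambda>(i, j). f i j) (SIGMA i:insert i I. J i) =
     asum A (\<lambda>(i, j). f i j) (Pair i ` J i) \<oplus> asum A (\<lambda>(i, j). f i j) (SIGMA i:I. J i)"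
    unfolding * using insert by (intro asum_Un) auto
  ultimately show ?case using insert by (simp add: Pi_iff)
qed auto

lemma asum_additive:
  assumes "star_algebra B" "f \<in> I \<rightarrow> acarrier A"
    "\<And>a. a \<in> acarrier A \<Longrightarrow> h a \<in> acarrier B" "h \<zero> = \<zero>\<^bsub>B\<^esub>"
    "\<And>a b. a \<in> acarrier A \<Longrightarrow> b \<in> acarrier A \<Longrightarrow> h (a \<oplus> b) = h a \<oplus>\<^bsub>B\<^esub> h b"
  shows "h (asum A f I) = asum B (\<lambda>i. h (f i)) I"
  using assms(2)
proof (induction I rule: infinite_finite_induct)
  case (infinite I)
  then show ?case by (simp add: asum_def assms)
next
  case empty
  interpret B: star_algebra B by fact
  show ?case by (simp add: assms)
next
  case (insert i I)
  interpret B: star_algebra B by fact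
  from insert have "f i \<in> acarrier A" "f \<in> I \<rightarrow> acarrier A" by auto
  moreover have "h (f i) \<in> acarrier B" "(\<lambda>i. h (f i)) \<in> I \<rightarrow> acarrier B"
    using insert assms(3) by (auto simp: Pi_iff)
  ultimately show ?case
    using insert by (simp add: assms(5))
qed

lemma mul_asum: "a \<in> acarrier A \<Longrightarrow> f \<in> I \<rightarrow> acarrier A \<Longrightarrow> a \<otimes> asum A f I = asum A (\<lambda>i. a \<otimes> f i) I"
  by (rule asum_additive[of A _ _ "\<lambda>x. a \<otimes> x"]) (auto simp: mul_add star_algebra_axioms)

lemma asum_mul: "a \<in> acarrier A \<Longrightarrow> f \<in> I \<rightarrow> acarrier A \<Longrightarrow> asum A f I \<otimes> a = asum A (\<lambda>i. f i \<otimes> a) I"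
  by (rule asum_additive[of A _ _ "\<lambda>x. x \<otimes> a"]) (auto simp: add_mul star_algebra_axioms)

lemma star_asum: "f \<in> I \<rightarrow> acarrier A \<Longrightarrow> star (asum A f I) = asum A (\<lambda>i. star (f i)) I"
  by (rule asum_additive[of A _ _ "\<lambda>x. star x"]) (auto simp: star_add star_algebra_axioms)

end


subsection \<open>Homomorphisms\<close>

lemma star_homD:
  assumes "h \<in> star_hom A B"
  shows "a \<in> acarrier A \<Longrightarrow> h a \<in> acarrier B"
    and "a \<in> acarrier A \<Longrightarrow> b \<in> acarrier A \<Longrightarrow> h (a \<oplus>\<^bsub>A\<^esub> b) = h a \<oplus>\<^bsub>B\<^esub> h b"
    and "a \<in> acarrier A \<Longrightarrow> b \<in> acarrier A \<Longrightarrow> h (a \<otimes>\<^bsub>A\<^esub> b) = h a \<otimes>\<^bsub>B\<^esub> h b"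
    and "a \<in> acarrier A \<Longrightarrow> h (k \<cdot>\<^bsub>A\<^esub> a) = k \<cdot>\<^bsub>B\<^esub> h a"
    and "a \<in> acarrier A \<Longrightarrow> h (star\<^bsub>A\<^esub> a) = star\<^bsub>B\<^esub> (h a)"
    and "a \<notin> acarrier A \<Longrightarrow> h a = undefined"
  using assms by (auto simp: star_hom_def PiE_iff extensional_def)

lemma star_homI:
  assumes "\<And>a. a \<in> acarrier A \<Longrightarrow> h a \<in> acarrier B"
    and "\<And>a b. a \<in> acarrier A \<Longrightarrow> b \<in> acarrier A \<Longrightarrow> h (a \<oplus>\<^bsub>A\<^esub> b) = h a \<oplus>\<^bsub>B\<^esub> h b"
    and "\<And>a b. a \<in> acarrier A \<Longrightarrow> b \<in> acarrier A \<Longrightarrow> h (a \<otimes>\<^bsub>A\<^esub> b) = h a \<otimes>\<^bsub>B\<^esub> h b"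
    and "\<And>a k. a \<in> acarrier A \<Longrightarrow> h (k \<cdot>\<^bsub>A\<^esub> a) = k \<cdot>\<^bsub>B\<^esub> h a"
    and "\<And>a. a \<in> acarrier A \<Longrightarrow> h (star\<^bsub>A\<^esub> a) = star\<^bsub>B\<^esub> (h a)"
    and "star_algebra A"
  shows "restrict h (acarrier A) \<in> star_hom A B"
proof -
  interpret star_algebra A by fact
  show ?thesis using assms by (auto simp: star_hom_def)
qed

lemma star_hom_eqI:
  assumes "h \<in> star_hom A B" "h' \<in> star_hom A B'" "\<And>a. a \<in> acarrier A \<Longrightarrow> h a = h' a"
  shows "h = h'"
proof
  fix a show "h a = h' a"
    using assms(3)[of a] star_homD(6)[OF assms(1), of a] star_homD(6)[OF assms(2), of a] by metis
qed

lemma star_hom_zero: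
  assumes "h \<in> star_hom A B" "star_algebra A" "star_algebra B"
  shows "h \<zero>\<^bsub>A\<^esub> = \<zero>\<^bsub>B\<^esub>"
proof -
  interpret A: star_algebra A by fact
  interpret B: star_algebra B by fact
  have "h (0 \<cdot>\<^bsub>A\<^esub> \<zero>\<^bsub>A\<^esub>) = 0 \<cdot>\<^bsub>B\<^esub> h \<zero>\<^bsub>A\<^esub>" by (rule star_homD(4)[OF assms(1)]) simp
  then show ?thesis using star_homD(1)[OF assms(1) A.zero_in] by simp
qed

lemma star_hom_sub:
  assumes "h \<in> star_hom A B" "star_algebra A" "a \<in> acarrier A" "b \<in> acarrier A"
  shows "h (a \<ominus>\<^bsub>A\<^esub> b) = h a \<ominus>\<^bsub>B\<^esub> h b"
proof -
  interpret A: star_algebra A by fact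
  show ?thesis using assms by (simp add: asub_def star_homD[OF assms(1)])
qed

lemma star_hom_asum:
  assumes "h \<in> star_hom A B" "star_algebra A" "star_algebra B" "f \<in> I \<rightarrow> acarrier A"
  shows "h (asum A f I) = asum B (\<lambda>i. h (f i)) I"
  by (rule star_algebra.asum_additive[OF assms(2,3,4)])
     (use assms star_homD[OF assms(1)] star_hom_zero in auto)

lemma star_hom_comp:
  assumes "h \<in> star_hom A B" "g \<in> star_hom B C" "star_algebra A"
  shows "restrict (g \<circ> h) (acarrier A) \<in> star_hom A C"
  by (rule star_homI) (use assms star_homD[OF assms(1)] star_homD[OF assms(2)] in auto)


subsection \<open>Corners\<close>

lemma corner_sel [simp]:
  "azero (corner A p) = azero A" "aadd (corner A p) = aadd A" "amul (corner A p) = amul A"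
  "ascale (corner A p) = ascale A" "astar (corner A p) = astar A" "asub (corner A p) = asub A"
  "asum (corner A p) = asum A"
  by (auto simp: corner_def asub_def fun_eq_iff asum_def)

lemma cnorm_corner [simp]: "cnorm (corner A p) = cnorm A"
  by (simp add: corner_def)

text \<open>
  The corner of a projection is \<open>{a. p a = a = a p}\<close>, which is easier to work with than the image of
  \<open>a \<mapsto> p a p\<close>.
\<close>

locale star_projection = star_algebra +
  fixes p
  assumes p_in [simp]: "p \<in> acarrier A" and p_idem: "p \<otimes> p = p" and p_star: "star p = p"
begin

lemma corner_iff: "a \<in> acarrier (corner A p) \<longleftrightarrow> a \<in> acarrier A \<and> p \<otimes> a = a \<and> a \<otimes> p = a"
proof
  assume "a \<in> acarrier (corner A p)"
  then obtain b where b: "b \<in> acarrier A" "a = p \<otimes> b \<otimes> p" by (auto simp: corner_def)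
  have "p \<otimes> (p \<otimes> (b \<otimes> p)) = p \<otimes> (b \<otimes> p)" using b p_idem by (metis mul_assoc mul_in p_in)
  then show "a \<in> acarrier A \<and> p \<otimes> a = a \<and> a \<otimes> p = a" using b by (simp add: mul_assoc p_idem)
next
  assume "a \<in> acarrier A \<and> p \<otimes> a = a \<and> a \<otimes> p = a"
  then show "a \<in> acarrier (corner A p)" unfolding corner_def by (auto intro!: image_eqI[of _ _ a])
qed

lemma compress_in: "a \<in> acarrier A \<Longrightarrow> p \<otimes> a \<otimes> p \<in> acarrier (corner A p)"
  by (simp add: corner_def)

lemma corner_star_algebra: "star_algebra (corner A p)"
proof
  fix a assume "a \<in> acarrier (corner A p)"
  then have a: "a \<in> acarrier A" "p \<otimes> a = a" "a \<otimes> p = a" by (auto simp: corner_iff)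
  then have "p \<otimes> star a = star a" "star a \<otimes> p = star a"
    by (metis p_in p_star star_mul)+
  then show "star\<^bsub>corner A p\<^esub> a \<in> acarrier (corner A p)" using a by (simp add: corner_iff)
qed (auto simp: corner_iff add_assoc add_lcomm add_neg scale_add add_scale mul_assoc mul_add
  add_mul star_add star_scale star_mul intro: add_comm, auto simp flip: mul_assoc)

lemma p_corner: "p \<in> acarrier (corner A p)"
  by (simp add: corner_iff p_idem)

end


subsection \<open>Presented algebras\<close>

lemma UN_const_eq: "a \<in> S \<Longrightarrow> (\<And>y. y \<in> S \<Longrightarrow> f y = c) \<Longrightarrow> (\<Union>y\<in>S. f y) = c"
  by auto

lemma pres_class_eq_iff: "pres_class G R s = pres_class G R t \<longleftrightarrow> pres_eq G R s t"
proof
  assume "pres_class G R s = pres_class G R t"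
  moreover have "t \<in> pres_class G R t" by (simp add: pres_class_def pres_eq.refl)
  ultimately have "t \<in> pres_class G R s" by (rule ssubst)
  then show "pres_eq G R s t" by (simp add: pres_class_def)
next
  assume "pres_eq G R s t"
  then show "pres_class G R s = pres_class G R t"
    unfolding pres_class_def by (intro Collect_cong iffI) (erule pres_eq.trans[OF pres_eq.sym] pres_eq.trans, assumption)+
qed

lemma in_pres_class: "s' \<in> pres_class G R s \<longleftrightarrow> pres_class G R s' = pres_class G R s"
  unfolding pres_class_eq_iff unfolding pres_class_def mem_Collect_eq by (metis pres_eq.sym)

lemma pres_class_self: "s \<in> pres_class G R s"
  by (simp add: in_pres_class)

lemma presented_carrier: "acarrier (presented G R) = range (pres_class G R)"
  by (simp add: presented_def)

text \<open>
  The operations of \<open>presented\<close> are unions over representatives; all members of the union agree because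
  \<open>pres_eq\<close> is a congruence.
\<close>

lemma presented_ops:
  "azero (presented G R) = pres_class G R Zero"
  "aadd (presented G R) (pres_class G R s) (pres_class G R t) = pres_class G R (Add s t)"
  "amul (presented G R) (pres_class G R s) (pres_class G R t) = pres_class G R (Mul s t)"
  "ascale (presented G R) k (pres_class G R s) = pres_class G R (Scale k s)"
  "astar (presented G R) (pres_class G R s) = pres_class G R (Star s)"
proof -
  have add: "pres_class G R (Add s' t') = pres_class G R (Add s t)"
    if "s' \<in> pres_class G R s" "t' \<in> pres_class G R t" for s' t'
    using that unfolding in_pres_class pres_class_eq_iff by (rule pres_eq.cong_add)
  have mul: "pres_class G R (Mul s' t') = pres_class G R (Mul s t)"
    if "s' \<in> pres_class G R s" "t' \<in> pres_class G R t" for s' t'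
    using that unfolding in_pres_class pres_class_eq_iff by (rule pres_eq.cong_mul)
  have sc: "pres_class G R (Scale k s') = pres_class G R (Scale k s)" if "s' \<in> pres_class G R s" for s'
    using that unfolding in_pres_class pres_class_eq_iff by (rule pres_eq.cong_scale)
  have st: "pres_class G R (Star s') = pres_class G R (Star s)" if "s' \<in> pres_class G R s" for s'
    using that unfolding in_pres_class pres_class_eq_iff by (rule pres_eq.cong_star)
  note self = pres_class_self[of s G R] pres_class_self[of t G R]
  show "azero (presented G R) = pres_class G R Zero" by (simp add: presented_def)
  show "aadd (presented G R) (pres_class G R s) (pres_class G R t) = pres_class G R (Add s t)"
    unfolding presented_def star_alg.simps by (rule UN_const_eq[OF self(1)], rule UN_const_eq[OF self(2)], rule add)
  show "amul (presented G R) (pres_class G R s) (pres_class G R t) = pres_class G R (Mul s t)"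
    unfolding presented_def star_alg.simps by (rule UN_const_eq[OF self(1)], rule UN_const_eq[OF self(2)], rule mul)
  show "ascale (presented G R) k (pres_class G R s) = pres_class G R (Scale k s)"
    unfolding presented_def star_alg.simps by (rule UN_const_eq[OF self(1)], rule sc)
  show "astar (presented G R) (pres_class G R s) = pres_class G R (Star s)"
    unfolding presented_def star_alg.simps by (rule UN_const_eq[OF self(1)], rule st)
qed

lemma presented_star_algebra: "star_algebra (presented G R)"
proof (unfold_locales; unfold presented_carrier; (elim imageE)?; (simp only: presented_ops rangeI pres_class_eq_iff)?)
qed (rule rangeI pres_eq.add_assoc pres_eq.add_comm pres_eq.add_zero pres_eq.add_neg pres_eq.scale_add
    pres_eq.add_scale pres_eq.scale_scale pres_eq.scale_one pres_eq.mul_assoc pres_eq.mul_add pres_eq.add_mul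
    pres_eq.scale_mul pres_eq.mul_scale pres_eq.star_star pres_eq.star_add pres_eq.star_scale pres_eq.star_mul)+

primrec interp :: "('b, 'm) star_alg_scheme \<Rightarrow> ('g \<Rightarrow> 'b) \<Rightarrow> 'g sterm \<Rightarrow> 'b" where
  "interp B \<gamma> (Gen g) = \<gamma> g"
| "interp B \<gamma> Zero = \<zero>\<^bsub>B\<^esub>"
| "interp B \<gamma> (Add s t) = interp B \<gamma> s \<oplus>\<^bsub>B\<^esub> interp B \<gamma> t"
| "interp B \<gamma> (Mul s t) = interp B \<gamma> s \<otimes>\<^bsub>B\<^esub> interp B \<gamma> t"
| "interp B \<gamma> (Scale k s) = k \<cdot>\<^bsub>B\<^esub> interp B \<gamma> s"
| "interp B \<gamma> (Star s) = star\<^bsub>B\<^esub> (interp B \<gamma> s)"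

lemma (in star_algebra) interp_in: "(\<And>g. \<gamma> g \<in> acarrier A) \<Longrightarrow> interp A \<gamma> t \<in> acarrier A"
  by (induction t) auto

lemma (in star_algebra) interp_sound:
  assumes "pres_eq G R s t" "\<And>g. \<gamma> g \<in> acarrier A" "\<And>g. g \<notin> G \<Longrightarrow> \<gamma> g = \<zero>"
    "\<And>s t. (s, t) \<in> R \<Longrightarrow> interp A \<gamma> s = interp A \<gamma> t"
  shows "interp A \<gamma> s = interp A \<gamma> t"
  using assms(1)
proof induction
  case (rel s t)
  then show ?case by (rule assms(4))
next
  case (add_comm s t)
  then show ?case by (simp add: star_algebra.add_comm[OF star_algebra_axioms] interp_in assms(2))
qed (simp_all add: assms(2,3) interp_in add_assoc add_neg scale_add add_scale mul_assoc mul_add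
      add_mul star_add star_scale star_mul)

text \<open>
  The universal property. A letter outside \<open>G\<close> is a term all the same, and \<open>pres_eq\<close> identifies it with
  \<open>Zero\<close>; therefore the assignment has to send it to zero.
\<close>

lemma presented_lift:
  assumes "star_algebra B" "\<And>g. \<gamma> g \<in> acarrier B" "\<And>g. g \<notin> G \<Longrightarrow> \<gamma> g = \<zero>\<^bsub>B\<^esub>"
    "\<And>s t. (s, t) \<in> R \<Longrightarrow> interp B \<gamma> s = interp B \<gamma> t"
  shows "\<exists>h\<in>star_hom (presented G R) B. \<forall>t. h (pres_class G R t) = interp B \<gamma> t"
proof -
  interpret star_algebra B by fact
  interpret P: star_algebra "presented G R" by (rule presented_star_algebra)
  define h0 where "h0 S = interp B \<gamma> (SOME t. pres_class G R t = S)" for S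
  have h0: "h0 (pres_class G R t) = interp B \<gamma> t" for t
  proof -
    have "\<exists>t'. pres_class G R t' = pres_class G R t" by blast
    then have "pres_class G R (SOME t'. pres_class G R t' = pres_class G R t) = pres_class G R t"
      by (rule someI_ex)
    then have "pres_eq G R (SOME t'. pres_class G R t' = pres_class G R t) t"
      by (simp add: pres_class_eq_iff)
    then show ?thesis unfolding h0_def by (rule interp_sound[OF _ assms(2-4)])
  qed
  have "restrict h0 (acarrier (presented G R)) \<in> star_hom (presented G R) B"
    by (rule star_homI[OF _ _ _ _ _ P.star_algebra_axioms]; unfold presented_carrier; (elim imageE)?;
        simp add: presented_ops h0 interp_in assms(2))
  moreover have "\<forall>t. restrict h0 (acarrier (presented G R)) (pres_class G R t) = interp B \<gamma> t"
    by (simp add: presented_carrier h0)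
  ultimately show ?thesis by blast
qed

lemma presented_induct [consumes 1]:
  assumes "S \<in> acarrier (presented G R)" "\<And>g. g \<in> G \<Longrightarrow> Q (pres_class G R (Gen g))"
    "Q (azero (presented G R))"
    "\<And>a b. \<lbrakk>a \<in> acarrier (presented G R); b \<in> acarrier (presented G R); Q a; Q b\<rbrakk> \<Longrightarrow> Q (a \<oplus>\<^bsub>presented G R\<^esub> b)"
    "\<And>a b. \<lbrakk>a \<in> acarrier (presented G R); b \<in> acarrier (presented G R); Q a; Q b\<rbrakk> \<Longrightarrow> Q (a \<otimes>\<^bsub>presented G R\<^esub> b)"
    "\<And>a k. \<lbrakk>a \<in> acarrier (presented G R); Q a\<rbrakk> \<Longrightarrow> Q (k \<cdot>\<^bsub>presented G R\<^esub> a)"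
    "\<And>a. \<lbrakk>a \<in> acarrier (presented G R); Q a\<rbrakk> \<Longrightarrow> Q (star\<^bsub>presented G R\<^esub> a)"
  shows "Q S"
proof -
  have "Q (pres_class G R t)" for t
  proof (induction t)
    case (Gen g)
    show ?case
    proof (cases "g \<in> G")
      case False
      then have "pres_class G R (Gen g) = azero (presented G R)"
        by (simp add: presented_ops pres_class_eq_iff pres_eq.outside)
      then show ?thesis using assms(3) by simp
    qed (use assms(2) in blast)
  next
    case Zero
    show ?case using assms(3) by (simp add: presented_ops)
  next
    case (Add s t)
    then show ?case using assms(4)[of "pres_class G R s" "pres_class G R t"]
      by (simp add: presented_ops presented_carrier)
  next
    case (Mul s t)
    then show ?case using assms(5)[of "pres_class G R s" "pres_class G R t"]
      by (simp add: presented_ops presented_carrier)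
  next
    case (Scale k t)
    then show ?case using assms(6)[of "pres_class G R t" k]
      by (simp add: presented_ops presented_carrier)
  next
    case (Star t)
    then show ?case using assms(7)[of "pres_class G R t"]
      by (simp add: presented_ops presented_carrier)
  qed
  then show ?thesis using assms(1) by (auto simp: presented_carrier)
qed

lemma presented_hom_eqI:
  assumes "h \<in> star_hom (presented G R) B" "h' \<in> star_hom (presented G R) B" "star_algebra B"
    "\<And>g. g \<in> G \<Longrightarrow> h (pres_class G R (Gen g)) = h' (pres_class G R (Gen g))"
  shows "h = h'"
proof (rule star_hom_eqI[OF assms(1,2)])
  fix a assume "a \<in> acarrier (presented G R)"
  then show "h a = h' a"
    by (induction rule: presented_induct)
      (simp_all add: assms star_hom_zero[OF assms(1) presented_star_algebra assms(3)]
        star_hom_zero[OF assms(2) presented_star_algebra assms(3)] star_homD[OF assms(1)] star_homD[OF assms(2)])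
qed


subsection \<open>Leavitt path algebras\<close>

text \<open>
  A family in \<open>B\<close> that satisfies the defining relations of the Leavitt path algebra of \<open>E\<close>, that is, the
  data of a \<open>*\<close>-homomorphism from this algebra to \<open>B\<close>.
\<close>

definition leavitt_family ::
  "('v, 'e) sep_graph \<Rightarrow> ('b, 'm) star_alg_scheme \<Rightarrow> ('v \<Rightarrow> 'b) \<Rightarrow> ('e \<Rightarrow> 'b) \<Rightarrow> bool" where
  "leavitt_family E B \<nu> \<epsilon> \<longleftrightarrow>
     \<nu> \<in> gverts E \<rightarrow> acarrier B \<and> \<epsilon> \<in> gedges E \<rightarrow> acarrier B \<and>
     (\<forall>v\<in>gverts E. \<forall>w\<in>gverts E. \<nu> v \<otimes>\<^bsub>B\<^esub> \<nu> w = (if v = w then \<nu> v else \<zero>\<^bsub>B\<^esub>)) \<and>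
     (\<forall>v\<in>gverts E. star\<^bsub>B\<^esub> (\<nu> v) = \<nu> v) \<and>
     (\<forall>e\<in>gedges E. \<nu> (grange E e) \<otimes>\<^bsub>B\<^esub> \<epsilon> e = \<epsilon> e) \<and>
     (\<forall>e\<in>gedges E. \<epsilon> e \<otimes>\<^bsub>B\<^esub> \<nu> (gsource E e) = \<epsilon> e) \<and>
     (\<forall>v\<in>gverts E. \<forall>Y\<in>gsep E v. \<forall>e\<in>Y. \<forall>f\<in>Y.
        star\<^bsub>B\<^esub> (\<epsilon> e) \<otimes>\<^bsub>B\<^esub> \<epsilon> f = (if e = f then \<nu> (gsource E e) else \<zero>\<^bsub>B\<^esub>)) \<and>
     (\<forall>v\<in>gverts E. \<forall>Y\<in>gsep E v. finite Y \<longrightarrow>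
        asum B (\<lambda>e. \<epsilon> e \<otimes>\<^bsub>B\<^esub> star\<^bsub>B\<^esub> (\<epsilon> e)) Y = \<nu> v)"

lemma leavitt_familyD:
  assumes "leavitt_family E B \<nu> \<epsilon>"
  shows "v \<in> gverts E \<Longrightarrow> \<nu> v \<in> acarrier B" "e \<in> gedges E \<Longrightarrow> \<epsilon> e \<in> acarrier B"
    "v \<in> gverts E \<Longrightarrow> w \<in> gverts E \<Longrightarrow> \<nu> v \<otimes>\<^bsub>B\<^esub> \<nu> w = (if v = w then \<nu> v else \<zero>\<^bsub>B\<^esub>)"
    "v \<in> gverts E \<Longrightarrow> star\<^bsub>B\<^esub> (\<nu> v) = \<nu> v"
    "e \<in> gedges E \<Longrightarrow> \<nu> (grange E e) \<otimes>\<^bsub>B\<^esub> \<epsilon> e = \<epsilon> e"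
    "e \<in> gedges E \<Longrightarrow> \<epsilon> e \<otimes>\<^bsub>B\<^esub> \<nu> (gsource E e) = \<epsilon> e"
    "v \<in> gverts E \<Longrightarrow> Y \<in> gsep E v \<Longrightarrow> e \<in> Y \<Longrightarrow> f \<in> Y \<Longrightarrow>
        star\<^bsub>B\<^esub> (\<epsilon> e) \<otimes>\<^bsub>B\<^esub> \<epsilon> f = (if e = f then \<nu> (gsource E e) else \<zero>\<^bsub>B\<^esub>)"
    "v \<in> gverts E \<Longrightarrow> Y \<in> gsep E v \<Longrightarrow> finite Y \<Longrightarrow>
        asum B (\<lambda>e. \<epsilon> e \<otimes>\<^bsub>B\<^esub> star\<^bsub>B\<^esub> (\<epsilon> e)) Y = \<nu> v"
  using assms unfolding leavitt_family_def by (simp_all add: Pi_iff)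

lemma leavitt_star_algebra: "star_algebra (leavitt E)"
  unfolding leavitt_def by (rule presented_star_algebra)

lemma sep_edges:
  assumes "separated_graph E" "v \<in> gverts E" "Y \<in> gsep E v" "e \<in> Y"
  shows "e \<in> gedges E" "grange E e = v"
  using assms by (auto simp: separated_graph_def partition_on_def)

lemma interp_sum_term:
  assumes "star_algebra B" "distinct es" "\<And>e. e \<in> set es \<Longrightarrow> interp B \<gamma> (f e) \<in> acarrier B"
  shows "interp B \<gamma> (sum_term (map f es)) = asum B (\<lambda>e. interp B \<gamma> (f e)) (set es)"
proof -
  interpret star_algebra B by fact
  show ?thesis using assms(2,3) by (induction es) (auto simp: Pi_iff)
qed

lemma leavitt_lift:
  assumes "star_algebra B" "separated_graph E" "leavitt_family E B \<nu> \<epsilon>"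
  obtains h where "h \<in> star_hom (leavitt E) B"
    "\<And>v. v \<in> gverts E \<Longrightarrow> h (leavitt_vtx E v) = \<nu> v"
    "\<And>e. e \<in> gedges E \<Longrightarrow> h (leavitt_edg E e) = \<epsilon> e"
proof -
  interpret star_algebra B by fact
  define \<gamma> where "\<gamma> g = (case g of Vtx v \<Rightarrow> if v \<in> gverts E then \<nu> v else \<zero>\<^bsub>B\<^esub>
     | Edg e \<Rightarrow> if e \<in> gedges E then \<epsilon> e else \<zero>\<^bsub>B\<^esub>)" for g
  note fam = leavitt_familyD[OF assms(3)]
  have \<gamma>_in: "\<gamma> g \<in> acarrier B" for g using fam(1,2) by (auto simp: \<gamma>_def split: letter.split)
  have out: "\<gamma> g = \<zero>\<^bsub>B\<^esub>" if "g \<notin> letters E" for g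
    using that by (auto simp: \<gamma>_def letters_def split: letter.split)
  have rels: "interp B \<gamma> s = interp B \<gamma> t" if "(s, t) \<in> leavitt_rels E" for s t
    using that
  proof cases
    case (5 v Y e f)
    then have "e \<in> gedges E" "f \<in> gedges E" using sep_edges[OF assms(2)] by blast+
    moreover have "gsource E e \<in> gverts E" using assms(2) \<open>e \<in> gedges E\<close> by (simp add: separated_graph_def)
    ultimately show ?thesis using 5(1,2) fam(7)[OF 5(3-6)] by (cases "e = f") (simp_all add: \<gamma>_def)
  next
    case (6 v Y es)
    have ed: "e \<in> gedges E" "\<epsilon> e \<in> acarrier B" if "e \<in> Y" for e
      using 6 sep_edges[OF assms(2)] that fam(2) by blast+
    have "interp B \<gamma> t = asum B (\<lambda>e. interp B \<gamma> (Mul (Gen (Edg e)) (Star (Gen (Edg e))))) (set es)"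
      unfolding 6(2) by (rule interp_sum_term) (use 6 \<gamma>_in in \<open>auto intro: star_algebra_axioms\<close>)
    also have "\<dots> = asum B (\<lambda>e. \<epsilon> e \<otimes>\<^bsub>B\<^esub> star\<^bsub>B\<^esub> (\<epsilon> e)) Y"
      by (rule asum_cong) (use 6 ed in \<open>auto simp: \<gamma>_def\<close>)
    also have "\<dots> = \<nu> v" by (rule fam(8)) (use 6 in auto)
    finally show ?thesis using 6 by (simp add: \<gamma>_def)
  next
    case (1 v w)
    then show ?thesis using fam(3)[of v w] by (cases "v = w") (simp_all add: \<gamma>_def)
  next
    case (2 v)
    then show ?thesis using fam(4)[of v] by (simp add: \<gamma>_def)
  next
    case (3 e)
    then have "grange E e \<in> gverts E" using assms(2) by (simp add: separated_graph_def)
    then show ?thesis using 3 fam(5)[of e] by (simp add: \<gamma>_def)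
  next
    case (4 e)
    then have "gsource E e \<in> gverts E" using assms(2) by (simp add: separated_graph_def)
    then show ?thesis using 4 fam(6)[of e] by (simp add: \<gamma>_def)
  qed
  have "\<exists>h\<in>star_hom (presented (letters E) (leavitt_rels E)) B.
      \<forall>t. h (pres_class (letters E) (leavitt_rels E) t) = interp B \<gamma> t"
    by (rule presented_lift[OF assms(1) \<gamma>_in out rels])
  then obtain h where h: "h \<in> star_hom (leavitt E) B"
    "\<And>t. h (pres_class (letters E) (leavitt_rels E) t) = interp B \<gamma> t"
    unfolding leavitt_def by blast
  show ?thesis
  proof (rule that[OF h(1)])
    show "h (leavitt_vtx E v) = \<nu> v" if "v \<in> gverts E" for v
      unfolding leavitt_vtx_def h(2) using that by (simp add: \<gamma>_def)
    show "h (leavitt_edg E e) = \<epsilon> e" if "e \<in> gedges E" for e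
      unfolding leavitt_edg_def h(2) using that by (simp add: \<gamma>_def)
  qed
qed

lemma leavitt_generators:
  assumes "separated_graph E"
  shows "leavitt_family E (leavitt E) (leavitt_vtx E) (leavitt_edg E)"
proof -
  interpret star_algebra "leavitt E" by (rule leavitt_star_algebra)
  let ?c = "pres_class (letters E) (leavitt_rels E)"
  have c_in: "?c t \<in> acarrier (leavitt E)" for t by (simp add: leavitt_def presented_carrier)
  have rel: "?c s = ?c t" if "(s, t) \<in> leavitt_rels E" for s t
    using that by (simp add: pres_class_eq_iff pres_eq.rel)
  note ops = presented_ops[of "letters E" "leavitt_rels E", folded leavitt_def]
  have sums: "?c (sum_term (map f es)) = asum (leavitt E) (\<lambda>e. ?c (f e)) (set es)"
    if "distinct es" for f :: "_ \<Rightarrow> _ sterm" and es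
    using that by (induction es) (auto simp: ops(1) c_in simp flip: ops(2))
  show ?thesis
    unfolding leavitt_family_def leavitt_vtx_def leavitt_edg_def ops
  proof (intro conjI ballI impI)
    fix v Y assume vY: "v \<in> gverts E" "Y \<in> gsep E v" "finite Y"
    obtain es where es: "set es = Y" "distinct es" using finite_distinct_list[OF vY(3)] by blast
    show "asum (leavitt E) (\<lambda>e. ?c (Mul (Gen (Edg e)) (Star (Gen (Edg e))))) Y = ?c (Gen (Vtx v))"
      using rel[OF leavitt_rels.intros(6)[OF vY(1,2) es(2,1)]] sums[OF es(2)] es(1) by simp
  next
    fix v assume "v \<in> gverts E"
    from rel[OF leavitt_rels.intros(2)[OF this]]
    show "?c (Star (Gen (Vtx v))) = ?c (Gen (Vtx v))" by simp
  next
    fix v w assume "v \<in> gverts E" "w \<in> gverts E"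
    from rel[OF leavitt_rels.intros(1)[OF this]]
    show "?c (Mul (Gen (Vtx v)) (Gen (Vtx w))) = (if v = w then ?c (Gen (Vtx v)) else ?c Zero)"
      by (cases "v = w") simp_all
  next
    fix v Y e f assume "v \<in> gverts E" "Y \<in> gsep E v" "e \<in> Y" "f \<in> Y"
    from rel[OF leavitt_rels.intros(5)[OF this]]
    show "?c (Mul (Star (Gen (Edg e))) (Gen (Edg f))) = (if e = f then ?c (Gen (Vtx (gsource E e))) else ?c Zero)"
      by (cases "e = f") simp_all
  next
    fix e assume e: "e \<in> gedges E"
    show "?c (Mul (Gen (Vtx (grange E e))) (Gen (Edg e))) = ?c (Gen (Edg e))"
      by (rule rel[OF leavitt_rels.intros(3)[OF e]])
    show "?c (Mul (Gen (Edg e)) (Gen (Vtx (gsource E e)))) = ?c (Gen (Edg e))"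
      by (rule rel[OF leavitt_rels.intros(4)[OF e]])
  qed (simp_all add: c_in)
qed

lemma leavitt_induct [consumes 1, case_names vtx edg zero add mul scale star]:
  assumes "S \<in> acarrier (leavitt E)" "\<And>v. v \<in> gverts E \<Longrightarrow> Q (leavitt_vtx E v)"
    "\<And>e. e \<in> gedges E \<Longrightarrow> Q (leavitt_edg E e)"
    "Q (azero (leavitt E))"
    "\<And>a b. \<lbrakk>a \<in> acarrier (leavitt E); b \<in> acarrier (leavitt E); Q a; Q b\<rbrakk> \<Longrightarrow> Q (a \<oplus>\<^bsub>leavitt E\<^esub> b)"
    "\<And>a b. \<lbrakk>a \<in> acarrier (leavitt E); b \<in> acarrier (leavitt E); Q a; Q b\<rbrakk> \<Longrightarrow> Q (a \<otimes>\<^bsub>leavitt E\<^esub> b)"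
    "\<And>a k. \<lbrakk>a \<in> acarrier (leavitt E); Q a\<rbrakk> \<Longrightarrow> Q (k \<cdot>\<^bsub>leavitt E\<^esub> a)"
    "\<And>a. \<lbrakk>a \<in> acarrier (leavitt E); Q a\<rbrakk> \<Longrightarrow> Q (star\<^bsub>leavitt E\<^esub> a)"
  shows "Q S"
proof (rule presented_induct[OF assms(1)[unfolded leavitt_def], of Q, folded leavitt_def])
  fix g assume "g \<in> letters E"
  then show "Q (pres_class (letters E) (leavitt_rels E) (Gen g))"
    using assms(2)[unfolded leavitt_vtx_def] assms(3)[unfolded leavitt_edg_def]
    unfolding letters_def by blast
qed (fact assms(4-8))+

lemma leavitt_hom_eqI:
  assumes "h \<in> star_hom (leavitt E) B" "h' \<in> star_hom (leavitt E) B" "star_algebra B"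
    "\<And>v. v \<in> gverts E \<Longrightarrow> h (leavitt_vtx E v) = h' (leavitt_vtx E v)"
    "\<And>e. e \<in> gedges E \<Longrightarrow> h (leavitt_edg E e) = h' (leavitt_edg E e)"
  shows "h = h'"
proof (rule presented_hom_eqI[OF assms(1,2)[unfolded leavitt_def] assms(3)])
  fix g assume "g \<in> letters E"
  then show "h (pres_class (letters E) (leavitt_rels E) (Gen g)) = h' (pres_class (letters E) (leavitt_rels E) (Gen g))"
    using assms(4)[unfolded leavitt_vtx_def] assms(5)[unfolded leavitt_edg_def]
    unfolding letters_def by blast
qed


section \<open>\<open>C\<^sup>*\<close>-seminorms, completions and automatic continuity\<close>

locale cstar_seminormed = star_algebra A for A :: "('a, 'm) star_alg_scheme" (structure) +
  fixes p :: "'a \<Rightarrow> real"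
  assumes seminorm: "cstar_seminorm A p"
begin

lemma p_nonneg [simp]: "a \<in> acarrier A \<Longrightarrow> 0 \<le> p a"
  and p_add: "a \<in> acarrier A \<Longrightarrow> b \<in> acarrier A \<Longrightarrow> p (a \<oplus> b) \<le> p a + p b"
  and p_scale: "a \<in> acarrier A \<Longrightarrow> p (k \<cdot> a) = cmod k * p a"
  and p_mul: "a \<in> acarrier A \<Longrightarrow> b \<in> acarrier A \<Longrightarrow> p (a \<otimes> b) \<le> p a * p b"
  and p_cstar: "a \<in> acarrier A \<Longrightarrow> p (star a \<otimes> a) = (p a)\<^sup>2"
  using seminorm unfolding cstar_seminorm_def by blast+

lemma p_zero [simp]: "p \<zero> = 0"
  using p_scale[of \<zero> 0] by simp

text \<open>
  The \<open>C\<^sup>*\<close>-identity gives \<open>p(a)\<^sup>2 = p(a\<^sup>* a) \<le> p(a\<^sup>*) p(a)\<close>, so \<open>p(a) \<le> p(a\<^sup>*)\<close>, and conversely with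
  \<open>a\<^sup>*\<close> for \<open>a\<close>.
\<close>

lemma p_star [simp]: assumes "a \<in> acarrier A" shows "p (star a) = p a"
proof -
  have le: "p b \<le> p (star b)" if b: "b \<in> acarrier A" for b
  proof (cases "p b = 0")
    case False
    have "p b * p b \<le> p (star b) * p b"
      using p_cstar[OF b] p_mul[of "star b" b] b by (simp add: power2_eq_square)
    then show ?thesis using False p_nonneg[OF b] by simp
  qed (use b in simp)
  show ?thesis using le[OF assms] le[of "star a"] assms by simp
qed

lemma p_sub_sym: "a \<in> acarrier A \<Longrightarrow> b \<in> acarrier A \<Longrightarrow> p (b \<ominus> a) = p (a \<ominus> b)"
  using p_scale[of "a \<ominus> b" "-1"] by (simp add: sub_swap[of a b])

lemma p_triangle: "\<lbrakk>a \<in> acarrier A; b \<in> acarrier A; c \<in> acarrier A\<rbrakk> \<Longrightarrow> p (a \<ominus> c) \<le> p (a \<ominus> b) + p (b \<ominus> c)"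
  using p_add[of "a \<ominus> b" "b \<ominus> c"] by (simp add: sub_trans[of a b c])

lemma p_le_sub: "\<lbrakk>a \<in> acarrier A; b \<in> acarrier A\<rbrakk> \<Longrightarrow> p a \<le> p (a \<ominus> b) + p b"
  using p_triangle[of a b \<zero>] by simp

lemma p_diff: "\<lbrakk>a \<in> acarrier A; b \<in> acarrier A\<rbrakk> \<Longrightarrow> \<bar>p a - p b\<bar> \<le> p (a \<ominus> b)"
  using p_le_sub[of a b] p_le_sub[of b a] p_sub_sym[of a b] by simp

text \<open>
  The relation of \<open>null_rel\<close> without the Cauchy condition, so that convergence \<open>s \<rightarrow> l\<close> is \<open>nul s (\<lambda>_. l)\<close>.
\<close>

definition nul :: "(nat \<Rightarrow> 'a) \<Rightarrow> (nat \<Rightarrow> 'a) \<Rightarrow> bool" where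
  "nul s t \<longleftrightarrow> range s \<subseteq> acarrier A \<and> range t \<subseteq> acarrier A \<and> (\<lambda>n. p (s n \<ominus> t n)) \<longlonglongrightarrow> 0"

lemma nulD: "nul s t \<Longrightarrow> s n \<in> acarrier A" "nul s t \<Longrightarrow> t n \<in> acarrier A"
  "nul s t \<Longrightarrow> (\<lambda>n. p (s n \<ominus> t n)) \<longlonglongrightarrow> 0"
  by (auto simp: nul_def)

lemma nulI:
  assumes "\<And>n. s n \<in> acarrier A" "\<And>n. t n \<in> acarrier A" "f \<longlonglongrightarrow> 0" "\<And>n. p (s n \<ominus> t n) \<le> f n"
  shows "nul s t"
  unfolding nul_def
  using assms by (auto intro!: tendsto_sandwich[OF _ _ tendsto_const assms(3)])

lemma nul_small: "nul s t \<Longrightarrow> e > 0 \<Longrightarrow> \<exists>N. \<forall>n\<ge>N. p (s n \<ominus> t n) < e"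
  using LIMSEQ_D[OF nulD(3)[of s t], of e] by (auto dest: abs_le_D1 simp: abs_less_iff)

lemma nul_refl: "(\<And>n. s n \<in> acarrier A) \<Longrightarrow> nul s s"
  by (rule nulI[of _ _ "\<lambda>_. 0"]) auto

lemma nul_sym: "nul s t \<Longrightarrow> nul t s"
  by (rule nulI[OF _ _ nulD(3)]) (auto simp: nulD p_sub_sym)

lemma nul_trans: "nul s t \<Longrightarrow> nul t u \<Longrightarrow> nul s u"
  using tendsto_add[OF nulD(3)[of s t] nulD(3)[of t u]]
  by (intro nulI[of s u "\<lambda>n. p (s n \<ominus> t n) + p (t n \<ominus> u n)"]) (auto simp: nulD intro!: p_triangle)

lemma nul_add: "nul s t \<Longrightarrow> nul s' t' \<Longrightarrow> nul (\<lambda>n. s n \<oplus> s' n) (\<lambda>n. t n \<oplus> t' n)"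
  using tendsto_add[OF nulD(3)[of s t] nulD(3)[of s' t']]
  by (intro nulI[of _ _ "\<lambda>n. p (s n \<ominus> t n) + p (s' n \<ominus> t' n)"]) (auto simp: nulD add_sub_add intro!: p_add)

lemma nul_scale: "nul s t \<Longrightarrow> nul (\<lambda>n. k \<cdot> s n) (\<lambda>n. k \<cdot> t n)"
  using tendsto_mult[OF tendsto_const[of "cmod k"] nulD(3)[of s t]]
  by (intro nulI[of _ _ "\<lambda>n. cmod k * p (s n \<ominus> t n)"]) (auto simp: nulD scale_sub p_scale)

lemma nul_star: "nul s t \<Longrightarrow> nul (\<lambda>n. star (s n)) (\<lambda>n. star (t n))"
  by (rule nulI[OF _ _ nulD(3)]) (auto simp: nulD star_sub)

lemma nul_mul:
  assumes st: "nul s t" "nul s' t'" and bd: "\<And>n. p (s' n) \<le> K" "\<And>n. p (t n) \<le> K"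
  shows "nul (\<lambda>n. s n \<otimes> s' n) (\<lambda>n. t n \<otimes> t' n)"
proof (rule nulI)
  note in_A = nulD(1,2)[OF st(1)] nulD(1,2)[OF st(2)]
  show "(\<lambda>n. p (s n \<ominus> t n) * K + K * p (s' n \<ominus> t' n)) \<longlonglongrightarrow> 0"
    using tendsto_add[OF tendsto_mult_left_zero[OF nulD(3)[OF st(1)]] tendsto_mult_right_zero[OF nulD(3)[OF st(2)]]]
    by simp
  fix n
  have "p (s n \<otimes> s' n \<ominus> t n \<otimes> t' n) \<le> p ((s n \<ominus> t n) \<otimes> s' n) + p (t n \<otimes> (s' n \<ominus> t' n))"
    using in_A by (simp add: mul_sub_mul p_add)
  also have "\<dots> \<le> p (s n \<ominus> t n) * p (s' n) + p (t n) * p (s' n \<ominus> t' n)"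
    using in_A by (intro add_mono p_mul) auto
  also have "\<dots> \<le> p (s n \<ominus> t n) * K + K * p (s' n \<ominus> t' n)"
    using in_A bd by (intro add_mono mult_left_mono mult_right_mono) auto
  finally show "p (s n \<otimes> s' n \<ominus> t n \<otimes> t' n) \<le> p (s n \<ominus> t n) * K + K * p (s' n \<ominus> t' n)" .
qed (use nulD(1,2)[OF st(1)] nulD(1,2)[OF st(2)] in auto)

lemma nul_norm: "nul s t \<Longrightarrow> (\<lambda>n. p (s n) - p (t n)) \<longlonglongrightarrow> 0"
  by (rule Lim_null_comparison[OF _ nulD(3)]) (auto simp: nulD p_diff)

lemma nul_limit_bounded:
  assumes "nul s (\<lambda>_. l)"
  shows "\<exists>K. (\<forall>n. p (s n) \<le> K) \<and> p l \<le> K"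
proof -
  obtain K where K: "\<And>n. \<bar>p (s n \<ominus> l)\<bar> \<le> K"
    using convergent_imp_Bseq[OF convergentI[OF nulD(3)[OF assms]]] by (auto simp: Bseq_def)
  have "p (s n) \<le> K + p l" for n
    using p_le_sub[OF nulD(1,2)[OF assms], of n] K[of n] by linarith
  moreover have "p l \<le> K + p l" using K[of 0] by linarith
  ultimately show ?thesis by blast
qed

lemma nul_limit_mul: "nul s (\<lambda>_. a) \<Longrightarrow> nul t (\<lambda>_. b) \<Longrightarrow> nul (\<lambda>n. s n \<otimes> t n) (\<lambda>_. a \<otimes> b)"
proof -
  assume st: "nul s (\<lambda>_. a)" "nul t (\<lambda>_. b)"
  obtain K L where "\<And>n. p (t n) \<le> K" "p a \<le> L"
    using nul_limit_bounded[OF st(1)] nul_limit_bounded[OF st(2)] by blast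
  then show ?thesis by (intro nul_mul[OF st, of "max K L"]) (auto simp: le_max_iff_disj)
qed

lemma nul_limit_norm: "nul s (\<lambda>_. l) \<Longrightarrow> (\<lambda>n. p (s n)) \<longlonglongrightarrow> p l"
  using nul_norm[of s "\<lambda>_. l"] by (simp add: LIM_zero_iff)

lemma nul_const_iff: "a \<in> acarrier A \<Longrightarrow> b \<in> acarrier A \<Longrightarrow> nul (\<lambda>_. a) (\<lambda>_. b) \<longleftrightarrow> p (a \<ominus> b) = 0"
  by (auto simp: nul_def LIMSEQ_const_iff)


subsection \<open>Completion\<close>

abbreviation "cs \<equiv> cauchy_seqs A p"
abbreviation "cls s \<equiv> null_rel A p `` {s}"

lemma cs_in: "s \<in> cs \<Longrightarrow> s n \<in> acarrier A"
  by (auto simp: cauchy_seqs_def)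

lemma null_rel_iff: "(s, t) \<in> null_rel A p \<longleftrightarrow> s \<in> cs \<and> t \<in> cs \<and> nul s t"
  by (auto simp: null_rel_def nul_def cauchy_seqs_def)

lemma equiv_null: "equiv cs (null_rel A p)"
  by (intro equivI) (auto simp: refl_on_def sym_def trans_def null_rel_iff cs_in
      intro: nul_refl nul_sym nul_trans)

lemma cls_eq_iff: "s \<in> cs \<Longrightarrow> t \<in> cs \<Longrightarrow> cls s = cls t \<longleftrightarrow> nul s t"
  using eq_equiv_class_iff[OF equiv_null, of s t] by (simp add: null_rel_iff)

lemma cls_memD: "s' \<in> cls s \<Longrightarrow> s \<in> cs \<and> s' \<in> cs \<and> nul s s'"
  by (simp add: null_rel_iff)

lemma cls_self: "s \<in> cs \<Longrightarrow> s \<in> cls s"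
  by (simp add: null_rel_iff nul_refl cs_in)

lemma csD: "s \<in> cs \<Longrightarrow> e > 0 \<Longrightarrow> \<exists>N. \<forall>m\<ge>N. \<forall>n\<ge>N. p (s m \<ominus> s n) < e"
  by (simp add: cauchy_seqs_def)

lemma cls_eqI: "s \<in> cs \<Longrightarrow> t \<in> cs \<Longrightarrow> nul s t \<Longrightarrow> cls s = cls t"
  by (simp only: cls_eq_iff)

text \<open>
  One criterion for all the operations: \<open>u\<close> is Cauchy if its variation is bounded by
  a multiple of the variation of two Cauchy sequences.
\<close>

lemma csI_bound:
  assumes "\<And>n. u n \<in> acarrier A" "s \<in> cs" "t \<in> cs" "K \<ge> 0"
    "\<And>m n. p (u m \<ominus> u n) \<le> K * (p (s m \<ominus> s n) + p (t m \<ominus> t n))"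
  shows "u \<in> cs"
  unfolding cauchy_seqs_def
proof (intro CollectI conjI allI impI)
  show "range u \<subseteq> acarrier A" using assms(1) by auto
  fix e :: real assume e: "e > 0"
  define d where "d = e / (K + 1) / 2"
  have d: "d > 0" using e assms(4) by (simp add: d_def)
  obtain M where M: "\<And>m n. m \<ge> M \<Longrightarrow> n \<ge> M \<Longrightarrow> p (s m \<ominus> s n) < d"
    using csD[OF assms(2) d] by blast
  obtain N where N: "\<And>m n. m \<ge> N \<Longrightarrow> n \<ge> N \<Longrightarrow> p (t m \<ominus> t n) < d"
    using csD[OF assms(3) d] by blast
  show "\<exists>N. \<forall>m\<ge>N. \<forall>n\<ge>N. p (u m \<ominus> u n) < e"
  proof (intro exI allI impI)
    fix m n assume mn: "m \<ge> max M N" "n \<ge> max M N"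
    have "p (u m \<ominus> u n) \<le> K * (p (s m \<ominus> s n) + p (t m \<ominus> t n))" by (rule assms(5))
    also have "\<dots> \<le> K * (d + d)"
      using M[of m n] N[of m n] mn assms(4) by (intro mult_left_mono add_mono) auto
    also have "\<dots> < (K + 1) * (d + d)" using d by simp
    also have "\<dots> = e"
    proof -
      have "d + d = e / (K + 1)" unfolding d_def by (rule field_sum_of_halves)
      then show ?thesis using assms(4) by (simp only:) simp
    qed
    finally show "p (u m \<ominus> u n) < e" .
  qed
qed

lemma cs_bounded: assumes "s \<in> cs" shows "\<exists>K\<ge>0. \<forall>n. p (s n) \<le> K"
proof -
  obtain N where N: "\<And>m n. m \<ge> N \<Longrightarrow> n \<ge> N \<Longrightarrow> p (s m \<ominus> s n) < 1"
    using csD[OF assms, of 1] by auto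
  define K where "K = Max (p ` s ` {..N}) + 1"
  have "p (s n) \<le> K" for n
  proof (cases "n \<le> N")
    case True
    then show ?thesis unfolding K_def by (simp add: add.commute add_increasing)
  next
    case False
    then have "p (s n) \<le> 1 + p (s N)"
      using N[of n N] p_le_sub[of "s n" "s N"] cs_in[OF assms] by fastforce
    moreover have "p (s N) \<le> Max (p ` s ` {..N})" by simp
    ultimately show ?thesis unfolding K_def by linarith
  qed
  moreover from this[of 0] have "K \<ge> 0" using p_nonneg[OF cs_in[OF assms, of 0]] by linarith
  ultimately show ?thesis by blast
qed

lemma cs_const [simp]: "a \<in> acarrier A \<Longrightarrow> (\<lambda>_. a) \<in> cs"
  by (auto simp: cauchy_seqs_def)

lemma cs_add: "s \<in> cs \<Longrightarrow> t \<in> cs \<Longrightarrow> (\<lambda>n. s n \<oplus> t n) \<in> cs"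
  by (rule csI_bound[of _ s t 1]) (auto simp: cs_in add_sub_add intro!: p_add)

lemma cs_scale: "s \<in> cs \<Longrightarrow> (\<lambda>n. k \<cdot> s n) \<in> cs"
  by (rule csI_bound[of _ s s "cmod k"])
     (auto simp: cs_in scale_sub p_scale distrib_left intro!: mult_left_mono)

lemma cs_star: "s \<in> cs \<Longrightarrow> (\<lambda>n. star (s n)) \<in> cs"
  by (rule csI_bound[of _ s s 1]) (auto simp: cs_in star_sub)

lemma cs_mul: assumes "s \<in> cs" "t \<in> cs" shows "(\<lambda>n. s n \<otimes> t n) \<in> cs"
proof -
  obtain K L where K: "K \<ge> 0" "\<And>n. p (s n) \<le> K" and L: "L \<ge> 0" "\<And>n. p (t n) \<le> L"
    using cs_bounded assms by meson
  show ?thesis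
  proof (rule csI_bound[OF _ assms])
    show "0 \<le> max K L" using K by simp
    fix m n
    note in_A = cs_in[OF assms(1)] cs_in[OF assms(2)]
    have "p (s m \<otimes> t m \<ominus> s n \<otimes> t n) \<le> p ((s m \<ominus> s n) \<otimes> t m) + p (s n \<otimes> (t m \<ominus> t n))"
      using in_A by (simp add: mul_sub_mul p_add)
    also have "\<dots> \<le> p (s m \<ominus> s n) * p (t m) + p (s n) * p (t m \<ominus> t n)"
      using in_A by (intro add_mono p_mul) auto
    also have "\<dots> \<le> p (s m \<ominus> s n) * max K L + max K L * p (t m \<ominus> t n)"
      using in_A K L by (intro add_mono mult_left_mono mult_right_mono) (auto simp: le_max_iff_disj)
    finally show "p (s m \<otimes> t m \<ominus> s n \<otimes> t n) \<le> max K L * (p (s m \<ominus> s n) + p (t m \<ominus> t n))"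
      by (simp add: algebra_simps)
  qed (auto simp: cs_in assms)
qed

lemma nul_mul_cs: "s \<in> cs \<Longrightarrow> s' \<in> cs \<Longrightarrow> t \<in> cs \<Longrightarrow> nul s t \<Longrightarrow> nul s' t' \<Longrightarrow> nul (\<lambda>n. s n \<otimes> s' n) (\<lambda>n. t n \<otimes> t' n)"
proof -
  assume st: "s \<in> cs" "s' \<in> cs" "t \<in> cs" "nul s t" "nul s' t'"
  obtain K L where "\<And>n. p (s' n) \<le> K" "\<And>n. p (t n) \<le> L"
    using cs_bounded[OF st(2)] cs_bounded[OF st(3)] by blast
  then show ?thesis by (intro nul_mul[OF st(4,5), of "max K L"]) (auto simp: le_max_iff_disj)
qed

lemma completion_carrier: "acarrier (completion A p) = cls ` cs"
  by (auto simp: completion_def quotient_def)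

lemma completion_zero: "\<zero>\<^bsub>completion A p\<^esub> = cls (\<lambda>_. \<zero>)"
  by (simp add: completion_def)

lemma completion_add: assumes "s \<in> cs" "t \<in> cs"
  shows "cls s \<oplus>\<^bsub>completion A p\<^esub> cls t = cls (\<lambda>n. s n \<oplus> t n)"
  unfolding completion_def star_alg.simps cstar_alg.simps
proof (rule UN_const_eq[OF cls_self[OF assms(1)]], rule UN_const_eq[OF cls_self[OF assms(2)]])
  fix s' t' assume "s' \<in> cls s" "t' \<in> cls t"
  then show "cls (\<lambda>n. s' n \<oplus> t' n) = cls (\<lambda>n. s n \<oplus> t n)"
    using cls_memD[of s' s] cls_memD[of t' t] nul_sym[of s s'] nul_sym[of t t']
    by (intro cls_eqI cs_add nul_add) simp_all
qed

lemma completion_mul: assumes "s \<in> cs" "t \<in> cs"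
  shows "cls s \<otimes>\<^bsub>completion A p\<^esub> cls t = cls (\<lambda>n. s n \<otimes> t n)"
  unfolding completion_def star_alg.simps cstar_alg.simps
proof (rule UN_const_eq[OF cls_self[OF assms(1)]], rule UN_const_eq[OF cls_self[OF assms(2)]])
  fix s' t' assume "s' \<in> cls s" "t' \<in> cls t"
  then show "cls (\<lambda>n. s' n \<otimes> t' n) = cls (\<lambda>n. s n \<otimes> t n)"
    using cls_memD[of s' s] cls_memD[of t' t] nul_sym[of s s'] nul_sym[of t t']
    by (intro cls_eqI cs_mul nul_mul_cs) simp_all
qed

lemma completion_scale: assumes "s \<in> cs"
  shows "k \<cdot>\<^bsub>completion A p\<^esub> cls s = cls (\<lambda>n. k \<cdot> s n)"
  unfolding completion_def star_alg.simps cstar_alg.simps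
proof (rule UN_const_eq[OF cls_self[OF assms(1)]])
  fix s' assume "s' \<in> cls s"
  then show "cls (\<lambda>n. k \<cdot> s' n) = cls (\<lambda>n. k \<cdot> s n)"
    using cls_memD[of s' s] nul_sym[of s s'] by (intro cls_eqI cs_scale nul_scale) simp_all
qed

lemma completion_star: assumes "s \<in> cs"
  shows "star\<^bsub>completion A p\<^esub> (cls s) = cls (\<lambda>n. star (s n))"
  unfolding completion_def star_alg.simps cstar_alg.simps
proof (rule UN_const_eq[OF cls_self[OF assms(1)]])
  fix s' assume "s' \<in> cls s"
  then show "cls (\<lambda>n. star (s' n)) = cls (\<lambda>n. star (s n))"
    using cls_memD[of s' s] nul_sym[of s s'] by (intro cls_eqI cs_star nul_star) simp_all
qed

lemmas completion_ops = completion_add completion_mul completion_scale completion_star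
lemmas cs_ops = cs_add cs_mul cs_scale cs_star

lemma completion_sub: "s \<in> cs \<Longrightarrow> t \<in> cs \<Longrightarrow> cls s \<ominus>\<^bsub>completion A p\<^esub> cls t = cls (\<lambda>n. s n \<ominus> t n)"
  by (simp add: asub_def completion_ops cs_ops)

lemma completion_norm: assumes "s \<in> cs" shows "(\<lambda>n. p (s n)) \<longlonglongrightarrow> cnorm (completion A p) (cls s)"
proof -
  have "Cauchy (\<lambda>n. p (s n))"
  proof (rule metric_CauchyI)
    fix e :: real assume "e > 0"
    then obtain N where N: "\<And>m n. m \<ge> N \<Longrightarrow> n \<ge> N \<Longrightarrow> p (s m \<ominus> s n) < e"
      using csD[OF assms] by blast
    show "\<exists>M. \<forall>m\<ge>M. \<forall>n\<ge>M. dist (p (s m)) (p (s n)) < e"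
      using N by (intro exI[of _ N])
        (auto simp: dist_real_def intro: le_less_trans[OF p_diff[OF cs_in[OF assms] cs_in[OF assms]]])
  qed
  then obtain r where r: "(\<lambda>n. p (s n)) \<longlonglongrightarrow> r" using Cauchy_convergent_iff convergent_def by metis
  have "(\<lambda>n. p (t n)) \<longlonglongrightarrow> r" if "t \<in> cls s" for t
    using tendsto_diff[OF r nul_norm[of s t]] cls_memD[OF that] by simp
  moreover have "r' = r" if "\<forall>t\<in>cls s. (\<lambda>n. p (t n)) \<longlonglongrightarrow> r'" for r'
    using that cls_self[OF assms] LIMSEQ_unique r by blast
  ultimately have "(THE r. \<forall>t\<in>cls s. (\<lambda>n. p (t n)) \<longlonglongrightarrow> r) = r"
    by (intro the_equality) blast+
  then show ?thesis using r by (simp add: completion_def)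
qed

lemma completion_star_algebra: "star_algebra (completion A p)"
proof (unfold_locales; unfold completion_carrier; (elim imageE)?;
    (simp only: completion_ops completion_zero cs_ops zero_in cs_const)?)
qed ((rule imageI, (rule cs_ops cs_const zero_in | assumption)+) |
    (rule arg_cong[where f = "\<lambda>s. cls s"], rule ext, rule add_comm; rule cs_in; assumption) |
    (rule arg_cong[where f = "\<lambda>s. cls s"], rule ext, simp add: cs_in add_assoc add_neg scale_add add_scale
      mul_assoc mul_add add_mul star_add star_scale star_mul; fail))+

lemma completion_cstar_seminorm: "cstar_seminorm (completion A p) (cnorm (completion A p))"
  unfolding cstar_seminorm_def completion_carrier
proof (intro conjI ballI allI; elim imageE)
  fix S s assume s: "S = cls s" "s \<in> cs"
  show "0 \<le> cnorm (completion A p) S"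
    unfolding s(1) by (rule LIMSEQ_le_const[OF completion_norm[OF s(2)]]) (auto simp: cs_in s)
  have "(\<lambda>n. p (star (s n) \<otimes> s n)) \<longlonglongrightarrow> (cnorm (completion A p) (cls s))\<^sup>2"
    using tendsto_power[OF completion_norm[OF s(2)], of 2] by (simp add: p_cstar cs_in s(2))
  with completion_norm[OF cs_mul[OF cs_star[OF s(2)] s(2)]]
  show "cnorm (completion A p) (star\<^bsub>completion A p\<^esub> S \<otimes>\<^bsub>completion A p\<^esub> S) = (cnorm (completion A p) S)\<^sup>2"
    unfolding s(1) by (simp add: completion_ops cs_ops s(2) LIMSEQ_unique)
  fix k
  have "(\<lambda>n. p (k \<cdot> s n)) \<longlonglongrightarrow> cmod k * cnorm (completion A p) (cls s)"
    using tendsto_mult[OF tendsto_const completion_norm[OF s(2)]] by (simp add: p_scale cs_in s(2))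
  with completion_norm[OF cs_scale[OF s(2)], of k]
  show "cnorm (completion A p) (k \<cdot>\<^bsub>completion A p\<^esub> S) = cmod k * cnorm (completion A p) S"
    unfolding s(1) by (simp add: completion_ops s(2) LIMSEQ_unique)
next
  fix S s T t assume s: "S = cls s" "s \<in> cs" and t: "T = cls t" "t \<in> cs"
  show "cnorm (completion A p) (S \<oplus>\<^bsub>completion A p\<^esub> T) \<le> cnorm (completion A p) S + cnorm (completion A p) T"
    unfolding s(1) t(1) completion_add[OF s(2) t(2)]
    by (rule LIMSEQ_le[OF completion_norm[OF cs_add[OF s(2) t(2)]] tendsto_add[OF completion_norm[OF s(2)] completion_norm[OF t(2)]]])
       (auto simp: p_add cs_in s t)
  show "cnorm (completion A p) (S \<otimes>\<^bsub>completion A p\<^esub> T) \<le> cnorm (completion A p) S * cnorm (completion A p) T"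
    unfolding s(1) t(1) completion_mul[OF s(2) t(2)]
    by (rule LIMSEQ_le[OF completion_norm[OF cs_mul[OF s(2) t(2)]] tendsto_mult[OF completion_norm[OF s(2)] completion_norm[OF t(2)]]])
       (auto simp: p_mul cs_in s t)
qed

lemma completion_norm_zero: "s \<in> cs \<Longrightarrow> cnorm (completion A p) (cls s) = 0 \<Longrightarrow> cls s = cls (\<lambda>_. \<zero>)"
  using completion_norm[of s] by (simp add: cls_eq_iff nul_def cs_in image_subset_iff)

lemma to_completion_hom: "restrict (to_completion A p) (acarrier A) \<in> star_hom A (completion A p)"
  by (rule star_homI) (auto simp: to_completion_def completion_ops completion_carrier star_algebra_axioms)

lemma cnorm_to_completion: "a \<in> acarrier A \<Longrightarrow> cnorm (completion A p) (to_completion A p a) = p a"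
  using completion_norm[of "\<lambda>_. a"] by (simp add: to_completion_def LIMSEQ_const_iff)

lemma to_completion_in: "a \<in> acarrier A \<Longrightarrow> to_completion A p a \<in> acarrier (completion A p)"
  using star_homD(1)[OF to_completion_hom] by simp

lemma completion_dense:
  assumes "S \<in> acarrier (completion A p)" "e > 0"
  shows "\<exists>a\<in>acarrier A. cnorm (completion A p) (S \<ominus>\<^bsub>completion A p\<^esub> to_completion A p a) < e"
proof -
  obtain s where s: "S = cls s" "s \<in> cs" using assms by (auto simp: completion_carrier)
  obtain N where N: "\<And>m n. m \<ge> N \<Longrightarrow> n \<ge> N \<Longrightarrow> p (s m \<ominus> s n) < e / 2"
    using csD[OF s(2), of "e / 2"] assms(2) by auto
  let ?t = "\<lambda>_. s N"
  have sN: "s N \<in> acarrier A" using cs_in[OF s(2)] .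
  have "(\<lambda>n. s n \<ominus> s N) \<in> cs" using cs_add[OF s(2) cs_scale[OF cs_const[OF sN]], of "-1"] by (simp add: asub_def)
  from completion_norm[OF this]
  have "cnorm (completion A p) (cls (\<lambda>n. s n \<ominus> s N)) \<le> e / 2"
    by (rule LIMSEQ_le_const2) (use N in \<open>auto intro!: exI[of _ N] less_imp_le\<close>)
  moreover have "S \<ominus>\<^bsub>completion A p\<^esub> to_completion A p (s N) = cls (\<lambda>n. s n \<ominus> s N)"
    unfolding s(1) to_completion_def by (rule completion_sub[OF s(2)]) (simp add: sN)
  ultimately show ?thesis using assms(2) sN by (intro bexI[of _ "s N"]) auto
qed

end


subsection \<open>C*-algebras\<close>

locale cstar_algebra = star_algebra A for A :: "('a, 'm) cstar_alg_scheme" (structure) +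
  assumes norm_cstar: "cstar_seminorm A (cnorm A)"
    and norm_zero: "a \<in> acarrier A \<Longrightarrow> cnorm A a = 0 \<Longrightarrow> a = \<zero>"
    and complete: "s \<in> cauchy_seqs A (cnorm A) \<Longrightarrow> \<exists>l\<in>acarrier A. (\<lambda>n. cnorm A (s n \<ominus> l)) \<longlonglongrightarrow> 0"

sublocale cstar_algebra \<subseteq> cstar_seminormed A "cnorm A"
  by unfold_locales (rule norm_cstar)

context cstar_algebra
begin

lemma nul_limit_unique: "nul s (\<lambda>_. a) \<Longrightarrow> nul s (\<lambda>_. b) \<Longrightarrow> a = b"
  using nul_trans[OF nul_sym[of s "\<lambda>_. a"], of "\<lambda>_. b"] nulD(2)[of s "\<lambda>_. a"] nulD(2)[of s "\<lambda>_. b"]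
  by (metis norm_zero nul_const_iff sub_eq_zero sub_in)

lemma complete_nul: "s \<in> cs \<Longrightarrow> \<exists>l. nul s (\<lambda>_. l)"
  using complete[of s] by (auto simp: nul_def cs_in)

end

text \<open>
  Completeness is the diagonal argument: replace the \<open>n\<close>-th element of a Cauchy sequence of classes by a
  constant sequence \<open>a n\<close> at distance less than \<open>1 / (n + 1)\<close>; the class of the sequence \<open>a\<close> is the limit.
\<close>

lemma (in cstar_seminormed) completion_cstar_algebra: "cstar_algebra (completion A p)"
proof -
  interpret C: star_algebra "completion A p" by (rule completion_star_algebra)
  interpret C: cstar_seminormed "completion A p" "cnorm (completion A p)"
    by unfold_locales (rule completion_cstar_seminorm)
  show ?thesis
  proof
    show "cstar_seminorm (completion A p) (cnorm (completion A p))" by (rule completion_cstar_seminorm)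
    fix a assume "a \<in> acarrier (completion A p)" "cnorm (completion A p) a = 0"
    then obtain s where s: "a = cls s" "s \<in> cs" "cnorm (completion A p) (cls s) = 0"
      unfolding completion_carrier by blast
    show "a = \<zero>\<^bsub>completion A p\<^esub>"
      unfolding completion_zero s(1) by (rule completion_norm_zero[OF s(2,3)])
  next
    fix S assume S: "S \<in> C.cs"
    let ?\<iota> = "to_completion A p" and ?N = "cnorm (completion A p)"
    have "\<exists>a. a \<in> acarrier A \<and> ?N (S n \<ominus>\<^bsub>completion A p\<^esub> ?\<iota> a) < inverse (Suc n)" for n
      using completion_dense[OF C.cs_in[OF S, of n], of "inverse (Suc n)"] by auto
    then obtain a where a: "\<And>n. a n \<in> acarrier A"
        "\<And>n. ?N (S n \<ominus>\<^bsub>completion A p\<^esub> ?\<iota> (a n)) < inverse (Suc n)"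
      by metis
    have nul: "C.nul S (\<lambda>n. ?\<iota> (a n))"
      by (rule C.nulI[OF _ _ LIMSEQ_inverse_real_of_nat less_imp_le[OF a(2)]]) (auto simp: C.cs_in[OF S] a to_completion_in)
    have dist: "?N (?\<iota> x \<ominus>\<^bsub>completion A p\<^esub> ?\<iota> y) = p (x \<ominus> y)" if "x \<in> acarrier A" "y \<in> acarrier A" for x y
      using star_hom_sub[OF to_completion_hom star_algebra_axioms that] cnorm_to_completion[of "x \<ominus> y"] that by simp
    have "a \<in> cs"
      unfolding cauchy_seqs_def
    proof (intro CollectI conjI allI impI)
      show "range a \<subseteq> acarrier A" using a by auto
      fix e :: real assume e: "e > 0"
      obtain N1 where N1: "\<And>m n. m \<ge> N1 \<Longrightarrow> n \<ge> N1 \<Longrightarrow> ?N (S m \<ominus>\<^bsub>completion A p\<^esub> S n) < e / 3"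
        using C.csD[OF S, of "e / 3"] e by auto
      obtain N2 where N2: "\<And>n. n \<ge> N2 \<Longrightarrow> ?N (S n \<ominus>\<^bsub>completion A p\<^esub> ?\<iota> (a n)) < e / 3"
        using C.nul_small[OF nul, of "e / 3"] e by auto
      show "\<exists>N. \<forall>m\<ge>N. \<forall>n\<ge>N. p (a m \<ominus> a n) < e"
      proof (intro exI allI impI)
        fix m n assume mn: "m \<ge> max N1 N2" "n \<ge> max N1 N2"
        note cl = C.cs_in[OF S] to_completion_in[OF a(1)]
        have "p (a m \<ominus> a n) = ?N (?\<iota> (a m) \<ominus>\<^bsub>completion A p\<^esub> ?\<iota> (a n))" using dist a by simp
        also have "\<dots> \<le> ?N (?\<iota> (a m) \<ominus>\<^bsub>completion A p\<^esub> S m) + ?N (S m \<ominus>\<^bsub>completion A p\<^esub> ?\<iota> (a n))"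
          by (rule C.p_triangle) (auto simp: cl)
        also have "\<dots> \<le> ?N (?\<iota> (a m) \<ominus>\<^bsub>completion A p\<^esub> S m) +
            (?N (S m \<ominus>\<^bsub>completion A p\<^esub> S n) + ?N (S n \<ominus>\<^bsub>completion A p\<^esub> ?\<iota> (a n)))"
          by (intro add_left_mono C.p_triangle) (auto simp: cl)
        also have "\<dots> < e"
          using N1[of m n] N2[of m] N2[of n] mn C.p_sub_sym[of "S m" "?\<iota> (a m)"] by (simp add: cl)
        finally show "p (a m \<ominus> a n) < e" .
      qed
    qed
    moreover have "C.nul (\<lambda>n. ?\<iota> (a n)) (\<lambda>_. cls a)" if "a \<in> cs"
    proof (unfold C.nul_def, intro conjI)
      show "(\<lambda>n. ?N (?\<iota> (a n) \<ominus>\<^bsub>completion A p\<^esub> cls a)) \<longlonglongrightarrow> 0"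
      proof (rule LIMSEQ_I)
        fix e :: real assume e: "e > 0"
        obtain M where M: "\<And>m n. m \<ge> M \<Longrightarrow> n \<ge> M \<Longrightarrow> p (a m \<ominus> a n) < e / 2"
          using csD[OF \<open>a \<in> cs\<close>, of "e / 2"] e by auto
        have "?N (?\<iota> (a n) \<ominus>\<^bsub>completion A p\<^esub> cls a) \<le> e / 2" if n: "n \<ge> M" for n
        proof -
          have "(\<lambda>m. a n \<ominus> a m) \<in> cs"
            using cs_add[OF cs_const[OF a(1)[of n]] cs_scale[OF \<open>a \<in> cs\<close>], of "-1"] by (simp add: asub_def)
          from completion_norm[OF this] have "?N (cls (\<lambda>m. a n \<ominus> a m)) \<le> e / 2"
            by (rule LIMSEQ_le_const2) (use M n in \<open>intro exI[of _ M] allI impI less_imp_le\<close>)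
          then show ?thesis using a \<open>a \<in> cs\<close> by (simp add: to_completion_def completion_sub)
        qed
        then show "\<exists>M. \<forall>n\<ge>M. norm (?N (?\<iota> (a n) \<ominus>\<^bsub>completion A p\<^esub> cls a) - 0) < e"
          using e C.p_nonneg[OF C.sub_in[OF to_completion_in[OF a(1)]]] that
          by (intro exI[of _ M] allI impI) (fastforce simp: completion_carrier)
      qed
    qed (use that a to_completion_in in \<open>auto simp: completion_carrier\<close>)
    ultimately have "C.nul S (\<lambda>_. cls a)" using C.nul_trans[OF nul] by blast
    then show "\<exists>l\<in>acarrier (completion A p). (\<lambda>n. ?N (S n \<ominus>\<^bsub>completion A p\<^esub> l)) \<longlonglongrightarrow> 0"
      using C.nulD[of S "\<lambda>_. cls a"] by blast
  qed
qed


subsection \<open>Extension of homomorphisms from dense subalgebras\<close>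

definition dense_image :: "('a, 'm) star_alg_scheme \<Rightarrow> ('a \<Rightarrow> 'b) \<Rightarrow> ('b, 'n) cstar_alg_scheme \<Rightarrow> bool" where
  "dense_image A j B \<longleftrightarrow> (\<forall>b\<in>acarrier B. \<forall>e>0. \<exists>a\<in>acarrier A. cnorm B (b \<ominus>\<^bsub>B\<^esub> j a) < e)"

lemma (in cstar_algebra) dense_image_seq:
  assumes "dense_image D j A" "j \<in> star_hom D A" "b \<in> acarrier A"
  shows "\<exists>s. range s \<subseteq> acarrier D \<and> nul (\<lambda>n. j (s n)) (\<lambda>_. b)"
proof -
  have "\<exists>a. a \<in> acarrier D \<and> cnorm A (b \<ominus> j a) < inverse (Suc n)" for n
    using assms(1,3) unfolding dense_image_def by (meson inverse_positive_iff_positive of_nat_0_less_iff zero_less_Suc)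
  then obtain s where s: "\<And>n. s n \<in> acarrier D" "\<And>n. cnorm A (b \<ominus> j (s n)) < inverse (Suc n)" by metis
  have "nul (\<lambda>n. j (s n)) (\<lambda>_. b)"
    by (rule nulI[OF _ _ LIMSEQ_inverse_real_of_nat])
       (use s star_homD(1)[OF assms(2)] assms(3) in \<open>auto simp: p_sub_sym intro: less_imp_le\<close>)
  then show ?thesis using s by auto
qed

text \<open>
  A contraction extends by continuity. The extension is obtained as a relation, the closure of the graph
  of \<open>j1 a \<mapsto> j2 a\<close>, which is single-valued since \<open>j2\<close> is dominated by \<open>j1\<close> and total since \<open>B2\<close> is complete.
\<close>

lemma extend_hom:
  assumes "star_algebra A" "cstar_algebra B1" "cstar_algebra B2"
    and j1: "j1 \<in> star_hom A B1" and j2: "j2 \<in> star_hom A B2"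
    and le: "\<And>a. a \<in> acarrier A \<Longrightarrow> cnorm B2 (j2 a) \<le> cnorm B1 (j1 a)"
    and dense: "dense_image A j1 B1"
  shows "\<exists>h\<in>star_hom B1 B2. (\<forall>a\<in>acarrier A. h (j1 a) = j2 a) \<and> (\<forall>b\<in>acarrier B1. cnorm B2 (h b) \<le> cnorm B1 b)"
proof -
  interpret A: star_algebra A by fact
  interpret B1: cstar_algebra B1 by fact
  interpret B2: cstar_algebra B2 by fact
  note j1D = star_homD[OF j1] and j2D = star_homD[OF j2]
  define R where "R b c \<longleftrightarrow> (\<exists>s. range s \<subseteq> acarrier A \<and> B1.nul (\<lambda>n. j1 (s n)) (\<lambda>_. b) \<and> B2.nul (\<lambda>n. j2 (s n)) (\<lambda>_. c))" for b c
  have RI: "R b c" if "\<And>n. s n \<in> acarrier A" "B1.nul (\<lambda>n. j1 (s n)) (\<lambda>_. b)" "B2.nul (\<lambda>n. j2 (s n)) (\<lambda>_. c)" for s b c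
    using that unfolding R_def by blast
  have Rin: "b \<in> acarrier B1" "c \<in> acarrier B2" if "R b c" for b c
    using that B1.nulD(2) B2.nulD(2) unfolding R_def by blast+
  have nul_le: "B2.nul (\<lambda>n. j2 (s n)) (\<lambda>n. j2 (t n))"
    if "\<And>n. s n \<in> acarrier A" "\<And>n. t n \<in> acarrier A" "B1.nul (\<lambda>n. j1 (s n)) (\<lambda>n. j1 (t n))" for s t
  proof (rule B2.nulI[OF _ _ B1.nulD(3)[OF that(3)]])
    fix n show "cnorm B2 (j2 (s n) \<ominus>\<^bsub>B2\<^esub> j2 (t n)) \<le> cnorm B1 (j1 (s n) \<ominus>\<^bsub>B1\<^esub> j1 (t n))"
      using le[of "s n \<ominus>\<^bsub>A\<^esub> t n"] that(1,2)
      by (simp add: star_hom_sub[OF j1 A.star_algebra_axioms] star_hom_sub[OF j2 A.star_algebra_axioms])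
  qed (use that j2D in auto)
  have Runique: "c = c'" if bc: "R b c" and bc': "R b c'" for b c c'
  proof -
    from bc obtain s where s: "\<And>n. s n \<in> acarrier A" "B1.nul (\<lambda>n. j1 (s n)) (\<lambda>_. b)" "B2.nul (\<lambda>n. j2 (s n)) (\<lambda>_. c)"
      unfolding R_def by blast
    from bc' obtain t where t: "\<And>n. t n \<in> acarrier A" "B1.nul (\<lambda>n. j1 (t n)) (\<lambda>_. b)" "B2.nul (\<lambda>n. j2 (t n)) (\<lambda>_. c')"
      unfolding R_def by blast
    have "B2.nul (\<lambda>n. j2 (s n)) (\<lambda>n. j2 (t n))"
      by (rule nul_le[OF s(1) t(1) B1.nul_trans[OF s(2) B1.nul_sym[OF t(2)]]])
    from B2.nul_trans[OF this t(3)] show ?thesis using B2.nul_limit_unique s(3) by blast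
  qed
  have Rex: "\<exists>c. R b c" if b: "b \<in> acarrier B1" for b
  proof -
    obtain s where s: "\<And>n. s n \<in> acarrier A" "B1.nul (\<lambda>n. j1 (s n)) (\<lambda>_. b)"
      using B1.dense_image_seq[OF dense j1 b] by blast
    have "(\<lambda>n. j2 (s n)) \<in> B2.cs"
      unfolding cauchy_seqs_def
    proof (intro CollectI conjI allI impI)
      show "range (\<lambda>n. j2 (s n)) \<subseteq> acarrier B2" using s j2D by auto
      fix e :: real assume e: "e > 0"
      obtain N where N: "\<And>n. n \<ge> N \<Longrightarrow> cnorm B1 (j1 (s n) \<ominus>\<^bsub>B1\<^esub> b) < e / 2"
        using B1.nul_small[OF s(2), of "e / 2"] e by auto
      show "\<exists>N. \<forall>m\<ge>N. \<forall>n\<ge>N. cnorm B2 (j2 (s m) \<ominus>\<^bsub>B2\<^esub> j2 (s n)) < e"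
      proof (intro exI allI impI)
        fix m n assume mn: "m \<ge> N" "n \<ge> N"
        have "cnorm B2 (j2 (s m) \<ominus>\<^bsub>B2\<^esub> j2 (s n)) \<le> cnorm B1 (j1 (s m) \<ominus>\<^bsub>B1\<^esub> j1 (s n))"
          using le[of "s m \<ominus>\<^bsub>A\<^esub> s n"] s(1)
          by (simp add: star_hom_sub[OF j1 A.star_algebra_axioms] star_hom_sub[OF j2 A.star_algebra_axioms])
        also have "\<dots> \<le> cnorm B1 (j1 (s m) \<ominus>\<^bsub>B1\<^esub> b) + cnorm B1 (b \<ominus>\<^bsub>B1\<^esub> j1 (s n))"
          using s b j1D by (intro B1.p_triangle) auto
        also have "\<dots> < e" using N[OF mn(1)] N[OF mn(2)] B1.p_sub_sym[OF j1D(1)[OF s(1)] b] by (simp)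
        finally show "cnorm B2 (j2 (s m) \<ominus>\<^bsub>B2\<^esub> j2 (s n)) < e" .
      qed
    qed
    then show ?thesis using B2.complete_nul RI[OF s(1) s(2)] by blast
  qed
  define h where "h b = (THE c. R b c)" for b
  have h: "R b (h b)" if "b \<in> acarrier B1" for b
    unfolding h_def using Rex[OF that] Runique by (metis theI)
  have h_eq: "h b = c" if "R b c" for b c using h[OF Rin(1)[OF that]] Runique that by blast
  have hom: "restrict h (acarrier B1) \<in> star_hom B1 B2"
  proof (rule star_homI)
    fix a b assume ab: "a \<in> acarrier B1" "b \<in> acarrier B1"
    from h[OF ab(1)] obtain s where s: "\<And>n. s n \<in> acarrier A" "B1.nul (\<lambda>n. j1 (s n)) (\<lambda>_. a)" "B2.nul (\<lambda>n. j2 (s n)) (\<lambda>_. h a)"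
      unfolding R_def by blast
    from h[OF ab(2)] obtain t where t: "\<And>n. t n \<in> acarrier A" "B1.nul (\<lambda>n. j1 (t n)) (\<lambda>_. b)" "B2.nul (\<lambda>n. j2 (t n)) (\<lambda>_. h b)"
      unfolding R_def by blast
    show "h (a \<oplus>\<^bsub>B1\<^esub> b) = h a \<oplus>\<^bsub>B2\<^esub> h b"
      by (rule h_eq, rule RI[of "\<lambda>n. s n \<oplus>\<^bsub>A\<^esub> t n"])
         (use s t B1.nul_add[OF s(2) t(2)] B2.nul_add[OF s(3) t(3)] in \<open>simp_all add: j1D j2D\<close>)
    show "h (a \<otimes>\<^bsub>B1\<^esub> b) = h a \<otimes>\<^bsub>B2\<^esub> h b"
      by (rule h_eq, rule RI[of "\<lambda>n. s n \<otimes>\<^bsub>A\<^esub> t n"])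
         (use s t B1.nul_limit_mul[OF s(2) t(2)] B2.nul_limit_mul[OF s(3) t(3)] in \<open>simp_all add: j1D j2D\<close>)
    show "h (k \<cdot>\<^bsub>B1\<^esub> a) = k \<cdot>\<^bsub>B2\<^esub> h a" for k
      by (rule h_eq, rule RI[of "\<lambda>n. k \<cdot>\<^bsub>A\<^esub> s n"])
         (use s B1.nul_scale[OF s(2)] B2.nul_scale[OF s(3)] in \<open>simp_all add: j1D j2D\<close>)
    show "h (star\<^bsub>B1\<^esub> a) = star\<^bsub>B2\<^esub> (h a)"
      by (rule h_eq, rule RI[of "\<lambda>n. star\<^bsub>A\<^esub> (s n)"])
         (use s B1.nul_star[OF s(2)] B2.nul_star[OF s(3)] in \<open>simp_all add: j1D j2D\<close>)
    show "h a \<in> acarrier B2" using Rin(2)[OF h[OF ab(1)]] .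
  qed (rule B1.star_algebra_axioms)
  have "cnorm B2 (h b) \<le> cnorm B1 b" if b: "b \<in> acarrier B1" for b
  proof -
    from h[OF b] obtain s where s: "\<And>n. s n \<in> acarrier A" "B1.nul (\<lambda>n. j1 (s n)) (\<lambda>_. b)" "B2.nul (\<lambda>n. j2 (s n)) (\<lambda>_. h b)"
      unfolding R_def by blast
    show ?thesis
      by (rule LIMSEQ_le[OF B2.nul_limit_norm[OF s(3)] B1.nul_limit_norm[OF s(2)]]) (use le s(1) in auto)
  qed
  moreover have "h (j1 a) = j2 a" if "a \<in> acarrier A" for a
    by (rule h_eq, rule RI[of "\<lambda>_. a"]) (use that j1D j2D in \<open>auto intro!: B1.nul_refl B2.nul_refl\<close>)
  ultimately show ?thesis using hom j1D(1)
    by (intro bexI[OF _ hom]) auto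
qed

lemma hom_eq_of_dense:
  assumes "cstar_algebra B1" "cstar_algebra B2" "dense_image A j B1" "j \<in> star_hom A B1"
    and h: "h \<in> star_hom B1 B2" "\<And>b. b \<in> acarrier B1 \<Longrightarrow> cnorm B2 (h b) \<le> cnorm B1 b"
    and h': "h' \<in> star_hom B1 B2" "\<And>b. b \<in> acarrier B1 \<Longrightarrow> cnorm B2 (h' b) \<le> cnorm B1 b"
    and eq: "\<And>a. a \<in> acarrier A \<Longrightarrow> h (j a) = h' (j a)"
  shows "h = h'"
proof (rule star_hom_eqI[OF h(1) h'(1)])
  interpret B1: cstar_algebra B1 by fact
  interpret B2: cstar_algebra B2 by fact
  fix b assume b: "b \<in> acarrier B1"
  obtain s where s: "\<And>n. s n \<in> acarrier A" "B1.nul (\<lambda>n. j (s n)) (\<lambda>_. b)"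
    using B1.dense_image_seq[OF assms(3,4) b] by blast
  have lim: "B2.nul (\<lambda>n. g (j (s n))) (\<lambda>_. g b)"
    if g: "g \<in> star_hom B1 B2" "\<And>b. b \<in> acarrier B1 \<Longrightarrow> cnorm B2 (g b) \<le> cnorm B1 b" for g
  proof (rule B2.nulI[OF _ _ B1.nulD(3)[OF s(2)]])
    fix n show "cnorm B2 (g (j (s n)) \<ominus>\<^bsub>B2\<^esub> g b) \<le> cnorm B1 (j (s n) \<ominus>\<^bsub>B1\<^esub> b)"
      using g(2)[of "j (s n) \<ominus>\<^bsub>B1\<^esub> b"] star_homD(1)[OF assms(4) s(1)] b
      by (simp add: star_hom_sub[OF g(1) B1.star_algebra_axioms])
  qed (use star_homD(1)[OF g(1)] star_homD(1)[OF assms(4) s(1)] b in auto)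
  show "h b = h' b"
    using B2.nul_limit_unique[OF lim[OF h]] lim[OF h'] eq s(1) by simp
qed


subsection \<open>Automatic continuity\<close>

text \<open>
  In a \<open>C\<^sup>*\<close>-algebra the norm dominates every \<open>C\<^sup>*\<close>-seminorm. Usually this comes from the spectral radius;
  here it comes from unitaries. A selfadjoint \<open>h\<close> of norm less than \<open>1\<close> is the real part of
  \<open>w = h + \<i> k\<close> with \<open>k\<close> a square root of \<open>1 - h\<^sup>2\<close>, and \<open>q(w) \<le> 1\<close> as \<open>w\<^sup>* w = 1\<close>.
\<close>

locale unital_cstar_algebra = cstar_algebra A for A :: "('a, 'm) cstar_alg_scheme" (structure) +
  fixes u
  assumes u_in [simp]: "u \<in> acarrier A"
    and u_left [simp]: "a \<in> acarrier A \<Longrightarrow> u \<otimes> a = a"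
    and u_right [simp]: "a \<in> acarrier A \<Longrightarrow> a \<otimes> u = a"
begin

lemma star_u [simp]: "star u = u"
  by (metis star_in star_mul star_star u_in u_left)

text \<open>
  The square root is \<open>k = 1 - l\<close> with \<open>l\<close> a solution of \<open>l = (a\<^sup>2 + l\<^sup>2) / 2\<close>, the limit of the iteration
  that starts in \<open>0\<close>. The iterates stay in the ball whose radius \<open>\<beta>\<close> solves the corresponding scalar
  equation, where the iteration contracts by the factor \<open>\<beta> < 1\<close>; they commute with \<open>a\<close> and are selfadjoint,
  and both properties pass to the limit.
\<close>

lemma square_root_complement:
  assumes a: "a \<in> acarrier A" "star a = a" "cnorm A a < 1"
  shows "\<exists>k\<in>acarrier A. star k = k \<and> a \<otimes> k = k \<otimes> a \<and> a \<otimes> a \<oplus> k \<otimes> k = u"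
proof -
  define x where "x = a \<otimes> a"
  define r where "r = (cnorm A a)\<^sup>2"
  have r: "0 \<le> r" "r < 1" using a by (auto simp: r_def power_less_one_iff abs_square_less_1)
  have x: "x \<in> acarrier A" "star x = x" "cnorm A x = r"
    using a p_cstar[OF a(1)] by (auto simp: x_def r_def star_mul)
  \<comment> \<open>the smaller root of \<open>(r + \<beta>\<^sup>2) / 2 = \<beta>\<close>\<close>
  define \<beta> where "\<beta> = 1 - sqrt (1 - r)"
  have \<beta>: "0 \<le> \<beta>" "\<beta> < 1"
    using r by (auto simp: \<beta>_def)
  have \<beta>_fix: "(r + \<beta>\<^sup>2) / 2 = \<beta>"
    using r by (simp add: \<beta>_def power2_diff field_simps)
  define b where "b = rec_nat \<zero> (\<lambda>_ y. (1/2) \<cdot> (x \<oplus> y \<otimes> y))"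
  have b0: "b 0 = \<zero>" and bS: "b (Suc n) = (1/2) \<cdot> (x \<oplus> b n \<otimes> b n)" for n by (simp_all add: b_def)
  have b_in [simp]: "b n \<in> acarrier A" for n by (induction n) (simp_all add: b0 bS x)
  have b_star: "star (b n) = b n" for n by (induction n) (simp_all add: b0 bS x star_scale star_add star_mul)
  have b_comm: "a \<otimes> b n = b n \<otimes> a" for n
  proof (induction n)
    case (Suc n)
    have "a \<otimes> (b n \<otimes> b n) = b n \<otimes> b n \<otimes> a" using Suc a(1) by (metis b_in mul_assoc)
    moreover have "a \<otimes> x = x \<otimes> a" using a(1) by (simp add: x_def mul_assoc)
    ultimately show ?case using a(1) x(1) by (simp add: bS mul_add add_mul)
  qed (simp add: b0 a)
  have b_norm: "cnorm A (b n) \<le> \<beta>" for n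
  proof (induction n)
    case (Suc n)
    have "cnorm A (b (Suc n)) = cnorm A (x \<oplus> b n \<otimes> b n) / 2" using x(1) by (simp add: bS p_scale)
    also have "\<dots> \<le> (cnorm A x + cnorm A (b n \<otimes> b n)) / 2" using x(1) by (intro divide_right_mono p_add) auto
    also have "\<dots> \<le> (r + \<beta>\<^sup>2) / 2"
      using p_mul[of "b n" "b n"] mult_mono[OF Suc Suc \<beta>(1) p_nonneg[OF b_in]] x(3)
      by (simp add: power2_eq_square)
    finally show ?case using \<beta>_fix by simp
  qed (simp add: b0 \<beta>)
  have step: "cnorm A (b (Suc n) \<ominus> b n) \<le> \<beta> ^ n" for n
  proof (induction n)
    case 0
    show ?case using b_norm[of 1] \<beta>(2) by (simp add: b0)
  next
    case (Suc n)
    have eq: "b (Suc (Suc n)) \<ominus> b (Suc n) =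
        (1/2) \<cdot> ((b (Suc n) \<ominus> b n) \<otimes> b (Suc n) \<oplus> b n \<otimes> (b (Suc n) \<ominus> b n))"
    proof -
      have "b (Suc (Suc n)) \<ominus> b (Suc n) = (1/2) \<cdot> ((x \<oplus> b (Suc n) \<otimes> b (Suc n)) \<ominus> (x \<oplus> b n \<otimes> b n))"
        unfolding scale_sub[symmetric, OF add_in[OF x(1) mul_in[OF b_in b_in]] add_in[OF x(1) mul_in[OF b_in b_in]]]
        by (simp only: bS[symmetric])
      also have "(x \<oplus> b (Suc n) \<otimes> b (Suc n)) \<ominus> (x \<oplus> b n \<otimes> b n) = b (Suc n) \<otimes> b (Suc n) \<ominus> b n \<otimes> b n"
        using x(1) by (simp add: add_sub_add)
      also have "\<dots> = (b (Suc n) \<ominus> b n) \<otimes> b (Suc n) \<oplus> b n \<otimes> (b (Suc n) \<ominus> b n)"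
        by (simp add: mul_sub_mul)
      finally show ?thesis .
    qed
    let ?d = "b (Suc n) \<ominus> b n"
    have "cnorm A (b (Suc (Suc n)) \<ominus> b (Suc n)) = cnorm A (?d \<otimes> b (Suc n) \<oplus> b n \<otimes> ?d) / 2"
      unfolding eq by (simp add: p_scale)
    also have "\<dots> \<le> (cnorm A ?d * cnorm A (b (Suc n)) + cnorm A (b n) * cnorm A ?d) / 2"
      by (intro divide_right_mono order_trans[OF p_add] add_mono p_mul) auto
    also have "\<dots> \<le> (cnorm A ?d * \<beta> + \<beta> * cnorm A ?d) / 2"
      by (intro divide_right_mono add_mono mult_left_mono mult_right_mono b_norm) auto
    also have "\<dots> = \<beta> * cnorm A ?d" by simp
    also have "\<dots> \<le> \<beta> ^ Suc n" using Suc \<beta>(1) by (simp add: mult_left_mono)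
    finally show ?case .
  qed
  \<comment> \<open>geometric series\<close>
  have tail: "cnorm A (b (m + k) \<ominus> b m) \<le> \<beta> ^ m / (1 - \<beta>)" for m k
  proof -
    have "cnorm A (b (m + k) \<ominus> b m) \<le> (\<beta> ^ m - \<beta> ^ (m + k)) / (1 - \<beta>)"
    proof (induction k)
      case (Suc k)
      have "cnorm A (b (m + Suc k) \<ominus> b m) \<le> cnorm A (b (Suc (m + k)) \<ominus> b (m + k)) + cnorm A (b (m + k) \<ominus> b m)"
        by (simp add: p_triangle)
      also have "\<dots> \<le> \<beta> ^ (m + k) + (\<beta> ^ m - \<beta> ^ (m + k)) / (1 - \<beta>)"
        by (intro add_mono step Suc)
      also have "\<dots> = (\<beta> ^ m - \<beta> ^ (m + Suc k)) / (1 - \<beta>)"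
        using \<beta>(2) by (simp add: field_simps)
      finally show ?case .
    qed simp
    also have "\<dots> \<le> \<beta> ^ m / (1 - \<beta>)" using \<beta> by (intro divide_right_mono) auto
    finally show ?thesis .
  qed
  have "b \<in> cs"
    unfolding cauchy_seqs_def
  proof (intro CollectI conjI allI impI)
    fix e :: real assume e: "e > 0"
    have "(\<lambda>m. \<beta> ^ m / (1 - \<beta>)) \<longlonglongrightarrow> 0 / (1 - \<beta>)"
      using \<beta> by (intro tendsto_divide LIMSEQ_realpow_zero tendsto_const) auto
    then obtain N where N: "\<bar>\<beta> ^ N / (1 - \<beta>)\<bar> < e / 2"
      using LIMSEQ_D[of "\<lambda>m. \<beta> ^ m / (1 - \<beta>)" 0 "e / 2"] e by auto
    have near: "cnorm A (b n \<ominus> b N) < e / 2" if "n \<ge> N" for n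
    proof -
      have "cnorm A (b n \<ominus> b N) \<le> \<beta> ^ N / (1 - \<beta>)" using tail[of N "n - N"] that by simp
      then show ?thesis using N by linarith
    qed
    show "\<exists>N. \<forall>m\<ge>N. \<forall>n\<ge>N. cnorm A (b m \<ominus> b n) < e"
    proof (intro exI allI impI)
      fix m n assume mn: "m \<ge> N" "n \<ge> N"
      have "cnorm A (b m \<ominus> b n) \<le> cnorm A (b m \<ominus> b N) + cnorm A (b N \<ominus> b n)"
        by (simp add: p_triangle)
      then show "cnorm A (b m \<ominus> b n) < e"
        using near[OF mn(1)] near[OF mn(2)] p_sub_sym[of "b n" "b N"] by simp
    qed
  qed auto
  then obtain l where l: "nul b (\<lambda>_. l)" using complete_nul by blast
  then have l_in [simp]: "l \<in> acarrier A" by (rule nulD(2))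
  have "nul (\<lambda>n. b (Suc n)) (\<lambda>_. l)"
    using l LIMSEQ_Suc[OF nulD(3)[OF l]] by (auto simp: nul_def)
  moreover have "nul (\<lambda>n. b (Suc n)) (\<lambda>_. (1/2) \<cdot> (x \<oplus> l \<otimes> l))"
    unfolding bS by (intro nul_scale nul_add nul_limit_mul l nul_refl x)
  ultimately have l_eq: "l = (1/2) \<cdot> (x \<oplus> l \<otimes> l)" by (rule nul_limit_unique)
  have l_star: "star l = l"
    using nul_limit_unique[OF nul_star[OF l]] l by (simp add: b_star)
  have l_comm: "a \<otimes> l = l \<otimes> a"
  proof (rule nul_limit_unique)
    show "nul (\<lambda>n. a \<otimes> b n) (\<lambda>_. a \<otimes> l)" by (rule nul_limit_mul[OF nul_refl l]) (use a in simp)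
    show "nul (\<lambda>n. a \<otimes> b n) (\<lambda>_. l \<otimes> a)"
      unfolding b_comm by (rule nul_limit_mul[OF l nul_refl]) (use a in simp)
  qed
  have two: "2 \<cdot> l = x \<oplus> l \<otimes> l"
    using arg_cong[OF l_eq, of "\<lambda>y. 2 \<cdot> y"] x(1) by simp
  define k where "k = u \<ominus> l"
  have k_in: "k \<in> acarrier A" by (simp add: k_def)
  have "k \<otimes> k = (u \<ominus> l) \<ominus> (l \<ominus> l \<otimes> l)" by (simp add: k_def sub_mul mul_sub)
  also have "\<dots> = u \<ominus> x"
  proof -
    have "(u \<ominus> l) \<ominus> (l \<ominus> l \<otimes> l) = u \<oplus> ((-1) \<cdot> (2 \<cdot> l) \<oplus> l \<otimes> l)"
      using add_scale[of l "-1" "-1"] by (simp add: asub_def scale_add add_ac)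
    also have "(-1) \<cdot> (2 \<cdot> l) \<oplus> l \<otimes> l = (-1) \<cdot> x"
      unfolding two using x(1) by (simp add: scale_add add_assoc neg_add)
    finally show ?thesis by (simp add: asub_def)
  qed
  finally have "a \<otimes> a \<oplus> k \<otimes> k = u"
    using a(1) by (simp add: x_def add_comm[of "a \<otimes> a"] sub_add_cancel)
  moreover have "star k = k" unfolding k_def by (simp add: l_star flip: star_sub)
  moreover have "a \<otimes> k = k \<otimes> a" using a(1) l_comm by (simp add: k_def sub_mul mul_sub)
  ultimately show ?thesis using k_in by blast
qed

text \<open>
  For selfadjoint elements by the unitaries above and rescaling, in general by the \<open>C\<^sup>*\<close>-identity.
\<close>

lemma cstar_seminorm_le_cnorm:
  assumes "cstar_seminorm A q" "a \<in> acarrier A"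
  shows "q a \<le> cnorm A a"
proof -
  interpret Q: cstar_seminormed A q by unfold_locales (rule assms(1))
  have "(q u)\<^sup>2 = q u" using Q.p_cstar[of u] by simp
  then have qu: "q u \<le> 1" by (auto simp: power2_eq_square)
  have small: "q h \<le> 1" if h: "h \<in> acarrier A" "star h = h" "cnorm A h < 1" for h
  proof -
    obtain k where k: "k \<in> acarrier A" "star k = k" "h \<otimes> k = k \<otimes> h" "h \<otimes> h \<oplus> k \<otimes> k = u"
      using square_root_complement[OF h] by blast
    define w where "w = h \<oplus> \<i> \<cdot> k"
    have w: "w \<in> acarrier A" "star w = h \<oplus> (- \<i>) \<cdot> k"
      using h k by (simp_all add: w_def star_add star_scale)
    have "star w \<otimes> w = (h \<oplus> (- \<i>) \<cdot> k) \<otimes> (h \<oplus> \<i> \<cdot> k)" by (simp only: w(2)) (simp add: w_def)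
    also have "\<dots> = (h \<otimes> h \<oplus> (- \<i>) \<cdot> (k \<otimes> h)) \<oplus> (\<i> \<cdot> (k \<otimes> h) \<oplus> k \<otimes> k)"
      using h k by (simp add: mul_add add_mul scale_add)
    also have "\<dots> = (h \<otimes> h \<oplus> k \<otimes> k) \<oplus> (\<i> \<cdot> (k \<otimes> h) \<oplus> (- \<i>) \<cdot> (k \<otimes> h))"
      using h(1) k(1) by (simp add: add_ac)
    also have "\<i> \<cdot> (k \<otimes> h) \<oplus> (- \<i>) \<cdot> (k \<otimes> h) = \<zero>"
      using h k add_scale[of "k \<otimes> h" \<i> "- \<i>"] by simp
    finally have "(q w)\<^sup>2 \<le> 1" using Q.p_cstar[OF w(1)] k(4) qu by simp
    then have qw: "q w \<le> 1" by (intro power2_le_imp_le[of "q w" 1]) simp_all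
    have "w \<oplus> star w = 2 \<cdot> h"
    proof -
      have "w \<oplus> star w = (h \<oplus> h) \<oplus> (\<i> \<cdot> k \<oplus> (- \<i>) \<cdot> k)"
        using h k unfolding w(2) by (simp add: w_def add_ac)
      also have "\<i> \<cdot> k \<oplus> (- \<i>) \<cdot> k = \<zero>" using k add_scale[of k \<i> "- \<i>"] by simp
      also have "h \<oplus> h = 2 \<cdot> h" using h add_scale[of h 1 1] by simp
      finally show ?thesis using h by simp
    qed
    then have "2 * q h = q (w \<oplus> star w)" using h by (simp add: Q.p_scale)
    also have "\<dots> \<le> q w + q (star w)" by (rule Q.p_add) (use w(1) in auto)
    finally show ?thesis using qw w(1) by simp
  qed
  have sa: "q h \<le> cnorm A h" if h: "h \<in> acarrier A" "star h = h" for h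
  proof (rule field_le_epsilon)
    fix e :: real assume e: "e > 0"
    define t where "t = cnorm A h + e"
    have t: "t > 0" using e p_nonneg[OF h(1)] by (simp add: t_def)
    have "q (complex_of_real (1 / t) \<cdot> h) \<le> 1"
    proof (rule small)
      show "star (complex_of_real (1 / t) \<cdot> h) = complex_of_real (1 / t) \<cdot> h"
        using h by (simp add: star_scale)
      show "cnorm A (complex_of_real (1 / t) \<cdot> h) < 1"
        using h t e by (simp only: p_scale norm_of_real) (simp add: t_def)
    qed (use h in simp)
    then show "q h \<le> cnorm A h + e"
      using h t by (simp only: Q.p_scale norm_of_real) (simp add: t_def)
  qed
  have "(q a)\<^sup>2 \<le> (cnorm A a)\<^sup>2"
    using sa[of "star a \<otimes> a"] assms(2) Q.p_cstar[OF assms(2)] p_cstar[OF assms(2)]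
    by (simp add: star_mul)
  then show ?thesis using p_nonneg[OF assms(2)] by (rule power2_le_imp_le)
qed

end

lemma cstar_seminorm_pullback:
  assumes "h \<in> star_hom A B" "cstar_seminorm B q" "star_algebra A"
  shows "cstar_seminorm A (\<lambda>a. q (h a))"
proof -
  interpret star_algebra A by fact
  show ?thesis
    using assms(2) unfolding cstar_seminorm_def
    by (intro conjI ballI allI) (simp_all add: star_homD(1-5)[OF assms(1)])
qed

lemma hom_contractive:
  assumes "unital_cstar_algebra B1 u" "cstar_algebra B2" "h \<in> star_hom B1 B2" "b \<in> acarrier B1"
  shows "cnorm B2 (h b) \<le> cnorm B1 b"
proof -
  interpret B1: unital_cstar_algebra B1 u by fact
  interpret B2: cstar_algebra B2 by fact
  show ?thesis
    using B1.cstar_seminorm_le_cnorm[OF cstar_seminorm_pullback[OF assms(3) B2.norm_cstar B1.star_algebra_axioms] assms(4)] .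
qed

lemma dense_unital:
  assumes "star_algebra A" "cstar_algebra B" "j \<in> star_hom A B" "dense_image A j B"
    and "u \<in> acarrier A" "\<And>a. a \<in> acarrier A \<Longrightarrow> u \<otimes>\<^bsub>A\<^esub> a = a" "\<And>a. a \<in> acarrier A \<Longrightarrow> a \<otimes>\<^bsub>A\<^esub> u = a"
  shows "unital_cstar_algebra B (j u)"
proof -
  interpret A: star_algebra A by fact
  interpret B: cstar_algebra B by fact
  note jD = star_homD[OF assms(3)]
  show ?thesis
  proof
    show ju: "j u \<in> acarrier B" using assms(5) jD by blast
    fix b assume b: "b \<in> acarrier B"
    obtain s where s: "\<And>n. s n \<in> acarrier A" "B.nul (\<lambda>n. j (s n)) (\<lambda>_. b)"
      using B.dense_image_seq[OF assms(4,3) b] by blast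
    have "j u \<otimes>\<^bsub>B\<^esub> j (s n) = j (s n)" "j (s n) \<otimes>\<^bsub>B\<^esub> j u = j (s n)" for n
      using jD(3)[OF assms(5) s(1)] jD(3)[OF s(1) assms(5)] assms(6,7) s(1) by metis+
    then show "j u \<otimes>\<^bsub>B\<^esub> b = b" "b \<otimes>\<^bsub>B\<^esub> j u = b"
      using B.nul_limit_unique[OF B.nul_limit_mul[OF B.nul_refl[of "\<lambda>_. j u"] s(2)]]
        B.nul_limit_unique[OF B.nul_limit_mul[OF s(2) B.nul_refl[of "\<lambda>_. j u"]]] ju s(2) by simp_all
  qed
qed

lemma hom_eq_of_dense_unital:
  assumes "unital_cstar_algebra B1 u" "cstar_algebra B2" "dense_image A j B1" "j \<in> star_hom A B1"
    and h: "h \<in> star_hom B1 B2" and h': "h' \<in> star_hom B1 B2"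
    and eq: "\<And>a. a \<in> acarrier A \<Longrightarrow> h (j a) = h' (j a)"
  shows "h = h'"
proof -
  interpret B1: unital_cstar_algebra B1 u by fact
  show ?thesis
    by (rule hom_eq_of_dense[OF B1.cstar_algebra_axioms assms(2-4) h hom_contractive[OF assms(1,2) h]
          h' hom_contractive[OF assms(1,2) h'] eq])
qed

text \<open>
  The inverse of the extension of \<open>j1 a \<mapsto> j2 a\<close> is the extension of \<open>j2 a \<mapsto> j1 a\<close>. The unit of \<open>A\<close> is there
  to make \<open>B1\<close> and \<open>B2\<close> unital, as contractivity is available for unital algebras.
\<close>

lemma completions_unique_iso:
  assumes A: "star_algebra A" and B1: "cstar_algebra B1" and B2: "cstar_algebra B2"
    and j1: "j1 \<in> star_hom A B1" "dense_image A j1 B1"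
    and j2: "j2 \<in> star_hom A B2" "dense_image A j2 B2"
    and eq: "\<And>a. a \<in> acarrier A \<Longrightarrow> cnorm B2 (j2 a) = cnorm B1 (j1 a)"
    and u: "u \<in> acarrier A" "\<And>a. a \<in> acarrier A \<Longrightarrow> u \<otimes>\<^bsub>A\<^esub> a = a" "\<And>a. a \<in> acarrier A \<Longrightarrow> a \<otimes>\<^bsub>A\<^esub> u = a"
  shows "\<exists>!\<psi>. \<psi> \<in> star_iso B1 B2 \<and> (\<forall>a\<in>acarrier A. \<psi> (j1 a) = j2 a)"
proof -
  interpret B1: cstar_algebra B1 by fact
  interpret B2: cstar_algebra B2 by fact
  have U1: "unital_cstar_algebra B1 (j1 u)" and U2: "unital_cstar_algebra B2 (j2 u)"
    using dense_unital[OF A B1 j1 u(1)] dense_unital[OF A B2 j2 u(1)] u(2,3) by blast+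
  obtain h where h: "h \<in> star_hom B1 B2" "\<forall>a\<in>acarrier A. h (j1 a) = j2 a"
    using extend_hom[OF A B1 B2 j1(1) j2(1) _ j1(2)] eq by (metis order_refl)
  obtain g where g: "g \<in> star_hom B2 B1" "\<forall>a\<in>acarrier A. g (j2 a) = j1 a"
    using extend_hom[OF A B2 B1 j2(1) j1(1) _ j2(2)] eq by (metis order_refl)
  have id_hom: "restrict (\<lambda>b. b) (acarrier B) \<in> star_hom B B" if "star_algebra B" for B :: "('x, 'y) cstar_alg_scheme"
    by (rule star_homI[OF _ _ _ _ _ that]) auto
  have gh: "g (h b) = b" if "b \<in> acarrier B1" for b
  proof -
    have "restrict (g \<circ> h) (acarrier B1) = restrict (\<lambda>b. b) (acarrier B1)"
      by (rule hom_eq_of_dense_unital[OF U1 B1 j1(2,1) star_hom_comp[OF h(1) g(1) B1.star_algebra_axioms]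
            id_hom[OF B1.star_algebra_axioms]])
         (use h g star_homD(1)[OF j1(1)] in simp)
    then show ?thesis using that by (metis comp_apply restrict_apply')
  qed
  have hg: "h (g b) = b" if "b \<in> acarrier B2" for b
  proof -
    have "restrict (h \<circ> g) (acarrier B2) = restrict (\<lambda>b. b) (acarrier B2)"
      by (rule hom_eq_of_dense_unital[OF U2 B2 j2(2,1) star_hom_comp[OF g(1) h(1) B2.star_algebra_axioms]
            id_hom[OF B2.star_algebra_axioms]])
         (use h g star_homD(1)[OF j2(1)] in simp)
    then show ?thesis using that by (metis comp_apply restrict_apply')
  qed
  have "bij_betw h (acarrier B1) (acarrier B2)"
    by (rule bij_betwI[where g = g]) (use gh hg star_homD(1)[OF h(1)] star_homD(1)[OF g(1)] in auto)
  then have "h \<in> star_iso B1 B2" using h by (simp add: star_iso_def)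
  moreover have "\<psi> = h" if "\<psi> \<in> star_hom B1 B2" "\<forall>a\<in>acarrier A. \<psi> (j1 a) = j2 a" for \<psi>
    by (rule hom_eq_of_dense_unital[OF U1 B2 j1(2,1) that(1) h(1)]) (use that h in auto)
  ultimately show ?thesis using h(2) by (intro ex1I[of _ h]) (auto simp: star_iso_def)
qed


subsection \<open>Enveloping norms\<close>

lemma env_norm_upper:
  assumes "\<And>p. cstar_seminorm A p \<Longrightarrow> p a \<le> C" "cstar_seminorm A p"
  shows "p a \<le> env_norm A a"
  unfolding env_norm_def
  by (rule cSUP_upper) (use assms in \<open>auto intro!: bdd_aboveI[of _ C]\<close>)

text \<open>
  So the supremum in \<open>env_norm\<close> is over a nonempty set.
\<close>

lemma zero_seminorm: "cstar_seminorm A (\<lambda>_. 0)"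
  by (simp add: cstar_seminorm_def)

lemma env_norm_least:
  assumes "\<And>p. cstar_seminorm A p \<Longrightarrow> p a \<le> C"
  shows "env_norm A a \<le> C"
  unfolding env_norm_def
  by (rule cSUP_least) (use assms zero_seminorm in auto)

text \<open>
  A pointwise finite supremum of \<open>C\<^sup>*\<close>-seminorms is one. Without finiteness \<open>env_norm\<close> is a supremum of an
  unbounded set of reals and has no meaning.
\<close>

lemma (in star_algebra) env_norm_cstar_seminorm:
  assumes "\<And>a. a \<in> acarrier A \<Longrightarrow> \<exists>C. \<forall>p. cstar_seminorm A p \<longrightarrow> p a \<le> C"
  shows "cstar_seminorm A (env_norm A)"
proof -
  have up: "p a \<le> env_norm A a" if "a \<in> acarrier A" "cstar_seminorm A p" for p a
    using assms[OF that(1)] env_norm_upper[OF _ that(2), of a] by blast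
  have nonneg: "0 \<le> env_norm A a" if "a \<in> acarrier A" for a
    using up[OF that zero_seminorm] .
  show ?thesis
    unfolding cstar_seminorm_def
  proof (intro conjI ballI allI)
    fix a b assume ab: "a \<in> acarrier A" "b \<in> acarrier A"
    show "env_norm A (a \<oplus> b) \<le> env_norm A a + env_norm A b"
    proof (rule env_norm_least)
      fix p assume p: "cstar_seminorm A p"
      then have "p (a \<oplus> b) \<le> p a + p b" using ab by (simp add: cstar_seminorm_def)
      then show "p (a \<oplus> b) \<le> env_norm A a + env_norm A b" using up[OF ab(1) p] up[OF ab(2) p] by simp
    qed
    show "env_norm A (a \<otimes> b) \<le> env_norm A a * env_norm A b"
    proof (rule env_norm_least)
      fix p assume p: "cstar_seminorm A p"
      then have "p (a \<otimes> b) \<le> p a * p b" "0 \<le> p b" using ab by (simp_all add: cstar_seminorm_def)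
      then show "p (a \<otimes> b) \<le> env_norm A a * env_norm A b"
        using mult_mono[OF up[OF ab(1) p] up[OF ab(2) p] nonneg[OF ab(1)]] by simp
    qed
  next
    fix k a assume a: "a \<in> acarrier A"
    have le: "env_norm A (k \<cdot> a) \<le> cmod k * env_norm A a" if a: "a \<in> acarrier A" for k a
    proof (rule env_norm_least)
      fix p assume p: "cstar_seminorm A p"
      then have "p (k \<cdot> a) = cmod k * p a" using a by (simp add: cstar_seminorm_def)
      then show "p (k \<cdot> a) \<le> cmod k * env_norm A a" using up[OF a p] by (simp add: mult_left_mono)
    qed
    show "env_norm A (k \<cdot> a) = cmod k * env_norm A a"
    proof (cases "k = 0")
      case True
      then show ?thesis using le[OF a, of 0] nonneg[of "0 \<cdot> a"] a by simp
    next
      case False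
      have "env_norm A a \<le> cmod (1 / k) * env_norm A (k \<cdot> a)"
        using le[of "k \<cdot> a" "1 / k"] a False by simp
      then show ?thesis using le[OF a, of k] False by (simp add: norm_divide field_simps)
    qed
  next
    fix a assume a: "a \<in> acarrier A"
    show "env_norm A (star a \<otimes> a) = (env_norm A a)\<^sup>2"
    proof (rule antisym)
      show "env_norm A (star a \<otimes> a) \<le> (env_norm A a)\<^sup>2"
      proof (rule env_norm_least)
        fix p assume p: "cstar_seminorm A p"
        then have "p (star a \<otimes> a) = (p a)\<^sup>2" "0 \<le> p a" using a by (simp_all add: cstar_seminorm_def)
        then show "p (star a \<otimes> a) \<le> (env_norm A a)\<^sup>2" using up[OF a p] by (simp add: power_mono)
      qed
      have "env_norm A a \<le> sqrt (env_norm A (star a \<otimes> a))"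
      proof (rule env_norm_least)
        fix p assume p: "cstar_seminorm A p"
        then have "(p a)\<^sup>2 = p (star a \<otimes> a)" using a by (simp add: cstar_seminorm_def)
        then show "p a \<le> sqrt (env_norm A (star a \<otimes> a))"
          using up[of "star a \<otimes> a", OF _ p] a by (intro real_le_rsqrt) simp
      qed
      then show "(env_norm A a)\<^sup>2 \<le> env_norm A (star a \<otimes> a)"
        using nonneg[OF a] nonneg[of "star a \<otimes> a"] a
        by (metis mul_in power_mono real_sqrt_pow2 star_in)
    qed
  qed (use nonneg in auto)
qed


section \<open>Corners and homomorphisms\<close>

lemma corner_hom:
  assumes "star_projection A p" "star_projection B q" "h \<in> star_hom A B" "h p = q"
  shows "restrict h (acarrier (corner A p)) \<in> star_hom (corner A p) (corner B q)"
proof -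
  interpret A: star_projection A p by fact
  interpret B: star_projection B q by fact
  note hD = star_homD[OF assms(3)]
  show ?thesis
  proof (rule star_homI[OF _ _ _ _ _ A.corner_star_algebra])
    fix a assume "a \<in> acarrier (corner A p)"
    then have a: "a \<in> acarrier A" "p \<otimes>\<^bsub>A\<^esub> a = a" "a \<otimes>\<^bsub>A\<^esub> p = a" by (auto simp: A.corner_iff)
    then show "h a \<in> acarrier (corner B q)"
      unfolding B.corner_iff using hD(1)[OF a(1)] hD(3)[OF A.p_in a(1)] hD(3)[OF a(1) A.p_in] assms(4) by simp
  qed (auto simp: A.corner_iff hD)
qed

lemma (in star_projection) hom_projection:
  assumes "h \<in> star_hom A B" "star_algebra B"
  shows "star_projection B (h p)"
proof -
  interpret B: star_algebra B by fact
  show ?thesis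
    by unfold_locales (use star_homD(1,3,5)[OF assms(1)] p_idem p_star p_in in metis)+
qed

text \<open>
  Compression by the projection has norm at most \<open>1\<close>, so it turns approximations in \<open>C\<close> into approximations
  in the corner.
\<close>

lemma corner_dense:
  assumes "star_projection L p" "cstar_algebra C" "j \<in> star_hom L C" "dense_image L j C"
  shows "dense_image (corner L p) j (corner C (j p))"
proof -
  interpret L: star_projection L p by fact
  interpret C: cstar_algebra C by fact
  interpret P: star_projection C "j p" by (rule L.hom_projection[OF assms(3) C.star_algebra_axioms])
  have np: "cnorm C (j p) \<le> 1"
    using C.p_cstar[OF P.p_in] P.p_star P.p_idem by (auto simp: power2_eq_square)
  note jD = star_homD[OF assms(3)]
  show ?thesis
    unfolding dense_image_def cnorm_corner corner_sel
  proof (intro ballI allI impI)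
    fix b and e :: real assume b: "b \<in> acarrier (corner C (j p))" and e: "e > 0"
    then have bC: "b \<in> acarrier C" and bp: "j p \<otimes>\<^bsub>C\<^esub> b = b" "b \<otimes>\<^bsub>C\<^esub> j p = b"
      by (auto simp: P.corner_iff)
    obtain a where a: "a \<in> acarrier L" "cnorm C (b \<ominus>\<^bsub>C\<^esub> j a) < e"
      using assms(4) bC e unfolding dense_image_def by blast
    let ?d = "b \<ominus>\<^bsub>C\<^esub> j a"
    have d: "?d \<in> acarrier C" using a(1) bC jD(1) by simp
    have "b \<ominus>\<^bsub>C\<^esub> j (p \<otimes>\<^bsub>L\<^esub> a \<otimes>\<^bsub>L\<^esub> p) = j p \<otimes>\<^bsub>C\<^esub> ?d \<otimes>\<^bsub>C\<^esub> j p"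
      using a(1) bC bp jD(1) by (simp add: jD(3) C.mul_sub C.sub_mul)
    also have "cnorm C \<dots> \<le> cnorm C (j p) * cnorm C ?d * cnorm C (j p)"
      using C.p_mul[of "j p \<otimes>\<^bsub>C\<^esub> ?d" "j p"] C.p_mul[of "j p" ?d] d P.p_in
      by (meson C.mul_in C.p_nonneg mult_right_mono order_trans)
    also have "\<dots> \<le> 1 * cnorm C ?d * 1"
      using np d P.p_in by (intro mult_mono) auto
    finally show "\<exists>a\<in>acarrier (corner L p). cnorm C (b \<ominus>\<^bsub>C\<^esub> j a) < e"
      using a L.compress_in[OF a(1)] by (intro bexI[of _ "p \<otimes>\<^bsub>L\<^esub> a \<otimes>\<^bsub>L\<^esub> p"]) auto
  qed
qed


section \<open>Direct limits\<close>

locale star_system =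
  fixes A :: "nat \<Rightarrow> ('a, 'm) star_alg_scheme" and f :: "nat \<Rightarrow> 'a \<Rightarrow> 'a"
  assumes alg: "star_algebra (A n)" and hom: "f n \<in> star_hom (A n) (A (Suc n))"
begin

abbreviation "T \<equiv> transit f"
abbreviation "\<iota> \<equiv> to_star_lim A f"
abbreviation "DL \<equiv> star_lim A f"

lemma T_below [simp]: "k \<le> m \<Longrightarrow> T m k a = a"
  by (induction k) auto

lemma T_in: "a \<in> acarrier (A m) \<Longrightarrow> m \<le> k \<Longrightarrow> T m k a \<in> acarrier (A k)"
proof (induction k)
  case (Suc k)
  then show ?case
  proof (cases "m \<le> k")
    case False
    then have "m = Suc k" using Suc by simp
    then show ?thesis using Suc by simp
  qed (use star_homD(1)[OF hom] in auto)
qed simp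

lemma T_add: "\<lbrakk>a \<in> acarrier (A m); b \<in> acarrier (A m); m \<le> k\<rbrakk> \<Longrightarrow>
    T m k (a \<oplus>\<^bsub>A m\<^esub> b) = T m k a \<oplus>\<^bsub>A k\<^esub> T m k b"
proof (induction k)
  case (Suc k)
  then show ?case
    by (cases "m \<le> k") (auto simp: le_Suc_eq star_homD(2)[OF hom] T_in)
qed simp

lemma T_mul: "\<lbrakk>a \<in> acarrier (A m); b \<in> acarrier (A m); m \<le> k\<rbrakk> \<Longrightarrow>
    T m k (a \<otimes>\<^bsub>A m\<^esub> b) = T m k a \<otimes>\<^bsub>A k\<^esub> T m k b"
proof (induction k)
  case (Suc k)
  then show ?case
    by (cases "m \<le> k") (auto simp: le_Suc_eq star_homD(3)[OF hom] T_in)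
qed simp

lemma T_scale: "\<lbrakk>a \<in> acarrier (A m); m \<le> k\<rbrakk> \<Longrightarrow> T m k (c \<cdot>\<^bsub>A m\<^esub> a) = c \<cdot>\<^bsub>A k\<^esub> T m k a"
proof (induction k)
  case (Suc k)
  then show ?case
    by (cases "m \<le> k") (auto simp: le_Suc_eq star_homD(4)[OF hom] T_in)
qed simp

lemma T_star: "\<lbrakk>a \<in> acarrier (A m); m \<le> k\<rbrakk> \<Longrightarrow> T m k (star\<^bsub>A m\<^esub> a) = star\<^bsub>A k\<^esub> (T m k a)"
proof (induction k)
  case (Suc k)
  then show ?case
    by (cases "m \<le> k") (auto simp: le_Suc_eq star_homD(5)[OF hom] T_in)
qed simp

lemma T_comp: "\<lbrakk>m \<le> k; k \<le> l\<rbrakk> \<Longrightarrow> T k l (T m k a) = T m l a"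
proof (induction l)
  case (Suc l)
  then show ?case by (cases "k \<le> l") (auto simp: le_Suc_eq)
qed simp

abbreviation "S \<equiv> (SIGMA n:UNIV. acarrier (A n))"

lemma lim_rel_iff: "((m, a), (n, b)) \<in> lim_rel A f \<longleftrightarrow> a \<in> acarrier (A m) \<and> b \<in> acarrier (A n) \<and>
    (\<exists>k. m \<le> k \<and> n \<le> k \<and> T m k a = T n k b)"
  by (simp add: lim_rel_def)

lemma equiv_lim: "equiv S (lim_rel A f)"
proof (rule equivI)
  show "lim_rel A f \<subseteq> S \<times> S" "refl_on S (lim_rel A f)" "sym (lim_rel A f)"
    by (auto simp: refl_on_def sym_def lim_rel_def)
  show "trans (lim_rel A f)"
  proof (rule transI, clarify)
    fix m a n b l c
    assume "((m, a), (n, b)) \<in> lim_rel A f" "((n, b), (l, c)) \<in> lim_rel A f"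
    then obtain k k' where k: "a \<in> acarrier (A m)" "c \<in> acarrier (A l)" "m \<le> k" "n \<le> k" "T m k a = T n k b"
        "n \<le> k'" "l \<le> k'" "T n k' b = T l k' c"
      by (auto simp: lim_rel_iff)
    have "T m (max k k') a = T l (max k k') c"
      using k by (metis T_comp max.cobounded1 max.cobounded2)
    then show "((m, a), (l, c)) \<in> lim_rel A f"
      using k by (auto simp: lim_rel_iff intro!: exI[of _ "max k k'"])
  qed
qed

lemma \<iota>_eq_iff: "a \<in> acarrier (A m) \<Longrightarrow> b \<in> acarrier (A n) \<Longrightarrow>
    \<iota> m a = \<iota> n b \<longleftrightarrow> (\<exists>k. m \<le> k \<and> n \<le> k \<and> T m k a = T n k b)"
  unfolding to_star_lim_def by (subst eq_equiv_class_iff[OF equiv_lim]) (auto simp: lim_rel_iff)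

lemma \<iota>_T: "a \<in> acarrier (A m) \<Longrightarrow> m \<le> k \<Longrightarrow> \<iota> k (T m k a) = \<iota> m a"
  by (subst \<iota>_eq_iff) (auto simp: T_in)

lemma \<iota>_memD: "(m, b) \<in> \<iota> n a \<Longrightarrow> a \<in> acarrier (A n) \<and> b \<in> acarrier (A m) \<and> (\<exists>k. n \<le> k \<and> m \<le> k \<and> T n k a = T m k b)"
  by (simp add: to_star_lim_def lim_rel_iff)

lemma \<iota>_self: "a \<in> acarrier (A n) \<Longrightarrow> (n, a) \<in> \<iota> n a"
  by (auto simp: to_star_lim_def lim_rel_iff)

lemma lim_carrier: "acarrier DL = {\<iota> n a | n a. a \<in> acarrier (A n)}"
  by (auto simp: star_lim_def quotient_def to_star_lim_def)

lemma \<iota>_in [simp]: "a \<in> acarrier (A n) \<Longrightarrow> \<iota> n a \<in> acarrier DL"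
  by (auto simp: lim_carrier)

text \<open>
  Finitely many elements of a limit come from one level. All identities in the limit reduce to this.
\<close>

lemma lim_common2:
  assumes "x \<in> acarrier DL" "y \<in> acarrier DL"
  obtains n a b where "a \<in> acarrier (A n)" "b \<in> acarrier (A n)" "x = \<iota> n a" "y = \<iota> n b"
proof -
  obtain m a n b where "a \<in> acarrier (A m)" "x = \<iota> m a" "b \<in> acarrier (A n)" "y = \<iota> n b"
    using assms by (auto simp: lim_carrier)
  then show ?thesis
    by (intro that[of "T m (max m n) a" "max m n" "T n (max m n) b"]) (simp_all add: T_in \<iota>_T)
qed

lemma lim_common3:
  assumes "x \<in> acarrier DL" "y \<in> acarrier DL" "z \<in> acarrier DL"
  obtains n a b c where "a \<in> acarrier (A n)" "b \<in> acarrier (A n)" "c \<in> acarrier (A n)"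
    "x = \<iota> n a" "y = \<iota> n b" "z = \<iota> n c"
proof -
  obtain m a b where "a \<in> acarrier (A m)" "x = \<iota> m a" "b \<in> acarrier (A m)" "y = \<iota> m b"
    using lim_common2[OF assms(1,2)] by metis
  moreover obtain n c where "c \<in> acarrier (A n)" "z = \<iota> n c"
    using assms(3) by (auto simp: lim_carrier)
  ultimately show ?thesis
    by (intro that[of "T m (max m n) a" "max m n" "T m (max m n) b" "T n (max m n) c"]) (simp_all add: T_in \<iota>_T)
qed

lemma lim_zero: "\<zero>\<^bsub>DL\<^esub> = \<iota> n \<zero>\<^bsub>A n\<^esub>"
proof -
  interpret A0: star_algebra "A 0" by (rule alg)
  interpret An: star_algebra "A n" by (rule alg)
  have "T 0 n \<zero>\<^bsub>A 0\<^esub> = 0 \<cdot>\<^bsub>A n\<^esub> T 0 n \<zero>\<^bsub>A 0\<^esub>"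
    using T_scale[of "\<zero>\<^bsub>A 0\<^esub>" 0 n 0] by simp
  then have "T 0 n \<zero>\<^bsub>A 0\<^esub> = \<zero>\<^bsub>A n\<^esub>" by (simp add: T_in)
  then show ?thesis using \<iota>_T[of "\<zero>\<^bsub>A 0\<^esub>" 0 n] by (simp add: star_lim_def to_star_lim_def)
qed

text \<open>
  The binary operations of the limit are unions over all pairs of representatives; this evaluates them
  on representatives of one level, once for addition and multiplication.
\<close>

lemma lim_op2_aux:
  assumes ab: "a \<in> acarrier (A n)" "b \<in> acarrier (A n)"
    and op_in: "\<And>k x y. x \<in> acarrier (A k) \<Longrightarrow> y \<in> acarrier (A k) \<Longrightarrow> op k x y \<in> acarrier (A k)"
    and op_T: "\<And>m k x y. \<lbrakk>x \<in> acarrier (A m); y \<in> acarrier (A m); m \<le> k\<rbrakk> \<Longrightarrow>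
      T m k (op m x y) = op k (T m k x) (T m k y)"
  shows "(\<Union>(m, a)\<in>\<iota> n a. \<Union>(n, b)\<in>\<iota> n b. let k = max m n in lim_rel A f `` {(k, op k (T m k a) (T n k b))}) = \<iota> n (op n a b)"
proof (rule UN_const_eq[OF \<iota>_self[OF ab(1)]], clarify, rule UN_const_eq[OF \<iota>_self[OF ab(2)]], clarify)
  fix m a' m' b' assume "(m, a') \<in> \<iota> n a" "(m', b') \<in> \<iota> n b"
  then obtain k l where k: "a' \<in> acarrier (A m)" "n \<le> k" "m \<le> k" "T n k a = T m k a'"
     and l: "b' \<in> acarrier (A m')" "n \<le> l" "m' \<le> l" "T n l b = T m' l b'"
    by (auto dest!: \<iota>_memD)
  let ?M = "max m m'" and ?K = "max k l"
  have "T m ?K a' = T n ?K a" "T m' ?K b' = T n ?K b"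
    using k l by (metis T_comp max.cobounded1 max.cobounded2)+
  then have "T ?M ?K (op ?M (T m ?M a') (T m' ?M b')) = T n ?K (op n a b)"
  proof -
    have "T ?M ?K (op ?M (T m ?M a') (T m' ?M b')) = op ?K (T ?M ?K (T m ?M a')) (T ?M ?K (T m' ?M b'))"
      by (rule op_T) (use k l in \<open>auto simp: T_in\<close>)
    also have "\<dots> = op ?K (T m ?K a') (T m' ?K b')"
    proof -
      have "?M \<le> ?K" using k l by auto
      then show ?thesis using T_comp[of m ?M ?K a'] T_comp[of m' ?M ?K b'] by simp
    qed
    finally show ?thesis
      using k l ab \<open>T m ?K a' = T n ?K a\<close> \<open>T m' ?K b' = T n ?K b\<close> by (simp add: op_T)
  qed
  then have "\<iota> ?M (op ?M (T m ?M a') (T m' ?M b')) = \<iota> n (op n a b)"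
    using k l ab by (subst \<iota>_eq_iff) (auto simp: op_in T_in intro!: exI[of _ ?K])
  then show "(let k = max m m' in lim_rel A f `` {(k, op k (T m k a') (T m' k b'))}) = \<iota> n (op n a b)"
    by (simp add: Let_def to_star_lim_def)
qed

lemma lim_add: "a \<in> acarrier (A n) \<Longrightarrow> b \<in> acarrier (A n) \<Longrightarrow> \<iota> n a \<oplus>\<^bsub>DL\<^esub> \<iota> n b = \<iota> n (a \<oplus>\<^bsub>A n\<^esub> b)"
  unfolding star_lim_def star_alg.simps
  by (rule lim_op2_aux) (auto simp: star_algebra.add_in[OF alg] T_add)

lemma lim_mul: "a \<in> acarrier (A n) \<Longrightarrow> b \<in> acarrier (A n) \<Longrightarrow> \<iota> n a \<otimes>\<^bsub>DL\<^esub> \<iota> n b = \<iota> n (a \<otimes>\<^bsub>A n\<^esub> b)"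
  unfolding star_lim_def star_alg.simps
  by (rule lim_op2_aux) (auto simp: star_algebra.mul_in[OF alg] T_mul)

lemma lim_op1_aux:
  assumes a: "a \<in> acarrier (A n)"
    and op_in: "\<And>k x. x \<in> acarrier (A k) \<Longrightarrow> op k x \<in> acarrier (A k)"
    and op_T: "\<And>m k x. \<lbrakk>x \<in> acarrier (A m); m \<le> k\<rbrakk> \<Longrightarrow> T m k (op m x) = op k (T m k x)"
  shows "(\<Union>(n, a)\<in>\<iota> n a. lim_rel A f `` {(n, op n a)}) = \<iota> n (op n a)"
proof (rule UN_const_eq[OF \<iota>_self[OF a]], clarify)
  fix m a' assume "(m, a') \<in> \<iota> n a"
  then obtain k where k: "a' \<in> acarrier (A m)" "n \<le> k" "m \<le> k" "T n k a = T m k a'"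
    by (auto dest!: \<iota>_memD)
  then have "\<iota> m (op m a') = \<iota> n (op n a)"
    using a by (subst \<iota>_eq_iff) (auto simp: op_in op_T intro!: exI[of _ k])
  then show "lim_rel A f `` {(m, op m a')} = \<iota> n (op n a)" by (simp add: to_star_lim_def)
qed

lemma lim_scale: "a \<in> acarrier (A n) \<Longrightarrow> c \<cdot>\<^bsub>DL\<^esub> \<iota> n a = \<iota> n (c \<cdot>\<^bsub>A n\<^esub> a)"
  unfolding star_lim_def star_alg.simps
  by (rule lim_op1_aux) (auto simp: star_algebra.scale_in[OF alg] T_scale)

lemma lim_star: "a \<in> acarrier (A n) \<Longrightarrow> star\<^bsub>DL\<^esub> (\<iota> n a) = \<iota> n (star\<^bsub>A n\<^esub> a)"
  unfolding star_lim_def star_alg.simps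
  by (rule lim_op1_aux) (auto simp: star_algebra.star_in[OF alg] T_star)

lemmas lim_ops = lim_add lim_mul lim_scale lim_star

lemma lim_star_algebra: "star_algebra DL"
proof
  fix x assume "x \<in> acarrier DL"
  then obtain n a where a: "a \<in> acarrier (A n)" "x = \<iota> n a" by (auto simp: lim_carrier)
  interpret An: star_algebra "A n" by (rule alg)
  show "k \<cdot>\<^bsub>DL\<^esub> x \<in> acarrier DL" "star\<^bsub>DL\<^esub> x \<in> acarrier DL" "x \<oplus>\<^bsub>DL\<^esub> \<zero>\<^bsub>DL\<^esub> = x"
    "x \<oplus>\<^bsub>DL\<^esub> (- 1) \<cdot>\<^bsub>DL\<^esub> x = \<zero>\<^bsub>DL\<^esub>"
    "(k + l) \<cdot>\<^bsub>DL\<^esub> x = k \<cdot>\<^bsub>DL\<^esub> x \<oplus>\<^bsub>DL\<^esub> l \<cdot>\<^bsub>DL\<^esub> x" "k \<cdot>\<^bsub>DL\<^esub> l \<cdot>\<^bsub>DL\<^esub> x = (k * l) \<cdot>\<^bsub>DL\<^esub> x"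
    "1 \<cdot>\<^bsub>DL\<^esub> x = x" "star\<^bsub>DL\<^esub> (star\<^bsub>DL\<^esub> x) = x" "star\<^bsub>DL\<^esub> (k \<cdot>\<^bsub>DL\<^esub> x) = cnj k \<cdot>\<^bsub>DL\<^esub> star\<^bsub>DL\<^esub> x" for k l
    using a(1) by (simp_all add: a(2) lim_ops lim_zero[of n] An.add_neg An.add_scale An.star_scale)
next
  fix x y assume "x \<in> acarrier DL" "y \<in> acarrier DL"
  then obtain n a b where a: "a \<in> acarrier (A n)" "b \<in> acarrier (A n)" "x = \<iota> n a" "y = \<iota> n b"
    by (rule lim_common2)
  interpret An: star_algebra "A n" by (rule alg)
  show "x \<oplus>\<^bsub>DL\<^esub> y \<in> acarrier DL" "x \<otimes>\<^bsub>DL\<^esub> y \<in> acarrier DL" 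
    "k \<cdot>\<^bsub>DL\<^esub> (x \<oplus>\<^bsub>DL\<^esub> y) = k \<cdot>\<^bsub>DL\<^esub> x \<oplus>\<^bsub>DL\<^esub> k \<cdot>\<^bsub>DL\<^esub> y"
    "k \<cdot>\<^bsub>DL\<^esub> x \<otimes>\<^bsub>DL\<^esub> y = k \<cdot>\<^bsub>DL\<^esub> (x \<otimes>\<^bsub>DL\<^esub> y)" "x \<otimes>\<^bsub>DL\<^esub> k \<cdot>\<^bsub>DL\<^esub> y = k \<cdot>\<^bsub>DL\<^esub> (x \<otimes>\<^bsub>DL\<^esub> y)"
    "star\<^bsub>DL\<^esub> (x \<oplus>\<^bsub>DL\<^esub> y) = star\<^bsub>DL\<^esub> x \<oplus>\<^bsub>DL\<^esub> star\<^bsub>DL\<^esub> y" "star\<^bsub>DL\<^esub> (x \<otimes>\<^bsub>DL\<^esub> y) = star\<^bsub>DL\<^esub> y \<otimes>\<^bsub>DL\<^esub> star\<^bsub>DL\<^esub> x" for k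
    using a(1,2) by (simp_all add: a(3,4) lim_ops An.scale_add An.star_add An.star_mul)
  show "x \<oplus>\<^bsub>DL\<^esub> y = y \<oplus>\<^bsub>DL\<^esub> x"
    using a(1,2) An.add_comm[OF a(1,2)] by (simp add: a(3,4) lim_ops)
next
  fix x y z assume "x \<in> acarrier DL" "y \<in> acarrier DL" "z \<in> acarrier DL"
  then obtain n a b c where a: "a \<in> acarrier (A n)" "b \<in> acarrier (A n)" "c \<in> acarrier (A n)"
    "x = \<iota> n a" "y = \<iota> n b" "z = \<iota> n c" by (rule lim_common3)
  interpret An: star_algebra "A n" by (rule alg)
  show "x \<oplus>\<^bsub>DL\<^esub> y \<oplus>\<^bsub>DL\<^esub> z = x \<oplus>\<^bsub>DL\<^esub> (y \<oplus>\<^bsub>DL\<^esub> z)" "x \<otimes>\<^bsub>DL\<^esub> y \<otimes>\<^bsub>DL\<^esub> z = x \<otimes>\<^bsub>DL\<^esub> (y \<otimes>\<^bsub>DL\<^esub> z)"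
    "x \<otimes>\<^bsub>DL\<^esub> (y \<oplus>\<^bsub>DL\<^esub> z) = x \<otimes>\<^bsub>DL\<^esub> y \<oplus>\<^bsub>DL\<^esub> x \<otimes>\<^bsub>DL\<^esub> z" "(x \<oplus>\<^bsub>DL\<^esub> y) \<otimes>\<^bsub>DL\<^esub> z = x \<otimes>\<^bsub>DL\<^esub> z \<oplus>\<^bsub>DL\<^esub> y \<otimes>\<^bsub>DL\<^esub> z"
    using a(1,2,3) by (simp_all add: a(4-6) lim_ops An.add_assoc An.mul_assoc An.mul_add An.add_mul)
next
  show "\<zero>\<^bsub>DL\<^esub> \<in> acarrier DL"
    by (subst lim_zero[of 0]) (simp add: star_algebra.zero_in[OF alg])
qed

lemma \<iota>_hom: "restrict (\<iota> n) (acarrier (A n)) \<in> star_hom (A n) DL"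
proof -
  interpret An: star_algebra "A n" by (rule alg)
  show ?thesis by (rule star_homI[OF _ _ _ _ _ alg]) (auto simp: lim_ops)
qed

lemma lim_unital:
  assumes u: "\<And>n. u n \<in> acarrier (A n)" "\<And>n a. a \<in> acarrier (A n) \<Longrightarrow> u n \<otimes>\<^bsub>A n\<^esub> a = a"
    "\<And>n a. a \<in> acarrier (A n) \<Longrightarrow> a \<otimes>\<^bsub>A n\<^esub> u n = a" "\<And>n. f n (u n) = u (Suc n)"
    and x: "x \<in> acarrier DL"
  shows "\<iota> 0 (u 0) \<otimes>\<^bsub>DL\<^esub> x = x" "x \<otimes>\<^bsub>DL\<^esub> \<iota> 0 (u 0) = x"
proof -
  have "T 0 n (u 0) = u n" for n by (induction n) (simp_all add: u(4))
  then have eq: "\<iota> 0 (u 0) = \<iota> n (u n)" for n using \<iota>_T[OF u(1), of 0 n] by simp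
  obtain n a where a: "a \<in> acarrier (A n)" "x = \<iota> n a" using x by (auto simp: lim_carrier)
  show "\<iota> 0 (u 0) \<otimes>\<^bsub>DL\<^esub> x = x" "x \<otimes>\<^bsub>DL\<^esub> \<iota> 0 (u 0) = x"
    unfolding eq[of n] using a u by (simp_all add: lim_ops)
qed

end

lemma lim_functorial:
  assumes "star_system A f" "star_system B f'"
    and g: "\<And>n. g n \<in> star_hom (A n) (B n)"
    and comm: "\<And>n a. a \<in> acarrier (A n) \<Longrightarrow> g (Suc n) (f n a) = f' n (g n a)"
  shows "\<exists>h\<in>star_hom (star_lim A f) (star_lim B f').
    \<forall>n. \<forall>a\<in>acarrier (A n). h (to_star_lim A f n a) = to_star_lim B f' n (g n a)"
proof -
  interpret A: star_system A f by fact
  interpret B: star_system B f' by fact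
  note gD = star_homD[OF g]
  have gT: "g k (A.T m k a) = B.T m k (g m a)" if "a \<in> acarrier (A m)" "m \<le> k" for m k a
    using that(2)
  proof (induction k)
    case (Suc k)
    show ?case
    proof (cases "m \<le> k")
      case True
      then show ?thesis using Suc comm[OF A.T_in[OF that(1) True]] by simp
    qed (use Suc in \<open>simp add: le_Suc_eq\<close>)
  qed simp
  define h where "h x = (let (n, a) = (SOME (n, a). a \<in> acarrier (A n) \<and> x = A.\<iota> n a) in B.\<iota> n (g n a))" for x
  have h: "h (A.\<iota> n a) = B.\<iota> n (g n a)" if a: "a \<in> acarrier (A n)" for n a
  proof -
    obtain m b where mb: "(SOME (m, b). b \<in> acarrier (A m) \<and> A.\<iota> n a = A.\<iota> m b) = (m, b)" by fastforce
    have "case (SOME (m, b). b \<in> acarrier (A m) \<and> A.\<iota> n a = A.\<iota> m b) of (m, b) \<Rightarrow> b \<in> acarrier (A m) \<and> A.\<iota> n a = A.\<iota> m b"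
      by (rule someI[of _ "(n, a)"]) (use a in simp)
    then have b: "b \<in> acarrier (A m)" "A.\<iota> n a = A.\<iota> m b" unfolding mb by auto
    then obtain k where k: "n \<le> k" "m \<le> k" "A.T n k a = A.T m k b" using A.\<iota>_eq_iff[OF a b(1)] by blast
    then have "B.T n k (g n a) = B.T m k (g m b)" using gT a b(1) by metis
    then have "B.\<iota> n (g n a) = B.\<iota> m (g m b)" using k a b(1) by (subst B.\<iota>_eq_iff) (auto simp: gD)
    then show ?thesis unfolding h_def mb by simp
  qed
  have "restrict h (acarrier A.DL) \<in> star_hom A.DL B.DL"
  proof (rule star_homI[OF _ _ _ _ _ A.lim_star_algebra])
    fix x y assume "x \<in> acarrier A.DL" "y \<in> acarrier A.DL"
    then obtain n a b where a: "a \<in> acarrier (A n)" "b \<in> acarrier (A n)" "x = A.\<iota> n a" "y = A.\<iota> n b"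
      by (rule A.lim_common2)
    interpret An: star_algebra "A n" by (rule A.alg)
    show "h (x \<oplus>\<^bsub>A.DL\<^esub> y) = h x \<oplus>\<^bsub>B.DL\<^esub> h y" "h (x \<otimes>\<^bsub>A.DL\<^esub> y) = h x \<otimes>\<^bsub>B.DL\<^esub> h y"
      "h (k \<cdot>\<^bsub>A.DL\<^esub> x) = k \<cdot>\<^bsub>B.DL\<^esub> h x" "h (star\<^bsub>A.DL\<^esub> x) = star\<^bsub>B.DL\<^esub> (h x)" "h x \<in> acarrier B.DL" for k
      using a(1,2) by (simp_all add: a(3,4) A.lim_ops B.lim_ops h gD)
  qed
  then show ?thesis using h by (intro bexI) auto
qed


subsection \<open>Limits of normed systems\<close>

locale cstar_system = star_system A f for A :: "nat \<Rightarrow> 'a cstar_alg" and f +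
  assumes sn: "cstar_seminorm (A n) (cnorm (A n))"
    and contr: "a \<in> acarrier (A n) \<Longrightarrow> cnorm (A (Suc n)) (f n a) \<le> cnorm (A n) a"
begin

abbreviation "LN \<equiv> lim_norm A f"

lemma seminormed: "cstar_seminormed (A n) (cnorm (A n))"
  unfolding cstar_seminormed_def cstar_seminormed_axioms_def using alg sn by blast

lemma norm_T_decreasing:
  assumes "a \<in> acarrier (A n)" "n \<le> k" "k \<le> l"
  shows "cnorm (A l) (T n l a) \<le> cnorm (A k) (T n k a)"
  using assms(3)
proof (induction l rule: dec_induct)
  case (step l)
  then have "cnorm (A (Suc l)) (T n (Suc l) a) \<le> cnorm (A l) (T n l a)"
    using assms contr[OF T_in[OF assms(1), of l]] by simp
  with step show ?case by simp
qed simp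

text \<open>
  The norms decrease along the system, so they converge, and two representatives of a class have
  eventually equal images.
\<close>

lemma lim_norm_tendsto:
  assumes a: "a \<in> acarrier (A n)"
  shows "(\<lambda>k. cnorm (A k) (T n k a)) \<longlonglongrightarrow> LN (\<iota> n a)"
proof -
  have "convergent (\<lambda>k. cnorm (A (k + n)) (T n (k + n) a))"
  proof (rule Bseq_monoseq_convergent)
    show "monoseq (\<lambda>k. cnorm (A (k + n)) (T n (k + n) a))"
      by (rule decseq_imp_monoseq) (auto simp: decseq_def intro!: norm_T_decreasing a)
    have "\<bar>cnorm (A (k + n)) (T n (k + n) a)\<bar> \<le> cnorm (A n) a" for k
    proof -
    have "0 \<le> cnorm (A (k + n)) (T n (k + n) a)"
      by (rule cstar_seminormed.p_nonneg[OF seminormed]) (simp add: T_in a)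
    moreover have "cnorm (A (k + n)) (T n (k + n) a) \<le> cnorm (A n) a"
      using norm_T_decreasing[OF a, of n "k + n"] by simp
    ultimately show ?thesis by simp
    qed
    then show "Bseq (\<lambda>k. cnorm (A (k + n)) (T n (k + n) a))" by (intro BseqI'[of _ "cnorm (A n) a"]) simp
  qed
  then obtain r where "(\<lambda>k. cnorm (A (k + n)) (T n (k + n) a)) \<longlonglongrightarrow> r" by (auto simp: convergent_def)
  then have r: "(\<lambda>k. cnorm (A k) (T n k a)) \<longlonglongrightarrow> r" by (rule LIMSEQ_offset)
  have all: "(\<lambda>k. cnorm (A k) (T m k b)) \<longlonglongrightarrow> r" if mb: "(m, b) \<in> \<iota> n a" for m b
  proof -
    obtain k where k: "n \<le> k" "m \<le> k" "T n k a = T m k b" using \<iota>_memD[OF mb] by blast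
    have "\<forall>\<^sub>F l in sequentially. cnorm (A l) (T n l a) = cnorm (A l) (T m l b)"
      using eventually_ge_at_top[of k] by eventually_elim (metis T_comp k)
    then show ?thesis by (rule Lim_transform_eventually[OF r])
  qed
  have "(THE r. \<forall>(m, b)\<in>\<iota> n a. (\<lambda>k. cnorm (A k) (T m k b)) \<longlonglongrightarrow> r) = r"
  proof (rule the_equality)
    show "\<forall>(m, b)\<in>\<iota> n a. (\<lambda>k. cnorm (A k) (T m k b)) \<longlonglongrightarrow> r" using all by auto
    show "r' = r" if "\<forall>(m, b)\<in>\<iota> n a. (\<lambda>k. cnorm (A k) (T m k b)) \<longlonglongrightarrow> r'" for r'
      using bspec[OF that \<iota>_self[OF a]] LIMSEQ_unique[OF _ r] by simp
  qed
  then show ?thesis using r by (simp add: lim_norm_def)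
qed

lemma lim_norm_le: "a \<in> acarrier (A n) \<Longrightarrow> LN (\<iota> n a) \<le> cnorm (A n) a"
  using norm_T_decreasing[of a n n]
  by (intro LIMSEQ_le_const2[OF lim_norm_tendsto]) (auto intro!: exI[of _ n])

lemma lim_norm_seminorm: "cstar_seminorm DL LN"
  unfolding cstar_seminorm_def
proof (intro conjI ballI allI)
  fix x assume "x \<in> acarrier DL"
  then obtain n a where a: "a \<in> acarrier (A n)" "x = \<iota> n a" by (auto simp: lim_carrier)
  interpret An: star_algebra "A n" by (rule alg)
  note lim = lim_norm_tendsto[OF a(1)]
  show "0 \<le> LN x" unfolding a(2)
    by (rule LIMSEQ_le_const[OF lim])
       (auto intro!: exI[of _ n] cstar_seminormed.p_nonneg[OF seminormed] T_in a)
  have "(\<lambda>k. cnorm (A k) (T n k (star\<^bsub>A n\<^esub> a \<otimes>\<^bsub>A n\<^esub> a))) \<longlonglongrightarrow> (LN x)\<^sup>2"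
  proof (rule Lim_transform_eventually[OF tendsto_power[OF lim, of 2, folded a(2)]])
    show "\<forall>\<^sub>F k in sequentially. (cnorm (A k) (T n k a))\<^sup>2 = cnorm (A k) (T n k (star\<^bsub>A n\<^esub> a \<otimes>\<^bsub>A n\<^esub> a))"
      using eventually_ge_at_top[of n]
      by eventually_elim (simp add: T_mul T_star a T_in cstar_seminormed.p_cstar[OF seminormed])
  qed
  then show "LN (star\<^bsub>DL\<^esub> x \<otimes>\<^bsub>DL\<^esub> x) = (LN x)\<^sup>2"
    using lim_norm_tendsto[of "star\<^bsub>A n\<^esub> a \<otimes>\<^bsub>A n\<^esub> a" n] a(1) unfolding a(2)
    by (simp add: lim_ops LIMSEQ_unique)
  fix c
  have "(\<lambda>k. cnorm (A k) (T n k (c \<cdot>\<^bsub>A n\<^esub> a))) \<longlonglongrightarrow> cmod c * LN x"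
  proof (rule Lim_transform_eventually[OF tendsto_mult[OF tendsto_const lim, folded a(2)]])
    show "\<forall>\<^sub>F k in sequentially. cmod c * cnorm (A k) (T n k a) = cnorm (A k) (T n k (c \<cdot>\<^bsub>A n\<^esub> a))"
      using eventually_ge_at_top[of n]
      by eventually_elim (simp add: T_scale a T_in cstar_seminormed.p_scale[OF seminormed])
  qed
  then show "LN (c \<cdot>\<^bsub>DL\<^esub> x) = cmod c * LN x"
    using lim_norm_tendsto[of "c \<cdot>\<^bsub>A n\<^esub> a" n] a(1) unfolding a(2)
    by (simp add: lim_ops LIMSEQ_unique)
next
  fix x y assume "x \<in> acarrier DL" "y \<in> acarrier DL"
  then obtain n a b where a: "a \<in> acarrier (A n)" "b \<in> acarrier (A n)" "x = \<iota> n a" "y = \<iota> n b"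
    by (rule lim_common2)
  interpret An: star_algebra "A n" by (rule alg)
  note lims = lim_norm_tendsto[OF a(1)] lim_norm_tendsto[OF a(2)]
  have "LN (\<iota> n (a \<oplus>\<^bsub>A n\<^esub> b)) \<le> LN (\<iota> n a) + LN (\<iota> n b)"
    by (rule LIMSEQ_le[OF lim_norm_tendsto tendsto_add[OF lims]])
       (use a in \<open>auto intro!: exI[of _ n] cstar_seminormed.p_add[OF seminormed] simp: T_add T_in\<close>)
  then show "LN (x \<oplus>\<^bsub>DL\<^esub> y) \<le> LN x + LN y" using a by (simp add: lim_ops)
  have "LN (\<iota> n (a \<otimes>\<^bsub>A n\<^esub> b)) \<le> LN (\<iota> n a) * LN (\<iota> n b)"
    by (rule LIMSEQ_le[OF lim_norm_tendsto tendsto_mult[OF lims]])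
       (use a in \<open>auto intro!: exI[of _ n] cstar_seminormed.p_mul[OF seminormed] simp: T_mul T_in\<close>)
  then show "LN (x \<otimes>\<^bsub>DL\<^esub> y) \<le> LN x * LN y" using a by (simp add: lim_ops)
qed

lemma lim_seminormed: "cstar_seminormed DL LN"
  unfolding cstar_seminormed_def cstar_seminormed_axioms_def using lim_star_algebra lim_norm_seminorm by blast

end


section \<open>The diagram\<close>

locale diagram =
  fixes X :: "'a::metric_space set" and \<sigma> :: "'a \<Rightarrow> 'a" and P :: "nat \<Rightarrow> 'a set set"
  assumes ref: "sigma_refined X \<sigma> P" and surj: "\<sigma> ` X = X"
begin

abbreviation "G \<equiv> F_graph \<sigma> P"
abbreviation "L \<equiv> L_alg \<sigma> P"
abbreviation "Xs \<equiv> X_set \<sigma> P"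
abbreviation "vt \<equiv> vtx \<sigma> P"
abbreviation "ed \<equiv> edg \<sigma> P"

lemma sep: "separated_graph (G n)"
  by (rule F_graph_separated[OF ref surj])

lemma graph_sel [simp]: "gverts (G n) = F0 P n \<union> F0 P (Suc n)" "gedges (G n) = F1 \<sigma> P n"
  "grange (G n) = erange" "gsource (G n) = esource"
  "v \<in> F0 P n \<Longrightarrow> gsep (G n) v = D_sep \<sigma> P v"
  by (auto simp: F_graph_def)

lemma gsep_iff: "Y \<in> gsep (G n) v \<longleftrightarrow> v \<in> F0 P n \<and> Y \<in> D_sep \<sigma> P v"
  by (simp add: F_graph_def)

lemma finite_F0 [simp]: "finite (F0 P n)"
  using part_props(3)[OF ref] by (simp add: F0_def)

lemma F0_disjoint: "v \<in> F0 P n \<Longrightarrow> v \<notin> F0 P (Suc n)"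
  by (auto simp: F0_def)

lemma F0_disjoint': "v \<in> F0 P (Suc n) \<Longrightarrow> v \<notin> F0 P n"
  by (auto simp: F0_def)

lemma edge_ends: "e \<in> F1 \<sigma> P n \<Longrightarrow> erange e \<in> F0 P n" "e \<in> F1 \<sigma> P n \<Longrightarrow> esource e \<in> F0 P (Suc n)"
  by (auto simp: F1_def F0_def erange_def esource_def)

lemma finite_F1 [simp]: "finite (F1 \<sigma> P n)"
proof -
  have "F1 \<sigma> P n \<subseteq> (\<lambda>(c, Z, Z'). Edge c n Z Z') ` ({Blue, Red} \<times> P n \<times> P (n + 1))"
    by (auto simp: F1_def image_iff)
  then show ?thesis using part_props(3)[OF ref] by (meson finite.intros finite_SigmaI finite_imageI finite_subset)
qed

lemma D_sep_edges: "v \<in> F0 P n \<Longrightarrow> Y \<in> D_sep \<sigma> P v \<Longrightarrow> e \<in> Y \<Longrightarrow> e \<in> F1 \<sigma> P n \<and> erange e = v"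
  using sep_edges[OF sep, of v n Y e] by simp

lemma D_sep_finite: "v \<in> F0 P n \<Longrightarrow> Y \<in> D_sep \<sigma> P v \<Longrightarrow> finite Y"
  using D_sep_edges[of v n Y] finite_subset[OF _ finite_F1[of n]] by blast

lemma D_sep_cover: assumes "e \<in> F1 \<sigma> P n" obtains Y where "Y \<in> D_sep \<sigma> P (erange e)" "e \<in> Y"
proof -
  have "partition_on {e' \<in> F1 \<sigma> P n. erange e' = erange e} (D_sep \<sigma> P (erange e))"
  proof -
    have "\<forall>v\<in>gverts (G n). partition_on {e \<in> gedges (G n). grange (G n) e = v} (gsep (G n) v)"
      using sep[of n] unfolding separated_graph_def by blast
    from bspec[OF this, of "erange e"] edge_ends(1)[OF assms] show ?thesis by simp
  qed
  then show ?thesis using that assms by (auto simp: partition_on_def)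
qed


definition two_below :: "'a vertex \<Rightarrow> 'a vertex set" where
  "two_below v = {u \<in> F0 P (fst v + 2). snd u \<subseteq> snd v}"

lemma blue_iff: "e \<in> coloured_edges \<sigma> P Blue (n, Z) \<longleftrightarrow>
    (\<exists>Z'. e = Edge Blue n Z Z' \<and> Z \<in> P n \<and> Z' \<in> P (Suc n) \<and> Z' \<subseteq> Z)"
  by (cases e) (auto simp: coloured_edges_def F1_def erange_def)

lemma red_iff: "e \<in> coloured_edges \<sigma> P Red (n, Z) \<longleftrightarrow>
    (\<exists>Z'. e = Edge Red n Z Z' \<and> Z \<in> P n \<and> Z' \<in> P (Suc n) \<and> (if even n then Z' \<subseteq> \<sigma> ` Z else \<sigma> ` Z' \<subseteq> Z))"
  by (cases e) (auto simp: coloured_edges_def F1_def erange_def)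

text \<open>
  Each \<open>X(e)\<close> is a member of the partition of the edges that end in \<open>s(e)\<close>. This is what makes the relations
  of \<open>L\<^sub>n\<^sub>+\<^sub>1\<close> applicable to the images of edges.
\<close>

lemma X_set_D_sep: assumes "e \<in> F1 \<sigma> P n" shows "Xs e \<in> D_sep \<sigma> P (esource e)"
proof -
  have n: "elevel e = n" "fst (esource e) = Suc n" using assms by (auto simp: F1_def esource_def)
  show ?thesis
  proof (cases "ecol e")
    case Blue
    then show ?thesis by (auto simp: X_set_def D_sep_def)
  next
    case Red
    then show ?thesis using n assms by (auto simp: X_set_def D_sep_def)
  qed
qed

lemma X_set_edges: "e \<in> F1 \<sigma> P n \<Longrightarrow> g \<in> Xs e \<Longrightarrow> g \<in> F1 \<sigma> P (Suc n) \<and> erange g = esource e"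
  using D_sep_edges[OF edge_ends(2) X_set_D_sep] by blast

lemma X_set_finite: "e \<in> F1 \<sigma> P n \<Longrightarrow> finite (Xs e)"
  using D_sep_finite[OF edge_ends(2) X_set_D_sep] .

lemma part_meet: "Z \<in> P n \<Longrightarrow> \<exists>x. x \<in> Z \<and> x \<in> X \<and> \<sigma> x \<in> X"
  using part_props(1,2)[OF ref] surj by blast

lemma part_ex: "x \<in> X \<Longrightarrow> \<exists>Z\<in>P n. x \<in> Z"
  using part_props(1)[OF ref] by blast

text \<open>
  \<open>T\<close> parametrises the two-step paths by their middle and lower sets, and the second component is a
  bijection from \<open>T\<close> to the sets of \<open>P (n + 2)\<close> in \<open>Z\<close>.
\<close>

lemma two_step_bijI:
  assumes "(SIGMA e:Y. Xs e) = (\<lambda>(Z', Z''). (Edge c n Z Z', Edge c (Suc n) Z' Z'')) ` T"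
    and "\<And>Z' Z''. (Z', Z'') \<in> T \<Longrightarrow> Z'' \<in> P (n + 2) \<and> Z'' \<subseteq> Z"
    and "\<And>Z''. Z'' \<in> P (n + 2) \<Longrightarrow> Z'' \<subseteq> Z \<Longrightarrow> \<exists>Z'. (Z', Z'') \<in> T"
    and "\<And>Z1 Z2 Z''. (Z1, Z'') \<in> T \<Longrightarrow> (Z2, Z'') \<in> T \<Longrightarrow> Z1 = Z2"
  shows "bij_betw (\<lambda>(e, g). esource g) (SIGMA e:Y. Xs e) (two_below (n, Z))"
proof -
  let ?k = "\<lambda>(Z', Z''). (Edge c n Z Z', Edge c (Suc n) Z' Z'')"
  have comp: "(\<lambda>(e, g). esource g) \<circ> ?k = (\<lambda>(Z', Z''). (n + 2, Z''))"
    by (auto simp: fun_eq_iff esource_def)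
  have "inj_on ((\<lambda>(e, g). esource g) \<circ> ?k) T"
    unfolding comp using assms(4) by (auto simp: inj_on_def)
  moreover have "((\<lambda>(e, g). esource g) \<circ> ?k) ` T = two_below (n, Z)"
    unfolding comp
  proof (intro set_eqI iffI)
    fix u assume "u \<in> (\<lambda>(Z', Z''). (n + 2, Z'')) ` T"
    then obtain Z' Z'' where "(Z', Z'') \<in> T" "u = (n + 2, Z'')" by auto
    with assms(2)[of Z' Z''] show "u \<in> two_below (n, Z)" by (simp add: two_below_def F0_def)
  next
    fix u assume "u \<in> two_below (n, Z)"
    then obtain Z'' where Z'': "u = (n + 2, Z'')" "Z'' \<in> P (n + 2)" "Z'' \<subseteq> Z"
      by (auto simp: two_below_def F0_def)
    from assms(3)[OF Z''(2,3)] obtain Z' where "(Z', Z'') \<in> T" by blast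
    then show "u \<in> (\<lambda>(Z', Z''). (n + 2, Z'')) ` T" using Z''(1) by (intro image_eqI[of _ _ "(Z', Z'')"]) auto
  qed
  ultimately show ?thesis
    unfolding assms(1) bij_betw_def by (auto simp: image_comp intro: inj_on_imageI)
qed

text \<open>
  The combinatorial fact behind the maps \<open>\<phi>\<^sub>n\<close>: a vertex two levels below \<open>v\<close> is reached from \<open>v\<close> by exactly one
  path \<open>e\<close>, \<open>g\<close> with \<open>e\<close> in a given member of the partition of the edges at \<open>v\<close> and \<open>g\<close> in \<open>X(e)\<close>.
  For blue edges this is refinement of the partitions. A red path goes through an image or a preimage,
  and its middle set is found by mapping, or lifting, one point of \<open>Z''\<close>; the choice of the partitions
  makes it independent of the point. For odd \<open>n\<close> the lift is unique because \<open>\<sigma>\<close> is injective on \<open>Y0\<close>.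
\<close>

lemma two_step_bij:
  assumes v: "v \<in> F0 P n" and Y: "Y \<in> D_sep \<sigma> P v"
  shows "bij_betw (\<lambda>(e, g). esource g) (SIGMA e:Y. Xs e) (two_below v)"
proof -
  obtain Z where Z: "v = (n, Z)" "Z \<in> P n" using v by (auto simp: F0_def)
  note uniq = part_props(4)[OF ref]
  consider (blue) "Y = coloured_edges \<sigma> P Blue v"
    | (even) "even n" "Y = coloured_edges \<sigma> P Red v"
    | (odd) f where "odd n" "Y = red_fork \<sigma> P f" "f \<in> F1 \<sigma> P (n - 1)" "ecol f = Red" "esource f = v"
    using Y Z by (auto simp: D_sep_def split: if_splits)
  then show ?thesis
  proof cases
    case blue
    show ?thesis
      unfolding Z(1)
    proof (rule two_step_bijI[where T = "{(Z', Z''). Z' \<in> P (Suc n) \<and> Z' \<subseteq> Z \<and> Z'' \<in> P (n + 2) \<and> Z'' \<subseteq> Z'}"])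
      show "(SIGMA e:Y. Xs e) = (\<lambda>(Z', Z''). (Edge Blue n Z Z', Edge Blue (Suc n) Z' Z'')) `
        {(Z', Z''). Z' \<in> P (Suc n) \<and> Z' \<subseteq> Z \<and> Z'' \<in> P (n + 2) \<and> Z'' \<subseteq> Z'}"
        using Z by (auto simp: blue Z(1) blue_iff X_set_def esource_def image_iff)
    next
      fix Z'' assume h: "Z'' \<in> P (n + 2)" "Z'' \<subseteq> Z"
      obtain Z' where Z': "Z' \<in> P (Suc n)" "Z'' \<subseteq> Z'" using refine_step[OF ref h(1), of "Suc n"] by auto
      obtain x where x: "x \<in> Z''" using part_meet[OF h(1)] by blast
      have "Z' \<subseteq> Z" using part_sub[OF ref Z'(1) _ Z(2), of x] x Z' h by auto
      then show "\<exists>Z'. (Z', Z'') \<in> {(Z', Z''). Z' \<in> P (Suc n) \<and> Z' \<subseteq> Z \<and> Z'' \<in> P (n + 2) \<and> Z'' \<subseteq> Z'}"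
        using Z' h by blast
    next
      fix Z1 Z2 Z''
      assume "(Z1, Z'') \<in> {(Z', Z''). Z' \<in> P (Suc n) \<and> Z' \<subseteq> Z \<and> Z'' \<in> P (n + 2) \<and> Z'' \<subseteq> Z'}"
        "(Z2, Z'') \<in> {(Z', Z''). Z' \<in> P (Suc n) \<and> Z' \<subseteq> Z \<and> Z'' \<in> P (n + 2) \<and> Z'' \<subseteq> Z'}"
      then have h: "Z1 \<in> P (Suc n)" "Z2 \<in> P (Suc n)" "Z'' \<in> P (n + 2)" "Z'' \<subseteq> Z1" "Z'' \<subseteq> Z2" by auto
      obtain x where "x \<in> Z''" using part_meet[OF h(3)] by blast
      then show "Z1 = Z2" using uniq[OF h(1,2)] h(4,5) by blast
    qed auto
  next
    case even
    then obtain j where j: "n = 2 * j" by auto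
    define T where "T = {(Z', Z''). Z' \<in> P (Suc n) \<and> Z' \<subseteq> \<sigma> ` Z \<and> Z'' \<in> P (n + 2) \<and> \<sigma> ` Z'' \<subseteq> Z' \<and> Z'' \<subseteq> Z}"
    show ?thesis
      unfolding Z(1)
    proof (rule two_step_bijI[where T = T])
      show "(SIGMA e:Y. Xs e) = (\<lambda>(Z', Z''). (Edge Red n Z Z', Edge Red (Suc n) Z' Z'')) ` T"
        using Z even(1) by (auto simp: even(2) Z(1) red_iff X_set_def esource_def image_iff red_fork_def T_def)
    next
      fix Z'' assume h: "Z'' \<in> P (n + 2)" "Z'' \<subseteq> Z"
      obtain x where x: "x \<in> Z''" "\<sigma> x \<in> X" using part_meet[OF h(1)] by blast
      obtain Z' where Z': "Z' \<in> P (Suc n)" "\<sigma> x \<in> Z'" using part_ex[OF x(2)] by blast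
      have "Z' \<subseteq> \<sigma> ` Z" using image_sub[OF ref, of Z j Z' "\<sigma> x"] Z(2) Z' j h x by auto
      moreover have "\<sigma> ` Z'' \<subseteq> Z'" using image_into[OF ref, of Z' j Z'' x] Z' h j x by auto
      ultimately show "\<exists>Z'. (Z', Z'') \<in> T" using Z' h unfolding T_def by blast
    next
      fix Z1 Z2 Z'' assume "(Z1, Z'') \<in> T" "(Z2, Z'') \<in> T"
      then have h: "Z1 \<in> P (Suc n)" "Z2 \<in> P (Suc n)" "Z'' \<in> P (n + 2)" "\<sigma> ` Z'' \<subseteq> Z1" "\<sigma> ` Z'' \<subseteq> Z2"
        by (auto simp: T_def)
      obtain x where "x \<in> Z''" using part_meet[OF h(3)] by blast
      then show "Z1 = Z2" using uniq[OF h(1,2), of "\<sigma> x"] h(4,5) by blast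
    qed (auto simp: T_def)
  next
    case odd
    then obtain j where j: "n = 2 * j + 1" using oddE by blast
    obtain Y0 where Y0: "f = Edge Red (2 * j) Y0 Z" "Y0 \<in> P (2 * j)" "Z \<subseteq> \<sigma> ` Y0"
      using odd(3-5) Z j by (auto simp: F1_def esource_def)
    define T where "T = {(Z', Z''). Z' \<in> P (Suc n) \<and> \<sigma> ` Z' \<subseteq> Z \<and> Z' \<subseteq> Y0 \<and> Z'' \<in> P (n + 2) \<and> Z'' \<subseteq> \<sigma> ` Z'}"
    show ?thesis
      unfolding Z(1)
    proof (rule two_step_bijI[where T = T])
      show "(SIGMA e:Y. Xs e) = (\<lambda>(Z', Z''). (Edge Red n Z Z', Edge Red (Suc n) Z' Z'')) ` T"
        using Z odd(1) j by (auto simp: odd(2) Y0(1) red_iff X_set_def esource_def image_iff red_fork_def T_def)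
    next
      fix Z'' assume h: "Z'' \<in> P (n + 2)" "Z'' \<subseteq> Z"
      obtain y where y: "y \<in> Z''" using part_meet[OF h(1)] by blast
      then obtain x where x: "x \<in> Y0" "y = \<sigma> x" using h(2) Y0(3) by blast
      then have "x \<in> X" using part_props(1)[OF ref] Y0(2) by blast
      then obtain Z' where Z': "Z' \<in> P (Suc n)" "x \<in> Z'" using part_ex by blast
      have "Z' \<subseteq> Y0" using part_sub[OF ref Z'(1) _ Y0(2) Z'(2) x(1)] j by simp
      moreover have "\<sigma> ` Z' \<subseteq> Z" using image_into[OF ref, of Z j Z' x] Z Z' j x y h by auto
      moreover have "Z'' \<subseteq> \<sigma> ` Z'" using image_sub[OF ref, of Z' "Suc j" Z'' y] Z' j x y h by auto
      ultimately show "\<exists>Z'. (Z', Z'') \<in> T" using Z' h unfolding T_def by blast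
    next
      fix Z1 Z2 Z'' assume "(Z1, Z'') \<in> T" "(Z2, Z'') \<in> T"
      then have h: "Z1 \<in> P (Suc n)" "Z2 \<in> P (Suc n)" "Z'' \<in> P (n + 2)"
        "Z'' \<subseteq> \<sigma> ` Z1" "Z'' \<subseteq> \<sigma> ` Z2" "Z1 \<subseteq> Y0" "Z2 \<subseteq> Y0" by (auto simp: T_def)
      obtain y where y: "y \<in> Z''" using part_meet[OF h(3)] by blast
      obtain x1 x2 where x: "x1 \<in> Z1" "x2 \<in> Z2" "\<sigma> x1 = y" "\<sigma> x2 = y"
        using subsetD[OF h(4) y] subsetD[OF h(5) y] by auto
      then have "x1 = x2" using inj_on_part[OF ref Y0(2)] h(6,7) by (metis inj_onD subsetD)
      then show "Z1 = Z2" using uniq[OF h(1,2)] x by blast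
    next
      fix Z' Z'' assume "(Z', Z'') \<in> T"
      then show "Z'' \<in> P (n + 2) \<and> Z'' \<subseteq> Z" unfolding T_def by blast
    qed
  qed
qed

lemma two_step_source: "v \<in> F0 P n \<Longrightarrow> Y \<in> D_sep \<sigma> P v \<Longrightarrow> e \<in> Y \<Longrightarrow> g \<in> Xs e \<Longrightarrow> esource g \<in> two_below v"
  using bij_betwE[OF two_step_bij[of v n Y]] by fastforce

lemma two_step_inj: "\<lbrakk>v \<in> F0 P n; Y \<in> D_sep \<sigma> P v; e \<in> Y; g \<in> Xs e; e' \<in> Y; g' \<in> Xs e'; esource g = esource g'\<rbrakk>
    \<Longrightarrow> e = e' \<and> g = g'"
  using inj_onD[OF bij_betw_imp_inj_on[OF two_step_bij[of v n Y]], of "(e, g)" "(e', g')"] by simp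

lemma two_below_subset: "v \<in> F0 P n \<Longrightarrow> two_below v \<subseteq> F0 P (Suc (Suc n))"
  by (auto simp: two_below_def F0_def)

lemma two_below_disjoint: "v \<in> F0 P n \<Longrightarrow> w \<in> F0 P n \<Longrightarrow> u \<in> two_below v \<Longrightarrow> u \<in> two_below w \<Longrightarrow> v = w"
proof -
  assume vw: "v \<in> F0 P n" "w \<in> F0 P n" and u: "u \<in> two_below v" "u \<in> two_below w"
  then have "snd u \<in> P (n + 2)" "snd u \<subseteq> snd v" "snd u \<subseteq> snd w"
    by (auto simp: two_below_def F0_def)
  moreover obtain x where "x \<in> snd u" using part_meet[OF calculation(1)] by blast
  ultimately have "snd v = snd w"
    using part_props(4)[OF ref, of "snd v" n "snd w" x] vw by (simp add: F0_def mem_Times_iff subset_iff)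
  then show "v = w" using vw by (simp add: F0_def mem_Times_iff prod_eq_iff)
qed

lemma two_below_cover: "u \<in> F0 P (Suc (Suc n)) \<Longrightarrow> \<exists>v\<in>F0 P n. u \<in> two_below v"
proof -
  assume u: "u \<in> F0 P (Suc (Suc n))"
  then obtain W where "W \<in> P n" "snd u \<subseteq> W"
    using refine_step[OF ref, of "snd u" "Suc (Suc n)" n] by (auto simp: F0_def)
  then show ?thesis using u by (intro bexI[of _ "(n, W)"]) (auto simp: two_below_def F0_def)
qed


subsection \<open>The algebras \<open>L\<^sub>n\<close>\<close>

lemma L_alg: "star_algebra (L n)"
  by (rule leavitt_star_algebra)

lemma fam: "leavitt_family (G n) (L n) (vt n) (ed n)"
  by (rule leavitt_generators[OF sep])

lemmas famD = leavitt_familyD[OF fam, simplified]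

definition vsum :: "nat \<Rightarrow> 'a vertex set \<Rightarrow> 'a lelem" where
  "vsum n U = asum (L n) (vt n) U"

lemma vt_in: "v \<in> F0 P n \<union> F0 P (Suc n) \<Longrightarrow> vt n v \<in> acarrier (L n)"
  using famD(1) by blast

lemma vt_Pi: "U \<subseteq> F0 P n \<union> F0 P (Suc n) \<Longrightarrow> vt n \<in> U \<rightarrow> acarrier (L n)"
  using vt_in by blast

lemma finite_verts: "U \<subseteq> F0 P n \<union> F0 P (Suc n) \<Longrightarrow> finite U"
  by (meson finite_F0 finite_UnI finite_subset)

lemma vsum_in: "U \<subseteq> F0 P n \<union> F0 P (Suc n) \<Longrightarrow> vsum n U \<in> acarrier (L n)"
  unfolding vsum_def by (rule star_algebra.asum_in[OF L_alg vt_Pi])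

lemma vt_mul: "v \<in> F0 P n \<union> F0 P (Suc n) \<Longrightarrow> w \<in> F0 P n \<union> F0 P (Suc n) \<Longrightarrow>
    vt n v \<otimes>\<^bsub>L n\<^esub> vt n w = (if v = w then vt n v else \<zero>\<^bsub>L n\<^esub>)"
  using famD(3)[of v n w] by auto

lemma vsum_single: "v \<in> F0 P n \<union> F0 P (Suc n) \<Longrightarrow> vsum n {v} = vt n v"
proof -
  assume v: "v \<in> F0 P n \<union> F0 P (Suc n)"
  interpret star_algebra "L n" by (rule L_alg)
  show ?thesis unfolding vsum_def by (rule asum_single) (use vt_in[OF v] in auto)
qed

lemma vt_vsum: assumes "v \<in> F0 P n \<union> F0 P (Suc n)" "U \<subseteq> F0 P n \<union> F0 P (Suc n)"
  shows "vt n v \<otimes>\<^bsub>L n\<^esub> vsum n U = (if v \<in> U then vt n v else \<zero>\<^bsub>L n\<^esub>)"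
    "vsum n U \<otimes>\<^bsub>L n\<^esub> vt n v = (if v \<in> U then vt n v else \<zero>\<^bsub>L n\<^esub>)"
proof -
  interpret star_algebra "L n" by (rule L_alg)
  have m: "vt n v \<otimes>\<^bsub>L n\<^esub> vt n u = (if u = v then vt n v else \<zero>\<^bsub>L n\<^esub>)"
     "vt n u \<otimes>\<^bsub>L n\<^esub> vt n v = (if u = v then vt n v else \<zero>\<^bsub>L n\<^esub>)" if "u \<in> U" for u
    using vt_mul[OF assms(1), of u] vt_mul[of u n v] that assms by auto
  have "vt n v \<otimes>\<^bsub>L n\<^esub> vsum n U = asum (L n) (\<lambda>u. vt n v \<otimes>\<^bsub>L n\<^esub> vt n u) U"
    unfolding vsum_def by (rule mul_asum[OF vt_in[OF assms(1)] vt_Pi[OF assms(2)]])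
  also have "\<dots> = (if v \<in> U then vt n v else \<zero>\<^bsub>L n\<^esub>)"
  proof (cases "v \<in> U")
    case True
    have "asum (L n) (\<lambda>u. vt n v \<otimes>\<^bsub>L n\<^esub> vt n u) U = vt n v \<otimes>\<^bsub>L n\<^esub> vt n v"
      by (rule asum_single[OF finite_verts[OF assms(2)] True]) (simp_all add: m vt_in[OF assms(1)])
    then show ?thesis using m(1)[OF True] True by simp
  next
    case False
    have "asum (L n) (\<lambda>u. vt n v \<otimes>\<^bsub>L n\<^esub> vt n u) U = \<zero>\<^bsub>L n\<^esub>"
      by (rule asum_zero) (use m False in metis)
    then show ?thesis using False by simp
  qed
  finally show "vt n v \<otimes>\<^bsub>L n\<^esub> vsum n U = (if v \<in> U then vt n v else \<zero>\<^bsub>L n\<^esub>)" .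
  have "vsum n U \<otimes>\<^bsub>L n\<^esub> vt n v = asum (L n) (\<lambda>u. vt n u \<otimes>\<^bsub>L n\<^esub> vt n v) U"
    unfolding vsum_def by (rule asum_mul[OF vt_in[OF assms(1)] vt_Pi[OF assms(2)]])
  also have "\<dots> = (if v \<in> U then vt n v else \<zero>\<^bsub>L n\<^esub>)"
  proof (cases "v \<in> U")
    case True
    have "asum (L n) (\<lambda>u. vt n u \<otimes>\<^bsub>L n\<^esub> vt n v) U = vt n v \<otimes>\<^bsub>L n\<^esub> vt n v"
      by (rule asum_single[OF finite_verts[OF assms(2)] True]) (simp_all add: m vt_in[OF assms(1)])
    then show ?thesis using m(1)[OF True] True by simp
  next
    case False
    have "asum (L n) (\<lambda>u. vt n u \<otimes>\<^bsub>L n\<^esub> vt n v) U = \<zero>\<^bsub>L n\<^esub>"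
      by (rule asum_zero) (use m False in metis)
    then show ?thesis using False by simp
  qed
  finally show "vsum n U \<otimes>\<^bsub>L n\<^esub> vt n v = (if v \<in> U then vt n v else \<zero>\<^bsub>L n\<^esub>)" .
qed

lemma vsum_mul: assumes "U \<subseteq> F0 P n \<union> F0 P (Suc n)" "V \<subseteq> F0 P n \<union> F0 P (Suc n)"
  shows "vsum n U \<otimes>\<^bsub>L n\<^esub> vsum n V = vsum n (U \<inter> V)"
proof -
  interpret star_algebra "L n" by (rule L_alg)
  have "vsum n U \<otimes>\<^bsub>L n\<^esub> vsum n V = asum (L n) (\<lambda>u. vt n u \<otimes>\<^bsub>L n\<^esub> vsum n V) U"
    by (subst vsum_def) (rule asum_mul[OF vsum_in[OF assms(2)] vt_Pi[OF assms(1)]])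
  also have "\<dots> = asum (L n) (\<lambda>u. if u \<in> V then vt n u else \<zero>\<^bsub>L n\<^esub>) U"
    by (rule asum_cong) (use assms vt_vsum(1)[OF _ assms(2)] vt_in in \<open>auto simp: subset_iff\<close>)
  also have "\<dots> = asum (L n) (\<lambda>u. if u \<in> V then vt n u else \<zero>\<^bsub>L n\<^esub>) (U \<inter> V)"
    by (rule asum_neutral) (use assms vt_in finite_verts[OF assms(1)] in auto)
  also have "\<dots> = vsum n (U \<inter> V)"
    unfolding vsum_def by (rule asum_cong) (use assms vt_in in auto)
  finally show ?thesis .
qed

lemma vsum_star: assumes "U \<subseteq> F0 P n \<union> F0 P (Suc n)" shows "star\<^bsub>L n\<^esub> (vsum n U) = vsum n U"
proof -
  interpret star_algebra "L n" by (rule L_alg)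
  show ?thesis
    unfolding vsum_def star_asum[OF vt_Pi[OF assms]]
    by (rule asum_cong) (use assms vt_in famD(4) in auto)
qed

lemma ed_in: "e \<in> F1 \<sigma> P n \<Longrightarrow> ed n e \<in> acarrier (L n)"
  using famD(2) .

lemma vsum_ed: assumes "e \<in> F1 \<sigma> P n" "U \<subseteq> F0 P n \<union> F0 P (Suc n)"
  shows "vsum n U \<otimes>\<^bsub>L n\<^esub> ed n e = (if erange e \<in> U then ed n e else \<zero>\<^bsub>L n\<^esub>)"
    "ed n e \<otimes>\<^bsub>L n\<^esub> vsum n U = (if esource e \<in> U then ed n e else \<zero>\<^bsub>L n\<^esub>)"
proof -
  interpret star_algebra "L n" by (rule L_alg)
  note e = ed_in[OF assms(1)] and ends = edge_ends[OF assms(1)]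
  have rng: "vt n (erange e) \<otimes>\<^bsub>L n\<^esub> ed n e = ed n e" and src: "ed n e \<otimes>\<^bsub>L n\<^esub> vt n (esource e) = ed n e"
    using famD(5,6)[OF assms(1)] by auto
  have vin: "vt n (erange e) \<in> acarrier (L n)" "vt n (esource e) \<in> acarrier (L n)"
    using vt_in ends by auto
  have "vsum n U \<otimes>\<^bsub>L n\<^esub> ed n e = (vsum n U \<otimes>\<^bsub>L n\<^esub> vt n (erange e)) \<otimes>\<^bsub>L n\<^esub> ed n e"
    using e vin vsum_in[OF assms(2)] by (simp add: mul_assoc rng)
  also have "\<dots> = (if erange e \<in> U then ed n e else \<zero>\<^bsub>L n\<^esub>)"
    using vt_vsum(2)[OF _ assms(2), of "erange e"] ends e rng by simp
  finally show "vsum n U \<otimes>\<^bsub>L n\<^esub> ed n e = (if erange e \<in> U then ed n e else \<zero>\<^bsub>L n\<^esub>)" .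
  have "ed n e \<otimes>\<^bsub>L n\<^esub> vsum n U = ed n e \<otimes>\<^bsub>L n\<^esub> (vt n (esource e) \<otimes>\<^bsub>L n\<^esub> vsum n U)"
    using e vin vsum_in[OF assms(2)] by (simp add: src flip: mul_assoc)
  also have "\<dots> = (if esource e \<in> U then ed n e else \<zero>\<^bsub>L n\<^esub>)"
    using vt_vsum(1)[OF _ assms(2), of "esource e"] ends e src by simp
  finally show "ed n e \<otimes>\<^bsub>L n\<^esub> vsum n U = (if esource e \<in> U then ed n e else \<zero>\<^bsub>L n\<^esub>)" .
qed

text \<open>
  The projections of distinct sources are orthogonal.
\<close>

lemma ed_ed_star_zero:
  assumes "g \<in> F1 \<sigma> P n" "h \<in> F1 \<sigma> P n" "esource g \<noteq> esource h"
  shows "ed n g \<otimes>\<^bsub>L n\<^esub> star\<^bsub>L n\<^esub> (ed n h) = \<zero>\<^bsub>L n\<^esub>"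
proof -
  interpret star_algebra "L n" by (rule L_alg)
  note in_L = ed_in[OF assms(1)] ed_in[OF assms(2)]
  have s: "{esource g} \<subseteq> F0 P n \<union> F0 P (Suc n)" "{esource h} \<subseteq> F0 P n \<union> F0 P (Suc n)"
    using edge_ends assms by auto
  have "ed n g \<otimes>\<^bsub>L n\<^esub> star\<^bsub>L n\<^esub> (ed n h) = (ed n g \<otimes>\<^bsub>L n\<^esub> vsum n {esource g}) \<otimes>\<^bsub>L n\<^esub> star\<^bsub>L n\<^esub> (ed n h)"
    using vsum_ed(2)[OF assms(1) s(1)] by simp
  also have "\<dots> = ed n g \<otimes>\<^bsub>L n\<^esub> star\<^bsub>L n\<^esub> (ed n h \<otimes>\<^bsub>L n\<^esub> vsum n {esource g})"
    using in_L vsum_in[OF s(1)] by (simp add: star_mul vsum_star[OF s(1)] mul_assoc)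
  also have "\<dots> = \<zero>\<^bsub>L n\<^esub>" using vsum_ed(2)[OF assms(2) s(1)] assms(3) in_L by simp
  finally show ?thesis .
qed

definition unit_L :: "nat \<Rightarrow> 'a lelem" where "unit_L n = vsum n (F0 P n \<union> F0 P (Suc n))"

lemma unit_L_unit:
  assumes "a \<in> acarrier (L n)"
  shows "unit_L n \<otimes>\<^bsub>L n\<^esub> a = a" "a \<otimes>\<^bsub>L n\<^esub> unit_L n = a"
proof -
  interpret star_algebra "L n" by (rule L_alg)
  have o: "unit_L n \<in> acarrier (L n)" "star\<^bsub>L n\<^esub> (unit_L n) = unit_L n"
    unfolding unit_L_def by (simp_all add: vsum_in vsum_star)
  have "unit_L n \<otimes>\<^bsub>L n\<^esub> a = a \<and> a \<otimes>\<^bsub>L n\<^esub> unit_L n = a"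
    using assms
  proof (induction rule: leavitt_induct)
    case (vtx v)
    then show ?case using vt_vsum[of v n "F0 P n \<union> F0 P (Suc n)"] by (auto simp: unit_L_def)
  next
    case (edg e)
    then show ?case using vsum_ed[of e n "F0 P n \<union> F0 P (Suc n)"] edge_ends[of e n] by (auto simp: unit_L_def)
  next
    case (mul a b)
    then show ?case using o by (metis mul_assoc)
  next
    case (star a)
    then show ?case using o by (metis star_mul)
  qed (use o in \<open>simp_all add: mul_add add_mul\<close>)
  then show "unit_L n \<otimes>\<^bsub>L n\<^esub> a = a" "a \<otimes>\<^bsub>L n\<^esub> unit_L n = a" by auto
qed

lemma unit_L_in: "unit_L n \<in> acarrier (L n)"
  unfolding unit_L_def by (simp add: vsum_in)

text \<open>
  Vertices are projections and edges are partial isometries, so every \<open>C\<^sup>*\<close>-seminorm is at most \<open>1\<close> on them,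
  and the bound propagates to all terms.
\<close>

lemma L_bounded:
  assumes "a \<in> acarrier (L n)"
  shows "\<exists>C. \<forall>p. cstar_seminorm (L n) p \<longrightarrow> p a \<le> C"
proof -
  interpret star_algebra "L n" by (rule L_alg)
  have q: "cstar_seminormed (L n) p" if "cstar_seminorm (L n) p" for p
    using that L_alg by (simp add: cstar_seminormed_def cstar_seminormed_axioms_def)
  have v1: "p (vt n v) \<le> 1" if "v \<in> F0 P n \<union> F0 P (Suc n)" "cstar_seminorm (L n) p" for p v
  proof -
    have "(p (vt n v))\<^sup>2 = p (vt n v)"
      using cstar_seminormed.p_cstar[OF q[OF that(2)] vt_in[OF that(1)]] famD(4)[of v n] vt_mul[OF that(1) that(1)] that(1)
      by auto
    then show ?thesis by (auto simp: power2_eq_square)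
  qed
  show ?thesis
    using assms
  proof (induction rule: leavitt_induct)
    case (vtx v)
    then show ?case using v1[of v] by auto
  next
    case (edg e)
    then have e: "e \<in> F1 \<sigma> P n" by simp
    obtain Y where Y: "Y \<in> D_sep \<sigma> P (erange e)" "e \<in> Y" by (rule D_sep_cover[OF e])
    have "p (ed n e) \<le> 1" if p: "cstar_seminorm (L n) p" for p
    proof -
      have "(p (ed n e))\<^sup>2 = p (vt n (esource e))"
        using cstar_seminormed.p_cstar[OF q[OF p] ed_in[OF e]] famD(7)[of "erange e" n Y e e] Y edge_ends(1)[OF e] by simp
      also have "\<dots> \<le> 1\<^sup>2" using v1[OF _ p] edge_ends(2)[OF e] by simp
      finally show ?thesis by (rule power2_le_imp_le) simp
    qed
    then show ?case by blast
  next
    case zero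
    show ?case using cstar_seminormed.p_zero[OF q] by (metis order_refl)
  next
    case (add a b)
    then obtain C D where "\<And>p. cstar_seminorm (L n) p \<Longrightarrow> p a \<le> C" "\<And>p. cstar_seminorm (L n) p \<Longrightarrow> p b \<le> D" by blast
    then show ?case using cstar_seminormed.p_add[OF q add(1,2)]
      by (intro exI[of _ "C + D"]) (meson add_mono order_trans)
  next
    case (mul a b)
    then obtain C D where CD: "\<And>p. cstar_seminorm (L n) p \<Longrightarrow> p a \<le> C" "\<And>p. cstar_seminorm (L n) p \<Longrightarrow> p b \<le> D" by blast
    show ?case
    proof (intro exI allI impI)
      fix p assume p: "cstar_seminorm (L n) p"
      have "p (a \<otimes>\<^bsub>L n\<^esub> b) \<le> p a * p b" by (rule cstar_seminormed.p_mul[OF q[OF p] mul(1,2)])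
      also have "\<dots> \<le> C * D"
        using CD[OF p] cstar_seminormed.p_nonneg[OF q[OF p]] mul(1,2) by (intro mult_mono) (auto intro: order_trans)
      finally show "p (a \<otimes>\<^bsub>L n\<^esub> b) \<le> C * D" .
    qed
  next
    case (scale a k)
    then obtain C where C: "\<And>p. cstar_seminorm (L n) p \<Longrightarrow> p a \<le> C" by blast
    show ?case
      by (rule exI[of _ "cmod k * C"]) (use C in \<open>simp add: cstar_seminormed.p_scale[OF q scale(1)] mult_left_mono\<close>)
  next
    case (star a)
    then obtain C where "\<And>p. cstar_seminorm (L n) p \<Longrightarrow> p a \<le> C" by blast
    then show ?case by (intro exI[of _ C]) (simp add: cstar_seminormed.p_star[OF q star(1)])
  qed
qed


subsection \<open>The maps \<open>\<phi>\<close>\<close>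

text \<open>
  The images of the generators under \<open>\<phi>\<^sub>n\<close> satisfy the relations of \<open>L\<^sub>n\<close>. The image of an edge \<open>e\<close> is the sum
  of the adjoints of the edges in \<open>X(e)\<close>, so products \<open>e\<^sup>* f\<close> become sums of \<open>g h\<^sup>*\<close>, of which only those with
  \<open>s(g) = s(h)\<close> survive, that is, \<open>e = f\<close> and \<open>g = h\<close> by \<open>two_step_bij\<close>. In the same way \<open>\<Sum> e e\<^sup>*\<close> becomes the
  sum of all \<open>s(g)\<close>, over paths \<open>e\<close>, \<open>g\<close>, which is the sum of the vertices two levels below.
\<close>

lemma phi_family:
  "leavitt_family (G n) (L (Suc n))
     (\<lambda>v. vsum (Suc n) (if v \<in> F0 P n then two_below v else {v}))
     (\<lambda>e. asum (L (Suc n)) (\<lambda>g. star\<^bsub>L (Suc n)\<^esub> (ed (Suc n) g)) (Xs e))"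
proof -
  let ?M = "L (Suc n)" and ?D = "\<lambda>v. if v \<in> F0 P n then two_below v else {v}"
  let ?\<nu> = "\<lambda>v. vsum (Suc n) (?D v)"
  let ?\<epsilon> = "\<lambda>e. asum ?M (\<lambda>g. star\<^bsub>?M\<^esub> (ed (Suc n) g)) (Xs e)"
  interpret star_algebra ?M by (rule L_alg)
  have D: "?D v \<subseteq> F0 P (Suc n) \<union> F0 P (Suc (Suc n))" if "v \<in> F0 P n \<union> F0 P (Suc n)" for v
    using two_below_subset[of v n] that by (cases "v \<in> F0 P n") auto
  have g_in: "ed (Suc n) g \<in> acarrier ?M" "erange g = esource e" "g \<in> F1 \<sigma> P (Suc n)"
    if "e \<in> F1 \<sigma> P n" "g \<in> Xs e" for e g
    using X_set_edges[OF that] ed_in by auto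
  have Pi: "(\<lambda>g. star\<^bsub>?M\<^esub> (ed (Suc n) g)) \<in> Xs e \<rightarrow> acarrier ?M" "(\<lambda>g. ed (Suc n) g) \<in> Xs e \<rightarrow> acarrier ?M"
    if "e \<in> F1 \<sigma> P n" for e
    using g_in[OF that] by auto
  have \<epsilon>_in: "?\<epsilon> e \<in> acarrier ?M" if "e \<in> F1 \<sigma> P n" for e using Pi(1)[OF that] by simp
  have \<epsilon>_star: "star\<^bsub>?M\<^esub> (?\<epsilon> e) = asum ?M (ed (Suc n)) (Xs e)" if "e \<in> F1 \<sigma> P n" for e
    unfolding star_asum[OF Pi(1)[OF that]] by (rule asum_cong) (use g_in[OF that] in auto)
  show ?thesis
    unfolding leavitt_family_def graph_sel
  proof (intro conjI ballI impI)
    show "?\<nu> \<in> F0 P n \<union> F0 P (Suc n) \<rightarrow> acarrier ?M" using D vsum_in by blast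
    show "?\<epsilon> \<in> F1 \<sigma> P n \<rightarrow> acarrier ?M" using \<epsilon>_in by blast
    fix v assume v: "v \<in> F0 P n \<union> F0 P (Suc n)"
    show "star\<^bsub>?M\<^esub> (?\<nu> v) = ?\<nu> v" by (rule vsum_star[OF D[OF v]])
    fix w assume w: "w \<in> F0 P n \<union> F0 P (Suc n)"
    have "?D v \<inter> ?D w = (if v = w then ?D v else {})"
    proof (cases "v \<in> F0 P n")
      case vt: True
      show ?thesis
      proof (cases "w \<in> F0 P n")
        case True
        then show ?thesis using vt two_below_disjoint[of v n w] by (cases "v = w") (simp, fastforce)
      next
        case False
        then have "w \<notin> two_below v" using w two_below_subset[OF vt] F0_disjoint[of w "Suc n"] by blast
        then show ?thesis using vt False by auto
      qed
    next
      case vf: False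
      show ?thesis
      proof (cases "w \<in> F0 P n")
        case True
        then have "v \<notin> two_below w" using v vf two_below_subset[OF True] F0_disjoint[of v "Suc n"] by blast
        then show ?thesis using vf True by auto
      qed (use vf in auto)
    qed
    then show "?\<nu> v \<otimes>\<^bsub>?M\<^esub> ?\<nu> w = (if v = w then ?\<nu> v else \<zero>\<^bsub>?M\<^esub>)"
      using vsum_mul[OF D[OF v] D[OF w]] by (auto simp: vsum_def)
  next
    fix e assume e: "e \<in> F1 \<sigma> P n"
    obtain Y where Y: "Y \<in> D_sep \<sigma> P (erange e)" "e \<in> Y" by (rule D_sep_cover[OF e])
    note ends = edge_ends[OF e]
    have re: "?D (erange e) = two_below (erange e)" using ends by simp
    have se: "?D (esource e) = {esource e}" using F0_disjoint'[OF ends(2)] by simp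
    have Dr: "two_below (erange e) \<subseteq> F0 P (Suc n) \<union> F0 P (Suc (Suc n))" using D[of "erange e"] ends re by simp
    have Ds: "{esource e} \<subseteq> F0 P (Suc n) \<union> F0 P (Suc (Suc n))" using ends by simp
    have s1: "vsum (Suc n) (two_below (erange e)) \<otimes>\<^bsub>?M\<^esub> star\<^bsub>?M\<^esub> (ed (Suc n) g) = star\<^bsub>?M\<^esub> (ed (Suc n) g)" if g: "g \<in> Xs e" for g
    proof -
      have "ed (Suc n) g \<otimes>\<^bsub>?M\<^esub> vsum (Suc n) (two_below (erange e)) = ed (Suc n) g"
        using vsum_ed(2)[OF g_in(3)[OF e g] Dr] two_step_source[OF ends(1) Y g] by simp
      then show ?thesis using g_in(1)[OF e g] vsum_in[OF Dr] vsum_star[OF Dr] by (metis star_mul)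
    qed
    have s2: "star\<^bsub>?M\<^esub> (ed (Suc n) g) \<otimes>\<^bsub>?M\<^esub> vsum (Suc n) {esource e} = star\<^bsub>?M\<^esub> (ed (Suc n) g)" if g: "g \<in> Xs e" for g
    proof -
      have "vsum (Suc n) {esource e} \<otimes>\<^bsub>?M\<^esub> ed (Suc n) g = ed (Suc n) g"
        using vsum_ed(1)[OF g_in(3)[OF e g] Ds] g_in(2)[OF e g] by simp
      then show ?thesis using g_in(1)[OF e g] vsum_in[OF Ds] vsum_star[OF Ds] by (metis star_mul)
    qed
    show "?\<nu> (erange e) \<otimes>\<^bsub>?M\<^esub> ?\<epsilon> e = ?\<epsilon> e"
      unfolding re mul_asum[OF vsum_in[OF Dr] Pi(1)[OF e]] by (rule asum_cong) (use s1 Pi(1)[OF e] in auto)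
    show "?\<epsilon> e \<otimes>\<^bsub>?M\<^esub> ?\<nu> (esource e) = ?\<epsilon> e"
      unfolding se asum_mul[OF vsum_in[OF Ds] Pi(1)[OF e]] by (rule asum_cong) (use s2 Pi(1)[OF e] in auto)
  next
    fix v Y e f assume "v \<in> F0 P n \<union> F0 P (Suc n)" "Y \<in> gsep (G n) v" and ef: "e \<in> Y" "f \<in> Y"
    then have v: "v \<in> F0 P n" and Y: "Y \<in> D_sep \<sigma> P v" by (simp_all add: gsep_iff)
    have e: "e \<in> F1 \<sigma> P n" and f: "f \<in> F1 \<sigma> P n" using D_sep_edges[OF v Y] ef by auto
    have se: "?D (esource e) = {esource e}" using F0_disjoint'[OF edge_ends(2)[OF e]] by simp
    have zero: "ed (Suc n) g \<otimes>\<^bsub>?M\<^esub> star\<^bsub>?M\<^esub> (ed (Suc n) h) = \<zero>\<^bsub>?M\<^esub>" if "g \<in> Xs e" "h \<in> Xs f" "e \<noteq> f \<or> g \<noteq> h" for g h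
      by (rule ed_ed_star_zero[OF g_in(3)[OF e that(1)] g_in(3)[OF f that(2)]])
         (use two_step_inj[OF v Y ef(1) that(1) ef(2) that(2)] that(3) in blast)
    have "star\<^bsub>?M\<^esub> (?\<epsilon> e) \<otimes>\<^bsub>?M\<^esub> ?\<epsilon> f = asum ?M (\<lambda>g. ed (Suc n) g \<otimes>\<^bsub>?M\<^esub> ?\<epsilon> f) (Xs e)"
      unfolding \<epsilon>_star[OF e] by (rule asum_mul[OF \<epsilon>_in[OF f] Pi(2)[OF e]])
    also have "\<dots> = asum ?M (\<lambda>g. if e = f then ed (Suc n) g \<otimes>\<^bsub>?M\<^esub> star\<^bsub>?M\<^esub> (ed (Suc n) g) else \<zero>\<^bsub>?M\<^esub>) (Xs e)"
    proof (rule asum_cong[OF HOL.refl])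
      fix g assume g: "g \<in> Xs e"
      have "ed (Suc n) g \<otimes>\<^bsub>?M\<^esub> ?\<epsilon> f = asum ?M (\<lambda>h. ed (Suc n) g \<otimes>\<^bsub>?M\<^esub> star\<^bsub>?M\<^esub> (ed (Suc n) h)) (Xs f)"
        by (rule mul_asum[OF g_in(1)[OF e g] Pi(1)[OF f]])
      also have "\<dots> = (if e = f then ed (Suc n) g \<otimes>\<^bsub>?M\<^esub> star\<^bsub>?M\<^esub> (ed (Suc n) g) else \<zero>\<^bsub>?M\<^esub>)"
      proof (cases "e = f")
        case True
        then show ?thesis
          using asum_single[OF X_set_finite[OF f], of g "\<lambda>h. ed (Suc n) g \<otimes>\<^bsub>?M\<^esub> star\<^bsub>?M\<^esub> (ed (Suc n) h)"] g g_in(1)[OF e g] zero[OF g]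
          by auto
      next
        case False
        then show ?thesis using asum_zero[of "Xs f" "\<lambda>h. ed (Suc n) g \<otimes>\<^bsub>?M\<^esub> star\<^bsub>?M\<^esub> (ed (Suc n) h)"] zero[OF g] by auto
      qed
      finally show "ed (Suc n) g \<otimes>\<^bsub>?M\<^esub> ?\<epsilon> f = (if e = f then ed (Suc n) g \<otimes>\<^bsub>?M\<^esub> star\<^bsub>?M\<^esub> (ed (Suc n) g) else \<zero>\<^bsub>?M\<^esub>)" .
    qed (use g_in[OF e] in auto)
    also have "\<dots> = (if e = f then vt (Suc n) (esource e) else \<zero>\<^bsub>?M\<^esub>)"
      using famD(8)[of "esource e" "Suc n" "Xs e"] edge_ends(2)[OF e] X_set_D_sep[OF e] X_set_finite[OF e]
      asum_zero[of "Xs e" "\<lambda>g. \<zero>\<^bsub>?M\<^esub>"] by (cases "e = f") simp_all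
    also have "vt (Suc n) (esource e) = ?\<nu> (esource e)"
      unfolding se by (rule vsum_single[symmetric]) (use edge_ends[OF e] in auto)
    finally show "star\<^bsub>?M\<^esub> (?\<epsilon> e) \<otimes>\<^bsub>?M\<^esub> ?\<epsilon> f = (if e = f then ?\<nu> (esource e) else \<zero>\<^bsub>?M\<^esub>)" .
  next
    fix v Y assume "v \<in> F0 P n \<union> F0 P (Suc n)" "Y \<in> gsep (G n) v" "finite Y"
    then have v: "v \<in> F0 P n" and Y: "Y \<in> D_sep \<sigma> P v" by (simp_all add: gsep_iff)
    have e: "e \<in> F1 \<sigma> P n" if "e \<in> Y" for e using D_sep_edges[OF v Y that] by simp
    have src: "esource g \<in> F0 P (Suc n) \<union> F0 P (Suc (Suc n))" if "e \<in> Y" "g \<in> Xs e" for e g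
      using edge_ends(2)[OF g_in(3)[OF e[OF that(1)] that(2)]] by blast
    have "asum ?M (\<lambda>e. ?\<epsilon> e \<otimes>\<^bsub>?M\<^esub> star\<^bsub>?M\<^esub> (?\<epsilon> e)) Y = asum ?M (\<lambda>e. asum ?M (\<lambda>g. vt (Suc n) (esource g)) (Xs e)) Y"
    proof (rule asum_cong[OF HOL.refl])
      fix f assume f: "f \<in> Y"
      have vf: "esource f \<in> F0 P (Suc n)" using edge_ends(2)[OF e[OF f]] .
      have "?\<epsilon> f \<otimes>\<^bsub>?M\<^esub> star\<^bsub>?M\<^esub> (?\<epsilon> f) = asum ?M (\<lambda>g. star\<^bsub>?M\<^esub> (ed (Suc n) g) \<otimes>\<^bsub>?M\<^esub> star\<^bsub>?M\<^esub> (?\<epsilon> f)) (Xs f)"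
        by (rule asum_mul) (use \<epsilon>_in[OF e[OF f]] Pi(1)[OF e[OF f]] in auto)
      also have "\<dots> = asum ?M (\<lambda>g. vt (Suc n) (esource g)) (Xs f)"
      proof (rule asum_cong[OF HOL.refl])
        fix g assume g: "g \<in> Xs f"
        have rel: "star\<^bsub>?M\<^esub> (ed (Suc n) g) \<otimes>\<^bsub>?M\<^esub> ed (Suc n) h = (if g = h then vt (Suc n) (esource g) else \<zero>\<^bsub>?M\<^esub>)" if "h \<in> Xs f" for h
          using famD(7)[of "esource f" "Suc n" "Xs f" g h] vf X_set_D_sep[OF e[OF f]] g that by simp
        have "star\<^bsub>?M\<^esub> (ed (Suc n) g) \<otimes>\<^bsub>?M\<^esub> star\<^bsub>?M\<^esub> (?\<epsilon> f) = asum ?M (\<lambda>h. star\<^bsub>?M\<^esub> (ed (Suc n) g) \<otimes>\<^bsub>?M\<^esub> ed (Suc n) h) (Xs f)"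
          unfolding \<epsilon>_star[OF e[OF f]] by (rule mul_asum) (use g_in(1)[OF e[OF f]] g in auto)
        also have "\<dots> = star\<^bsub>?M\<^esub> (ed (Suc n) g) \<otimes>\<^bsub>?M\<^esub> ed (Suc n) g"
          by (rule asum_single[OF X_set_finite[OF e[OF f]] g]) (simp_all add: rel g vt_in[OF src[OF f]])
        finally show "star\<^bsub>?M\<^esub> (ed (Suc n) g) \<otimes>\<^bsub>?M\<^esub> star\<^bsub>?M\<^esub> (?\<epsilon> f) = vt (Suc n) (esource g)"
          using rel[OF g] by simp
      qed (use vt_in[OF src[OF f]] in blast)
      finally show "?\<epsilon> f \<otimes>\<^bsub>?M\<^esub> star\<^bsub>?M\<^esub> (?\<epsilon> f) = asum ?M (\<lambda>g. vt (Suc n) (esource g)) (Xs f)" .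
    qed (auto intro!: asum_in intro: vt_in[OF src])
    also have "\<dots> = asum ?M (\<lambda>(e, g). vt (Suc n) (esource g)) (SIGMA e:Y. Xs e)"
      by (rule asum_Sigma) (use \<open>finite Y\<close> X_set_finite[OF e] vt_in[OF src] in blast)+
    also have "\<dots> = asum ?M (\<lambda>x. vt (Suc n) ((\<lambda>(e, g). esource g) x)) (SIGMA e:Y. Xs e)"
      by (rule asum_cong) (auto intro: vt_in[OF src])
    also have "\<dots> = asum ?M (vt (Suc n)) ((\<lambda>(e, g). esource g) ` (SIGMA e:Y. Xs e))"
      by (rule asum_reindex[symmetric])
        (use two_step_bij[OF v Y] vt_Pi[of "two_below v" "Suc n"] two_below_subset[OF v] in \<open>auto simp: bij_betw_def\<close>)
    also have "\<dots> = ?\<nu> v" using two_step_bij[OF v Y] v by (simp add: bij_betw_def vsum_def)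
    finally show "asum ?M (\<lambda>e. ?\<epsilon> e \<otimes>\<^bsub>?M\<^esub> star\<^bsub>?M\<^esub> (?\<epsilon> e)) Y = ?\<nu> v" .
  qed
qed

lemma blue_blue_sum:
  assumes v: "v \<in> F0 P n"
  shows "asum (L (Suc n)) (\<lambda>e. asum (L (Suc n)) (\<lambda>e'. vt (Suc n) (esource e')) (coloured_edges \<sigma> P Blue (esource e)))
     (coloured_edges \<sigma> P Blue v) = vsum (Suc n) (two_below v)"
proof -
  let ?Y = "coloured_edges \<sigma> P Blue v"
  interpret star_algebra "L (Suc n)" by (rule L_alg)
  have Y: "?Y \<in> D_sep \<sigma> P v" by (auto simp: D_sep_def)
  have e: "e \<in> F1 \<sigma> P n" if "e \<in> ?Y" for e using D_sep_edges[OF v Y that] by simp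
  have Xe: "coloured_edges \<sigma> P Blue (esource e) = Xs e" if "e \<in> ?Y" for e
    using that by (auto simp: coloured_edges_def X_set_def)
  have src: "esource g \<in> F0 P (Suc n) \<union> F0 P (Suc (Suc n))" if "e \<in> ?Y" "g \<in> Xs e" for e g
    using edge_ends(2) X_set_edges[OF e[OF that(1)] that(2)] by blast
  have "asum (L (Suc n)) (\<lambda>e. asum (L (Suc n)) (\<lambda>e'. vt (Suc n) (esource e')) (coloured_edges \<sigma> P Blue (esource e))) ?Y
      = asum (L (Suc n)) (\<lambda>e. asum (L (Suc n)) (\<lambda>g. vt (Suc n) (esource g)) (Xs e)) ?Y"
    by (rule asum_cong) (auto simp: Xe intro!: asum_in intro: vt_in[OF src])
  also have "\<dots> = asum (L (Suc n)) (\<lambda>(e, g). vt (Suc n) (esource g)) (SIGMA e:?Y. Xs e)"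
    by (rule asum_Sigma) (use D_sep_finite[OF v Y] X_set_finite[OF e] vt_in[OF src] in blast)+
  also have "\<dots> = asum (L (Suc n)) (\<lambda>x. vt (Suc n) ((\<lambda>(e, g). esource g) x)) (SIGMA e:?Y. Xs e)"
    by (rule asum_cong) (auto intro: vt_in[OF src])
  also have "\<dots> = asum (L (Suc n)) (vt (Suc n)) ((\<lambda>(e, g). esource g) ` (SIGMA e:?Y. Xs e))"
    by (rule asum_reindex[symmetric])
      (use two_step_bij[OF v Y] vt_Pi[of "two_below v" "Suc n"] two_below_subset[OF v] in \<open>auto simp: bij_betw_def\<close>)
  also have "\<dots> = vsum (Suc n) (two_below v)" using two_step_bij[OF v Y] by (simp add: bij_betw_def vsum_def)
  finally show ?thesis .
qed

abbreviation "pt \<equiv> phi_tilde \<sigma> P"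

lemma phi_tilde_spec:
  shows phi_tilde_hom: "pt n \<in> star_hom (L n) (L (Suc n))"
    and phi_tilde_low: "w \<in> F0 P (Suc n) \<Longrightarrow> pt n (vt n w) = vt (Suc n) w"
    and phi_tilde_top: "v \<in> F0 P n \<Longrightarrow> pt n (vt n v) = vsum (Suc n) (two_below v)"
proof -
  let ?Q = "\<lambda>h. h \<in> star_hom (L n) (L (n + 1)) \<and>
     (\<forall>w\<in>F0 P (n + 1). h (vt n w) = vt (n + 1) w) \<and>
     (\<forall>v\<in>F0 P n. h (vt n v) =
        asum (L (n + 1)) (\<lambda>e.
          asum (L (n + 1)) (\<lambda>e'. vt (n + 1) (esource e'))
            (coloured_edges \<sigma> P Blue (esource e)))
          (coloured_edges \<sigma> P Blue v)) \<and>
     (\<forall>e\<in>F1 \<sigma> P n. h (ed n e) =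
        asum (L (n + 1)) (\<lambda>g. astar (L (n + 1)) (ed (n + 1) g)) (Xs e))"
  obtain h where h: "h \<in> star_hom (L n) (L (Suc n))"
    "\<And>v. v \<in> gverts (G n) \<Longrightarrow> h (leavitt_vtx (G n) v) = vsum (Suc n) (if v \<in> F0 P n then two_below v else {v})"
    "\<And>e. e \<in> gedges (G n) \<Longrightarrow> h (leavitt_edg (G n) e) = asum (L (Suc n)) (\<lambda>g. star\<^bsub>L (Suc n)\<^esub> (ed (Suc n) g)) (Xs e)"
    by (rule leavitt_lift[OF L_alg sep phi_family]) blast
  have Qh: "?Q h"
    using h F0_disjoint vsum_single[of _ "Suc n"] by (auto simp: blue_blue_sum)
  have uniq: "h' = h" if "?Q h'" for h'
  proof (rule leavitt_hom_eqI)
    show "h' \<in> star_hom (L n) (L (Suc n))" "h \<in> star_hom (L n) (L (Suc n))" using that h by auto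
    show "star_algebra (L (Suc n))" by (rule L_alg)
    show "h' (vt n v) = h (vt n v)" if "v \<in> gverts (G n)" for v
      using \<open>?Q h'\<close> Qh that by auto
    show "h' (ed n e) = h (ed n e)" if "e \<in> gedges (G n)" for e
      using \<open>?Q h'\<close> Qh that by auto
  qed
  have "pt n = h" unfolding phi_tilde_def by (rule the_equality[of ?Q, OF Qh uniq])
  then show "pt n \<in> star_hom (L n) (L (Suc n))"
    "w \<in> F0 P (Suc n) \<Longrightarrow> pt n (vt n w) = vt (Suc n) w"
    "v \<in> F0 P n \<Longrightarrow> pt n (vt n v) = vsum (Suc n) (two_below v)"
    using Qh by (auto simp: blue_blue_sum)
qed

definition range_sum :: "nat \<Rightarrow> 'a lelem" where "range_sum n = vsum n (F0 P n)"

lemma range_sum_projection: "star_projection (L n) (range_sum n)"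
proof -
  interpret star_algebra "L n" by (rule L_alg)
  show ?thesis
    by unfold_locales (auto simp: range_sum_def vsum_in vsum_mul vsum_star)
qed

lemma phi_tilde_top_sum: "pt (Suc n) (pt n (range_sum n)) = range_sum (Suc (Suc n))"
proof -
  interpret L1: star_algebra "L (Suc n)" by (rule L_alg)
  interpret L2: star_algebra "L (Suc (Suc n))" by (rule L_alg)
  have d: "u \<in> F0 P (Suc (Suc n))" if "v \<in> F0 P n" "u \<in> two_below v" for u v
    using two_below_subset that by blast
  have "pt n (range_sum n) = asum (L (Suc n)) (\<lambda>v. pt n (vt n v)) (F0 P n)"
    unfolding range_sum_def vsum_def by (rule star_hom_asum[OF phi_tilde_hom L_alg L_alg]) (use vt_in in auto)
  also have "\<dots> = asum (L (Suc n)) (\<lambda>v. asum (L (Suc n)) (vt (Suc n)) (two_below v)) (F0 P n)"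
    by (rule L1.asum_cong) (use vt_in d in \<open>auto simp: phi_tilde_top vsum_def intro!: L1.asum_in\<close>)
  also have "\<dots> = asum (L (Suc n)) (\<lambda>(v, u). vt (Suc n) u) (SIGMA v:F0 P n. two_below v)"
    by (rule L1.asum_Sigma) (use vt_in d finite_subset[OF two_below_subset finite_F0] in auto)
  also have "\<dots> = asum (L (Suc n)) (\<lambda>x. vt (Suc n) (snd x)) (SIGMA v:F0 P n. two_below v)"
    by (rule L1.asum_cong) (use vt_in d in auto)
  also have "\<dots> = asum (L (Suc n)) (vt (Suc n)) (snd ` (SIGMA v:F0 P n. two_below v))"
    by (rule L1.asum_reindex[symmetric]) (use vt_in d two_below_disjoint in \<open>auto simp: inj_on_def\<close>)
  also have "snd ` (SIGMA v:F0 P n. two_below v) = F0 P (Suc (Suc n))"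
    using two_below_cover d by force
  finally have "pt (Suc n) (pt n (range_sum n)) = pt (Suc n) (asum (L (Suc n)) (vt (Suc n)) (F0 P (Suc (Suc n))))" by simp
  also have "\<dots> = asum (L (Suc (Suc n))) (\<lambda>u. pt (Suc n) (vt (Suc n) u)) (F0 P (Suc (Suc n)))"
    by (rule star_hom_asum[OF phi_tilde_hom L_alg L_alg]) (use vt_in in auto)
  also have "\<dots> = range_sum (Suc (Suc n))"
    unfolding range_sum_def vsum_def by (rule L2.asum_cong) (use vt_in phi_tilde_low in auto)
  finally show ?thesis .
qed

end


lemma (in star_projection) corner_seminorm: "cstar_seminorm A q \<Longrightarrow> cstar_seminorm (corner A p) q"
proof -
  assume q: "cstar_seminorm A q"
  have "acarrier (corner A p) \<subseteq> acarrier A" using corner_iff by blast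
  with q show ?thesis unfolding cstar_seminorm_def corner_sel by blast
qed

context diagram
begin

subsection \<open>The algebras \<open>C\<^sub>n\<close> and their maps\<close>

abbreviation "EN n \<equiv> env_norm (L n)"
abbreviation "C \<equiv> C_alg \<sigma> P"
abbreviation "j \<equiv> L_to_C \<sigma> P"
abbreviation "ptC \<equiv> phi_tilde_C \<sigma> P"
abbreviation "A n \<equiv> A_alg \<sigma> P n"
abbreviation "B n \<equiv> B_alg \<sigma> P n"

definition to_C :: "nat \<Rightarrow> 'a lelem \<Rightarrow> (nat \<Rightarrow> 'a lelem) set" where
  "to_C n = restrict (j n) (acarrier (L n))"

lemma EN_seminormed: "cstar_seminormed (L n) (EN n)"
  unfolding cstar_seminormed_def cstar_seminormed_axioms_def
  by (intro conjI L_alg star_algebra.env_norm_cstar_seminorm[OF L_alg L_bounded])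

text \<open>
  \<open>env_norm\<close> is a supremum; boundedness is \<open>L_bounded\<close>.
\<close>

lemma EN_upper: "cstar_seminorm (L n) p \<Longrightarrow> a \<in> acarrier (L n) \<Longrightarrow> p a \<le> EN n a"
proof -
  assume p: "cstar_seminorm (L n) p" and "a \<in> acarrier (L n)"
  then obtain K where "\<And>p. cstar_seminorm (L n) p \<Longrightarrow> p a \<le> K" using L_bounded by blast
  then show ?thesis by (rule env_norm_upper[OF _ p])
qed

lemma C_completion: "C n = completion (L n) (EN n)"
  by (simp add: graph_cstar_def enveloping_def)

lemma C_cstar: "cstar_algebra (C n)"
  unfolding C_completion by (rule cstar_seminormed.completion_cstar_algebra[OF EN_seminormed])

lemma C_alg: "star_algebra (C n)"
  using C_cstar cstar_algebra.axioms(1) by blast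

lemma to_C_eq: "a \<in> acarrier (L n) \<Longrightarrow> to_C n a = j n a"
  by (simp add: to_C_def)

lemma to_C_hom: "to_C n \<in> star_hom (L n) (C n)"
  unfolding to_C_def C_completion to_enveloping_def
  by (rule cstar_seminormed.to_completion_hom[OF EN_seminormed])

lemma to_C_norm: "a \<in> acarrier (L n) \<Longrightarrow> cnorm (C n) (to_C n a) = EN n a"
  unfolding C_completion to_enveloping_def to_C_def
  using cstar_seminormed.cnorm_to_completion[OF EN_seminormed] by simp

lemma to_C_dense: "dense_image (L n) (to_C n) (C n)"
  unfolding dense_image_def
proof (intro ballI allI impI)
  fix b and e :: real assume "b \<in> acarrier (C n)" "e > 0"
  then obtain a where "a \<in> acarrier (L n)"
    "cnorm (C n) (b \<ominus>\<^bsub>C n\<^esub> to_completion (L n) (EN n) a) < e"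
    using cstar_seminormed.completion_dense[OF EN_seminormed] unfolding C_completion by metis
  then show "\<exists>a\<in>acarrier (L n). cnorm (C n) (b \<ominus>\<^bsub>C n\<^esub> to_C n a) < e"
    by (intro bexI[of _ a]) (simp_all add: to_C_def to_enveloping_def)
qed

lemma C_unital: "unital_cstar_algebra (C n) (to_C n (unit_L n))"
  by (rule dense_unital[OF L_alg C_cstar to_C_hom to_C_dense unit_L_in unit_L_unit])

lemma EN_phi: assumes "a \<in> acarrier (L n)" shows "EN (Suc n) (pt n a) \<le> EN n a"
proof -
  have "cstar_seminorm (L n) (\<lambda>a. EN (Suc n) (pt n a))"
    by (rule cstar_seminorm_pullback[OF phi_tilde_hom cstar_seminormed.seminorm[OF EN_seminormed] L_alg])
  from EN_upper[OF this assms] show ?thesis .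
qed

text \<open>
  The pullback of the norm of \<open>C\<^sub>n\<^sub>+\<^sub>1\<close> is a \<open>C\<^sup>*\<close>-seminorm on \<open>L\<^sub>n\<close>, so \<open>\<phi>\<^sub>n\<close> is contractive and extends.
\<close>

lemma phi_tilde_C_spec:
  shows phi_tilde_C_hom: "ptC n \<in> star_hom (C n) (C (Suc n))"
    and phi_tilde_C_j: "a \<in> acarrier (L n) \<Longrightarrow> ptC n (to_C n a) = to_C (Suc n) (pt n a)"
    and phi_tilde_C_contr: "b \<in> acarrier (C n) \<Longrightarrow> cnorm (C (Suc n)) (ptC n b) \<le> cnorm (C n) b"
proof -
  let ?Q = "\<lambda>h. h \<in> star_hom (C n) (C (n + 1)) \<and> (\<forall>a\<in>acarrier (L n). h (j n a) = j (n + 1) (pt n a))"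
  have j2: "restrict (to_C (Suc n) \<circ> pt n) (acarrier (L n)) \<in> star_hom (L n) (C (Suc n))"
    by (rule star_hom_comp[OF phi_tilde_hom to_C_hom L_alg])
  have pin: "pt n a \<in> acarrier (L (Suc n))" if "a \<in> acarrier (L n)" for a
    by (rule star_homD(1)[OF phi_tilde_hom that])
  have "\<exists>h\<in>star_hom (C n) (C (Suc n)). (\<forall>a\<in>acarrier (L n). h (to_C n a) = restrict (to_C (Suc n) \<circ> pt n) (acarrier (L n)) a)
      \<and> (\<forall>b\<in>acarrier (C n). cnorm (C (Suc n)) (h b) \<le> cnorm (C n) b)"
    by (rule extend_hom[OF L_alg C_cstar C_cstar to_C_hom j2 _ to_C_dense]) (simp add: to_C_norm pin EN_phi)
  then obtain h where h: "h \<in> star_hom (C n) (C (Suc n))"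
    "\<And>a. a \<in> acarrier (L n) \<Longrightarrow> h (to_C n a) = to_C (Suc n) (pt n a)"
    "\<And>b. b \<in> acarrier (C n) \<Longrightarrow> cnorm (C (Suc n)) (h b) \<le> cnorm (C n) b"
    by auto
  have Qh: "?Q h" using h(1,2) pin by (simp add: to_C_def)
  have uniq: "h' = h" if "?Q h'" for h'
    by (rule hom_eq_of_dense_unital[OF C_unital[of n] C_cstar[of "Suc n"] to_C_dense[of n] to_C_hom[of n]])
       (use that Qh in \<open>simp_all add: to_C_def\<close>)
  have "ptC n = h" unfolding phi_tilde_C_def by (rule the_equality[of ?Q, OF Qh uniq])
  then show "ptC n \<in> star_hom (C n) (C (Suc n))"
    "a \<in> acarrier (L n) \<Longrightarrow> ptC n (to_C n a) = to_C (Suc n) (pt n a)"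
    "b \<in> acarrier (C n) \<Longrightarrow> cnorm (C (Suc n)) (ptC n b) \<le> cnorm (C n) b"
    using h by auto
qed

lemma A_corner: "A n = corner (L n) (range_sum n)"
  by (simp add: A_alg_def range_sum_def vsum_def)

lemma range_sum_in: "range_sum n \<in> acarrier (L n)"
  by (rule star_projection.p_in[OF range_sum_projection])

lemma B_corner: "B n = corner (C n) (to_C n (range_sum n))"
proof -
  have "to_C n (range_sum n) = asum (C n) (\<lambda>v. to_C n (vt n v)) (F0 P n)"
    unfolding range_sum_def vsum_def by (rule star_hom_asum[OF to_C_hom L_alg C_alg]) (use vt_in in auto)
  also have "\<dots> = asum (C n) (\<lambda>v. j n (vt n v)) (F0 P n)"
  proof (rule star_algebra.asum_cong[OF C_alg HOL.refl])
    have eq: "to_C n (vt n v) = j n (vt n v)" if "v \<in> F0 P n" for v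
      by (rule to_C_eq) (use that vt_in in blast)
    then show "\<And>v. v \<in> F0 P n \<Longrightarrow> to_C n (vt n v) = j n (vt n v)" .
    have "to_C n (vt n v) \<in> acarrier (C n)" if "v \<in> F0 P n" for v
      by (rule star_homD(1)[OF to_C_hom]) (use that vt_in in blast)
    then show "(\<lambda>v. j n (vt n v)) \<in> F0 P n \<rightarrow> acarrier (C n)" using eq by simp
  qed
  finally show ?thesis by (simp add: B_alg_def)
qed

lemma C_projection: "star_projection (C n) (to_C n (range_sum n))"
  by (rule star_projection.hom_projection[OF range_sum_projection to_C_hom C_alg])

lemma A_in_L: "a \<in> acarrier (A n) \<Longrightarrow> a \<in> acarrier (L n)"
  unfolding A_corner using star_projection.corner_iff[OF range_sum_projection] by blast

lemma B_in_C: "b \<in> acarrier (B n) \<Longrightarrow> b \<in> acarrier (C n)"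
  unfolding B_corner using star_projection.corner_iff[OF C_projection] by blast

lemma phi_A_hom: "phi_A \<sigma> P n \<in> star_hom (A (2 * n)) (A (2 * Suc n))"
proof -
  let ?h = "restrict (pt (Suc (2 * n)) \<circ> pt (2 * n)) (acarrier (L (2 * n)))"
  have "restrict ?h (acarrier (A (2 * n))) \<in> star_hom (A (2 * n)) (A (Suc (Suc (2 * n))))"
    unfolding A_corner
    by (rule corner_hom[OF range_sum_projection range_sum_projection star_hom_comp[OF phi_tilde_hom phi_tilde_hom L_alg]])
       (simp add: range_sum_in phi_tilde_top_sum)
  moreover have "restrict ?h (acarrier (A (2 * n))) = phi_A \<sigma> P n"
    unfolding phi_A_def by (auto simp: restrict_def fun_eq_iff A_in_L)
  ultimately show ?thesis by simp
qed

lemma phi_B_hom: "phi_B \<sigma> P n \<in> star_hom (B (2 * n)) (B (2 * Suc n))"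
proof -
  let ?h = "restrict (ptC (Suc (2 * n)) \<circ> ptC (2 * n)) (acarrier (C (2 * n)))"
  have tin: "to_C (2 * n) (range_sum (2 * n)) \<in> acarrier (C (2 * n))" by (rule star_homD(1)[OF to_C_hom range_sum_in])
  have "restrict ?h (acarrier (B (2 * n))) \<in> star_hom (B (2 * n)) (B (Suc (Suc (2 * n))))"
    unfolding B_corner
    by (rule corner_hom[OF C_projection C_projection star_hom_comp[OF phi_tilde_C_hom phi_tilde_C_hom C_alg]])
       (simp add: tin phi_tilde_C_j range_sum_in star_homD(1)[OF phi_tilde_hom] phi_tilde_top_sum)
  moreover have "restrict ?h (acarrier (B (2 * n))) = phi_B \<sigma> P n"
    unfolding phi_B_def by (auto simp: restrict_def fun_eq_iff B_in_C)
  ultimately show ?thesis by simp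
qed

lemma A_alg: "star_algebra (A n)"
  unfolding A_corner by (rule star_projection.corner_star_algebra[OF range_sum_projection])

lemma B_alg: "star_algebra (B n)"
  unfolding B_corner by (rule star_projection.corner_star_algebra[OF C_projection])

lemma A_system: "star_system (\<lambda>n. A (2 * n)) (phi_A \<sigma> P)"
  unfolding star_system_def using A_alg phi_A_hom by blast

lemma cnorm_B: "cnorm (B n) = cnorm (C n)"
  by (simp add: B_corner)

lemma B_system: "cstar_system (\<lambda>n. B (2 * n)) (phi_B \<sigma> P)"
  unfolding cstar_system_def cstar_system_axioms_def star_system_def
proof (intro conjI allI impI)
  fix n
  show "star_algebra (B (2 * n))" "phi_B \<sigma> P n \<in> star_hom (B (2 * n)) (B (2 * Suc n))"
    by (rule B_alg phi_B_hom)+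
  interpret C: cstar_algebra "C (2 * n)" by (rule C_cstar)
  interpret P: star_projection "C (2 * n)" "to_C (2 * n) (range_sum (2 * n))" by (rule C_projection)
  show "cstar_seminorm (B (2 * n)) (cnorm (B (2 * n)))"
    unfolding cnorm_B unfolding B_corner by (rule P.corner_seminorm[OF C.norm_cstar])
  fix b assume b: "b \<in> acarrier (B (2 * n))"
  then have bC: "b \<in> acarrier (C (2 * n))" by (rule B_in_C)
  have "cnorm (C (Suc (Suc (2 * n)))) (ptC (Suc (2 * n)) (ptC (2 * n) b)) \<le> cnorm (C (2 * n)) b"
    using phi_tilde_C_contr[OF star_homD(1)[OF phi_tilde_C_hom bC]] phi_tilde_C_contr[OF bC] by simp
  then show "cnorm (B (2 * Suc n)) (phi_B \<sigma> P n b) \<le> cnorm (B (2 * n)) b"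
    using b by (simp add: cnorm_B phi_B_def)
qed

definition corner_map :: "nat \<Rightarrow> 'a lelem \<Rightarrow> (nat \<Rightarrow> 'a lelem) set" where
  "corner_map n = restrict (to_C (2 * n)) (acarrier (A (2 * n)))"

lemma corner_map_hom: "corner_map n \<in> star_hom (A (2 * n)) (B (2 * n))"
  unfolding corner_map_def A_corner B_corner
  by (rule corner_hom[OF range_sum_projection C_projection to_C_hom HOL.refl])

lemma corner_map_comm:
  assumes "a \<in> acarrier (A (2 * n))"
  shows "corner_map (Suc n) (phi_A \<sigma> P n a) = phi_B \<sigma> P n (corner_map n a)"
proof -
  have a: "a \<in> acarrier (L (2 * n))" by (rule A_in_L[OF assms])
  have "phi_A \<sigma> P n a \<in> acarrier (A (2 * Suc n))" by (rule star_homD(1)[OF phi_A_hom assms])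
  moreover have "corner_map n a \<in> acarrier (B (2 * n))" by (rule star_homD(1)[OF corner_map_hom assms])
  ultimately show ?thesis
    using assms a by (simp add: corner_map_def phi_A_def phi_B_def phi_tilde_C_j star_homD(1)[OF phi_tilde_hom])
qed

interpretation AS: star_system "\<lambda>n. A (2 * n)" "phi_A \<sigma> P" by (rule A_system)
interpretation BS: cstar_system "\<lambda>n. B (2 * n)" "phi_B \<sigma> P" by (rule B_system)

lemma A_inf_alg: "star_algebra (A_inf \<sigma> P)"
  unfolding A_inf_def by (rule AS.lim_star_algebra)

lemma B_inf_completion: "B_inf \<sigma> P = completion BS.DL BS.LN"
  by (simp add: B_inf_def cstar_lim_def)

lemma B_inf_cstar: "cstar_algebra (B_inf \<sigma> P)"
  unfolding B_inf_completion by (rule cstar_seminormed.completion_cstar_algebra[OF BS.lim_seminormed])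

lemma to_B_inf_eq: "to_B_inf \<sigma> P n b = to_completion BS.DL BS.LN (BS.\<iota> n b)"
  by (simp add: to_B_inf_def to_cstar_lim_def)

lemma A_inf_carrier: "acarrier (A_inf \<sigma> P) = {to_A_inf \<sigma> P n a | n a. a \<in> acarrier (A (2 * n))}"
  unfolding A_inf_def to_A_inf_def by (rule AS.lim_carrier)

lemma A_to_B_spec:
  shows A_to_B_hom: "A_to_B \<sigma> P \<in> star_hom (A_inf \<sigma> P) (B_inf \<sigma> P)"
    and A_to_B_j: "a \<in> acarrier (A (2 * n)) \<Longrightarrow> A_to_B \<sigma> P (to_A_inf \<sigma> P n a) = to_B_inf \<sigma> P n (corner_map n a)"
proof -
  let ?Q = "\<lambda>h. h \<in> star_hom (A_inf \<sigma> P) (B_inf \<sigma> P) \<and>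
     (\<forall>n. \<forall>a\<in>acarrier (A (2*n)). h (to_A_inf \<sigma> P n a) = to_B_inf \<sigma> P n (j (2*n) a))"
  have "\<exists>h\<in>star_hom AS.DL BS.DL. \<forall>n. \<forall>a\<in>acarrier (A (2 * n)). h (AS.\<iota> n a) = BS.\<iota> n (corner_map n a)"
    by (rule lim_functorial[OF A_system BS.star_system_axioms corner_map_hom corner_map_comm])
  then obtain h where h: "h \<in> star_hom AS.DL BS.DL"
    and h_eq: "\<And>n a. a \<in> acarrier (A (2 * n)) \<Longrightarrow> h (AS.\<iota> n a) = BS.\<iota> n (corner_map n a)" by auto
  define k where "k = restrict (restrict (to_completion BS.DL BS.LN) (acarrier BS.DL) \<circ> h) (acarrier AS.DL)"
  have k1: "k \<in> star_hom (A_inf \<sigma> P) (B_inf \<sigma> P)"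
    unfolding A_inf_def B_inf_completion k_def
    by (rule star_hom_comp[OF h cstar_seminormed.to_completion_hom[OF BS.lim_seminormed] AS.lim_star_algebra])
  have k2: "k (to_A_inf \<sigma> P n a) = to_B_inf \<sigma> P n (corner_map n a)" if a: "a \<in> acarrier (A (2 * n))" for n a
    using a h_eq[OF a] star_homD(1)[OF corner_map_hom a] by (simp add: k_def to_A_inf_def to_B_inf_eq)
  have gj: "j (2 * n) a = corner_map n a" if "a \<in> acarrier (A (2 * n))" for n a
    using that by (simp add: corner_map_def to_C_def A_in_L)
  have Qk: "?Q k" by (intro conjI allI ballI k1) (simp only: k2 gj)
  have uniq: "h' = k" if Q: "?Q h'" for h'
  proof (rule star_hom_eqI[OF conjunct1[OF Q] k1])
    fix x assume "x \<in> acarrier (A_inf \<sigma> P)"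
    then obtain n a where x: "x = to_A_inf \<sigma> P n a" "a \<in> acarrier (A (2 * n))"
      unfolding A_inf_carrier by blast
    show "h' x = k x" unfolding x(1) using conjunct2[OF Q] x(2) by (simp only: k2 gj)
  qed
  have eq: "A_to_B \<sigma> P = k" unfolding A_to_B_def by (rule the_equality[of ?Q, OF Qk uniq])
  show "A_to_B \<sigma> P \<in> star_hom (A_inf \<sigma> P) (B_inf \<sigma> P)" unfolding eq by (rule k1)
  show "a \<in> acarrier (A (2 * n)) \<Longrightarrow> A_to_B \<sigma> P (to_A_inf \<sigma> P n a) = to_B_inf \<sigma> P n (corner_map n a)"
    unfolding eq by (rule k2)
qed

lemma corner_map_dense: "dense_image (A (2 * n)) (corner_map n) (B (2 * n))"
proof -
  have "dense_image (A (2 * n)) (to_C (2 * n)) (B (2 * n))"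
    unfolding A_corner B_corner by (rule corner_dense[OF range_sum_projection C_cstar to_C_hom to_C_dense])
  then show ?thesis by (simp add: dense_image_def corner_map_def)
qed

lemma A_to_B_dense: "dense_image (A_inf \<sigma> P) (A_to_B \<sigma> P) (B_inf \<sigma> P)"
  unfolding dense_image_def
proof (intro ballI allI impI)
  fix b and e :: real assume b: "b \<in> acarrier (B_inf \<sigma> P)" and e: "e > 0"
  interpret BI: cstar_algebra "B_inf \<sigma> P" by (rule B_inf_cstar)
  interpret BL: cstar_seminormed BS.DL BS.LN by (rule BS.lim_seminormed)
  let ?N = "cnorm (B_inf \<sigma> P)" and ?c = "to_completion BS.DL BS.LN"
  obtain x where x: "x \<in> acarrier BS.DL" "?N (b \<ominus>\<^bsub>B_inf \<sigma> P\<^esub> ?c x) < e / 2"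
    using BL.completion_dense[of b "e / 2"] b e unfolding B_inf_completion by auto
  obtain n y where y: "y \<in> acarrier (B (2 * n))" "x = BS.\<iota> n y" using x(1) by (auto simp: BS.lim_carrier)
  obtain a where a: "a \<in> acarrier (A (2 * n))" "cnorm (B (2 * n)) (y \<ominus>\<^bsub>B (2 * n)\<^esub> corner_map n a) < e / 2"
    using corner_map_dense[of n] y(1) e unfolding dense_image_def by (meson half_gt_zero)
  have ga: "corner_map n a \<in> acarrier (B (2 * n))" by (rule star_homD(1)[OF corner_map_hom a(1)])
  interpret Bn: star_algebra "B (2 * n)" by (rule B_alg)
  have in_BI: "?c x \<in> acarrier (B_inf \<sigma> P)" "?c (BS.\<iota> n (corner_map n a)) \<in> acarrier (B_inf \<sigma> P)"
    unfolding B_inf_completion using BL.to_completion_in x(1) ga by auto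
  have "?N (?c x \<ominus>\<^bsub>B_inf \<sigma> P\<^esub> ?c (BS.\<iota> n (corner_map n a))) = BS.LN (x \<ominus>\<^bsub>BS.DL\<^esub> BS.\<iota> n (corner_map n a))"
    using star_hom_sub[OF BL.to_completion_hom BL.star_algebra_axioms x(1), of "BS.\<iota> n (corner_map n a)"]
      BL.cnorm_to_completion[of "x \<ominus>\<^bsub>BS.DL\<^esub> BS.\<iota> n (corner_map n a)"] x(1) ga
    unfolding B_inf_completion by simp
  also have "x \<ominus>\<^bsub>BS.DL\<^esub> BS.\<iota> n (corner_map n a) = BS.\<iota> n (y \<ominus>\<^bsub>B (2 * n)\<^esub> corner_map n a)"
    using star_hom_sub[OF BS.\<iota>_hom B_alg y(1) ga] y ga by simp
  also have "BS.LN \<dots> \<le> cnorm (B (2 * n)) (y \<ominus>\<^bsub>B (2 * n)\<^esub> corner_map n a)"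
    by (rule BS.lim_norm_le) (use y ga in simp)
  finally have "?N (?c x \<ominus>\<^bsub>B_inf \<sigma> P\<^esub> ?c (BS.\<iota> n (corner_map n a))) < e / 2" using a(2) by simp
  then have "?N (b \<ominus>\<^bsub>B_inf \<sigma> P\<^esub> ?c (BS.\<iota> n (corner_map n a))) < e"
    using BI.p_triangle[OF b in_BI] x(2) by simp
  moreover have "A_to_B \<sigma> P (to_A_inf \<sigma> P n a) = ?c (BS.\<iota> n (corner_map n a))"
    using A_to_B_j[OF a(1)] by (simp add: to_B_inf_eq)
  ultimately show "\<exists>a\<in>acarrier (A_inf \<sigma> P). ?N (b \<ominus>\<^bsub>B_inf \<sigma> P\<^esub> A_to_B \<sigma> P a) < e"
    using a(1) by (intro bexI[of _ "to_A_inf \<sigma> P n a"]) (auto simp: A_inf_carrier)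
qed

text \<open>
  The seminorm that \<open>B_inf\<close> induces on \<open>A_inf\<close>, in terms of the norms of the \<open>C\<^sub>2\<^sub>k\<close>.
\<close>

lemma A_to_B_norm:
  assumes a: "a \<in> acarrier (A (2 * n))"
  shows "(\<lambda>k. EN (2 * k) (transit (phi_A \<sigma> P) n k a)) \<longlonglongrightarrow> cnorm (B_inf \<sigma> P) (A_to_B \<sigma> P (to_A_inf \<sigma> P n a))"
proof -
  interpret BL: cstar_seminormed BS.DL BS.LN by (rule BS.lim_seminormed)
  have ga: "corner_map n a \<in> acarrier (B (2 * n))" by (rule star_homD(1)[OF corner_map_hom a])
  have "cnorm (B_inf \<sigma> P) (A_to_B \<sigma> P (to_A_inf \<sigma> P n a)) = BS.LN (BS.\<iota> n (corner_map n a))"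
    using A_to_B_j[OF a] BL.cnorm_to_completion[of "BS.\<iota> n (corner_map n a)"] ga
    unfolding to_B_inf_eq B_inf_completion by simp
  moreover have "(\<lambda>k. EN (2 * k) (transit (phi_A \<sigma> P) n k a)) \<longlonglongrightarrow> BS.LN (BS.\<iota> n (corner_map n a))"
  proof (rule Lim_transform_eventually[OF BS.lim_norm_tendsto[OF ga]])
    have step: "transit (phi_B \<sigma> P) n k (corner_map n a) = corner_map k (transit (phi_A \<sigma> P) n k a)" if "n \<le> k" for k
      using that
    proof (induction k rule: dec_induct)
      case (step k)
      then show ?case using corner_map_comm[OF AS.T_in[OF a, of k]] by simp
    qed simp
    show "\<forall>\<^sub>F k in sequentially. cnorm (B (2 * k)) (transit (phi_B \<sigma> P) n k (corner_map n a)) = EN (2 * k) (transit (phi_A \<sigma> P) n k a)"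
      using eventually_ge_at_top[of n]
    proof eventually_elim
      case (elim k)
      have "transit (phi_A \<sigma> P) n k a \<in> acarrier (A (2 * k))" by (rule AS.T_in[OF a elim])
      then show ?case using step[OF elim] by (simp add: cnorm_B corner_map_def to_C_norm A_in_L)
    qed
  qed
  ultimately show ?thesis by simp
qed

definition unit_inf :: "(nat \<times> 'a lelem) set" where "unit_inf = to_A_inf \<sigma> P 0 (range_sum 0)"

lemma A_inf_unit:
  "unit_inf \<in> acarrier (A_inf \<sigma> P)"
  "x \<in> acarrier (A_inf \<sigma> P) \<Longrightarrow> unit_inf \<otimes>\<^bsub>A_inf \<sigma> P\<^esub> x = x"
  "x \<in> acarrier (A_inf \<sigma> P) \<Longrightarrow> x \<otimes>\<^bsub>A_inf \<sigma> P\<^esub> unit_inf = x"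
proof -
  have u: "range_sum (2 * n) \<in> acarrier (A (2 * n))"
    "a \<in> acarrier (A (2 * n)) \<Longrightarrow> range_sum (2 * n) \<otimes>\<^bsub>A (2 * n)\<^esub> a = a"
    "a \<in> acarrier (A (2 * n)) \<Longrightarrow> a \<otimes>\<^bsub>A (2 * n)\<^esub> range_sum (2 * n) = a" for n a
    unfolding A_corner using star_projection.p_corner[OF range_sum_projection]
    by (auto simp: star_projection.corner_iff[OF range_sum_projection])
  have s: "phi_A \<sigma> P n (range_sum (2 * n)) = range_sum (2 * Suc n)" for n
    using u(1)[of n] by (simp add: phi_A_def phi_tilde_top_sum)
  show "unit_inf \<in> acarrier (A_inf \<sigma> P)"
    unfolding unit_inf_def A_inf_carrier using u(1)[of 0] by force
  note un = AS.lim_unital[of "\<lambda>n. range_sum (2 * n)", OF u s, folded A_inf_def to_A_inf_def]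
  show "x \<in> acarrier (A_inf \<sigma> P) \<Longrightarrow> unit_inf \<otimes>\<^bsub>A_inf \<sigma> P\<^esub> x = x"
    "x \<in> acarrier (A_inf \<sigma> P) \<Longrightarrow> x \<otimes>\<^bsub>A_inf \<sigma> P\<^esub> unit_inf = x"
    unfolding unit_inf_def using un by simp_all
qed

end


section \<open>Operators on finitely supported functions\<close>

text \<open>
  Operators on an infinite-dimensional Hilbert space are replaced by operators on the dense subspace of
  finitely supported functions, with their norm for the \<open>\<ell>\<^sup>2\<close>-norm. This needs no completion and no
  square-summable functions.
\<close>

definition fs :: "('i \<Rightarrow> complex) set" where "fs = {v. finite {i. v i \<noteq> 0}}"

definition ip :: "('i \<Rightarrow> complex) \<Rightarrow> ('i \<Rightarrow> complex) \<Rightarrow> complex" where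
  "ip u v = (\<Sum>i | u i \<noteq> 0 \<and> v i \<noteq> 0. cnj (u i) * v i)"

definition nrm :: "('i \<Rightarrow> complex) \<Rightarrow> real" where
  "nrm v = sqrt (\<Sum>i | v i \<noteq> 0. (cmod (v i))\<^sup>2)"

definition delta :: "'i \<Rightarrow> 'i \<Rightarrow> complex" where "delta j i = (if i = j then 1 else 0)"

lemma ip_eq_sum: "finite F \<Longrightarrow> {i. u i \<noteq> 0 \<and> v i \<noteq> 0} \<subseteq> F \<Longrightarrow> ip u v = (\<Sum>i\<in>F. cnj (u i) * v i)"
  unfolding ip_def by (rule sum.mono_neutral_left) auto

lemma nrm_eq_L2: "finite F \<Longrightarrow> {i. v i \<noteq> 0} \<subseteq> F \<Longrightarrow> nrm v = L2_set (\<lambda>i. cmod (v i)) F"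
  unfolding nrm_def L2_set_def by (rule arg_cong[where f = sqrt], rule sum.mono_neutral_left) auto

lemma fsD: "v \<in> fs \<Longrightarrow> finite {i. v i \<noteq> 0}"
  by (simp add: fs_def)

lemma fs_add [simp]: "u \<in> fs \<Longrightarrow> v \<in> fs \<Longrightarrow> (\<lambda>i. u i + v i) \<in> fs"
  unfolding fs_def by (auto intro: finite_subset[of _ "{i. u i \<noteq> 0} \<union> {i. v i \<noteq> 0}"])

lemma fs_scale [simp]: "v \<in> fs \<Longrightarrow> (\<lambda>i. c * v i) \<in> fs"
  unfolding fs_def by (auto intro: finite_subset[of _ "{i. v i \<noteq> 0}"])

lemma fs_delta [simp]: "delta j \<in> fs"
  unfolding fs_def delta_def by simp

lemma fs_zero [simp]: "(\<lambda>_. 0) \<in> fs"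
  by (simp add: fs_def)

lemma nrm_nonneg [simp]: "0 \<le> nrm v"
  by (simp add: nrm_def sum_nonneg)

lemma nrm_zero [simp]: "nrm (\<lambda>_. 0) = 0"
  by (simp add: nrm_def)

lemma nrm_sq: "v \<in> fs \<Longrightarrow> (nrm v)\<^sup>2 = (\<Sum>i | v i \<noteq> 0. (cmod (v i))\<^sup>2)"
  by (simp add: nrm_def sum_nonneg)

lemma ip_self: "v \<in> fs \<Longrightarrow> ip v v = of_real ((nrm v)\<^sup>2)"
  unfolding nrm_sq ip_def of_real_sum by (rule sum.cong) (auto simp: complex_norm_square mult.commute simp del: of_real_power)

lemma ip_sym: "ip u v = cnj (ip v u)"
  unfolding ip_def cnj_sum by (rule sum.cong) auto

lemma ip_CS: assumes "u \<in> fs" "v \<in> fs" shows "cmod (ip u v) \<le> nrm u * nrm v"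
proof -
  let ?F = "{i. u i \<noteq> 0} \<union> {i. v i \<noteq> 0}"
  have F: "finite ?F" using assms by (simp add: fs_def)
  have "cmod (ip u v) = cmod (\<Sum>i\<in>?F. cnj (u i) * v i)" by (subst ip_eq_sum[OF F]) auto
  also have "\<dots> \<le> (\<Sum>i\<in>?F. \<bar>cmod (u i)\<bar> * \<bar>cmod (v i)\<bar>)"
    by (rule order_trans[OF norm_sum]) (simp add: norm_mult)
  also have "\<dots> \<le> L2_set (\<lambda>i. cmod (u i)) ?F * L2_set (\<lambda>i. cmod (v i)) ?F"
    by (rule L2_set_mult_ineq)
  also have "\<dots> = nrm u * nrm v" using nrm_eq_L2[OF F, of u] nrm_eq_L2[OF F, of v] by simp
  finally show ?thesis .
qed

lemma nrm_add: assumes "u \<in> fs" "v \<in> fs" shows "nrm (\<lambda>i. u i + v i) \<le> nrm u + nrm v"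
proof -
  let ?F = "{i. u i \<noteq> 0} \<union> {i. v i \<noteq> 0}"
  have F: "finite ?F" using assms by (simp add: fs_def)
  have "nrm (\<lambda>i. u i + v i) = L2_set (\<lambda>i. cmod (u i + v i)) ?F"
    by (rule nrm_eq_L2[OF F]) auto
  also have "\<dots> \<le> L2_set (\<lambda>i. cmod (u i) + cmod (v i)) ?F"
    by (rule L2_set_mono) (auto simp: norm_triangle_ineq)
  also have "\<dots> \<le> L2_set (\<lambda>i. cmod (u i)) ?F + L2_set (\<lambda>i. cmod (v i)) ?F"
    by (rule L2_set_triangle_ineq)
  also have "\<dots> = nrm u + nrm v" using nrm_eq_L2[OF F, of u] nrm_eq_L2[OF F, of v] by simp
  finally show ?thesis .
qed

lemma nrm_scale: assumes "v \<in> fs" shows "nrm (\<lambda>i. c * v i) = cmod c * nrm v"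
proof -
  have F: "finite {i. v i \<noteq> 0}" using assms by (rule fsD)
  have "nrm (\<lambda>i. c * v i) = L2_set (\<lambda>i. cmod c * cmod (v i)) {i. v i \<noteq> 0}"
    by (subst nrm_eq_L2[OF F]) (auto simp: norm_mult)
  also have "\<dots> = cmod c * L2_set (\<lambda>i. cmod (v i)) {i. v i \<noteq> 0}"
    by (simp add: L2_set_right_distrib)
  finally show ?thesis using nrm_eq_L2[OF F, of v] by simp
qed

lemma nrm_delta [simp]: "nrm (delta j) = 1"
  by (subst nrm_eq_L2[of "{j}"]) (auto simp: delta_def)

lemma ip_delta_left: "ip (delta i) v = v i"
  by (subst ip_eq_sum[of "{i}"]) (auto simp: delta_def split: if_splits)

lemma ip_delta_right: "ip v (delta i) = cnj (v i)"
  by (subst ip_sym) (simp add: ip_delta_left)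

lemma entry_le_nrm: "v \<in> fs \<Longrightarrow> cmod (v i) \<le> nrm v"
  using ip_CS[of "delta i" v] by (simp add: ip_delta_left)


subsection \<open>The algebra of adjointable bounded operators\<close>

type_synonym 'i vec_op = "('i \<Rightarrow> complex) \<Rightarrow> 'i \<Rightarrow> complex"

definition lin_op :: "'i vec_op \<Rightarrow> bool" where
  "lin_op T \<longleftrightarrow> (\<forall>u v. T (\<lambda>i. u i + v i) = (\<lambda>i. T u i + T v i)) \<and> (\<forall>c v. T (\<lambda>i. c * v i) = (\<lambda>i. c * T v i))"

definition adj_pair :: "'i vec_op \<Rightarrow> 'i vec_op \<Rightarrow> bool" where
  "adj_pair T T' \<longleftrightarrow> lin_op T \<and> lin_op T' \<and> (\<forall>v\<in>fs. T v \<in> fs \<and> T' v \<in> fs) \<and>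
     (\<forall>u\<in>fs. \<forall>v\<in>fs. ip u (T v) = ip (T' u) v) \<and> (\<exists>K\<ge>0. \<forall>v\<in>fs. nrm (T v) \<le> K * nrm v)"

text \<open>
  An adjoint need not exist on finitely supported functions, and outside of them an operator is not
  controlled by its norm. Therefore an element is a pair of an operator and its adjoint, which makes the
  involution the swap. The pairs are closed under the operations and satisfy the axioms as pairs of
  functions, without identifying operators that agree on finitely supported functions.
\<close>

definition op_alg :: "('i vec_op \<times> 'i vec_op) star_alg" where
  "op_alg = \<lparr> acarrier = {(T, T'). adj_pair T T'},
     azero = (\<lambda>_ _. 0, \<lambda>_ _. 0),
     aadd = (\<lambda>(T, T') (U, U'). (\<lambda>v i. T v i + U v i, \<lambda>v i. T' v i + U' v i)),
     amul = (\<lambda>(T, T') (U, U'). (T \<circ> U, U' \<circ> T')),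
     ascale = (\<lambda>c (T, T'). (\<lambda>v i. c * T v i, \<lambda>v i. cnj c * T' v i)),
     astar = (\<lambda>(T, T'). (T', T))\<rparr>"

definition opnorm :: "('i vec_op \<times> 'i vec_op) \<Rightarrow> real" where
  "opnorm T = Inf {K. 0 \<le> K \<and> (\<forall>v\<in>fs. nrm (fst T v) \<le> K * nrm v)}"

lemma adj_pairD:
  assumes "adj_pair T T'"
  shows "lin_op T" "lin_op T'" "v \<in> fs \<Longrightarrow> T v \<in> fs" "v \<in> fs \<Longrightarrow> T' v \<in> fs"
    "u \<in> fs \<Longrightarrow> v \<in> fs \<Longrightarrow> ip u (T v) = ip (T' u) v" "\<exists>K\<ge>0. \<forall>v\<in>fs. nrm (T v) \<le> K * nrm v"
  using assms unfolding adj_pair_def by blast+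

lemma lin_opD: "lin_op T \<Longrightarrow> T (\<lambda>i. u i + v i) = (\<lambda>i. T u i + T v i)" "lin_op T \<Longrightarrow> T (\<lambda>i. c * v i) = (\<lambda>i. c * T v i)"
  by (simp_all add: lin_op_def)

lemma lin_op_zero: "lin_op T \<Longrightarrow> T (\<lambda>_. 0) = (\<lambda>_. 0)"
  using lin_opD(2)[of T 0 "\<lambda>_. 0"] by simp

lemma ip_add_right: assumes "u \<in> fs" "v \<in> fs" "w \<in> fs" shows "ip w (\<lambda>i. u i + v i) = ip w u + ip w v"
proof -
  have F: "finite {i. w i \<noteq> 0}" using assms by (simp add: fs_def)
  show ?thesis
    using ip_eq_sum[OF F, of w "\<lambda>i. u i + v i"] ip_eq_sum[OF F, of w u] ip_eq_sum[OF F, of w v]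
    by (simp add: distrib_left sum.distrib Collect_mono_iff)
qed

lemma ip_add_left: assumes "u \<in> fs" "v \<in> fs" "w \<in> fs" shows "ip (\<lambda>i. u i + v i) w = ip u w + ip v w"
  using ip_add_right[OF assms] ip_sym[of "\<lambda>i. u i + v i" w] ip_sym[of u w] ip_sym[of v w] by simp

lemma ip_scale_right: assumes "v \<in> fs" shows "ip w (\<lambda>i. c * v i) = c * ip w v"
proof -
  have F: "finite {i. v i \<noteq> 0}" using assms by (simp add: fs_def)
  show ?thesis
    using ip_eq_sum[OF F, of w "\<lambda>i. c * v i"] ip_eq_sum[OF F, of w v]
    by (simp add: sum_distrib_left Collect_mono_iff algebra_simps)
qed

lemma ip_scale_left: assumes "v \<in> fs" shows "ip (\<lambda>i. c * v i) w = cnj c * ip v w"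
  using ip_scale_right[OF assms, of w c] ip_sym[of "\<lambda>i. c * v i" w] ip_sym[of v w] by simp

lemma adj_pair_swap_bound:
  assumes "adj_pair T T'" "K \<ge> 0" "\<forall>v\<in>fs. nrm (T v) \<le> K * nrm v" "u \<in> fs"
  shows "nrm (T' u) \<le> K * nrm u"
proof (cases "nrm (T' u) = 0")
  case False
  note D = adj_pairD[OF assms(1)]
  have "complex_of_real ((nrm (T' u))\<^sup>2) = ip u (T (T' u))"
    using ip_self[OF D(4)[OF assms(4)]] D(5)[OF assms(4) D(4)[OF assms(4)]] by simp
  then have "(nrm (T' u))\<^sup>2 = cmod (ip u (T (T' u)))"
    by (metis norm_of_real abs_of_nonneg zero_le_power2)
  also have "\<dots> \<le> nrm u * nrm (T (T' u))" by (rule ip_CS[OF assms(4) D(3)[OF D(4)[OF assms(4)]]])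
  also have "\<dots> \<le> nrm u * (K * nrm (T' u))"
    using assms(3) D(4)[OF assms(4)] by (intro mult_left_mono) auto
  finally have "nrm (T' u) * nrm (T' u) \<le> (K * nrm u) * nrm (T' u)" by (simp add: power2_eq_square algebra_simps)
  then show ?thesis using False nrm_nonneg[of "T' u"] by (metis less_eq_real_def mult_le_cancel_right_pos)
qed (use assms in simp)

lemma adj_pair_swap: assumes "adj_pair T T'" shows "adj_pair T' T"
proof -
  note D = adj_pairD[OF assms]
  have "ip u (T' v) = ip (T u) v" if "u \<in> fs" "v \<in> fs" for u v
    using D(5)[OF that(2,1)] ip_sym[of u "T' v"] ip_sym[of "T u" v] by simp
  then show ?thesis using D adj_pair_swap_bound[OF assms] unfolding adj_pair_def by blast
qed

lemma adj_pair_zero: "adj_pair (\<lambda>_ _. 0) (\<lambda>_ _. 0)"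
  by (auto simp: adj_pair_def lin_op_def ip_def)

lemma adj_pair_add: assumes "adj_pair T T'" "adj_pair U U'"
  shows "adj_pair (\<lambda>v i. T v i + U v i) (\<lambda>v i. T' v i + U' v i)"
proof -
  note D = adj_pairD[OF assms(1)] and E = adj_pairD[OF assms(2)]
  obtain K L where K: "K \<ge> 0" "\<forall>v\<in>fs. nrm (T v) \<le> K * nrm v" and L: "L \<ge> 0" "\<forall>v\<in>fs. nrm (U v) \<le> L * nrm v"
    using D(6) E(6) by blast
  have "nrm (\<lambda>i. T v i + U v i) \<le> (K + L) * nrm v" if "v \<in> fs" for v
    using nrm_add[OF D(3)[OF that] E(3)[OF that]] K(2) L(2) that by (fastforce simp: distrib_right)
  then have "\<exists>K\<ge>0. \<forall>v\<in>fs. nrm (\<lambda>i. T v i + U v i) \<le> K * nrm v" using K(1) L(1) by (intro exI[of _ "K + L"]) simp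
  moreover have "lin_op (\<lambda>v i. T v i + U v i)" "lin_op (\<lambda>v i. T' v i + U' v i)"
    using D(1,2) E(1,2) by (auto simp: lin_op_def algebra_simps)
  ultimately show ?thesis
    using D(3-5) E(3-5) by (simp add: adj_pair_def ip_add_left ip_add_right)
qed

lemma adj_pair_scale: assumes "adj_pair T T'"
  shows "adj_pair (\<lambda>v i. c * T v i) (\<lambda>v i. cnj c * T' v i)"
proof -
  note D = adj_pairD[OF assms]
  obtain K where K: "K \<ge> 0" "\<forall>v\<in>fs. nrm (T v) \<le> K * nrm v" using D(6) by blast
  have "nrm (\<lambda>i. c * T v i) \<le> (cmod c * K) * nrm v" if "v \<in> fs" for v
    using nrm_scale[OF D(3)[OF that]] K(2) that by (simp add: mult.assoc mult_left_mono)
  then have "\<exists>K\<ge>0. \<forall>v\<in>fs. nrm (\<lambda>i. c * T v i) \<le> K * nrm v" using K(1) by (intro exI[of _ "cmod c * K"]) simp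
  moreover have "lin_op (\<lambda>v i. c * T v i)" "lin_op (\<lambda>v i. cnj c * T' v i)"
    using D(1,2) by (auto simp: lin_op_def algebra_simps)
  ultimately show ?thesis
    using D(3-5) by (simp add: adj_pair_def ip_scale_left ip_scale_right)
qed

lemma adj_pair_comp: assumes "adj_pair T T'" "adj_pair U U'"
  shows "adj_pair (T \<circ> U) (U' \<circ> T')"
proof -
  note D = adj_pairD[OF assms(1)] and E = adj_pairD[OF assms(2)]
  obtain K L where K: "K \<ge> 0" "\<forall>v\<in>fs. nrm (T v) \<le> K * nrm v" and L: "L \<ge> 0" "\<forall>v\<in>fs. nrm (U v) \<le> L * nrm v"
    using D(6) E(6) by blast
  have "nrm (T (U v)) \<le> (K * L) * nrm v" if "v \<in> fs" for v
  proof -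
    have "nrm (T (U v)) \<le> K * nrm (U v)" using K(2) E(3)[OF that] by blast
    also have "\<dots> \<le> K * (L * nrm v)" using L(2) K(1) that by (intro mult_left_mono) auto
    finally show ?thesis by simp
  qed
  then have "\<exists>K\<ge>0. \<forall>v\<in>fs. nrm ((T \<circ> U) v) \<le> K * nrm v" using K(1) L(1) by (intro exI[of _ "K * L"]) simp
  moreover have "lin_op (T \<circ> U)" "lin_op (U' \<circ> T')"
    using D(1,2) E(1,2) by (auto simp: lin_op_def)
  ultimately show ?thesis
    using D(3-5) E(3-5) by (simp add: adj_pair_def)
qed

lemma op_alg_sel: "acarrier op_alg = {(T, T'). adj_pair T T'}" "azero op_alg = (\<lambda>_ _. 0, \<lambda>_ _. 0)"
  "aadd op_alg (T, T') (U, U') = (\<lambda>v i. T v i + U v i, \<lambda>v i. T' v i + U' v i)"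
  "amul op_alg (T, T') (U, U') = (T \<circ> U, U' \<circ> T')"
  "ascale op_alg c (T, T') = (\<lambda>v i. c * T v i, \<lambda>v i. cnj c * T' v i)"
  "astar op_alg (T, T') = (T', T)"
  by (simp_all add: op_alg_def)

lemma op_alg_closed:
  "\<zero>\<^bsub>op_alg\<^esub> \<in> acarrier op_alg"
  "S \<in> acarrier op_alg \<Longrightarrow> T \<in> acarrier op_alg \<Longrightarrow> S \<oplus>\<^bsub>op_alg\<^esub> T \<in> acarrier op_alg"
  "S \<in> acarrier op_alg \<Longrightarrow> T \<in> acarrier op_alg \<Longrightarrow> S \<otimes>\<^bsub>op_alg\<^esub> T \<in> acarrier op_alg"
  "S \<in> acarrier op_alg \<Longrightarrow> c \<cdot>\<^bsub>op_alg\<^esub> S \<in> acarrier op_alg"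
  "S \<in> acarrier op_alg \<Longrightarrow> star\<^bsub>op_alg\<^esub> S \<in> acarrier op_alg"
  by (auto simp: op_alg_sel adj_pair_zero intro: adj_pair_add adj_pair_comp adj_pair_scale adj_pair_swap)

lemma op_alg_star_algebra: "star_algebra op_alg"
  by (unfold_locales; (rule op_alg_closed; assumption)?; unfold op_alg_sel; clarsimp simp: op_alg_sel adj_pair_zero adj_pair_add adj_pair_scale
      adj_pair_comp adj_pair_swap fun_eq_iff algebra_simps lin_opD[OF adj_pairD(1)] lin_opD[OF adj_pairD(2)])

lemma opnorm_bound: assumes "T \<in> acarrier op_alg" "v \<in> fs" shows "nrm (fst T v) \<le> opnorm T * nrm v"
proof (cases "nrm v = 0")
  case True
  obtain K where "nrm (fst T v) \<le> K * nrm v" using assms adj_pairD(6) by (fastforce simp: op_alg_sel)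
  then show ?thesis using True by simp
next
  case False
  then have pos: "nrm v > 0" using nrm_nonneg[of v] by linarith
  have "nrm (fst T v) / nrm v \<le> opnorm T"
    unfolding opnorm_def
  proof (rule cInf_greatest)
    show "{K. 0 \<le> K \<and> (\<forall>v\<in>fs. nrm (fst T v) \<le> K * nrm v)} \<noteq> {}"
      using assms(1) adj_pairD(6) by (fastforce simp: op_alg_sel)
    fix K assume "K \<in> {K. 0 \<le> K \<and> (\<forall>v\<in>fs. nrm (fst T v) \<le> K * nrm v)}"
    then show "nrm (fst T v) / nrm v \<le> K" using assms(2) pos by (auto simp: divide_le_eq)
  qed
  then show ?thesis using pos by (simp add: divide_le_eq)
qed

lemma opnorm_least: "K \<ge> 0 \<Longrightarrow> (\<And>v. v \<in> fs \<Longrightarrow> nrm (fst T v) \<le> K * nrm v) \<Longrightarrow> opnorm T \<le> K"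
  unfolding opnorm_def by (rule cInf_lower) (auto intro!: bdd_belowI[of _ 0])

lemma opnorm_nonneg: assumes "T \<in> acarrier op_alg" shows "0 \<le> opnorm T"
  unfolding opnorm_def
proof (rule cInf_greatest)
  show "{K. 0 \<le> K \<and> (\<forall>v\<in>fs. nrm (fst T v) \<le> K * nrm v)} \<noteq> {}"
    using assms(1) adj_pairD(6) by (fastforce simp: op_alg_sel)
qed auto

lemma opnorm_cstar_seminorm: "cstar_seminorm (op_alg :: ('i vec_op \<times> 'i vec_op) star_alg) opnorm"
proof -
  interpret star_algebra "op_alg :: ('i vec_op \<times> 'i vec_op) star_alg" by (rule op_alg_star_algebra)
  have mul: "opnorm (S \<otimes>\<^bsub>op_alg\<^esub> T) \<le> opnorm S * opnorm T"
    if ST: "S \<in> acarrier op_alg" "T \<in> acarrier op_alg" for S T :: "'i vec_op \<times> 'i vec_op"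
  proof (rule opnorm_least)
    show "0 \<le> opnorm S * opnorm T" by (intro mult_nonneg_nonneg opnorm_nonneg ST)
    fix v :: "'i \<Rightarrow> complex" assume v: "v \<in> fs"
    have Tv: "fst T v \<in> fs" using ST(2) adj_pairD(3) v by (fastforce simp: op_alg_sel)
    have "nrm (fst (S \<otimes>\<^bsub>op_alg\<^esub> T) v) = nrm (fst S (fst T v))" by (cases S; cases T) (simp add: op_alg_sel)
    also have "\<dots> \<le> opnorm S * nrm (fst T v)" by (rule opnorm_bound[OF ST(1) Tv])
    also have "\<dots> \<le> opnorm S * (opnorm T * nrm v)"
      by (rule mult_left_mono[OF opnorm_bound[OF ST(2) v] opnorm_nonneg[OF ST(1)]])
    finally show "nrm (fst (S \<otimes>\<^bsub>op_alg\<^esub> T) v) \<le> opnorm S * opnorm T * nrm v" by simp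
  qed
  have scale: "opnorm (c \<cdot>\<^bsub>op_alg\<^esub> T) \<le> cmod c * opnorm T" if T: "T \<in> acarrier op_alg" for c and T :: "'i vec_op \<times> 'i vec_op"
  proof (rule opnorm_least)
    show "0 \<le> cmod c * opnorm T" by (intro mult_nonneg_nonneg opnorm_nonneg T norm_ge_zero)
    fix v :: "'i \<Rightarrow> complex" assume v: "v \<in> fs"
    have Tv: "fst T v \<in> fs" using T adj_pairD(3) v by (fastforce simp: op_alg_sel)
    have "nrm (fst (c \<cdot>\<^bsub>op_alg\<^esub> T) v) = cmod c * nrm (fst T v)"
      using nrm_scale[OF Tv] by (cases T) (simp add: op_alg_sel)
    then show "nrm (fst (c \<cdot>\<^bsub>op_alg\<^esub> T) v) \<le> cmod c * opnorm T * nrm v"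
      using opnorm_bound[OF T v] by (simp add: mult.assoc mult_left_mono)
  qed
  show ?thesis
    unfolding cstar_seminorm_def
  proof (intro conjI ballI allI)
    fix S T :: "'i vec_op \<times> 'i vec_op" assume ST: "S \<in> acarrier op_alg" "T \<in> acarrier op_alg"
    show "0 \<le> opnorm S" by (rule opnorm_nonneg[OF ST(1)])
    show "opnorm (S \<otimes>\<^bsub>op_alg\<^esub> T) \<le> opnorm S * opnorm T" by (rule mul[OF ST])
    show "opnorm (S \<oplus>\<^bsub>op_alg\<^esub> T) \<le> opnorm S + opnorm T"
    proof (rule opnorm_least)
      show "0 \<le> opnorm S + opnorm T" by (intro add_nonneg_nonneg opnorm_nonneg ST)
      fix v :: "'i \<Rightarrow> complex" assume v: "v \<in> fs"
      have in_fs: "fst S v \<in> fs" "fst T v \<in> fs" using ST adj_pairD(3) v by (fastforce simp: op_alg_sel)+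
      have "nrm (fst (S \<oplus>\<^bsub>op_alg\<^esub> T) v) = nrm (\<lambda>i. fst S v i + fst T v i)"
        by (cases S; cases T) (simp add: op_alg_sel)
      also have "\<dots> \<le> nrm (fst S v) + nrm (fst T v)" by (rule nrm_add[OF in_fs])
      also have "\<dots> \<le> opnorm S * nrm v + opnorm T * nrm v"
        by (rule add_mono[OF opnorm_bound[OF ST(1) v] opnorm_bound[OF ST(2) v]])
      finally show "nrm (fst (S \<oplus>\<^bsub>op_alg\<^esub> T) v) \<le> (opnorm S + opnorm T) * nrm v" by (simp add: distrib_right)
    qed
  next
    fix c and T :: "'i vec_op \<times> 'i vec_op" assume T: "T \<in> acarrier op_alg"
    show "opnorm (c \<cdot>\<^bsub>op_alg\<^esub> T) = cmod c * opnorm T"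
    proof (cases "c = 0")
      case True
      then show ?thesis using scale[OF T, of 0] opnorm_nonneg[of "0 \<cdot>\<^bsub>op_alg\<^esub> T"] T by simp
    next
      case False
      have "opnorm T \<le> cmod (1 / c) * opnorm (c \<cdot>\<^bsub>op_alg\<^esub> T)"
        using scale[of "c \<cdot>\<^bsub>op_alg\<^esub> T" "1 / c"] T False by simp
      then show ?thesis using scale[OF T, of c] False by (simp add: norm_divide field_simps)
    qed
  next
    fix T :: "'i vec_op \<times> 'i vec_op" assume T: "T \<in> acarrier op_alg"
    obtain U U' where U: "T = (U, U')" "adj_pair U U'" using T by (auto simp: op_alg_sel)
    note D = adj_pairD[OF U(2)]
    have star_le: "opnorm (star\<^bsub>op_alg\<^esub> T) \<le> opnorm T"
      by (rule opnorm_least[OF opnorm_nonneg[OF T]])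
         (use adj_pair_swap_bound[OF U(2) opnorm_nonneg[OF T]] opnorm_bound[OF T] in \<open>auto simp: U op_alg_sel\<close>)
    show "opnorm (star\<^bsub>op_alg\<^esub> T \<otimes>\<^bsub>op_alg\<^esub> T) = (opnorm T)\<^sup>2"
    proof (rule antisym)
      have "opnorm (star\<^bsub>op_alg\<^esub> T \<otimes>\<^bsub>op_alg\<^esub> T) \<le> opnorm (star\<^bsub>op_alg\<^esub> T) * opnorm T"
        by (rule mul) (use T in simp_all)
      also have "\<dots> \<le> opnorm T * opnorm T" by (rule mult_right_mono[OF star_le opnorm_nonneg[OF T]])
      finally show "opnorm (star\<^bsub>op_alg\<^esub> T \<otimes>\<^bsub>op_alg\<^esub> T) \<le> (opnorm T)\<^sup>2" by (simp add: power2_eq_square)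
      let ?M = "opnorm (star\<^bsub>op_alg\<^esub> T \<otimes>\<^bsub>op_alg\<^esub> T)"
      have TT: "star\<^bsub>op_alg\<^esub> T \<otimes>\<^bsub>op_alg\<^esub> T \<in> acarrier op_alg" using T by simp
      have M0: "0 \<le> ?M" by (rule opnorm_nonneg[OF TT])
      have "opnorm T \<le> sqrt ?M"
      proof (rule opnorm_least)
        fix v :: "'i \<Rightarrow> complex" assume v: "v \<in> fs"
        have "complex_of_real ((nrm (U v))\<^sup>2) = ip (U' (U v)) v"
          using ip_self[OF D(3)[OF v]] D(5)[OF D(3)[OF v] v] by simp
        then have "(nrm (U v))\<^sup>2 = cmod (ip (U' (U v)) v)"
          by (metis norm_of_real abs_of_nonneg zero_le_power2)
        also have "\<dots> \<le> nrm (U' (U v)) * nrm v" by (rule ip_CS[OF D(4)[OF D(3)[OF v]] v])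
        also have "\<dots> \<le> (?M * nrm v) * nrm v"
          using opnorm_bound[OF TT v] by (intro mult_right_mono) (auto simp: U op_alg_sel)
        also have "\<dots> = (sqrt ?M * nrm v)\<^sup>2" using M0 by (simp add: power_mult_distrib power2_eq_square)
        finally have "nrm (U v) \<le> sqrt ?M * nrm v" by (rule power2_le_imp_le) (use M0 in simp)
        then show "nrm (fst T v) \<le> sqrt ?M * nrm v" by (simp add: U)
      qed (use M0 in simp)
      then show "(opnorm T)\<^sup>2 \<le> ?M"
        using opnorm_nonneg[OF T] M0 by (metis power_mono real_sqrt_pow2)
    qed
  qed
qed


subsection \<open>Operators of partial injections\<close>

definition rop :: "('i \<times> 'i) set \<Rightarrow> 'i vec_op" where "rop r v i = (\<Sum>j\<in>r `` {i}. v j)"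

definition ropp :: "('i \<times> 'i) set \<Rightarrow> 'i vec_op \<times> 'i vec_op" where "ropp r = (rop r, rop (r\<inverse>))"

definition part_inj :: "('i \<times> 'i) set \<Rightarrow> bool" where
  "part_inj r \<longleftrightarrow> single_valued r \<and> single_valued (r\<inverse>)"

lemma part_inj_converse [simp]: "part_inj (r\<inverse>) \<longleftrightarrow> part_inj r"
  by (auto simp: part_inj_def)

lemma part_inj_Id_on [simp]: "part_inj (Id_on D)"
  by (auto simp: part_inj_def single_valued_def)

lemma part_inj_comp: "part_inj r \<Longrightarrow> part_inj s \<Longrightarrow> part_inj (r O s)"
  by (auto simp: part_inj_def single_valued_relcomp converse_relcomp)

lemma image_cases: assumes "part_inj r" obtains "r `` {i} = {}" | j where "r `` {i} = {j}" "(i, j) \<in> r"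
  using assms unfolding part_inj_def single_valued_def by blast

lemma image_single: "part_inj r \<Longrightarrow> (i, j) \<in> r \<Longrightarrow> r `` {i} = {j}"
  unfolding part_inj_def single_valued_def by blast

lemma rop_step: "part_inj r \<Longrightarrow> (i, j) \<in> r \<Longrightarrow> rop r v i = v j"
  by (simp add: rop_def image_single)

lemma rop_out: "i \<notin> Domain r \<Longrightarrow> rop r v i = 0"
proof -
  assume "i \<notin> Domain r"
  then have "r `` {i} = {}" by blast
  then show ?thesis by (simp add: rop_def)
qed

lemma rop_delta: "part_inj r \<Longrightarrow> rop r (delta j) i = (if (i, j) \<in> r then 1 else 0)"
  by (rule image_cases[of r i]) (auto simp: rop_def delta_def)

text \<open>
  The sums in the inner products and norms are carried into each other by the injection itself.
\<close>

lemma rop_adj_pair: assumes r: "part_inj r" shows "adj_pair (rop r) (rop (r\<inverse>))"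
proof -
  have lin: "lin_op (rop s)" for s :: "('i \<times> 'i) set"
    by (auto simp: lin_op_def rop_def sum.distrib sum_distrib_left)
  have img: "inj_on (\<lambda>i. THE j. (i, j) \<in> s) (Domain s)" "\<And>i j. (i, j) \<in> s \<Longrightarrow> (THE j. (i, j) \<in> s) = j"
    if s: "part_inj s" for s :: "('i \<times> 'i) set"
  proof -
    show *: "(THE j. (i, j) \<in> s) = j" if "(i, j) \<in> s" for i j
      using s that unfolding part_inj_def single_valued_def by blast
    show "inj_on (\<lambda>i. THE j. (i, j) \<in> s) (Domain s)"
    proof (rule inj_onI)
      fix a b assume "a \<in> Domain s" "b \<in> Domain s" "(THE j. (a, j) \<in> s) = (THE j. (b, j) \<in> s)"
      then obtain c where "(a, c) \<in> s" "(b, c) \<in> s" using * by fastforce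
      then show "a = b" using s unfolding part_inj_def single_valued_def by blast
    qed
  qed
  have supp: "{i. rop s v i \<noteq> 0} \<subseteq> s\<inverse> `` {j. v j \<noteq> 0}" if "part_inj s" for s :: "('i \<times> 'i) set" and v
  proof
    fix i assume "i \<in> {i. rop s v i \<noteq> 0}"
    then show "i \<in> s\<inverse> `` {j. v j \<noteq> 0}"
      by (cases rule: image_cases[OF that, of i]) (auto simp: rop_def)
  qed
  have fin: "finite (s `` F)" if "part_inj s" "finite F" for s :: "('i \<times> 'i) set" and F
  proof -
    have "s `` F = (\<Union>i\<in>F. s `` {i})" by blast
    moreover have "finite (s `` {i})" for i by (rule image_cases[OF that(1), of i]) auto
    ultimately show ?thesis using that(2) by simp
  qed
  have fs: "rop s v \<in> fs" if "part_inj s" "v \<in> fs" for s :: "('i \<times> 'i) set" and v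
    using finite_subset[OF supp[OF that(1)] fin[of "s\<inverse>" "{j. v j \<noteq> 0}"]] that by (simp add: fs_def)
  have adj: "ip u (rop r v) = ip (rop (r\<inverse>) u) v" if uv: "u \<in> fs" "v \<in> fs" for u v
  proof -
    let ?I = "{i. u i \<noteq> 0 \<and> rop r v i \<noteq> 0}" and ?J = "{j. rop (r\<inverse>) u j \<noteq> 0 \<and> v j \<noteq> 0}"
    let ?t = "\<lambda>i. THE j. (i, j) \<in> r"
    have I: "\<exists>j. (i, j) \<in> r \<and> rop r v i = v j" if "rop r v i \<noteq> 0" for i
      using that rop_out[of i r v] rop_step[OF r] by fastforce
    have J: "\<exists>i. (i, j) \<in> r \<and> rop (r\<inverse>) u j = u i" if "rop (r\<inverse>) u j \<noteq> 0" for j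
      using that rop_out[of j "r\<inverse>" u] rop_step[of "r\<inverse>" j] r by fastforce
    have im: "?t ` ?I = ?J"
    proof (intro set_eqI iffI)
      fix j assume "j \<in> ?t ` ?I"
      then obtain i where i: "u i \<noteq> 0" "rop r v i \<noteq> 0" "j = ?t i" by blast
      then obtain j' where j': "(i, j') \<in> r" "rop r v i = v j'" using I by blast
      then have "j = j'" using img(2)[OF r] i(3) by blast
      moreover have "rop (r\<inverse>) u j' = u i" using rop_step[of "r\<inverse>" j' i u] r j'(1) by simp
      ultimately show "j \<in> ?J" using i j' by simp
    next
      fix j assume "j \<in> ?J"
      then obtain i where i: "(i, j) \<in> r" "rop (r\<inverse>) u j = u i" "u i \<noteq> 0" "v j \<noteq> 0" using J by fastforce
      have "rop r v i = v j" by (rule rop_step[OF r i(1)])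
      then show "j \<in> ?t ` ?I" using i img(2)[OF r i(1)] by (intro image_eqI[of _ _ i]) auto
    qed
    have inj: "inj_on ?t ?I" by (rule inj_on_subset[OF img(1)[OF r]]) (use I in auto)
    have "ip (rop (r\<inverse>) u) v = (\<Sum>j\<in>?t ` ?I. cnj (rop (r\<inverse>) u j) * v j)" unfolding ip_def im ..
    also have "\<dots> = (\<Sum>i\<in>?I. cnj (rop (r\<inverse>) u (?t i)) * v (?t i))" by (simp add: sum.reindex[OF inj])
    also have "\<dots> = ip u (rop r v)"
      unfolding ip_def
    proof (rule sum.cong[OF HOL.refl])
      fix i assume "i \<in> ?I"
      then obtain j where j: "(i, j) \<in> r" "rop r v i = v j" using I by blast
      then show "cnj (rop (r\<inverse>) u (?t i)) * v (?t i) = cnj (u i) * rop r v i"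
        using img(2)[OF r j(1)] rop_step[of "r\<inverse>" j i u] r by simp
    qed
    finally show ?thesis by simp
  qed
  have bound: "nrm (rop r v) \<le> 1 * nrm v" if v: "v \<in> fs" for v
  proof -
    let ?I = "{i. rop r v i \<noteq> 0}" and ?t = "\<lambda>i. THE j. (i, j) \<in> r"
    have I: "\<exists>j. (i, j) \<in> r \<and> rop r v i = v j" if "rop r v i \<noteq> 0" for i
      using that rop_out[of i r v] rop_step[OF r] by fastforce
    have inj: "inj_on ?t ?I" by (rule inj_on_subset[OF img(1)[OF r]]) (use I in auto)
    have t: "v (?t i) = rop r v i" if "i \<in> ?I" for i
      using I[of i] that img(2)[OF r] by fastforce
    have "(\<Sum>i\<in>?I. (cmod (rop r v i))\<^sup>2) = (\<Sum>j\<in>?t ` ?I. (cmod (v j))\<^sup>2)"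
      by (simp add: sum.reindex[OF inj] t)
    also have "\<dots> \<le> (\<Sum>j | v j \<noteq> 0. (cmod (v j))\<^sup>2)"
      by (rule sum_mono2) (use v t in \<open>auto simp: fs_def\<close>)
    finally show ?thesis by (simp add: nrm_def)
  qed
  show ?thesis
    unfolding adj_pair_def using lin fs r adj bound by (auto intro!: exI[of _ 1])
qed

lemma ropp_in [simp]: "part_inj r \<Longrightarrow> ropp r \<in> acarrier op_alg"
  by (simp add: ropp_def op_alg_sel rop_adj_pair)

lemma ropp_star: "star\<^bsub>op_alg\<^esub> (ropp r) = ropp (r\<inverse>)"
  by (simp add: ropp_def op_alg_sel)

lemma rop_comp: assumes "part_inj r" "part_inj s" shows "rop r \<circ> rop s = rop (r O s)"
proof (intro ext)
  fix v i
  show "(rop r \<circ> rop s) v i = rop (r O s) v i"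
  proof (cases rule: image_cases[OF assms(1), of i])
    case 1
    then have "(r O s) `` {i} = {}" by blast
    with 1 show ?thesis by (simp add: rop_def)
  next
    case (2 j)
    then have "(r O s) `` {i} = s `` {j}" by (simp add: relcomp_Image)
    with 2 show ?thesis by (simp add: rop_def)
  qed
qed

lemma ropp_mul: "part_inj r \<Longrightarrow> part_inj s \<Longrightarrow> ropp r \<otimes>\<^bsub>op_alg\<^esub> ropp s = ropp (r O s)"
  by (simp add: ropp_def op_alg_sel rop_comp converse_relcomp)

lemma ropp_empty: "ropp {} = \<zero>\<^bsub>op_alg\<^esub>"
  by (simp add: ropp_def op_alg_sel rop_def fun_eq_iff)

lemma rop_Id_on: "rop (Id_on D) v i = (if i \<in> D then v i else 0)"
proof -
  have "Id_on D `` {i} = (if i \<in> D then {i} else {})" by auto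
  then show ?thesis by (simp add: rop_def)
qed

lemma ropp_sum:
  assumes "finite Y" "\<And>e f. e \<in> Y \<Longrightarrow> f \<in> Y \<Longrightarrow> e \<noteq> f \<Longrightarrow> D e \<inter> D f = {}"
  shows "asum op_alg (\<lambda>e. ropp (Id_on (D e))) Y = ropp (Id_on (\<Union>e\<in>Y. D e))"
  using assms
proof (induction Y rule: finite_induct)
  interpret star_algebra op_alg by (rule op_alg_star_algebra)
  case empty
  show ?case by (simp add: ropp_empty)
next
  interpret star_algebra op_alg by (rule op_alg_star_algebra)
  case (insert e Y)
  have dis: "D e \<inter> (\<Union>f\<in>Y. D f) = {}" using insert by blast
  have "asum op_alg (\<lambda>e. ropp (Id_on (D e))) (insert e Y) = ropp (Id_on (D e)) \<oplus>\<^bsub>op_alg\<^esub> ropp (Id_on (\<Union>f\<in>Y. D f))"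
    using insert by simp
  also have "\<dots> = ropp (Id_on (\<Union>f\<in>insert e Y. D f))"
    using dis by (auto simp: ropp_def op_alg_sel rop_Id_on fun_eq_iff)
  finally show ?case .
qed


section \<open>Iterated squares\<close>

context cstar_seminormed
begin

text \<open>
  \<open>(a\<^sup>* a)^(2^m)\<close>, in the form to which the \<open>C\<^sup>*\<close>-identity applies at each step.
\<close>

primrec iter_sq :: "'a \<Rightarrow> nat \<Rightarrow> 'a" where
  "iter_sq a 0 = star a \<otimes> a"
| "iter_sq a (Suc m) = star (iter_sq a m) \<otimes> iter_sq a m"

lemma iter_sq_in: "a \<in> acarrier A \<Longrightarrow> iter_sq a m \<in> acarrier A"
  by (induction m) auto

lemma p_iter_sq: "a \<in> acarrier A \<Longrightarrow> p (iter_sq a m) = p a ^ (2 ^ Suc m)"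
proof (induction m)
  case (Suc m)
  have "p (iter_sq a (Suc m)) = (p (iter_sq a m))\<^sup>2" using p_cstar[OF iter_sq_in[OF Suc.prems]] by simp
  also have "\<dots> = (p a ^ (2 ^ Suc m))\<^sup>2" using Suc by simp
  also have "\<dots> = p a ^ (2 ^ Suc (Suc m))" by (simp only: power_mult[symmetric]) (simp add: mult.commute)
  finally show ?case .
qed (simp add: p_cstar)

lemma p_asum: "finite I \<Longrightarrow> f \<in> I \<rightarrow> acarrier A \<Longrightarrow> p (asum A f I) \<le> (\<Sum>i\<in>I. p (f i))"
proof (induction I rule: finite_induct)
  case (insert i I)
  then have fi: "f i \<in> acarrier A" "f \<in> I \<rightarrow> acarrier A" by auto
  then have "p (asum A f (insert i I)) \<le> p (f i) + p (asum A f I)"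
    using insert by (simp add: p_add)
  then show ?case using insert fi by simp
qed simp

end

text \<open>
  Taking \<open>2^(m+1)\<close>-th roots removes a factor that grows at most linearly in \<open>2^m\<close>. With \<open>iter_sq\<close> this
  improves an inequality between \<open>C\<^sup>*\<close>-seminorms up to such factors to the inequality itself.
\<close>

lemma spectral_compare:
  fixes x y :: real
  assumes "0 \<le> x" "0 \<le> y" "\<And>m. x ^ (2 ^ Suc m) \<le> (a * 2 ^ m + b) * y ^ (2 ^ Suc m)"
  shows "x \<le> y"
proof (rule ccontr)
  assume "\<not> x \<le> y"
  then have xy: "y < x" by simp
  show False
  proof (cases "y = 0")
    case True
    then show False using assms(3)[of 0] xy by simp
  next
    case False
    then have y: "y > 0" using assms(2) by simp
    define t where "t = x / y"
    have t: "t > 1" using xy y by (simp add: t_def)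
    have bound: "t ^ (2 ^ Suc m) \<le> a * 2 ^ m + b" for m
      using assms(3)[of m] y by (simp add: t_def power_divide divide_le_eq)
    have "(\<lambda>n. (a * real n + b) / t ^ n) \<longlonglongrightarrow> 0"
    proof -
      have 1: "(\<lambda>n. real n / t ^ n) \<longlonglongrightarrow> 0"
        using powser_times_n_limit_0[of "1 / t"] t by (simp add: power_divide)
      have 2: "(\<lambda>n. (1 / t) ^ n) \<longlonglongrightarrow> 0" using t by (intro LIMSEQ_realpow_zero) auto
      show ?thesis
        using tendsto_add[OF tendsto_mult[OF tendsto_const[of a] 1] tendsto_mult[OF tendsto_const[of b] 2]]
        by (simp add: power_divide add_divide_distrib)
    qed
    then obtain N where N: "\<And>n. n \<ge> N \<Longrightarrow> \<bar>(a * real n + b) / t ^ n\<bar> < 1"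
      using LIMSEQ_D[of "\<lambda>n. (a * real n + b) / t ^ n" 0 1] by auto
    have big: "N \<le> 2 ^ N" by (simp add: less_imp_le)
    have "(a * 2 ^ N + b) / t ^ (2 ^ N) < 1" using N[OF big] unfolding abs_less_iff by simp
    then have "a * 2 ^ N + b < t ^ (2 ^ N)" using t by (simp add: divide_less_eq)
    also have "\<dots> \<le> t ^ (2 ^ Suc N)" using t by (intro power_increasing) auto
    finally show False using bound[of N] by simp
  qed
qed

section \<open>The algebra of the groupoid\<close>

text \<open>
  That the convolution algebra satisfies the axioms of a \<open>*\<close>-algebra is assumed here; it is inherited from
  \<open>A_inf\<close> by the isomorphism \<open>\<phi>\<close>. Everything else is taken from the definition of the convolution.
\<close>

locale steinberg_algebra =
  fixes X :: "'a::metric_space set" and \<sigma> :: "'a \<Rightarrow> 'a"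
  assumes st: "star_algebra (steinberg X \<sigma>)"
begin

abbreviation "GG \<equiv> groupoid X \<sigma>"
abbreviation "ST \<equiv> steinberg X \<sigma>"
abbreviation "tG \<equiv> groupoid_top X \<sigma>"

sublocale ST: star_algebra ST by (rule st)

lemma groupoid_iff: "(x, k, y) \<in> GG \<longleftrightarrow> x \<in> X \<and> y \<in> X \<and> (\<exists>m n. k = int m - int n \<and> (\<sigma> ^^ m) x = (\<sigma> ^^ n) y)"
  by (auto simp: groupoid_def Zset_def)

lemma groupoid_mul: assumes "(x, k, z) \<in> GG" "(z, p, y) \<in> GG" shows "(x, k + p, y) \<in> GG"
proof -
  obtain m n m' n' where h: "x \<in> X" "y \<in> X" "k = int m - int n" "(\<sigma> ^^ m) x = (\<sigma> ^^ n) z"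
    "p = int m' - int n'" "(\<sigma> ^^ m') z = (\<sigma> ^^ n') y"
    using assms by (auto simp: groupoid_iff)
  have "(\<sigma> ^^ (m' + m)) x = (\<sigma> ^^ (m' + n)) z" using h(4) by (simp add: funpow_add)
  also have "\<dots> = (\<sigma> ^^ (n + m')) z" by (simp add: add.commute)
  also have "\<dots> = (\<sigma> ^^ (n + n')) y" using h(6) by (simp add: funpow_add)
  finally show ?thesis using h unfolding groupoid_iff
    by (intro conjI exI[of _ "m' + m"] exI[of _ "n + n'"]) auto
qed

lemma open_Zset: "openin (top_of_set X) U \<Longrightarrow> openin (top_of_set X) V \<Longrightarrow> openin tG (Zset \<sigma> U m n V)"
  unfolding groupoid_top_def by (rule topology_generated_by_Basis) blast

lemma topspace_G: "topspace tG = GG"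
proof -
  have "Zset \<sigma> U m n V \<subseteq> GG" if "openin (top_of_set X) U" "openin (top_of_set X) V" for U m n V
  proof -
    have "Zset \<sigma> U m n V \<subseteq> Zset \<sigma> X m n X"
      using openin_imp_subset[OF that(1)] openin_imp_subset[OF that(2)] by (auto simp: Zset_def)
    then show ?thesis by (auto simp: groupoid_def)
  qed
  moreover have "GG \<subseteq> \<Union>{Zset \<sigma> U m n V | U m n V. openin (top_of_set X) U \<and> openin (top_of_set X) V}"
  proof
    fix \<gamma> assume "\<gamma> \<in> GG"
    then obtain m n where "\<gamma> \<in> Zset \<sigma> X m n X" by (auto simp: groupoid_def)
    moreover have "openin (top_of_set X) X" by simp
    ultimately show "\<gamma> \<in> \<Union>{Zset \<sigma> U m n V | U m n V. openin (top_of_set X) U \<and> openin (top_of_set X) V}" by blast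
  qed
  ultimately show ?thesis unfolding groupoid_top_def topology_generated_by_topspace
    by (intro equalityI Union_least) fast+
qed

lemma st_carrier: "f \<in> acarrier ST \<longleftrightarrow> (\<forall>\<gamma>. \<gamma> \<notin> GG \<longrightarrow> f \<gamma> = 0) \<and>
    (\<forall>\<gamma>\<in>GG. \<exists>W. openin tG W \<and> \<gamma> \<in> W \<and> (\<forall>\<eta>\<in>W. f \<eta> = f \<gamma>)) \<and>
    compactin tG (tG closure_of {\<gamma>. f \<gamma> \<noteq> 0})"
  by (simp add: steinberg_def)

lemma st_outside: "f \<in> acarrier ST \<Longrightarrow> \<gamma> \<notin> GG \<Longrightarrow> f \<gamma> = 0"
  unfolding st_carrier by blast

lemma st_ops:
  "azero ST = (\<lambda>\<gamma>. 0)" "aadd ST f g = (\<lambda>\<gamma>. f \<gamma> + g \<gamma>)" "ascale ST c f = (\<lambda>\<gamma>. c * f \<gamma>)"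
  "astar ST f (x, k, y) = cnj (f (y, - k, x))"
  by (simp_all add: steinberg_def)

text \<open>
  The support of \<open>f\<close> has compact closure. Applied to the level sets and to the sets on which \<open>f\<close> is
  constant, this bounds the levels of \<open>f\<close> and makes its range finite.
\<close>

lemma st_cover:
  assumes f: "f \<in> acarrier ST" and W: "\<And>W. W \<in> \<W> \<Longrightarrow> openin tG W" "GG \<subseteq> \<Union>\<W>"
  shows "\<exists>\<F>. finite \<F> \<and> \<F> \<subseteq> \<W> \<and> {\<gamma>. f \<gamma> \<noteq> 0} \<subseteq> \<Union>\<F>"
proof -
  let ?K = "tG closure_of {\<gamma>. f \<gamma> \<noteq> 0}"
  have K: "compactin tG ?K" using f unfolding st_carrier by (elim conjE)
  have "?K \<subseteq> topspace tG" by (rule closure_of_subset_topspace)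
  then have KW: "?K \<subseteq> \<Union>\<W>" using W(2) unfolding topspace_G by (rule subset_trans)
  have "\<exists>\<F>. finite \<F> \<and> \<F> \<subseteq> \<W> \<and> ?K \<subseteq> \<Union>\<F>"
    by (rule compactinD[OF K _ KW]) (rule W(1))
  then obtain \<F> where F: "finite \<F>" "\<F> \<subseteq> \<W>" "?K \<subseteq> \<Union>\<F>"
    by (elim exE conjE)
  have "{\<gamma>. f \<gamma> \<noteq> 0} \<subseteq> ?K"
  proof (rule closure_of_subset)
    have "\<gamma> \<in> GG" if "f \<gamma> \<noteq> 0" for \<gamma> by (rule ccontr) (use st_outside[OF f, of \<gamma>] that in simp)
    then show "{\<gamma>. f \<gamma> \<noteq> 0} \<subseteq> topspace tG" unfolding topspace_G by (intro subsetI) (elim CollectE)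
  qed
  then have "{\<gamma>. f \<gamma> \<noteq> 0} \<subseteq> \<Union>\<F>" using F(3) by (rule subset_trans)
  then show ?thesis using F(1,2) by (intro exI[of _ \<F>] conjI)
qed

text \<open>
  A locally constant function whose support lies in that of \<open>f\<close> belongs to the algebra, as closed subsets of
  compact sets are compact. Besides the algebraic operations this is the source of elements below.
\<close>

lemma st_restrict:
  assumes f: "f \<in> acarrier ST" and supp: "\<And>\<gamma>. h \<gamma> \<noteq> 0 \<Longrightarrow> f \<gamma> \<noteq> 0"
    and loc: "\<And>\<gamma>. \<gamma> \<in> GG \<Longrightarrow> \<exists>W. openin tG W \<and> \<gamma> \<in> W \<and> (\<forall>\<eta>\<in>W. h \<eta> = h \<gamma>)"
  shows "h \<in> acarrier ST"
proof -
  have "compactin tG (tG closure_of {\<gamma>. h \<gamma> \<noteq> 0})"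
  proof (rule closed_compactin)
    show "compactin tG (tG closure_of {\<gamma>. f \<gamma> \<noteq> 0})" using f unfolding st_carrier by (elim conjE)
    have "{\<gamma>. h \<gamma> \<noteq> 0} \<subseteq> {\<gamma>. f \<gamma> \<noteq> 0}" by (rule Collect_mono) (use supp in simp)
    then show "tG closure_of {\<gamma>. h \<gamma> \<noteq> 0} \<subseteq> tG closure_of {\<gamma>. f \<gamma> \<noteq> 0}" by (rule closure_of_mono)
  qed simp
  moreover have "h \<gamma> = 0" if "\<gamma> \<notin> GG" for \<gamma>
    by (rule ccontr) (use supp[of \<gamma>] st_outside[OF f that] in simp)
  ultimately show ?thesis unfolding st_carrier by (intro conjI allI impI ballI loc)
qed

lemma st_levels:
  assumes "f \<in> acarrier ST"
  shows "\<exists>N. \<forall>x k y. f (x, k, y) \<noteq> 0 \<longrightarrow> x \<in> X \<and> y \<in> X \<and> (\<exists>m\<le>N. \<exists>n\<le>N. k = int m - int n \<and> (\<sigma> ^^ m) x = (\<sigma> ^^ n) y)"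
proof -
  have "openin tG W" if "W \<in> range (\<lambda>(m, n). Zset \<sigma> X m n X)" for W
    using that open_Zset[of X X] by force
  moreover have "GG \<subseteq> \<Union>(range (\<lambda>(m, n). Zset \<sigma> X m n X))" by (auto simp: groupoid_def)
  ultimately have "\<exists>\<F>. finite \<F> \<and> \<F> \<subseteq> range (\<lambda>(m, n). Zset \<sigma> X m n X) \<and> {\<gamma>. f \<gamma> \<noteq> 0} \<subseteq> \<Union>\<F>"
    by (rule st_cover[OF assms])
  then obtain \<F> where F: "finite \<F>" "\<F> \<subseteq> range (\<lambda>(m, n). Zset \<sigma> X m n X)" "{\<gamma>. f \<gamma> \<noteq> 0} \<subseteq> \<Union>\<F>"
    by (elim exE conjE)
  obtain I where I: "finite I" "\<F> = (\<lambda>(m, n). Zset \<sigma> X m n X) ` I"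
    using finite_subset_image[OF F(1,2)] by blast
  have le: "m \<le> Max (fst ` I \<union> snd ` I)" "n \<le> Max (fst ` I \<union> snd ` I)" if "(m, n) \<in> I" for m n
    using I(1) that by (auto intro!: Max_ge image_eqI)
  show ?thesis
  proof (intro exI[of _ "Max (fst ` I \<union> snd ` I)"] allI impI)
    fix x k y assume "f (x, k, y) \<noteq> 0"
    then obtain m n where mn: "(m, n) \<in> I" "(x, k, y) \<in> Zset \<sigma> X m n X" using F(3) I(2) by blast
    then show "x \<in> X \<and> y \<in> X \<and> (\<exists>m\<le>Max (fst ` I \<union> snd ` I). \<exists>n\<le>Max (fst ` I \<union> snd ` I).
        k = int m - int n \<and> (\<sigma> ^^ m) x = (\<sigma> ^^ n) y)"
      using le[OF mn(1)] by (auto simp: Zset_def)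
  qed
qed

lemma st_finite_range: assumes "f \<in> acarrier ST" shows "finite (range f)"
proof -
  let ?\<W> = "{W. openin tG W \<and> (\<exists>c. \<forall>\<eta>\<in>W. f \<eta> = c)}"
  have "GG \<subseteq> \<Union>?\<W>" using assms unfolding st_carrier by blast
  then obtain \<F> where F: "finite \<F>" "\<F> \<subseteq> ?\<W>" "{\<gamma>. f \<gamma> \<noteq> 0} \<subseteq> \<Union>\<F>"
    using st_cover[OF assms, of ?\<W>] by blast
  define c where "c W = (SOME c. \<forall>\<eta>\<in>W. f \<eta> = c)" for W
  have c: "\<forall>\<eta>\<in>W. f \<eta> = c W" if "W \<in> \<F>" for W
    unfolding c_def by (rule someI_ex) (use F(2) that in blast)
  have "range f \<subseteq> insert 0 (c ` \<F>)"
  proof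
    fix z assume "z \<in> range f"
    then obtain \<gamma> where z: "z = f \<gamma>" by blast
    show "z \<in> insert 0 (c ` \<F>)"
    proof (cases "f \<gamma> = 0")
      case False
      then obtain W where "W \<in> \<F>" "\<gamma> \<in> W" using F(3) by blast
      then show ?thesis using c z by blast
    qed (use z in simp)
  qed
  then show ?thesis using F(1) by (meson finite_imageI finite_insert finite_subset)
qed

lemma st_compose:
  assumes f: "f \<in> acarrier ST" and h: "h 0 = (0::complex)"
  shows "(\<lambda>\<gamma>. h (f \<gamma>)) \<in> acarrier ST"
proof (rule st_restrict[OF f])
  show "f \<gamma> \<noteq> 0" if "h (f \<gamma>) \<noteq> 0" for \<gamma> using that h by auto
  fix \<gamma> assume "\<gamma> \<in> GG"
  then obtain W where "openin tG W" "\<gamma> \<in> W" "\<forall>\<eta>\<in>W. f \<eta> = f \<gamma>" using f unfolding st_carrier by blast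
  then show "\<exists>W. openin tG W \<and> \<gamma> \<in> W \<and> (\<forall>\<eta>\<in>W. h (f \<eta>) = h (f \<gamma>))"
    by (intro exI[of _ W] conjI ballI arg_cong[of _ _ h]) (assumption | (erule bspec, assumption))+
qed

lemma st_cut:
  assumes f: "f \<in> acarrier ST" and W: "\<And>\<gamma>. \<gamma> \<in> GG \<Longrightarrow> f \<gamma> \<noteq> 0 \<Longrightarrow> \<exists>W. openin tG W \<and> \<gamma> \<in> W \<and> (W \<subseteq> D \<or> W \<inter> D = {})"
  shows "(\<lambda>\<gamma>. if \<gamma> \<in> D then f \<gamma> else 0) \<in> acarrier ST"
proof (rule st_restrict[OF f])
  show "f \<gamma> \<noteq> 0" if "(if \<gamma> \<in> D then f \<gamma> else 0) \<noteq> 0" for \<gamma> using that by (auto split: if_splits)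
  fix \<gamma> assume g: "\<gamma> \<in> GG"
  then obtain V where V: "openin tG V" "\<gamma> \<in> V" "\<forall>\<eta>\<in>V. f \<eta> = f \<gamma>" using f unfolding st_carrier by blast
  show "\<exists>W. openin tG W \<and> \<gamma> \<in> W \<and> (\<forall>\<eta>\<in>W. (if \<eta> \<in> D then f \<eta> else 0) = (if \<gamma> \<in> D then f \<gamma> else 0))"
  proof (cases "f \<gamma> = 0")
    case True
    have "\<forall>\<eta>\<in>V. f \<eta> = 0" 
    proof
      fix \<eta> assume "\<eta> \<in> V"
      with V(3) have "f \<eta> = f \<gamma>" by (rule bspec)
      then show "f \<eta> = 0" using True by (simp only:)
    qed
    then show ?thesis using V(1,2) True by (intro exI[of _ V]) simp
  next
    case False
    then obtain W where "openin tG W" "\<gamma> \<in> W" "W \<subseteq> D \<or> W \<inter> D = {}" using W[OF g] by blast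
    note W = this
    have D: "\<eta> \<in> D \<longleftrightarrow> \<gamma> \<in> D" if "\<eta> \<in> W" for \<eta> using W(2,3) that by blast
    show ?thesis
    proof (intro exI[of _ "V \<inter> W"] conjI ballI)
      show "openin tG (V \<inter> W)" by (rule openin_Int[OF V(1) W(1)])
      show "\<gamma> \<in> V \<inter> W" using V(2) W(2) by blast
      fix \<eta> assume "\<eta> \<in> V \<inter> W"
      then have "f \<eta> = f \<gamma>" "\<eta> \<in> D \<longleftrightarrow> \<gamma> \<in> D" using V(3) D by blast+
      then show "(if \<eta> \<in> D then f \<eta> else 0) = (if \<gamma> \<in> D then f \<gamma> else 0)" by simp
    qed
  qed
qed

lemma st_asum: "finite I \<Longrightarrow> F \<in> I \<rightarrow> acarrier ST \<Longrightarrow> asum ST F I = (\<lambda>\<gamma>. \<Sum>i\<in>I. F i \<gamma>)"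
proof (induction I rule: finite_induct)
  case (insert i I)
  then have "F i \<in> acarrier ST" "F \<in> I \<rightarrow> acarrier ST" by auto
  with insert show ?case by (simp add: st_ops)
qed (simp add: st_ops)

text \<open>
  The sum over arrows as a finite sum over the pairs of middle point and degree.
\<close>

lemma st_mul:
  assumes f: "f \<in> acarrier ST" and g: "g \<in> acarrier ST"
    and I: "finite I" "\<And>z p. f (x, k - p, z) * g (z, p, y) \<noteq> 0 \<Longrightarrow> (z, p) \<in> I"
  shows "(f \<otimes>\<^bsub>ST\<^esub> g) (x, k, y) = (\<Sum>(z, p)\<in>I. f (x, k - p, z) * g (z, p, y))"
proof -
  let ?J = "{(z, p). f (x, k - p, z) * g (z, p, y) \<noteq> 0}"
  have J: "(\<Sum>(z, p)\<in>I. f (x, k - p, z) * g (z, p, y)) = (\<Sum>(z, p)\<in>?J. f (x, k - p, z) * g (z, p, y))"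
    by (rule sum.mono_neutral_right) (use I in auto)
  show ?thesis
  proof (cases "(x, k, y) \<in> GG")
    case True
    let ?A = "{\<alpha> \<in> GG. arr_source \<alpha> = arr_source (x, k, y) \<and> f (arr_mul (x, k, y) (arr_inv \<alpha>)) * g \<alpha> \<noteq> 0}"
    have "(f \<otimes>\<^bsub>ST\<^esub> g) (x, k, y) = (\<Sum>\<alpha>\<in>?A. f (arr_mul (x, k, y) (arr_inv \<alpha>)) * g \<alpha>)"
      using True by (simp add: steinberg_def)
    also have "\<dots> = (\<Sum>(z, p)\<in>?J. f (x, k - p, z) * g (z, p, y))"
    proof (rule sum.reindex_bij_witness[where i = "\<lambda>(z, p). (z, p, y)" and j = "\<lambda>(z, p, y). (z, p)"])
      fix b assume b: "b \<in> ?J"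
      obtain z p where zp: "b = (z, p)" by fastforce
      then have "g (z, p, y) \<noteq> 0" using b by auto
      then have "(z, p, y) \<in> GG" using st_outside[OF g] by blast
      then show "(case b of (z, p) \<Rightarrow> (z, p, y)) \<in> ?A" using b zp by auto
    qed auto
    finally show ?thesis using J by simp
  next
    case False
    have "?J = {}"
    proof -
      have "f (x, k - p, z) * g (z, p, y) = 0" for z p
      proof (cases "(x, k - p, z) \<in> GG \<and> (z, p, y) \<in> GG")
        case True
        then have "(x, k, y) \<in> GG" using groupoid_mul[of x "k - p" z p y] by simp
        then show ?thesis using False by blast
      next
        case False
        then have "f (x, k - p, z) = 0 \<or> g (z, p, y) = 0" using st_outside[OF f] st_outside[OF g] by blast
        then show ?thesis by auto
      qed
      then show ?thesis by auto
    qed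
    then show ?thesis using J False by (simp add: steinberg_def)
  qed
qed


subsection \<open>Operators that represent functions on the groupoid\<close>

text \<open>
  The convolution by \<open>f\<close> on functions on \<open>X \<times> \<int>\<close>, extended by zero to the second copy of \<open>X \<times> \<int>\<close>. The
  integer separates the degrees of arrows with the same ends, and the second copy is where the source
  vertices of \<open>F\<^sub>2\<^sub>n\<close> will act.
\<close>

definition mat :: "('a arrow \<Rightarrow> complex) \<Rightarrow> ('a \<times> int \<times> bool) \<Rightarrow> ('a \<times> int \<times> bool) \<Rightarrow> complex" where
  "mat f i j = (case (i, j) of ((x, k, b), (y, l, c)) \<Rightarrow> if b \<or> c then 0 else f (x, k - l, y))"

definition represents :: "('a arrow \<Rightarrow> complex) \<Rightarrow> (('a \<times> int \<times> bool) vec_op \<times> ('a \<times> int \<times> bool) vec_op) \<Rightarrow> bool" where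
  "represents f T \<longleftrightarrow> T \<in> acarrier op_alg \<and> (\<forall>i j. fst T (delta j) i = mat f i j)"

lemma mat_simp [simp]: "mat f (x, k, False) (y, l, False) = f (x, k - l, y)"
  "mat f (x, k, True) j = 0" "mat f i (y, l, True) = 0"
  by (auto simp: mat_def split: prod.splits)

lemma reprD: "represents f T \<Longrightarrow> T \<in> acarrier op_alg" "represents f T \<Longrightarrow> fst T (delta j) i = mat f i j"
  unfolding represents_def by blast+

lemma repr_bound: assumes "represents f T" shows "cmod (f \<gamma>) \<le> opnorm T"
proof -
  obtain x k y where g: "\<gamma> = (x, k, y)" by (cases \<gamma>)
  let ?j = "(y, 0::int, False)"
  have Tin: "fst T (delta ?j) \<in> fs" using reprD(1)[OF assms] adj_pairD(3) by (fastforce simp: op_alg_sel)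
  have "cmod (f \<gamma>) = cmod (fst T (delta ?j) (x, k, False))" by (simp add: reprD(2)[OF assms] g)
  also have "\<dots> \<le> nrm (fst T (delta ?j))" by (rule entry_le_nrm[OF Tin])
  also have "\<dots> \<le> opnorm T * nrm (delta ?j)" by (rule opnorm_bound[OF reprD(1)[OF assms] fs_delta])
  finally show ?thesis by simp
qed

lemma lin_op_sum: "finite F \<Longrightarrow> lin_op T \<Longrightarrow> T (\<lambda>i. \<Sum>l\<in>F. c l * delta l i) = (\<lambda>i. \<Sum>l\<in>F. c l * T (delta l) i)"
proof (induction F rule: finite_induct)
  case (insert l F)
  have "T (\<lambda>i. \<Sum>l\<in>insert l F. c l * delta l i) = T (\<lambda>i. c l * delta l i + (\<Sum>l\<in>F. c l * delta l i))"
    using insert by simp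
  also have "\<dots> = (\<lambda>i. c l * T (delta l) i + (\<Sum>l\<in>F. c l * T (delta l) i))"
    using lin_opD[OF insert.prems] insert by simp
  finally show ?case using insert by simp
qed (simp add: lin_op_zero)

lemma lin_op_expand: assumes "lin_op T" "v \<in> fs" shows "T v i = (\<Sum>l | v l \<noteq> 0. v l * T (delta l) i)"
proof -
  have fin: "finite {l. v l \<noteq> 0}" using assms(2) by (rule fsD)
  have "v = (\<lambda>i. \<Sum>l | v l \<noteq> 0. v l * delta l i)"
  proof
    fix i
    have "(\<Sum>l | v l \<noteq> 0. v l * delta l i) = (\<Sum>l | v l \<noteq> 0. if l = i then v l else 0)"
      by (rule sum.cong) (auto simp: delta_def)
    then show "v i = (\<Sum>l | v l \<noteq> 0. v l * delta l i)" using fin by simp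
  qed
  then have "T v i = T (\<lambda>i. \<Sum>l | v l \<noteq> 0. v l * delta l i) i" by (rule arg_cong[where f = "\<lambda>u. T u i"])
  also have "\<dots> = (\<Sum>l | v l \<noteq> 0. v l * T (delta l) i)" unfolding lin_op_sum[OF fin assms(1), of v] ..
  finally show ?thesis .
qed

text \<open>
  Matrix multiplication along the integers is convolution: the inner index \<open>(z, p + m)\<close> corresponds to the
  arrows \<open>(x, k - m - p, z)\<close> and \<open>(z, p, y)\<close>.
\<close>

lemma repr_mul:
  assumes "represents f T" "represents g U" "f \<in> acarrier ST" "g \<in> acarrier ST"
  shows "represents (f \<otimes>\<^bsub>ST\<^esub> g) (T \<otimes>\<^bsub>op_alg\<^esub> U)"
proof -
  obtain T1 T2 U1 U2 where TU: "T = (T1, T2)" "U = (U1, U2)" by (cases T; cases U)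
  have D: "adj_pair T1 T2" "adj_pair U1 U2" using reprD(1)[OF assms(1)] reprD(1)[OF assms(2)] by (auto simp: TU op_alg_sel)
  have T1: "T1 (delta j) i = mat f i j" and U1: "U1 (delta j) i = mat g i j" for i j
    using reprD(2)[OF assms(1)] reprD(2)[OF assms(2)] by (simp_all add: TU)
  have "T1 (U1 (delta j)) i = mat (f \<otimes>\<^bsub>ST\<^esub> g) i j" for i j
  proof -
    have Uj: "U1 (delta j) \<in> fs" using adj_pairD(3)[OF D(2)] by simp
    have eq: "T1 (U1 (delta j)) i = (\<Sum>l | mat g l j \<noteq> 0. mat g l j * mat f i l)"
      using lin_op_expand[OF adj_pairD(1)[OF D(1)] Uj] by (simp add: T1 U1)
    obtain x k b y m c where ij: "i = (x, k, b)" "j = (y, m, c)" by (cases i; cases j)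
    show ?thesis
    proof (cases "b \<or> c")
      case True
      then show ?thesis by (subst eq) (auto simp: ij)
    next
      case False
      then have bc: "b = False" "c = False" by auto
      have fin: "finite {l. mat g l j \<noteq> 0}" using Uj by (simp add: fs_def U1)
      let ?I = "{(z, p). g (z, p, y) \<noteq> 0}"
      have I: "(\<lambda>(z, p). (z, p + m, False)) ` ?I = {l. mat g l j \<noteq> 0}"
      proof (intro set_eqI iffI)
        fix l assume "l \<in> {l. mat g l j \<noteq> 0}"
        then have l: "mat g l j \<noteq> 0" by simp
        obtain z p d where zp: "l = (z, p, d)" by (cases l)
        with l have d: "d = False" by (cases d) auto
        then show "l \<in> (\<lambda>(z, p). (z, p + m, False)) ` ?I"
          using l by (auto simp: zp ij bc intro!: image_eqI[of _ _ "(z, p - m)"])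
      qed (auto simp: ij bc)
      have inj: "inj_on (\<lambda>(z, p). (z, p + m, False)) ?I" by (auto simp: inj_on_def)
      have finI: "finite ?I" using fin unfolding I[symmetric] by (rule finite_imageD[OF _ inj])
      have "(\<Sum>l | mat g l j \<noteq> 0. mat g l j * mat f i l) = (\<Sum>(z, p)\<in>?I. f (x, (k - m) - p, z) * g (z, p, y))"
        unfolding I[symmetric] sum.reindex[OF inj]
        by (rule sum.cong) (auto simp: ij bc algebra_simps)
      also have "\<dots> = (f \<otimes>\<^bsub>ST\<^esub> g) (x, k - m, y)"
        by (rule st_mul[OF assms(3,4) finI, symmetric]) auto
      finally show ?thesis unfolding eq by (simp add: ij bc)
    qed
  qed
  moreover have "T \<otimes>\<^bsub>op_alg\<^esub> U \<in> acarrier op_alg"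
    by (rule op_alg_closed(3)[OF reprD(1)[OF assms(1)] reprD(1)[OF assms(2)]])
  ultimately show ?thesis by (simp add: represents_def TU op_alg_sel)
qed

lemma repr_star:
  assumes "represents f T" shows "represents (star\<^bsub>ST\<^esub> f) (star\<^bsub>op_alg\<^esub> T)"
proof -
  obtain T1 T2 where T: "T = (T1, T2)" by (cases T)
  have D: "adj_pair T1 T2" using reprD(1)[OF assms(1)] by (auto simp: T op_alg_sel)
  have "T2 (delta j) i = mat (star\<^bsub>ST\<^esub> f) i j" for i j
  proof -
    have "T2 (delta j) i = cnj (ip (T2 (delta j)) (delta i))" by (simp add: ip_delta_right)
    also have "ip (T2 (delta j)) (delta i) = ip (delta j) (T1 (delta i))"
      using adj_pairD(5)[OF D] by simp
    also have "\<dots> = mat f j i" using reprD(2)[OF assms] by (simp add: ip_delta_left T)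
    also have "cnj (mat f j i) = mat (star\<^bsub>ST\<^esub> f) i j"
      by (cases i; cases j) (auto simp: mat_def st_ops)
    finally show ?thesis .
  qed
  then show ?thesis using op_alg_closed(5)[OF reprD(1)[OF assms]] by (simp add: represents_def T op_alg_sel)
qed

lemma repr_add: "represents f T \<Longrightarrow> represents g U \<Longrightarrow> represents (\<lambda>\<gamma>. f \<gamma> + g \<gamma>) (T \<oplus>\<^bsub>op_alg\<^esub> U)"
  using op_alg_closed(2)[of T U] by (cases T; cases U) (auto simp: represents_def op_alg_sel mat_def)

lemma repr_scale: "represents f T \<Longrightarrow> represents (\<lambda>\<gamma>. c * f \<gamma>) (c \<cdot>\<^bsub>op_alg\<^esub> T)"
  using op_alg_closed(4)[of T c] by (cases T) (auto simp: represents_def op_alg_sel mat_def)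

lemma repr_zero: "represents (\<lambda>_. 0) \<zero>\<^bsub>op_alg\<^esub>"
  using op_alg_closed(1) by (auto simp: represents_def op_alg_sel mat_def)

sublocale OP: cstar_seminormed "op_alg :: (('a \<times> int \<times> bool) vec_op \<times> ('a \<times> int \<times> bool) vec_op) star_alg" opnorm
  unfolding cstar_seminormed_def cstar_seminormed_axioms_def
  using op_alg_star_algebra opnorm_cstar_seminorm by blast

lemma repr_asum:
  assumes "finite I" "\<And>i. i \<in> I \<Longrightarrow> represents (F i) (T i)"
  shows "represents (\<lambda>\<gamma>. \<Sum>i\<in>I. F i \<gamma>) (asum op_alg T I)"
  using assms
proof (induction I rule: finite_induct)
  case empty
  then show ?case by (simp add: repr_zero)
next
  case (insert i I)
  have "T i \<in> acarrier op_alg" "T \<in> I \<rightarrow> acarrier op_alg" using insert(4) reprD(1) by blast+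
  then show ?case using insert repr_add[of "F i" "T i" "\<lambda>\<gamma>. \<Sum>i\<in>I. F i \<gamma>" "asum op_alg T I"] by simp
qed

text \<open>
  The unitary that implements the gauge action \<open>f(x, k, y) \<mapsto> w\<^sup>k f(x, k, y)\<close> by conjugation.
\<close>

definition gauge :: "complex \<Rightarrow> ('a \<times> int \<times> bool) vec_op \<times> ('a \<times> int \<times> bool) vec_op" where
  "gauge w = (\<lambda>v (x, k, b). (w powi k) * v (x, k, b), \<lambda>v (x, k, b). (cnj w powi k) * v (x, k, b))"

lemma gauge_in: assumes w: "cmod w = 1" shows "gauge w \<in> acarrier op_alg" and "opnorm (gauge w) \<le> 1"
proof -
  let ?D = "\<lambda>w v (x :: 'a, k :: int, b :: bool). (w powi k) * v (x, k, b)"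
  have iter_sq: "cmod (u powi k) = 1" if "cmod u = 1" for u k using that by (simp add: norm_power_int)
  have supp: "{i. ?D u v i \<noteq> 0} = {i. v i \<noteq> 0}" if "cmod u = 1" for u :: complex and v
  proof -
    have "u \<noteq> 0" using that by auto
    then have "u powi k \<noteq> 0" for k by simp
    then show ?thesis by auto
  qed
  have lin: "lin_op (?D u)" for u by (auto simp: lin_op_def fun_eq_iff algebra_simps)
  have fs: "?D u v \<in> fs" if "cmod u = 1" "v \<in> fs" for u v using supp[OF that(1)] that(2) by (simp add: fs_def)
  have nrm: "nrm (?D u v) = nrm v" if "cmod u = 1" for u v
    unfolding nrm_def supp[OF that] by (rule arg_cong[where f = sqrt], rule sum.cong) (auto simp: norm_mult iter_sq[OF that])
  have cw: "cmod (cnj w) = 1" using w by simp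
  have adj: "ip u (?D w v) = ip (?D (cnj w) u) v" if "u \<in> fs" "v \<in> fs" for u v
  proof -
    have "{i. u i \<noteq> 0 \<and> ?D w v i \<noteq> 0} = {i. ?D (cnj w) u i \<noteq> 0 \<and> v i \<noteq> 0}"
      using supp[OF w, of v] supp[OF cw, of u] by blast
    then show ?thesis unfolding ip_def by (rule sum.cong) (auto simp: power_int_def)
  qed
  show "gauge w \<in> acarrier op_alg"
    unfolding gauge_def op_alg_sel adj_pair_def mem_Collect_eq prod.case
  proof (intro conjI ballI exI[of _ 1])
    show "lin_op (?D w)" "lin_op (?D (cnj w))" by (rule lin)+
    show "?D w v \<in> fs" "?D (cnj w) v \<in> fs" if "v \<in> fs" for v by (rule fs[OF w that] fs[OF cw that])+
    show "ip u (?D w v) = ip (?D (cnj w) u) v" if "u \<in> fs" "v \<in> fs" for u v by (rule adj[OF that])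
    show "nrm (?D w v) \<le> 1 * nrm v" for v using nrm[OF w, of v] by simp
  qed simp
  show "opnorm (gauge w) \<le> 1"
  proof (rule opnorm_least)
    show "nrm (fst (gauge w) v) \<le> 1 * nrm v" for v using nrm[OF w, of v] unfolding gauge_def fst_conv by simp
  qed simp
qed

lemma repr_gauge:
  assumes w: "cmod w = 1" and f: "represents f T"
  shows "represents (\<lambda>(x, k, y). (w powi k) * f (x, k, y)) (gauge w \<otimes>\<^bsub>op_alg\<^esub> T \<otimes>\<^bsub>op_alg\<^esub> star\<^bsub>op_alg\<^esub> (gauge w))"
proof -
  obtain T1 T2 where T: "T = (T1, T2)" by (cases T)
  have lin: "lin_op T1" using reprD(1)[OF f] adj_pairD(1) by (auto simp: T op_alg_sel)
  have w0: "w \<noteq> 0" using w by auto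
  have cw: "cnj w = inverse w" 
    by (rule inverse_unique[symmetric]) (use w complex_norm_square[of w] in simp)
  have D: "(\<lambda>(x, k, b). (cnj w powi k) * delta j (x, k, b)) = (\<lambda>i. (cnj w powi (fst (snd j))) * delta j i)" for j
    by (auto simp: delta_def fun_eq_iff)
  have "fst (gauge w \<otimes>\<^bsub>op_alg\<^esub> T \<otimes>\<^bsub>op_alg\<^esub> star\<^bsub>op_alg\<^esub> (gauge w)) (delta j) i = mat (\<lambda>(x, k, y). (w powi k) * f (x, k, y)) i j" for i j
  proof -
    obtain x k b y l c where ij: "i = (x, k, b)" "j = (y, l, c)" by (cases i; cases j)
    have "fst (gauge w \<otimes>\<^bsub>op_alg\<^esub> T \<otimes>\<^bsub>op_alg\<^esub> star\<^bsub>op_alg\<^esub> (gauge w)) (delta j) i =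
        (w powi k) * ((cnj w powi l) * mat f i j)"
      using lin_opD(2)[OF lin, of "cnj w powi l" "delta j"] reprD(2)[OF f, of j i]
      by (simp add: T gauge_def op_alg_sel D ij)
    also have "\<dots> = mat (\<lambda>(x, k, y). (w powi k) * f (x, k, y)) i j"
      using w0 by (auto simp: mat_def ij cw power_int_inverse power_int_diff divide_inverse)
    finally show ?thesis .
  qed
  moreover have "gauge w \<otimes>\<^bsub>op_alg\<^esub> T \<otimes>\<^bsub>op_alg\<^esub> star\<^bsub>op_alg\<^esub> (gauge w) \<in> acarrier op_alg"
    using gauge_in(1)[OF w] reprD(1)[OF f] by simp
  ultimately show ?thesis by (simp add: represents_def)
qed

lemma root_of_unity_sum:
  assumes "0 < M" "\<bar>j\<bar> < int M"
  shows "(\<Sum>s<M. (cis (2 * pi / real M) ^ s) powi j) = (if j = 0 then of_nat M else 0)"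
proof (cases "j = 0")
  case False
  define w where "w = cis (2 * pi / real M)"
  have "w ^ M = cis (real M * (2 * pi / real M))" unfolding w_def by (rule Complex.DeMoivre)
  also have "real M * (2 * pi / real M) = 2 * pi" using assms(1) by simp
  finally have wM: "w ^ M = 1" by simp
  have w0: "w \<noteq> 0" by (simp add: w_def)
  have sw: "(w ^ s) powi j = (w powi j) ^ s" for s
    by (metis mult.commute power_int_mult power_int_of_nat)
  have "w powi j \<noteq> 1"
  proof
    assume "w powi j = 1"
    then have "cis (of_int j * (2 * pi / real M)) = 1" by (simp add: w_def cis_power_int)
    then have "cos (of_int j * (2 * pi / real M)) = 1" by (metis cis.sel(1) one_complex.sel(1))
    then obtain n :: int where "of_int j * (2 * pi / real M) = of_int n * 2 * pi"
      using cos_one_2pi_int by blast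
    then have "real_of_int j = of_int n * real M" using assms(1) by (simp add: field_simps)
    then have "j = n * int M" by (metis of_int_eq_iff of_int_mult of_int_of_nat_eq)
    then show False using False assms(2) by (simp add: abs_mult zero_less_abs_iff mult_less_cancel_right2)
  qed
  then have "(\<Sum>s<M. (w powi j) ^ s) = ((w powi j) ^ M - 1) / (w powi j - 1)"
    by (simp add: geometric_sum)
  also have "(w powi j) ^ M = 1" using sw[of M] wM by simp
  finally show ?thesis using False by (simp add: sw flip: w_def)
qed simp

text \<open>
  The component of degree \<open>k\<close> is the average of the gauge action over roots of unity, weighted by \<open>w powi (- k)\<close>.
  Finitely many roots suffice because the degrees are bounded, and an average of conjugates by unitaries
  has norm at most \<open>opnorm T\<close>.
\<close>

lemma repr_degree:
  assumes f: "represents f T" and deg: "\<And>x k y. f (x, k, y) \<noteq> 0 \<Longrightarrow> \<bar>k\<bar> \<le> int d" and k: "\<bar>k\<bar> \<le> int d"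
  shows "\<exists>U. represents (\<lambda>(x, l, y). if l = k then f (x, l, y) else 0) U \<and> opnorm U \<le> opnorm T"
proof -
  \<comment> \<open>larger than the difference of any two degrees\<close>
  define M where "M = 2 * d + 1"
  define w where "w s = cis (2 * pi / real M) ^ s" for s :: nat
  have M: "0 < M" by (simp add: M_def)
  have w: "cmod (w s) = 1" for s by (simp add: w_def norm_power)
  let ?U = "\<lambda>s. (w s powi (- k)) \<cdot>\<^bsub>op_alg\<^esub> (gauge (w s) \<otimes>\<^bsub>op_alg\<^esub> T \<otimes>\<^bsub>op_alg\<^esub> star\<^bsub>op_alg\<^esub> (gauge (w s)))"
  let ?F = "\<lambda>s \<gamma>. (w s powi (- k)) * (case \<gamma> of (x, l, y) \<Rightarrow> (w s powi l) * f (x, l, y))"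
  let ?V = "(1 / of_nat M) \<cdot>\<^bsub>op_alg\<^esub> asum op_alg ?U {..<M}"
  have rU: "represents (?F s) (?U s)" for s by (rule repr_scale[OF repr_gauge[OF w f]])
  have "represents (\<lambda>\<gamma>. (1 / of_nat M) * (\<Sum>s<M. ?F s \<gamma>)) ?V"
    by (rule repr_scale[OF repr_asum]) (use rU in auto)
  moreover have "(\<lambda>\<gamma>. (1 / of_nat M) * (\<Sum>s<M. ?F s \<gamma>)) = (\<lambda>(x, l, y). if l = k then f (x, l, y) else 0)"
  proof
    fix \<gamma> :: "'a arrow"
    obtain x l y where g: "\<gamma> = (x, l, y)" by (cases \<gamma>)
    have "(\<Sum>s<M. ?F s \<gamma>) = (\<Sum>s<M. (w s powi (l - k))) * f (x, l, y)"
    proof -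
      have "w s \<noteq> 0" for s using w[of s] by auto
      then have "(w s powi (- k)) * (w s powi l) = w s powi (l - k)" for s
        by (simp add: power_int_diff power_int_minus divide_inverse mult.commute)
      then show ?thesis by (simp add: g sum_distrib_right mult.assoc[symmetric])
    qed
    also have "\<dots> = (if l = k then of_nat M else 0) * f (x, l, y)"
    proof (cases "f (x, l, y) = 0")
      case False
      then have "\<bar>l - k\<bar> < int M" using deg[of x l y] k by (simp add: M_def)
      then show ?thesis using root_of_unity_sum[OF M, of "l - k"] by (simp add: w_def)
    qed simp
    finally show "(1 / of_nat M) * (\<Sum>s<M. ?F s \<gamma>) = (case \<gamma> of (x, l, y) \<Rightarrow> if l = k then f (x, l, y) else 0)"
      using M by (simp add: g)
  qed
  moreover have "opnorm ?V \<le> opnorm T"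
  proof -
    have Tin: "T \<in> acarrier op_alg" by (rule reprD(1)[OF f])
    have Uin: "?U s \<in> acarrier op_alg" for s by (rule reprD(1)[OF rU])
    have "opnorm (?U s) \<le> opnorm T" for s
    proof -
      note gin = gauge_in[OF w, of s]
      have "opnorm (?U s) = opnorm (gauge (w s) \<otimes>\<^bsub>op_alg\<^esub> T \<otimes>\<^bsub>op_alg\<^esub> star\<^bsub>op_alg\<^esub> (gauge (w s)))"
        using gin Tin by (simp add: OP.p_scale norm_power_int w)
      also have "\<dots> \<le> opnorm (gauge (w s)) * opnorm T * opnorm (gauge (w s))"
        using OP.p_mul[of "gauge (w s) \<otimes>\<^bsub>op_alg\<^esub> T" "star\<^bsub>op_alg\<^esub> (gauge (w s))"] OP.p_mul[OF gin(1) Tin] gin Tin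
        by (simp add: OP.p_star) (meson OP.p_nonneg mult_right_mono order_trans)
      also have "\<dots> \<le> 1 * opnorm T * 1"
        using gin Tin by (intro mult_mono) auto
      finally show ?thesis by simp
    qed
    then have "(\<Sum>s<M. opnorm (?U s)) \<le> of_nat M * opnorm T"
      using sum_bounded_above[of "{..<M}" "\<lambda>s. opnorm (?U s)" "opnorm T"] by simp
    then have "opnorm (asum op_alg ?U {..<M}) \<le> of_nat M * opnorm T"
      using OP.p_asum[of "{..<M}" ?U] Uin by force
    moreover have "opnorm ?V = (1 / of_nat M) * opnorm (asum op_alg ?U {..<M})"
      using Uin by (subst OP.p_scale) (auto simp: norm_divide)
    ultimately show ?thesis using M by (simp add: divide_le_eq mult.commute)
  qed
  ultimately have "represents (\<lambda>(x, l, y). if l = k then f (x, l, y) else 0) ?V \<and> opnorm ?V \<le> opnorm T" by simp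
  then show ?thesis by (rule exI)
qed

end


section \<open>Every \<open>C\<^sup>*\<close>-seminorm of the groupoid algebra is at most the reduced norm\<close>

text \<open>
  For each \<open>n\<close> the space is a finite disjoint union of open sets on which the \<open>n\<close>-th iterate of \<open>\<sigma>\<close> is
  injective. These pieces cut the arrows of level \<open>n\<close> into finitely many bisections.
\<close>

locale steinberg_seminorm = steinberg_algebra +
  fixes q :: "('a arrow \<Rightarrow> complex) \<Rightarrow> real"
  assumes q: "cstar_seminorm ST q"
    and injective_pieces: "\<exists>D. finite D \<and> \<Union>D = X \<and>
      (\<forall>Z\<in>D. openin (top_of_set X) Z \<and> inj_on (\<sigma> ^^ n) Z) \<and> (\<forall>Z\<in>D. \<forall>Z'\<in>D. Z \<noteq> Z' \<longrightarrow> Z \<inter> Z' = {})"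
begin

sublocale Q: cstar_seminormed ST q
  unfolding cstar_seminormed_def cstar_seminormed_axioms_def by (intro conjI st q)

definition diag :: "('a arrow \<Rightarrow> complex) \<Rightarrow> bool" where
  "diag f \<longleftrightarrow> (\<forall>x k y. f (x, k, y) \<noteq> 0 \<longrightarrow> k = 0 \<and> y = x)"

lemma mul_supp:
  assumes f: "f \<in> acarrier ST" and h: "h \<in> acarrier ST" and nz: "(f \<otimes>\<^bsub>ST\<^esub> h) (x, k, y) \<noteq> 0"
  shows "\<exists>z p. f (x, k - p, z) \<noteq> 0 \<and> h (z, p, y) \<noteq> 0"
proof (rule ccontr)
  assume "\<not> ?thesis"
  then have "(f \<otimes>\<^bsub>ST\<^esub> h) (x, k, y) = (\<Sum>(z, p)\<in>{}. f (x, k - p, z) * h (z, p, y))"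
    by (intro st_mul[OF f h]) auto
  then show False using nz by simp
qed

lemma diag_mul:
  assumes "diag f" "f \<in> acarrier ST" "h \<in> acarrier ST"
  shows "(f \<otimes>\<^bsub>ST\<^esub> h) (x, k, y) = f (x, 0, x) * h (x, k, y)"
proof -
  have "(f \<otimes>\<^bsub>ST\<^esub> h) (x, k, y) = (\<Sum>(z, p)\<in>{(x, k)}. f (x, k - p, z) * h (z, p, y))"
  proof (rule st_mul[OF assms(2,3)])
    fix z p assume "f (x, k - p, z) * h (z, p, y) \<noteq> 0"
    then have "f (x, k - p, z) \<noteq> 0" by auto
    then have "k - p = 0 \<and> z = x" using assms(1) unfolding diag_def by blast
    then show "(z, p) \<in> {(x, k)}" by simp
  qed simp
  then show ?thesis by simp
qed

lemma diag_star_mul: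
  assumes d: "diag f" and f: "f \<in> acarrier ST"
  shows "star\<^bsub>ST\<^esub> f \<otimes>\<^bsub>ST\<^esub> f = (\<lambda>\<gamma>. complex_of_real ((cmod (f \<gamma>))\<^sup>2))"
proof
  fix \<gamma> :: "'a arrow"
  obtain x k y where g: "\<gamma> = (x, k, y)" by (cases \<gamma>)
  have ds: "diag (star\<^bsub>ST\<^esub> f)"
    unfolding diag_def
  proof (intro allI impI)
    fix x k y assume "(star\<^bsub>ST\<^esub> f) (x, k, y) \<noteq> 0"
    then have "f (y, - k, x) \<noteq> 0" by (simp add: st_ops)
    then have "- k = 0 \<and> x = y" using d unfolding diag_def by blast
    then show "k = 0 \<and> y = x" by simp
  qed
  have "(star\<^bsub>ST\<^esub> f \<otimes>\<^bsub>ST\<^esub> f) \<gamma> = cnj (f (x, 0, x)) * f (x, k, y)"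
    unfolding g diag_mul[OF ds ST.star_in[OF f] f] by (simp add: st_ops)
  also have "\<dots> = complex_of_real ((cmod (f (x, k, y)))\<^sup>2)"
  proof (cases "k = 0 \<and> y = x")
    case True
    then show ?thesis using complex_norm_square[of "f (x, 0, x)"] by (simp add: mult.commute)
  next
    case False
    then have "f (x, k, y) = 0" using d unfolding diag_def by blast
    then show ?thesis by simp
  qed
  finally show "(star\<^bsub>ST\<^esub> f \<otimes>\<^bsub>ST\<^esub> f) \<gamma> = complex_of_real ((cmod (f \<gamma>))\<^sup>2)" by (simp add: g)
qed

text \<open>
  The indicator of a set of units is a projection, and \<open>q(f) = q(f)\<^sup>2\<close>.
\<close>

lemma q_indicator:
  assumes d: "diag f" and f: "f \<in> acarrier ST" and v: "\<And>\<gamma>. f \<gamma> = 0 \<or> f \<gamma> = 1"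
  shows "q f \<le> 1"
proof -
  have "star\<^bsub>ST\<^esub> f \<otimes>\<^bsub>ST\<^esub> f = f"
    unfolding diag_star_mul[OF d f]
  proof
    fix \<gamma> show "complex_of_real ((cmod (f \<gamma>))\<^sup>2) = f \<gamma>" using v[of \<gamma>] by auto
  qed
  then have "q f = (q f)\<^sup>2" using Q.p_cstar[OF f] by simp
  then show ?thesis by (auto simp: power2_eq_square)
qed

lemma iter_sq_diag:
  assumes d: "diag f" and f: "f \<in> acarrier ST"
  shows "Q.iter_sq f m = (\<lambda>\<gamma>. complex_of_real (cmod (f \<gamma>) ^ 2 ^ Suc m))"
proof (induction m)
  case 0
  show ?case using diag_star_mul[OF d f] by simp
next
  case (Suc m)
  have "diag (Q.iter_sq f m)" unfolding Suc.IH using d by (auto simp: diag_def)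
  from diag_star_mul[OF this Q.iter_sq_in[OF f]]
  have "Q.iter_sq f (Suc m) = (\<lambda>\<gamma>. complex_of_real ((cmod (Q.iter_sq f m \<gamma>))\<^sup>2))" by simp
  also have "\<dots> = (\<lambda>\<gamma>. complex_of_real (cmod (f \<gamma>) ^ 2 ^ Suc (Suc m)))"
  proof
    fix \<gamma>
    have "cmod (Q.iter_sq f m \<gamma>) = cmod (f \<gamma>) ^ 2 ^ Suc m" unfolding Suc.IH by (simp add: norm_power)
    then have "(cmod (Q.iter_sq f m \<gamma>))\<^sup>2 = cmod (f \<gamma>) ^ (2 ^ Suc m * 2)" by (simp only: power_mult)
    then show "complex_of_real ((cmod (Q.iter_sq f m \<gamma>))\<^sup>2) = complex_of_real (cmod (f \<gamma>) ^ 2 ^ Suc (Suc m))"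
      by (simp add: mult.commute)
  qed
  finally show ?case .
qed

text \<open>
  \<open>f\<close> is the sum of \<open>c\<close> times the indicator of \<open>f = c\<close> over its finitely many values. The iterated squares of
  \<open>f\<close> have no more values than \<open>f\<close>, so in \<open>q_diag\<close> the cardinality goes away by \<open>spectral_compare\<close>.
\<close>

lemma q_diag_crude:
  assumes d: "diag f" and f: "f \<in> acarrier ST" and M: "\<And>\<gamma>. cmod (f \<gamma>) \<le> M"
  shows "q f \<le> real (card (range f)) * M"
proof -
  let ?R = "range f - {0}"
  let ?e = "\<lambda>c \<gamma>. if f \<gamma> = c then 1 else (0::complex)"
  have fin: "finite ?R" "card ?R \<le> card (range f)"
    using st_finite_range[OF f] by (auto intro: card_mono)
  have M0: "M \<ge> 0" using M[of undefined] norm_ge_zero order_trans by blast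
  have e_in: "?e c \<in> acarrier ST" if "c \<noteq> 0" for c
    using st_compose[OF f, of "\<lambda>z. if z = c then 1 else 0"] that by simp
  have e_q: "q (?e c) \<le> 1" if "c \<noteq> 0" for c
    by (rule q_indicator[OF _ e_in[OF that]]) (use d that in \<open>auto simp: diag_def split: if_splits\<close>)
  let ?T = "\<lambda>c. c \<cdot>\<^bsub>ST\<^esub> ?e c"
  have T_in: "?T \<in> ?R \<rightarrow> acarrier ST" using e_in by auto
  have "f = asum ST ?T ?R"
    unfolding st_asum[OF fin(1) T_in]
  proof
    fix \<gamma>
    have "(\<Sum>c\<in>?R. ?T c \<gamma>) = (\<Sum>c\<in>?R. if f \<gamma> = c then c else 0)"
      by (rule sum.cong) (auto simp: st_ops)
    also have "\<dots> = f \<gamma>" using fin(1) by (simp add: sum.delta')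
    finally show "f \<gamma> = (\<Sum>c\<in>?R. ?T c \<gamma>)" by simp
  qed
  then have "q f \<le> (\<Sum>c\<in>?R. q (?T c))" using Q.p_asum[OF fin(1) T_in] by simp
  also have "\<dots> \<le> (\<Sum>c\<in>?R. M)"
  proof (rule sum_mono)
    fix c assume c: "c \<in> ?R"
    then have c0: "c \<noteq> 0" and cM: "cmod c \<le> M" using M by auto
    have "q (?T c) = cmod c * q (?e c)" by (rule Q.p_scale[OF e_in[OF c0]])
    also have "\<dots> \<le> M * 1" using e_q[OF c0] cM M0 Q.p_nonneg[OF e_in[OF c0]] by (intro mult_mono) auto
    finally show "q (?T c) \<le> M" by simp
  qed
  also have "\<dots> \<le> real (card (range f)) * M" using fin(2) M0 by (simp add: mult_right_mono)
  finally show ?thesis .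
qed

lemma q_diag:
  assumes d: "diag f" and f: "f \<in> acarrier ST" and M: "\<And>\<gamma>. cmod (f \<gamma>) \<le> M"
  shows "q f \<le> M"
proof (rule spectral_compare[where a = 0 and b = "real (card (range f))"])
  show "0 \<le> q f" by (rule Q.p_nonneg[OF f])
  show "0 \<le> M" using M[of undefined] norm_ge_zero order_trans by blast
  fix m
  let ?g = "Q.iter_sq f m" and ?h = "\<lambda>z. complex_of_real (cmod z ^ 2 ^ Suc m)"
  have g: "?g = (\<lambda>\<gamma>. ?h (f \<gamma>))" by (rule iter_sq_diag[OF d f])
  have gM: "cmod (?g \<gamma>) \<le> M ^ 2 ^ Suc m" for \<gamma>
    unfolding g using M[of \<gamma>] by (simp add: norm_power power_mono del: power_Suc)
  have "diag ?g" unfolding g using d by (auto simp: diag_def)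
  from q_diag_crude[OF this Q.iter_sq_in[OF f] gM]
  have "q f ^ 2 ^ Suc m \<le> real (card (range ?g)) * M ^ 2 ^ Suc m" by (simp only: Q.p_iter_sq[OF f])
  also have "range ?g = ?h ` range f" unfolding g by (simp add: image_image)
  also have "real (card (?h ` range f)) * M ^ 2 ^ Suc m \<le> real (card (range f)) * M ^ 2 ^ Suc m"
    by (intro mult_right_mono) (use card_image_le[OF st_finite_range[OF f], of ?h] \<open>0 \<le> M\<close> in auto)
  finally show "q f ^ 2 ^ Suc m \<le> (0 * 2 ^ m + real (card (range f))) * M ^ 2 ^ Suc m" by simp
qed

text \<open>
  If the support is a bisection, then \<open>f\<^sup>* f\<close> lives on the units and is bounded by \<open>M\<^sup>2\<close>.
\<close>

lemma q_bisection:
  assumes f: "f \<in> acarrier ST" and M: "\<And>\<gamma>. cmod (f \<gamma>) \<le> M"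
    and left: "\<And>x k y x' k'. f (x, k, y) \<noteq> 0 \<Longrightarrow> f (x', k', y) \<noteq> 0 \<Longrightarrow> x' = x \<and> k' = k"
    and right: "\<And>x k y k' y'. f (x, k, y) \<noteq> 0 \<Longrightarrow> f (x, k', y') \<noteq> 0 \<Longrightarrow> k' = k \<and> y' = y"
  shows "q f \<le> M"
proof -
  let ?g = "star\<^bsub>ST\<^esub> f \<otimes>\<^bsub>ST\<^esub> f"
  have M0: "0 \<le> M" using M[of undefined] norm_ge_zero order_trans by blast
  note sf = ST.star_in[OF f]
  have g: "?g \<in> acarrier ST" using f by simp
  have "diag ?g"
    unfolding diag_def
  proof (intro allI impI)
    fix x k y assume "?g (x, k, y) \<noteq> 0"
    then obtain z p where "(star\<^bsub>ST\<^esub> f) (x, k - p, z) \<noteq> 0" and fp: "f (z, p, y) \<noteq> 0"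
      using mul_supp[OF sf f] by blast
    then have "f (z, p - k, x) \<noteq> 0" by (simp add: st_ops)
    from right[OF this fp] show "k = 0 \<and> y = x" by simp
  qed
  moreover have "cmod (?g \<gamma>) \<le> M\<^sup>2" for \<gamma>
  proof -
    obtain x k y where \<gamma>: "\<gamma> = (x, k, y)" by (cases \<gamma>)
    show ?thesis
    proof (cases "?g \<gamma> = 0")
      case False
      then obtain z p where fp: "f (z, p, y) \<noteq> 0" using mul_supp[OF sf f] unfolding \<gamma> by blast
      have "?g (x, k, y) = (\<Sum>(z, p)\<in>{(z, p)}. (star\<^bsub>ST\<^esub> f) (x, k - p, z) * f (z, p, y))"
      proof (rule st_mul[OF sf f])
        fix z' p' assume "(star\<^bsub>ST\<^esub> f) (x, k - p', z') * f (z', p', y) \<noteq> 0"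
        then have "f (z', p', y) \<noteq> 0" by auto
        from left[OF fp this] show "(z', p') \<in> {(z, p)}" by simp
      qed simp
      then have "cmod (?g \<gamma>) = cmod (f (z, p - k, x)) * cmod (f (z, p, y))"
        unfolding \<gamma> by (simp add: st_ops norm_mult)
      also have "\<dots> \<le> M * M" using M M0 by (intro mult_mono) auto
      finally show ?thesis by (simp add: power2_eq_square)
    qed (use M0 in simp)
  qed
  ultimately have "q ?g \<le> M\<^sup>2" using q_diag[OF _ g] by blast
  then have "(q f)\<^sup>2 \<le> M\<^sup>2" using Q.p_cstar[OF f] by simp
  then show ?thesis using M0 by (rule power2_le_imp_le)
qed

definition level :: "nat \<Rightarrow> ('a arrow \<Rightarrow> complex) \<Rightarrow> bool" where
  "level n f \<longleftrightarrow> (\<forall>x k y. f (x, k, y) \<noteq> 0 \<longrightarrow> x \<in> X \<and> y \<in> X \<and> k = 0 \<and> (\<sigma> ^^ n) x = (\<sigma> ^^ n) y)"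

lemma level_star: "level n f \<Longrightarrow> level n (star\<^bsub>ST\<^esub> f)"
  unfolding level_def
proof (intro allI impI)
  fix x k y
  assume l: "\<forall>x k y. f (x, k, y) \<noteq> 0 \<longrightarrow> x \<in> X \<and> y \<in> X \<and> k = 0 \<and> (\<sigma> ^^ n) x = (\<sigma> ^^ n) y"
    and "(star\<^bsub>ST\<^esub> f) (x, k, y) \<noteq> 0"
  then have "f (y, - k, x) \<noteq> 0" by (simp add: st_ops)
  with l have "y \<in> X \<and> x \<in> X \<and> - k = 0 \<and> (\<sigma> ^^ n) y = (\<sigma> ^^ n) x" by blast
  then show "x \<in> X \<and> y \<in> X \<and> k = 0 \<and> (\<sigma> ^^ n) x = (\<sigma> ^^ n) y" by simp
qed

lemma level_mul:
  assumes f: "f \<in> acarrier ST" and h: "h \<in> acarrier ST" and l: "level n f" "level n h"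
  shows "level n (f \<otimes>\<^bsub>ST\<^esub> h)"
  unfolding level_def
proof (intro allI impI)
  fix x k y assume "(f \<otimes>\<^bsub>ST\<^esub> h) (x, k, y) \<noteq> 0"
  then obtain z p where zp: "f (x, k - p, z) \<noteq> 0" "h (z, p, y) \<noteq> 0" using mul_supp[OF f h] by blast
  then have 1: "x \<in> X \<and> z \<in> X \<and> k - p = 0 \<and> (\<sigma> ^^ n) x = (\<sigma> ^^ n) z"
    using l(1) unfolding level_def by blast
  from zp have 2: "z \<in> X \<and> y \<in> X \<and> p = 0 \<and> (\<sigma> ^^ n) z = (\<sigma> ^^ n) y"
    using l(2) unfolding level_def by blast
  from 1 2 show "x \<in> X \<and> y \<in> X \<and> k = 0 \<and> (\<sigma> ^^ n) x = (\<sigma> ^^ n) y" by simp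
qed

lemma level_iter_sq:
  assumes f: "f \<in> acarrier ST" and l: "level n f"
  shows "level n (Q.iter_sq f m)"
proof (induction m)
  case 0
  show ?case using level_mul[OF ST.star_in[OF f] f level_star[OF l] l] by simp
next
  case (Suc m)
  note i = Q.iter_sq_in[OF f, of m]
  show ?case using level_mul[OF ST.star_in[OF i] i level_star[OF Suc] Suc] by simp
qed

text \<open>
  The relation \<open>\<sigma>\<^sup>n x = \<sigma>\<^sup>n y\<close> is covered by the bisections \<open>Z \<times> Z'\<close> with \<open>Z\<close>, \<open>Z'\<close> pieces on which \<open>\<sigma>\<^sup>n\<close> is
  injective. The constant depends on \<open>n\<close> only, and not on \<open>f\<close>.
\<close>

lemma q_level:
  "\<exists>K. \<forall>f M. f \<in> acarrier ST \<longrightarrow> level n f \<longrightarrow> (\<forall>\<gamma>. cmod (f \<gamma>) \<le> M) \<longrightarrow> q f \<le> K * M"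
proof -
  obtain D where D: "finite D" "\<Union>D = X"
    and op: "\<And>Z. Z \<in> D \<Longrightarrow> openin (top_of_set X) Z" and inj: "\<And>Z. Z \<in> D \<Longrightarrow> inj_on (\<sigma> ^^ n) Z"
    and dis: "\<And>Z Z'. Z \<in> D \<Longrightarrow> Z' \<in> D \<Longrightarrow> Z \<noteq> Z' \<Longrightarrow> Z \<inter> Z' = {}"
    using injective_pieces[of n] by (elim exE conjE) blast
  have "q f \<le> real (card (D \<times> D)) * M"
    if f: "f \<in> acarrier ST" and l: "level n f" and M: "\<And>\<gamma>. cmod (f \<gamma>) \<le> M" for f M
  proof -
    define E where "E = (\<lambda>(Z, Z'). Zset \<sigma> Z n n Z')"
    define F where "F d = (\<lambda>\<gamma>. if \<gamma> \<in> E d then f \<gamma> else 0)" for d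
    have M0: "0 \<le> M" using M[of undefined] norm_ge_zero order_trans by blast
    have Edis: "d = d'" if d: "d \<in> D \<times> D" "d' \<in> D \<times> D" and "\<gamma> \<in> E d" "\<gamma> \<in> E d'" for d d' \<gamma>
    proof -
      obtain Z1 Z2 Z3 Z4 where dd: "d = (Z1, Z2)" "d' = (Z3, Z4)" by (cases d; cases d')
      with that(3,4) obtain x y where "x \<in> Z1 \<inter> Z3" "y \<in> Z2 \<inter> Z4" by (auto simp: E_def Zset_def)
      with dis[of Z1 Z3] dis[of Z2 Z4] d show ?thesis unfolding dd by blast
    qed
    have Ecov: "\<exists>d\<in>D \<times> D. \<gamma> \<in> E d" if "f \<gamma> \<noteq> 0" for \<gamma>
    proof -
      obtain x k y where \<gamma>: "\<gamma> = (x, k, y)" by (cases \<gamma>)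
      then have h: "x \<in> X" "y \<in> X" "k = 0" "(\<sigma> ^^ n) x = (\<sigma> ^^ n) y"
        using that l unfolding level_def by blast+
      then obtain Z Z' where Z: "Z \<in> D" "Z' \<in> D" "x \<in> Z" "y \<in> Z'" using D(2) by blast
      have "\<gamma> \<in> E (Z, Z')" using Z h by (auto simp: E_def Zset_def \<gamma>)
      then show ?thesis using Z by blast
    qed
    have Eopen: "openin tG (E d)" if "d \<in> D \<times> D" for d
      using that op open_Zset by (auto simp: E_def)
    have F_in: "F d \<in> acarrier ST" if d: "d \<in> D \<times> D" for d
      unfolding F_def
    proof (rule st_cut[OF f])
      fix \<gamma> assume "f \<gamma> \<noteq> 0"
      then obtain d' where d': "d' \<in> D \<times> D" "\<gamma> \<in> E d'" using Ecov by blast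
      have "E d' \<subseteq> E d \<or> E d' \<inter> E d = {}"
      proof (cases "d' = d")
        case False
        then show ?thesis using Edis[OF d'(1) d] by blast
      qed simp
      then show "\<exists>W. openin tG W \<and> \<gamma> \<in> W \<and> (W \<subseteq> E d \<or> W \<inter> E d = {})"
        using d' Eopen[OF d'(1)] by (intro exI[of _ "E d'"] conjI)
    qed
    have F_Pi: "F \<in> D \<times> D \<rightarrow> acarrier ST" using F_in by (rule Pi_I)
    have F_q: "q (F d) \<le> M" if d: "d \<in> D \<times> D" for d
    proof (rule q_bisection[OF F_in[OF d]])
      obtain Z Z' where ZZ: "d = (Z, Z')" by (cases d)
      have S: "x \<in> Z \<and> y \<in> Z' \<and> k = 0 \<and> (\<sigma> ^^ n) x = (\<sigma> ^^ n) y" if "F d (x, k, y) \<noteq> 0" for x k y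
        using that by (auto simp: F_def E_def Zset_def ZZ split: if_splits)
      have i: "inj_on (\<sigma> ^^ n) Z" "inj_on (\<sigma> ^^ n) Z'" using inj d unfolding ZZ by auto
      show "cmod (F d \<gamma>) \<le> M" for \<gamma> using M[of \<gamma>] M0 by (simp add: F_def)
      show "x' = x \<and> k' = k" if "F d (x, k, y) \<noteq> 0" "F d (x', k', y) \<noteq> 0" for x k y x' k'
        using S[OF that(1)] S[OF that(2)] inj_onD[OF i(1), of x' x] by simp
      show "k' = k \<and> y' = y" if "F d (x, k, y) \<noteq> 0" "F d (x, k', y') \<noteq> 0" for x k y k' y'
        using S[OF that(1)] S[OF that(2)] inj_onD[OF i(2), of y' y] by simp
    qed
    have finD: "finite (D \<times> D)" using D(1) by simp
    have "f = asum ST F (D \<times> D)"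
      unfolding st_asum[OF finD F_Pi]
    proof
      fix \<gamma>
      show "f \<gamma> = (\<Sum>d\<in>D \<times> D. F d \<gamma>)"
      proof (cases "f \<gamma> = 0")
        case True
        then have "F d \<gamma> = 0" for d by (simp add: F_def)
        then show ?thesis using True by simp
      next
        case False
        then obtain d where d: "d \<in> D \<times> D" "\<gamma> \<in> E d" using Ecov by blast
        have "F d' \<gamma> = (if d' = d then f \<gamma> else 0)" if "d' \<in> D \<times> D" for d'
        proof (cases "\<gamma> \<in> E d'")
          case True
          then have "d' = d" by (rule Edis[OF that d(1) _ d(2)])
          then show ?thesis using True by (simp add: F_def)
        next
          case False
          then have "d' \<noteq> d" using d(2) by blast
          then show ?thesis using False by (simp add: F_def)
        qed
        then have "(\<Sum>d'\<in>D \<times> D. F d' \<gamma>) = (\<Sum>d'\<in>D \<times> D. if d' = d then f \<gamma> else 0)"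
          by (rule sum.cong[OF HOL.refl])
        also have "\<dots> = (if d \<in> D \<times> D then f \<gamma> else 0)" by (rule sum.delta[OF finD])
        also have "\<dots> = f \<gamma>" using d(1) by (rule if_P)
        finally show ?thesis by (rule HOL.sym)
      qed
    qed
    then have "q f \<le> (\<Sum>d\<in>D \<times> D. q (F d))" using Q.p_asum[OF finD F_Pi] by simp
    also have "\<dots> \<le> real (card (D \<times> D)) * M" by (rule sum_bounded_above) (rule F_q)
    finally show ?thesis .
  qed
  then show ?thesis by blast
qed

lemma repr_iter_sq:
  assumes "represents f T" "f \<in> acarrier ST"
  shows "represents (Q.iter_sq f m) (OP.iter_sq T m)"
proof (induction m)
  case 0
  show ?case using repr_mul[OF repr_star[OF assms(1)] assms(1) ST.star_in[OF assms(2)] assms(2)] by simp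
next
  case (Suc m)
  note i = Q.iter_sq_in[OF assms(2), of m]
  show ?case using repr_mul[OF repr_star[OF Suc] Suc ST.star_in[OF i] i] by simp
qed

text \<open>
  The iterated squares of \<open>f\<close> stay on the same relation, so the constant of \<open>q_level\<close> is the same for all
  of them.
\<close>

lemma q_repr_level:
  assumes f: "f \<in> acarrier ST" and l: "level n f" and r: "represents f T"
  shows "q f \<le> opnorm T"
proof -
  note T = reprD(1)[OF r]
  obtain K where K: "\<And>f M. f \<in> acarrier ST \<Longrightarrow> level n f \<Longrightarrow> (\<And>\<gamma>. cmod (f \<gamma>) \<le> M) \<Longrightarrow> q f \<le> K * M"
    using q_level[of n] by (elim exE) blast
  show ?thesis
  proof (rule spectral_compare[where a = 0 and b = K])
    show "0 \<le> q f" by (rule Q.p_nonneg[OF f])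
    show "0 \<le> opnorm T" by (rule OP.p_nonneg[OF T])
    fix m
    have "q (Q.iter_sq f m) \<le> K * opnorm (OP.iter_sq T m)"
      by (rule K[OF Q.iter_sq_in[OF f] level_iter_sq[OF f l]]) (rule repr_bound[OF repr_iter_sq[OF r f]])
    then show "q f ^ 2 ^ Suc m \<le> (0 * 2 ^ m + K) * opnorm T ^ 2 ^ Suc m"
      by (simp only: Q.p_iter_sq[OF f] OP.p_iter_sq[OF T] mult_zero_left add_0_left)
  qed
qed

text \<open>
  \<open>f\<^sup>* f\<close> has degree zero. By compactness it lives on some relation \<open>\<sigma>\<^sup>N x = \<sigma>\<^sup>N y\<close>, as these increase with \<open>N\<close>.
\<close>

lemma q_homogeneous:
  assumes f: "f \<in> acarrier ST" and hom: "\<And>x l y. f (x, l, y) \<noteq> 0 \<Longrightarrow> l = k" and r: "represents f T"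
  shows "q f \<le> opnorm T"
proof -
  let ?g = "star\<^bsub>ST\<^esub> f \<otimes>\<^bsub>ST\<^esub> f"
  note T = reprD(1)[OF r] and sf = ST.star_in[OF f]
  have g: "?g \<in> acarrier ST" using f by simp
  have rg: "represents ?g (star\<^bsub>op_alg\<^esub> T \<otimes>\<^bsub>op_alg\<^esub> T)" by (rule repr_mul[OF repr_star[OF r] r sf f])
  obtain N where N: "\<And>x k y. ?g (x, k, y) \<noteq> 0 \<Longrightarrow> x \<in> X \<and> y \<in> X \<and>
      (\<exists>m\<le>N. \<exists>n\<le>N. k = int m - int n \<and> (\<sigma> ^^ m) x = (\<sigma> ^^ n) y)"
    using st_levels[OF g] by (elim exE) blast
  have "level N ?g"
    unfolding level_def
  proof (intro allI impI)
    fix x l y assume nz: "?g (x, l, y) \<noteq> 0"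
    then obtain z p where zp: "(star\<^bsub>ST\<^esub> f) (x, l - p, z) \<noteq> 0" "f (z, p, y) \<noteq> 0"
      using mul_supp[OF sf f] by blast
    have "p - l = k" using hom[of z "p - l" x] zp(1) by (simp add: st_ops)
    with hom[OF zp(2)] have l: "l = 0" by simp
    obtain m where m: "m \<le> N" "(\<sigma> ^^ m) x = (\<sigma> ^^ m) y" using N[OF nz] l by auto
    \<comment> \<open>apply \<open>\<sigma>\<close> to both sides \<open>N - m\<close> times\<close>
    have "(\<sigma> ^^ (N - m + m)) x = (\<sigma> ^^ (N - m + m)) y"
      unfolding funpow_add comp_apply m(2) by (rule HOL.refl)
    then show "x \<in> X \<and> y \<in> X \<and> l = 0 \<and> (\<sigma> ^^ N) x = (\<sigma> ^^ N) y"
      using N[OF nz] l m(1) by simp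
  qed
  from q_repr_level[OF g this rg] have "(q f)\<^sup>2 \<le> (opnorm T)\<^sup>2"
    by (simp only: Q.p_cstar[OF f] OP.p_cstar[OF T])
  then show ?thesis using OP.p_nonneg[OF T] by (rule power2_le_imp_le)
qed

definition degree_le :: "nat \<Rightarrow> ('a arrow \<Rightarrow> complex) \<Rightarrow> bool" where
  "degree_le d f \<longleftrightarrow> (\<forall>x k y. f (x, k, y) \<noteq> 0 \<longrightarrow> \<bar>k\<bar> \<le> int d)"

lemma q_degree:
  assumes f: "f \<in> acarrier ST" and d: "degree_le d f" and r: "represents f T"
  shows "q f \<le> (2 * real d + 1) * opnorm T"
proof -
  let ?I = "{- int d .. int d}"
  define D where "D k = {(x :: 'a, l :: int, y :: 'a). l = k}" for k
  define F where "F k = (\<lambda>\<gamma>. if \<gamma> \<in> D k then f \<gamma> else 0)" for k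
  have F_in: "F k \<in> acarrier ST" for k
    unfolding F_def
  proof (rule st_cut[OF f])
    fix \<gamma> assume "\<gamma> \<in> GG"
    then obtain m n where g: "\<gamma> \<in> Zset \<sigma> X m n X" by (auto simp: groupoid_def)
    have "Zset \<sigma> X m n X \<subseteq> D k \<or> Zset \<sigma> X m n X \<inter> D k = {}" by (auto simp: Zset_def D_def)
    moreover have "openin tG (Zset \<sigma> X m n X)" by (rule open_Zset) simp_all
    ultimately show "\<exists>W. openin tG W \<and> \<gamma> \<in> W \<and> (W \<subseteq> D k \<or> W \<inter> D k = {})"
      using g by (intro exI[of _ "Zset \<sigma> X m n X"] conjI)
  qed
  have F_Pi: "F \<in> ?I \<rightarrow> acarrier ST" using F_in by (intro Pi_I)
  have "f = asum ST F ?I"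
    unfolding st_asum[OF finite_atLeastAtMost_int F_Pi]
  proof
    fix \<gamma> :: "'a arrow"
    obtain x l y where \<gamma>: "\<gamma> = (x, l, y)" by (cases \<gamma>)
    have "(\<Sum>k\<in>?I. F k \<gamma>) = (\<Sum>k\<in>?I. if k = l then f \<gamma> else 0)"
      by (rule sum.cong[OF HOL.refl]) (simp add: F_def D_def \<gamma>)
    also have "\<dots> = (if l \<in> ?I then f \<gamma> else 0)" by (simp only: sum.delta finite_atLeastAtMost_int)
    also have "\<dots> = f \<gamma>"
    proof (cases "f \<gamma> = 0")
      case False
      then have "\<bar>l\<bar> \<le> int d" using d unfolding \<gamma> degree_le_def by blast
      then have "l \<in> ?I" by auto
      then show ?thesis by simp
    qed simp
    finally show "f \<gamma> = (\<Sum>k\<in>?I. F k \<gamma>)" by (rule HOL.sym)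
  qed
  then have "q f \<le> (\<Sum>k\<in>?I. q (F k))" using Q.p_asum[OF finite_atLeastAtMost_int F_Pi] by simp
  also have "\<dots> \<le> real (card ?I) * opnorm T"
  proof (rule sum_bounded_above)
    fix k assume "k \<in> ?I"
    then have k: "\<bar>k\<bar> \<le> int d" by auto
    have deg: "\<bar>l\<bar> \<le> int d" if "f (x, l, y) \<noteq> 0" for x l y using d that unfolding degree_le_def by blast
    have "\<exists>U. represents (\<lambda>(x, l, y). if l = k then f (x, l, y) else 0) U \<and> opnorm U \<le> opnorm T"
      by (rule repr_degree[OF r _ k]) (rule deg)
    then obtain U where U: "represents (\<lambda>(x, l, y). if l = k then f (x, l, y) else 0) U" "opnorm U \<le> opnorm T"
      by (elim exE conjE)
    have "F k = (\<lambda>(x, l, y). if l = k then f (x, l, y) else 0)" by (auto simp: F_def D_def fun_eq_iff)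
    with U(1) have rU: "represents (F k) U" by simp
    have "q (F k) \<le> opnorm U"
      by (rule q_homogeneous[OF F_in _ rU, of k]) (auto simp: F_def D_def split: if_splits)
    then show "q (F k) \<le> opnorm T" using U(2) by simp
  qed
  also have "real (card ?I) = 2 * real d + 1" by simp
  finally show ?thesis .
qed

lemma degree_star_mul:
  assumes f: "f \<in> acarrier ST" and d: "degree_le d f"
  shows "degree_le (2 * d) (star\<^bsub>ST\<^esub> f \<otimes>\<^bsub>ST\<^esub> f)"
  unfolding degree_le_def
proof (intro allI impI)
  fix x k y assume "(star\<^bsub>ST\<^esub> f \<otimes>\<^bsub>ST\<^esub> f) (x, k, y) \<noteq> 0"
  then obtain z p where zp: "(star\<^bsub>ST\<^esub> f) (x, k - p, z) \<noteq> 0" "f (z, p, y) \<noteq> 0"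
    using mul_supp[OF ST.star_in[OF f] f] by blast
  then have "f (z, p - k, x) \<noteq> 0" by (simp add: st_ops)
  then have "\<bar>p - k\<bar> \<le> int d" using d unfolding degree_le_def by blast
  moreover have "\<bar>p\<bar> \<le> int d" using d zp(2) unfolding degree_le_def by blast
  ultimately show "\<bar>k\<bar> \<le> int (2 * d)" by linarith
qed

lemma degree_iter_sq:
  assumes f: "f \<in> acarrier ST" and d: "degree_le d f"
  shows "degree_le (2 ^ Suc m * d) (Q.iter_sq f m)"
proof (induction m)
  case 0
  show ?case using degree_star_mul[OF f d] by simp
next
  case (Suc m)
  show ?case using degree_star_mul[OF Q.iter_sq_in[OF f] Suc] by (simp add: mult.assoc)
qed

text \<open>
  The degrees of the iterated squares of \<open>f\<close> grow linearly in \<open>2^m\<close>, and so does the factor in \<open>q_degree\<close>.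
\<close>

lemma q_le_opnorm:
  assumes f: "f \<in> acarrier ST" and r: "represents f T"
  shows "q f \<le> opnorm T"
proof -
  note T = reprD(1)[OF r]
  obtain N where N: "\<And>x k y. f (x, k, y) \<noteq> 0 \<Longrightarrow> x \<in> X \<and> y \<in> X \<and>
      (\<exists>m\<le>N. \<exists>n\<le>N. k = int m - int n \<and> (\<sigma> ^^ m) x = (\<sigma> ^^ n) y)"
    using st_levels[OF f] by (elim exE) blast
  have d: "degree_le N f"
    unfolding degree_le_def
  proof (intro allI impI)
    fix x k y assume "f (x, k, y) \<noteq> 0"
    then obtain m n where "m \<le> N" "n \<le> N" "k = int m - int n" using N by blast
    then show "\<bar>k\<bar> \<le> int N" by linarith
  qed
  show ?thesis
  proof (rule spectral_compare[where a = "4 * real N" and b = 1])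
    show "0 \<le> q f" by (rule Q.p_nonneg[OF f])
    show "0 \<le> opnorm T" by (rule OP.p_nonneg[OF T])
    fix m
    have "q f ^ 2 ^ Suc m \<le> (2 * real (2 ^ Suc m * N) + 1) * opnorm T ^ 2 ^ Suc m"
      using q_degree[OF Q.iter_sq_in[OF f] degree_iter_sq[OF f d] repr_iter_sq[OF r f], of m]
      by (simp only: Q.p_iter_sq[OF f] OP.p_iter_sq[OF T])
    also have "2 * real (2 ^ Suc m * N) + 1 = 4 * real N * 2 ^ m + 1" by simp
    finally show "q f ^ 2 ^ Suc m \<le> (4 * real N * 2 ^ m + 1) * opnorm T ^ 2 ^ Suc m" .
  qed
qed

end


section \<open>The representation of \<open>L\<^sub>2\<^sub>n\<close>\<close>

text \<open>
  The index \<open>(x, k, False)\<close> belongs to range vertices and \<open>(x, k, True)\<close> to source vertices. A vertex acts as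
  the indicator of its set. A blue edge moves a point between the copies, and a red edge in addition
  applies \<open>\<sigma>\<close> and shifts the degree by one, as \<open>(x, 1, \<sigma> x)\<close> is an arrow of degree \<open>1\<close>. The relations of
  \<open>L\<^sub>2\<^sub>n\<close> hold because \<open>\<sigma>\<close> is injective on each \<open>Z\<close> and the sets \<open>W\<close> below \<open>Z\<close>, or below \<open>\<sigma>(Z)\<close>, partition \<open>Z\<close>,
  or \<open>\<sigma>(Z)\<close>.
\<close>

context diagram
begin

definition vrel :: "'a vertex \<Rightarrow> (('a \<times> int \<times> bool) \<times> ('a \<times> int \<times> bool)) set" where
  "vrel v = Id_on {(x, k, b). x \<in> snd v \<and> b = odd (fst v)}"

fun erel :: "'a edge \<Rightarrow> (('a \<times> int \<times> bool) \<times> ('a \<times> int \<times> bool)) set" where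
  "erel (Edge Blue _ Z W) = {((x, k, False), (x, k, True)) | x k. x \<in> W}"
| "erel (Edge Red _ Z W) = {((x, k + 1, False), (\<sigma> x, k, True)) | x k. x \<in> Z \<and> \<sigma> x \<in> W}"

fun edom :: "'a edge \<Rightarrow> 'a set" where
  "edom (Edge Blue _ Z W) = W"
| "edom (Edge Red _ Z W) = {x \<in> Z. \<sigma> x \<in> W}"

lemma even_edge_cases:
  assumes "e \<in> F1 \<sigma> P (2 * n)"
  obtains (blue) Z W where "e = Edge Blue (2 * n) Z W" "Z \<in> P (2 * n)" "W \<in> P (Suc (2 * n))" "W \<subseteq> Z"
  | (red) Z W where "e = Edge Red (2 * n) Z W" "Z \<in> P (2 * n)" "W \<in> P (Suc (2 * n))" "W \<subseteq> \<sigma> ` Z"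
  using assms unfolding F1_def by auto

lemma part_inj_vrel [simp]: "part_inj (vrel v)"
  by (simp add: vrel_def)

lemma part_inj_erel:
  assumes "e \<in> F1 \<sigma> P (2 * n)" shows "part_inj (erel e)"
  using assms
proof (cases rule: even_edge_cases)
  case (blue Z W)
  then show ?thesis by (auto simp: part_inj_def single_valued_def)
next
  case (red Z W)
  have "x = y" if "x \<in> Z" "y \<in> Z" "\<sigma> x = \<sigma> y" for x y
    by (rule inj_onD[OF inj_on_part[OF ref red(2)] that(3,1,2)])
  then show ?thesis unfolding red(1) by (auto simp: part_inj_def single_valued_def)
qed

lemma erel_range: assumes "e \<in> F1 \<sigma> P (2 * n)" shows "vrel (erange e) O erel e = erel e"
  using assms by (cases rule: even_edge_cases) (auto simp: vrel_def erange_def)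

lemma erel_source: assumes "e \<in> F1 \<sigma> P (2 * n)" shows "erel e O vrel (esource e) = erel e"
  using assms by (cases rule: even_edge_cases) (auto simp: vrel_def esource_def)

lemma erel_final:
  assumes "e \<in> F1 \<sigma> P (2 * n)" shows "erel e O (erel e)\<inverse> = Id_on {(x, k, b). b = False \<and> x \<in> edom e}"
  using assms
proof (cases rule: even_edge_cases)
  case (blue Z W)
  then show ?thesis by auto
next
  case (red Z W)
  have "x = y" if "x \<in> Z" "y \<in> Z" "\<sigma> x = \<sigma> y" for x y
    by (rule inj_onD[OF inj_on_part[OF ref red(2)] that(3,1,2)])
  moreover have "\<exists>l::int. k = l + 1" for k by (rule exI[of _ "k - 1"]) simp
  ultimately show ?thesis unfolding red(1) by (fastforce simp: relcomp_unfold Id_on_def)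
qed

lemma erel_initial:
  assumes e: "e \<in> F1 \<sigma> P (2 * n)" and f: "f \<in> F1 \<sigma> P (2 * n)" and same: "ecol e = ecol f" "erange e = erange f"
  shows "(erel e)\<inverse> O erel f = (if e = f then vrel (esource e) else {})"
  using e
proof (cases rule: even_edge_cases)
  case (blue Z W)
  obtain W' where W': "f = Edge Blue (2 * n) Z W'" "W' \<in> P (Suc (2 * n))"
    by (rule even_edge_cases[OF f]) (use same blue(1) in \<open>auto simp: erange_def\<close>)
  show ?thesis
  proof (cases "e = f")
    case True
    then show ?thesis using blue(1) by (auto simp: vrel_def esource_def)
  next
    case False
    then have "W \<inter> W' = {}" using part_props(4)[OF ref blue(3) W'(2)] blue(1) W'(1) by blast
    then show ?thesis using False by (auto simp: blue(1) W'(1))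
  qed
next
  case (red Z W)
  obtain W' where W': "f = Edge Red (2 * n) Z W'" "W' \<in> P (Suc (2 * n))"
    by (rule even_edge_cases[OF f]) (use same red(1) in \<open>auto simp: erange_def\<close>)
  have inj: "x = y" if "x \<in> Z" "y \<in> Z" "\<sigma> x = \<sigma> y" for x y
    by (rule inj_onD[OF inj_on_part[OF ref red(2)] that(3,1,2)])
  show ?thesis
  proof (cases "e = f")
    case True
    have "(erel e)\<inverse> O erel e = vrel (esource e)"
    proof (intro equalityI subrelI)
      fix p q assume "(p, q) \<in> (erel e)\<inverse> O erel e"
      then obtain x k where "\<sigma> x \<in> W" "p = (\<sigma> x, k, True)" "q = (\<sigma> x, k, True)" unfolding red(1) by auto
      then show "(p, q) \<in> vrel (esource e)" by (auto simp: vrel_def esource_def red(1))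
    next
      fix p q assume "(p, q) \<in> vrel (esource e)"
      then obtain y k where y: "y \<in> W" "p = (y, k, True)" "q = (y, k, True)"
        by (auto simp: vrel_def esource_def red(1))
      then obtain x where x: "x \<in> Z" "y = \<sigma> x" using red(4) by blast
      have "((x, k + 1, False), q) \<in> erel e" "((x, k + 1, False), p) \<in> erel e"
        using x y unfolding red(1) by auto
      then show "(p, q) \<in> (erel e)\<inverse> O erel e" by blast
    qed
    with True show ?thesis by simp
  next
    case False
    then have "W \<inter> W' = {}" using part_props(4)[OF ref red(3) W'(2)] red(1) W'(1) by blast
    then show ?thesis using False inj by (auto simp: red(1) W'(1))
  qed
qed

lemma edom_cover:
  assumes v: "v \<in> F0 P (2 * n)"
  shows "(\<Union>e\<in>coloured_edges \<sigma> P c v. edom e) = snd v"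
proof -
  obtain Z where Z: "v = (2 * n, Z)" "Z \<in> P (2 * n)" using v by (auto simp: F0_def)
  have ZX: "Z \<subseteq> X" using part_props(1)[OF ref, of "2 * n"] Z(2) by blast
  show ?thesis
  proof (cases c)
    case Blue
    have "\<exists>e\<in>coloured_edges \<sigma> P Blue v. x \<in> edom e" if x: "x \<in> Z" for x
    proof -
      obtain W where W: "W \<in> P (Suc (2 * n))" "x \<in> W" using part_ex[of x "Suc (2 * n)"] x ZX by blast
      have "W \<subseteq> Z" by (rule part_sub[OF ref W(1) _ Z(2) W(2) x]) simp
      then have "Edge Blue (2 * n) Z W \<in> coloured_edges \<sigma> P Blue v"
        unfolding Z(1) blue_iff using Z(2) W(1) by blast
      then show ?thesis using W(2) by force
    qed
    then show ?thesis unfolding Blue Z(1) by (fastforce simp: blue_iff)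
  next
    case Red
    have "\<exists>e\<in>coloured_edges \<sigma> P Red v. x \<in> edom e" if x: "x \<in> Z" for x
    proof -
      have "\<sigma> x \<in> X" using surj x ZX by blast
      then obtain W where W: "W \<in> P (2 * n + 1)" "\<sigma> x \<in> W" using part_ex[of "\<sigma> x" "2 * n + 1"] by blast
      have "W \<subseteq> \<sigma> ` Z" by (rule image_sub[OF ref Z(2) W]) (use x in blast)
      then have "Edge Red (2 * n) Z W \<in> coloured_edges \<sigma> P Red v"
        unfolding Z(1) red_iff using Z(2) W(1) by simp
      then show ?thesis using W(2) x by force
    qed
    then show ?thesis unfolding Red Z(1) by (fastforce simp: red_iff)
  qed
qed

lemma edom_disjoint:
  assumes e: "e \<in> F1 \<sigma> P (2 * n)" and f: "f \<in> F1 \<sigma> P (2 * n)"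
    and same: "ecol e = ecol f" "erange e = erange f" and ne: "e \<noteq> f"
  shows "edom e \<inter> edom f = {}"
  using e
proof (cases rule: even_edge_cases)
  case (blue Z W)
  obtain W' where W': "f = Edge Blue (2 * n) Z W'" "W' \<in> P (Suc (2 * n))"
    by (rule even_edge_cases[OF f]) (use same blue(1) in \<open>auto simp: erange_def\<close>)
  show ?thesis using part_props(4)[OF ref blue(3) W'(2)] blue(1) W'(1) ne by auto
next
  case (red Z W)
  obtain W' where W': "f = Edge Red (2 * n) Z W'" "W' \<in> P (Suc (2 * n))"
    by (rule even_edge_cases[OF f]) (use same red(1) in \<open>auto simp: erange_def\<close>)
  show ?thesis using part_props(4)[OF ref red(3) W'(2)] red(1) W'(1) ne by auto
qed

text \<open>
  On even levels the edges at a vertex are partitioned by colour alone, which is the reason to represent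
  the even levels only.
\<close>

lemma D_sep_even: "v \<in> F0 P (2 * n) \<Longrightarrow> Y \<in> D_sep \<sigma> P v \<Longrightarrow> \<exists>c. Y = coloured_edges \<sigma> P c v"
  by (auto simp: D_sep_def F0_def)

lemma vrel_mul:
  assumes "v \<in> F0 P (2 * n) \<union> F0 P (Suc (2 * n))" "w \<in> F0 P (2 * n) \<union> F0 P (Suc (2 * n))"
  shows "vrel v O vrel w = (if v = w then vrel v else {})"
proof (cases "v = w")
  case False
  have "snd v \<inter> snd w = {}" if "fst v = fst w"
  proof -
    have "snd v \<in> P (fst v)" "snd w \<in> P (fst v)" using assms that by (auto simp: F0_def)
    moreover have "snd v \<noteq> snd w" using False that by (simp add: prod_eq_iff)
    ultimately show ?thesis using part_props(4)[OF ref] by blast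
  qed
  moreover have "odd (fst v) \<noteq> odd (fst w)" if "fst v \<noteq> fst w"
    using assms that by (auto simp: F0_def)
  ultimately show ?thesis using False by (fastforce simp: vrel_def)
qed (auto simp: vrel_def)

lemma rel_family:
  "leavitt_family (G (2 * n)) (op_alg :: (('a \<times> int \<times> bool) vec_op \<times> ('a \<times> int \<times> bool) vec_op) star_alg)
     (\<lambda>v. ropp (vrel v)) (\<lambda>e. ropp (erel e))"
  unfolding leavitt_family_def graph_sel(1-4)
proof (intro conjI ballI impI Pi_I)
  fix e assume e: "e \<in> F1 \<sigma> P (2 * n)"
  show "ropp (erel e) \<in> acarrier op_alg" by (rule ropp_in[OF part_inj_erel[OF e]])
  show "ropp (vrel (erange e)) \<otimes>\<^bsub>op_alg\<^esub> ropp (erel e) = ropp (erel e)"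
    by (simp only: ropp_mul[OF part_inj_vrel part_inj_erel[OF e]] erel_range[OF e])
  show "ropp (erel e) \<otimes>\<^bsub>op_alg\<^esub> ropp (vrel (esource e)) = ropp (erel e)"
    by (simp only: ropp_mul[OF part_inj_erel[OF e] part_inj_vrel] erel_source[OF e])
next
  fix v w assume "v \<in> F0 P (2 * n) \<union> F0 P (Suc (2 * n))" "w \<in> F0 P (2 * n) \<union> F0 P (Suc (2 * n))"
  then show "ropp (vrel v) \<otimes>\<^bsub>op_alg\<^esub> ropp (vrel w) = (if v = w then ropp (vrel v) else \<zero>\<^bsub>op_alg\<^esub>)"
    by (simp add: ropp_mul vrel_mul ropp_empty)
next
  fix v Y e f
  assume "Y \<in> gsep (G (2 * n)) v" and ef: "e \<in> Y" "f \<in> Y"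
  then have v: "v \<in> F0 P (2 * n)" and Y: "Y \<in> D_sep \<sigma> P v" unfolding gsep_iff by blast+
  obtain c where c: "Y = coloured_edges \<sigma> P c v" using D_sep_even[OF v Y] by blast
  have e: "e \<in> F1 \<sigma> P (2 * n)" and f: "f \<in> F1 \<sigma> P (2 * n)"
    using D_sep_edges[OF v Y ef(1)] D_sep_edges[OF v Y ef(2)] by blast+
  have same: "ecol e = ecol f" "erange e = erange f" using ef unfolding c coloured_edges_def by auto
  have pe: "part_inj ((erel e)\<inverse>)" using part_inj_erel[OF e] by simp
  show "star\<^bsub>op_alg\<^esub> (ropp (erel e)) \<otimes>\<^bsub>op_alg\<^esub> ropp (erel f) =
      (if e = f then ropp (vrel (esource e)) else \<zero>\<^bsub>op_alg\<^esub>)"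
    unfolding ropp_star ropp_mul[OF pe part_inj_erel[OF f]] erel_initial[OF e f same]
    by (simp add: ropp_empty)
next
  fix v Y assume "Y \<in> gsep (G (2 * n)) v"
  then have v: "v \<in> F0 P (2 * n)" and Y: "Y \<in> D_sep \<sigma> P v" unfolding gsep_iff by blast+
  obtain c where c: "Y = coloured_edges \<sigma> P c v" using D_sep_even[OF v Y] by blast
  have F: "e \<in> F1 \<sigma> P (2 * n)" if "e \<in> Y" for e using D_sep_edges[OF v Y that] by blast
  have same: "ecol e = ecol f \<and> erange e = erange f" if "e \<in> Y" "f \<in> Y" for e f
    using that unfolding c coloured_edges_def by auto
  define S where "S e = {(x :: 'a, k :: int, b). b = False \<and> x \<in> edom e}" for e :: "'a edge"
  interpret OA: star_algebra "op_alg :: (('a \<times> int \<times> bool) vec_op \<times> ('a \<times> int \<times> bool) vec_op) star_alg"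
    by (rule op_alg_star_algebra)
  have "asum op_alg (\<lambda>e. ropp (erel e) \<otimes>\<^bsub>op_alg\<^esub> star\<^bsub>op_alg\<^esub> (ropp (erel e))) Y = asum op_alg (\<lambda>e. ropp (Id_on (S e))) Y"
  proof (rule OA.asum_cong[OF HOL.refl])
    fix e assume e: "e \<in> Y"
    have pe: "part_inj ((erel e)\<inverse>)" using part_inj_erel[OF F[OF e]] by simp
    show "ropp (erel e) \<otimes>\<^bsub>op_alg\<^esub> star\<^bsub>op_alg\<^esub> (ropp (erel e)) = ropp (Id_on (S e))"
      unfolding ropp_star ropp_mul[OF part_inj_erel[OF F[OF e]] pe] erel_final[OF F[OF e]] S_def by (rule HOL.refl)
  qed simp
  also have "\<dots> = ropp (Id_on (\<Union>e\<in>Y. S e))"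
  proof (rule ropp_sum[OF D_sep_finite[OF v Y]])
    fix e f assume ef: "e \<in> Y" "f \<in> Y" "e \<noteq> f"
    have "edom e \<inter> edom f = {}"
      by (rule edom_disjoint[OF F[OF ef(1)] F[OF ef(2)]]) (use same[OF ef(1,2)] ef(3) in auto)
    then show "S e \<inter> S f = {}" unfolding S_def by blast
  qed
  also have "(\<Union>e\<in>Y. S e) = {(x, k, b). b = False \<and> x \<in> (\<Union>e\<in>Y. edom e)}" unfolding S_def by blast
  also have "\<dots> = {(x, k, b). x \<in> snd v \<and> b = odd (fst v)}"
    unfolding c edom_cover[OF v] using v by (auto simp: F0_def)
  finally show "asum op_alg (\<lambda>e. ropp (erel e) \<otimes>\<^bsub>op_alg\<^esub> star\<^bsub>op_alg\<^esub> (ropp (erel e))) Y = ropp (vrel v)"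
    by (simp add: vrel_def)
qed (simp_all add: ropp_star vrel_def)

definition rep :: "nat \<Rightarrow> 'a lelem \<Rightarrow> ('a \<times> int \<times> bool) vec_op \<times> ('a \<times> int \<times> bool) vec_op" where
  "rep n = (SOME h. h \<in> star_hom (L (2 * n)) op_alg \<and>
     (\<forall>v\<in>F0 P (2 * n) \<union> F0 P (Suc (2 * n)). h (vt (2 * n) v) = ropp (vrel v)) \<and>
     (\<forall>e\<in>F1 \<sigma> P (2 * n). h (ed (2 * n) e) = ropp (erel e)))"

lemma rep_spec:
  shows rep_hom: "rep n \<in> star_hom (L (2 * n)) op_alg"
    and rep_vt: "v \<in> F0 P (2 * n) \<union> F0 P (Suc (2 * n)) \<Longrightarrow> rep n (vt (2 * n) v) = ropp (vrel v)"
    and rep_ed: "e \<in> F1 \<sigma> P (2 * n) \<Longrightarrow> rep n (ed (2 * n) e) = ropp (erel e)"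
proof -
  let ?Q = "\<lambda>h. h \<in> star_hom (L (2 * n)) op_alg \<and>
     (\<forall>v\<in>F0 P (2 * n) \<union> F0 P (Suc (2 * n)). h (vt (2 * n) v) = ropp (vrel v)) \<and>
     (\<forall>e\<in>F1 \<sigma> P (2 * n). h (ed (2 * n) e) = ropp (erel e))"
  obtain h where h: "h \<in> star_hom (L (2 * n)) op_alg"
    "\<And>v. v \<in> gverts (G (2 * n)) \<Longrightarrow> h (vt (2 * n) v) = ropp (vrel v)"
    "\<And>e. e \<in> gedges (G (2 * n)) \<Longrightarrow> h (ed (2 * n) e) = ropp (erel e)"
    by (rule leavitt_lift[OF op_alg_star_algebra sep[of "2 * n"] rel_family[of n]]) (rule that)
  have "?Q h"
  proof (intro conjI ballI)
    show "h \<in> star_hom (L (2 * n)) op_alg" by (rule h(1))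
    show "h (vt (2 * n) v) = ropp (vrel v)" if "v \<in> F0 P (2 * n) \<union> F0 P (Suc (2 * n))" for v
      by (rule h(2)) (use that in \<open>simp only: graph_sel\<close>)
    show "h (ed (2 * n) e) = ropp (erel e)" if "e \<in> F1 \<sigma> P (2 * n)" for e
      by (rule h(3)) (use that in \<open>simp only: graph_sel\<close>)
  qed
  then have "?Q (rep n)" unfolding rep_def by (rule someI[of ?Q])
  then show "rep n \<in> star_hom (L (2 * n)) op_alg"
    "v \<in> F0 P (2 * n) \<union> F0 P (Suc (2 * n)) \<Longrightarrow> rep n (vt (2 * n) v) = ropp (vrel v)"
    "e \<in> F1 \<sigma> P (2 * n) \<Longrightarrow> rep n (ed (2 * n) e) = ropp (erel e)" by blast+
qed

lemma rep_le_EN: assumes "a \<in> acarrier (L (2 * n))" shows "opnorm (rep n a) \<le> EN (2 * n) a"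
  by (rule EN_upper[OF cstar_seminorm_pullback[OF rep_hom opnorm_cstar_seminorm L_alg] assms])

text \<open>
  \<open>\<sigma>\<close> maps a set of \<open>P (2 * (n + 1))\<close> into a set of \<open>P (2 * n)\<close>, on which the induction hypothesis applies.
\<close>

lemma iterate_part:
  "Z \<in> P (2 * n) \<Longrightarrow> inj_on (\<sigma> ^^ n) Z"
proof (induction n arbitrary: Z)
  case (Suc n)
  obtain x where x: "x \<in> Z" "\<sigma> x \<in> X" using part_meet[OF Suc.prems] by blast
  obtain Z' where Z': "Z' \<in> P (2 * n + 1)" "\<sigma> x \<in> Z'" using part_ex[OF x(2)] by blast
  have "\<sigma> ` Z \<subseteq> Z'" by (rule image_into[OF ref Z'(1) _ x(1) Z'(2)]) (use Suc.prems in simp)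
  moreover obtain Z'' where Z'': "Z'' \<in> P (2 * n)" "Z' \<subseteq> Z''" using refine_step[OF ref Z'(1), of "2 * n"] by auto
  ultimately have "inj_on (\<sigma> ^^ n) (\<sigma> ` Z)" by (intro inj_on_subset[OF Suc.IH[OF Z''(1)]]) blast
  then have "inj_on ((\<sigma> ^^ n) \<circ> \<sigma>) Z" by (rule comp_inj_on[OF inj_on_part[OF ref Suc.prems]])
  then show ?case by (simp only: funpow_Suc_right)
qed simp

lemma injective_partition:
  "\<exists>D. finite D \<and> \<Union>D = X \<and>
      (\<forall>Z\<in>D. openin (top_of_set X) Z \<and> inj_on (\<sigma> ^^ n) Z) \<and> (\<forall>Z\<in>D. \<forall>Z'\<in>D. Z \<noteq> Z' \<longrightarrow> Z \<inter> Z' = {})"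
proof (intro exI[of _ "P (2 * n)"] conjI ballI impI)
  show "finite (P (2 * n))" "\<Union>(P (2 * n)) = X" by (rule part_props(3)[OF ref] part_props(1)[OF ref])+
  fix Z assume Z: "Z \<in> P (2 * n)"
  show "openin (top_of_set X) Z" using ref Z unfolding sigma_refined_def clopen_partition_def by blast
  show "inj_on (\<sigma> ^^ n) Z" by (rule iterate_part[OF Z])
  show "Z \<inter> Z' = {}" if "Z' \<in> P (2 * n)" "Z \<noteq> Z'" for Z' using part_props(4)[OF ref Z that(1)] that(2) by blast
qed

end


section \<open>Transport along isomorphisms\<close>

lemma star_algebra_transfer:
  assumes A: "star_algebra A" and h: "h \<in> star_iso A B" and zero: "\<zero>\<^bsub>B\<^esub> = h \<zero>\<^bsub>A\<^esub>"
  shows "star_algebra B"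
proof -
  interpret A: star_algebra A by (rule A)
  have hh: "h \<in> star_hom A B" and im: "acarrier B = h ` acarrier A"
    using h by (auto simp: star_iso_def bij_betw_def)
  note ops = star_homD(2-5)[OF hh, symmetric]
  show ?thesis
  proof
    show "\<zero>\<^bsub>B\<^esub> \<in> acarrier B" unfolding zero im by simp
  next
    fix a b c k l
    assume "a \<in> acarrier B"
    then obtain a' where a: "a' \<in> acarrier A" "a = h a'" unfolding im by blast
    show "k \<cdot>\<^bsub>B\<^esub> a \<in> acarrier B" "star\<^bsub>B\<^esub> a \<in> acarrier B"
      unfolding a(2) im using a(1) by (simp_all add: ops)
    show "a \<oplus>\<^bsub>B\<^esub> \<zero>\<^bsub>B\<^esub> = a" "a \<oplus>\<^bsub>B\<^esub> (-1) \<cdot>\<^bsub>B\<^esub> a = \<zero>\<^bsub>B\<^esub>" "(k + l) \<cdot>\<^bsub>B\<^esub> a = k \<cdot>\<^bsub>B\<^esub> a \<oplus>\<^bsub>B\<^esub> l \<cdot>\<^bsub>B\<^esub> a"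
      "k \<cdot>\<^bsub>B\<^esub> l \<cdot>\<^bsub>B\<^esub> a = (k * l) \<cdot>\<^bsub>B\<^esub> a" "1 \<cdot>\<^bsub>B\<^esub> a = a" "star\<^bsub>B\<^esub> (star\<^bsub>B\<^esub> a) = a"
      "star\<^bsub>B\<^esub> (k \<cdot>\<^bsub>B\<^esub> a) = cnj k \<cdot>\<^bsub>B\<^esub> star\<^bsub>B\<^esub> a"
      unfolding a(2) zero using a(1) by (simp_all add: ops A.add_neg A.add_scale A.star_scale)
    assume "b \<in> acarrier B"
    then obtain b' where b: "b' \<in> acarrier A" "b = h b'" unfolding im by blast
    show "a \<oplus>\<^bsub>B\<^esub> b \<in> acarrier B" "a \<otimes>\<^bsub>B\<^esub> b \<in> acarrier B"
      unfolding a(2) b(2) im using a(1) b(1) by (simp_all add: ops)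
    show "a \<oplus>\<^bsub>B\<^esub> b = b \<oplus>\<^bsub>B\<^esub> a" "k \<cdot>\<^bsub>B\<^esub> (a \<oplus>\<^bsub>B\<^esub> b) = k \<cdot>\<^bsub>B\<^esub> a \<oplus>\<^bsub>B\<^esub> k \<cdot>\<^bsub>B\<^esub> b"
      "(k \<cdot>\<^bsub>B\<^esub> a) \<otimes>\<^bsub>B\<^esub> b = k \<cdot>\<^bsub>B\<^esub> (a \<otimes>\<^bsub>B\<^esub> b)" "a \<otimes>\<^bsub>B\<^esub> (k \<cdot>\<^bsub>B\<^esub> b) = k \<cdot>\<^bsub>B\<^esub> (a \<otimes>\<^bsub>B\<^esub> b)"
      "star\<^bsub>B\<^esub> (a \<oplus>\<^bsub>B\<^esub> b) = star\<^bsub>B\<^esub> a \<oplus>\<^bsub>B\<^esub> star\<^bsub>B\<^esub> b" "star\<^bsub>B\<^esub> (a \<otimes>\<^bsub>B\<^esub> b) = star\<^bsub>B\<^esub> b \<otimes>\<^bsub>B\<^esub> star\<^bsub>B\<^esub> a"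
      unfolding a(2) b(2) using a(1) b(1)
      by (simp_all add: ops A.add_comm A.scale_add A.star_add A.star_mul)
    assume "c \<in> acarrier B"
    then obtain c' where c: "c' \<in> acarrier A" "c = h c'" unfolding im by blast
    show "a \<oplus>\<^bsub>B\<^esub> b \<oplus>\<^bsub>B\<^esub> c = a \<oplus>\<^bsub>B\<^esub> (b \<oplus>\<^bsub>B\<^esub> c)" "a \<otimes>\<^bsub>B\<^esub> b \<otimes>\<^bsub>B\<^esub> c = a \<otimes>\<^bsub>B\<^esub> (b \<otimes>\<^bsub>B\<^esub> c)"
      "a \<otimes>\<^bsub>B\<^esub> (b \<oplus>\<^bsub>B\<^esub> c) = a \<otimes>\<^bsub>B\<^esub> b \<oplus>\<^bsub>B\<^esub> a \<otimes>\<^bsub>B\<^esub> c" "(a \<oplus>\<^bsub>B\<^esub> b) \<otimes>\<^bsub>B\<^esub> c = a \<otimes>\<^bsub>B\<^esub> c \<oplus>\<^bsub>B\<^esub> b \<otimes>\<^bsub>B\<^esub> c"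
      unfolding a(2) b(2) c(2) using a(1) b(1) c(1)
      by (simp_all add: ops A.add_assoc A.mul_assoc A.mul_add A.add_mul)
  qed
qed

lemma star_iso_inverse:
  assumes A: "star_algebra A" and B: "star_algebra B" and h: "h \<in> star_iso A B"
  shows "restrict (inv_into (acarrier A) h) (acarrier B) \<in> star_hom B A"
proof -
  interpret A: star_algebra A by (rule A)
  interpret B: star_algebra B by (rule B)
  have hh: "h \<in> star_hom A B" and bij: "bij_betw h (acarrier A) (acarrier B)" using h by (auto simp: star_iso_def)
  note hD = star_homD[OF hh]
  let ?k = "inv_into (acarrier A) h"
  have k: "?k b \<in> acarrier A" "h (?k b) = b" if "b \<in> acarrier B" for b
    using bij that by (auto simp: bij_betw_def inv_into_into f_inv_into_f)
  have kI: "?k b = a" if "a \<in> acarrier A" "h a = b" for a b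
    using bij that by (auto simp: bij_betw_def)
  show ?thesis
  proof (rule star_homI[OF _ _ _ _ _ B])
    fix a b k assume a: "a \<in> acarrier B"
    show "?k a \<in> acarrier A" using a k by simp
    show "?k (k \<cdot>\<^bsub>B\<^esub> a) = k \<cdot>\<^bsub>A\<^esub> ?k a"
      by (rule kI) (use a k[OF a] in \<open>simp_all add: hD\<close>)
    show "?k (star\<^bsub>B\<^esub> a) = star\<^bsub>A\<^esub> (?k a)"
      by (rule kI) (use a k[OF a] in \<open>simp_all add: hD\<close>)
    assume b: "b \<in> acarrier B"
    show "?k (a \<oplus>\<^bsub>B\<^esub> b) = ?k a \<oplus>\<^bsub>A\<^esub> ?k b"
      by (rule kI) (use a b k[OF a] k[OF b] in \<open>simp_all add: hD\<close>)
    show "?k (a \<otimes>\<^bsub>B\<^esub> b) = ?k a \<otimes>\<^bsub>A\<^esub> ?k b"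
      by (rule kI) (use a b k[OF a] k[OF b] in \<open>simp_all add: hD\<close>)
  qed
qed

section \<open>The representation implements \<open>\<phi>\<close>\<close>

text \<open>
  The axioms of a \<open>*\<close>-algebra for \<open>steinberg X \<sigma>\<close> come for free from the bijection \<open>\<phi>\<close>. That its zero is the
  image of zero follows from \<open>\<phi>(0 * 0) = 0 * \<phi>(0)\<close>.
\<close>

locale canonical_iso = diagram +
  fixes \<phi> :: "(nat \<times> 'a lelem) set \<Rightarrow> 'a arrow \<Rightarrow> complex"
  assumes iso: "\<phi> \<in> star_iso (A_inf \<sigma> P) (steinberg X \<sigma>)" and canonical: "canonical_values \<sigma> P \<phi>"
begin

lemma phi_hom: "\<phi> \<in> star_hom (A_inf \<sigma> P) (steinberg X \<sigma>)"
  using iso by (simp add: star_iso_def)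

lemma steinberg_star_algebra: "star_algebra (steinberg X \<sigma>)"
proof (rule star_algebra_transfer[OF A_inf_alg iso])
  interpret star_algebra "A_inf \<sigma> P" by (rule A_inf_alg)
  have "\<phi> (0 \<cdot>\<^bsub>A_inf \<sigma> P\<^esub> \<zero>\<^bsub>A_inf \<sigma> P\<^esub>) = 0 \<cdot>\<^bsub>steinberg X \<sigma>\<^esub> \<phi> \<zero>\<^bsub>A_inf \<sigma> P\<^esub>"
    by (rule star_homD(4)[OF phi_hom zero_in])
  then show "\<zero>\<^bsub>steinberg X \<sigma>\<^esub> = \<phi> \<zero>\<^bsub>A_inf \<sigma> P\<^esub>" by (simp add: steinberg_def)
qed

sublocale steinberg_algebra X \<sigma>
  unfolding steinberg_algebra_def by (rule steinberg_star_algebra)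

definition phi_at :: "nat \<Rightarrow> 'a lelem \<Rightarrow> 'a arrow \<Rightarrow> complex" where
  "phi_at n a = \<phi> (to_A_inf \<sigma> P n a)"

lemma phi_at_hom:
  assumes "a \<in> acarrier (A (2 * n))"
  shows "phi_at n a \<in> acarrier ST"
    and "b \<in> acarrier (A (2 * n)) \<Longrightarrow> phi_at n (a \<oplus>\<^bsub>L (2 * n)\<^esub> b) = phi_at n a \<oplus>\<^bsub>ST\<^esub> phi_at n b"
    and "b \<in> acarrier (A (2 * n)) \<Longrightarrow> phi_at n (a \<otimes>\<^bsub>L (2 * n)\<^esub> b) = phi_at n a \<otimes>\<^bsub>ST\<^esub> phi_at n b"
    and "phi_at n (k \<cdot>\<^bsub>L (2 * n)\<^esub> a) = k \<cdot>\<^bsub>ST\<^esub> phi_at n a"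
    and "phi_at n (star\<^bsub>L (2 * n)\<^esub> a) = star\<^bsub>ST\<^esub> (phi_at n a)"
proof -
  interpret AS: star_system "\<lambda>n. A (2 * n)" "phi_A \<sigma> P" by (rule A_system)
  have i: "to_A_inf \<sigma> P n b \<in> acarrier (A_inf \<sigma> P)" if "b \<in> acarrier (A (2 * n))" for b
    unfolding A_inf_carrier using that by blast
  have ops: "x \<oplus>\<^bsub>L (2 * n)\<^esub> y = x \<oplus>\<^bsub>A (2 * n)\<^esub> y" "x \<otimes>\<^bsub>L (2 * n)\<^esub> y = x \<otimes>\<^bsub>A (2 * n)\<^esub> y"
    "k \<cdot>\<^bsub>L (2 * n)\<^esub> x = k \<cdot>\<^bsub>A (2 * n)\<^esub> x" "star\<^bsub>L (2 * n)\<^esub> x = star\<^bsub>A (2 * n)\<^esub> x" for x y k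
    by (simp_all add: A_corner)
  note lim = AS.lim_add AS.lim_mul AS.lim_scale AS.lim_star
  show "phi_at n a \<in> acarrier ST" unfolding phi_at_def by (rule star_homD(1)[OF phi_hom i[OF assms]])
  show "b \<in> acarrier (A (2 * n)) \<Longrightarrow> phi_at n (a \<oplus>\<^bsub>L (2 * n)\<^esub> b) = phi_at n a \<oplus>\<^bsub>ST\<^esub> phi_at n b"
    unfolding phi_at_def ops star_homD(2)[OF phi_hom i[OF assms] i, symmetric]
    by (simp only: to_A_inf_def A_inf_def AS.lim_add[OF assms])
  show "b \<in> acarrier (A (2 * n)) \<Longrightarrow> phi_at n (a \<otimes>\<^bsub>L (2 * n)\<^esub> b) = phi_at n a \<otimes>\<^bsub>ST\<^esub> phi_at n b"
    unfolding phi_at_def ops star_homD(3)[OF phi_hom i[OF assms] i, symmetric]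
    by (simp only: to_A_inf_def A_inf_def AS.lim_mul[OF assms])
  show "phi_at n (k \<cdot>\<^bsub>L (2 * n)\<^esub> a) = k \<cdot>\<^bsub>ST\<^esub> phi_at n a"
    unfolding phi_at_def ops star_homD(4)[OF phi_hom i[OF assms], symmetric]
    by (simp only: to_A_inf_def A_inf_def AS.lim_scale[OF assms])
  show "phi_at n (star\<^bsub>L (2 * n)\<^esub> a) = star\<^bsub>ST\<^esub> (phi_at n a)"
    unfolding phi_at_def ops star_homD(5)[OF phi_hom i[OF assms], symmetric]
    by (simp only: to_A_inf_def A_inf_def AS.lim_star[OF assms])
qed

lemma A_iff: "a \<in> acarrier (A n) \<longleftrightarrow> a \<in> acarrier (L n) \<and> range_sum n \<otimes>\<^bsub>L n\<^esub> a = a \<and> a \<otimes>\<^bsub>L n\<^esub> range_sum n = a"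
  unfolding A_corner by (rule star_projection.corner_iff[OF range_sum_projection])

lemma A_closed:
  shows "\<zero>\<^bsub>L n\<^esub> \<in> acarrier (A n)"
    and "a \<in> acarrier (A n) \<Longrightarrow> b \<in> acarrier (A n) \<Longrightarrow> a \<oplus>\<^bsub>L n\<^esub> b \<in> acarrier (A n)"
    and "a \<in> acarrier (A n) \<Longrightarrow> b \<in> acarrier (A n) \<Longrightarrow> a \<otimes>\<^bsub>L n\<^esub> b \<in> acarrier (A n)"
    and "a \<in> acarrier (A n) \<Longrightarrow> k \<cdot>\<^bsub>L n\<^esub> a \<in> acarrier (A n)"
    and "a \<in> acarrier (A n) \<Longrightarrow> star\<^bsub>L n\<^esub> a \<in> acarrier (A n)"
proof -
  interpret AA: star_algebra "A n" by (rule A_alg)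
  show "\<zero>\<^bsub>L n\<^esub> \<in> acarrier (A n)"
    "a \<in> acarrier (A n) \<Longrightarrow> b \<in> acarrier (A n) \<Longrightarrow> a \<oplus>\<^bsub>L n\<^esub> b \<in> acarrier (A n)"
    "a \<in> acarrier (A n) \<Longrightarrow> b \<in> acarrier (A n) \<Longrightarrow> a \<otimes>\<^bsub>L n\<^esub> b \<in> acarrier (A n)"
    "a \<in> acarrier (A n) \<Longrightarrow> k \<cdot>\<^bsub>L n\<^esub> a \<in> acarrier (A n)"
    "a \<in> acarrier (A n) \<Longrightarrow> star\<^bsub>L n\<^esub> a \<in> acarrier (A n)"
    unfolding A_corner
    by (rule AA.zero_in[unfolded A_corner corner_sel] AA.add_in[unfolded A_corner corner_sel]
      AA.mul_in[unfolded A_corner corner_sel] AA.scale_in[unfolded A_corner corner_sel]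
      AA.star_in[unfolded A_corner corner_sel]; assumption)+
qed

lemma repr_ropp:
  assumes r: "part_inj r"
    and S: "\<And>x k b y l c. ((x, k, b), (y, l, c)) \<in> r \<longleftrightarrow> \<not> b \<and> \<not> c \<and> (x, k - l, y) \<in> S"
  shows "represents (indicator S) (ropp r)"
  unfolding represents_def
proof (intro conjI allI)
  show "ropp r \<in> acarrier op_alg" by (rule ropp_in[OF r])
  fix p q :: "'a \<times> int \<times> bool"
  obtain x k b y l c where pq: "p = (x, k, b)" "q = (y, l, c)" by (cases p; cases q)
  have "fst (ropp r) (delta q) p = (if (p, q) \<in> r then 1 else 0)"
    by (simp add: ropp_def rop_delta[OF r])
  also have "\<dots> = mat (indicator S) p q" unfolding pq S by (auto simp: mat_def indicator_def)
  finally show "fst (ropp r) (delta q) p = mat (indicator S) p q" .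
qed

definition represented :: "nat \<Rightarrow> 'a lelem \<Rightarrow> bool" where
  "represented n a \<longleftrightarrow> a \<in> acarrier (A (2 * n)) \<and> represents (phi_at n a) (rep n a)"

lemma represented_add: assumes "represented n a" "represented n b" shows "represented n (a \<oplus>\<^bsub>L (2 * n)\<^esub> b)"
proof -
  have ab: "a \<in> acarrier (A (2 * n))" "b \<in> acarrier (A (2 * n))" and r: "represents (phi_at n a) (rep n a)" "represents (phi_at n b) (rep n b)"
    using assms by (auto simp: represented_def)
  have "rep n (a \<oplus>\<^bsub>L (2 * n)\<^esub> b) = rep n a \<oplus>\<^bsub>op_alg\<^esub> rep n b"
    by (rule star_homD(2)[OF rep_hom A_in_L[OF ab(1)] A_in_L[OF ab(2)]])
  moreover have "phi_at n (a \<oplus>\<^bsub>L (2 * n)\<^esub> b) = (\<lambda>\<gamma>. phi_at n a \<gamma> + phi_at n b \<gamma>)"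
    unfolding phi_at_hom(2)[OF ab] st_ops by (rule HOL.refl)
  ultimately show ?thesis using repr_add[OF r] A_closed(2)[OF ab] by (simp add: represented_def)
qed

lemma represented_mul: assumes "represented n a" "represented n b" shows "represented n (a \<otimes>\<^bsub>L (2 * n)\<^esub> b)"
proof -
  have ab: "a \<in> acarrier (A (2 * n))" "b \<in> acarrier (A (2 * n))" and r: "represents (phi_at n a) (rep n a)" "represents (phi_at n b) (rep n b)"
    using assms by (auto simp: represented_def)
  have "rep n (a \<otimes>\<^bsub>L (2 * n)\<^esub> b) = rep n a \<otimes>\<^bsub>op_alg\<^esub> rep n b"
    by (rule star_homD(3)[OF rep_hom A_in_L[OF ab(1)] A_in_L[OF ab(2)]])
  then show ?thesis
    using repr_mul[OF r phi_at_hom(1)[OF ab(1)] phi_at_hom(1)[OF ab(2)]] A_closed(3)[OF ab]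
    by (simp add: represented_def phi_at_hom(3)[OF ab])
qed

lemma represented_scale: assumes "represented n a" shows "represented n (k \<cdot>\<^bsub>L (2 * n)\<^esub> a)"
proof -
  have a: "a \<in> acarrier (A (2 * n))" and r: "represents (phi_at n a) (rep n a)" using assms by (auto simp: represented_def)
  have "rep n (k \<cdot>\<^bsub>L (2 * n)\<^esub> a) = k \<cdot>\<^bsub>op_alg\<^esub> rep n a" by (rule star_homD(4)[OF rep_hom A_in_L[OF a]])
  moreover have "phi_at n (k \<cdot>\<^bsub>L (2 * n)\<^esub> a) = (\<lambda>\<gamma>. k * phi_at n a \<gamma>)"
    unfolding phi_at_hom(4)[OF a] st_ops by (rule HOL.refl)
  ultimately show ?thesis using repr_scale[OF r] A_closed(4)[OF a] by (simp add: represented_def)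
qed

lemma represented_star: assumes "represented n a" shows "represented n (star\<^bsub>L (2 * n)\<^esub> a)"
proof -
  have a: "a \<in> acarrier (A (2 * n))" and r: "represents (phi_at n a) (rep n a)" using assms by (auto simp: represented_def)
  have "rep n (star\<^bsub>L (2 * n)\<^esub> a) = star\<^bsub>op_alg\<^esub> (rep n a)" by (rule star_homD(5)[OF rep_hom A_in_L[OF a]])
  then show ?thesis using repr_star[OF r] A_closed(5)[OF a] by (simp add: represented_def phi_at_hom(5)[OF a])
qed

lemma represented_vt: assumes v: "v \<in> F0 P (2 * n)" shows "represented n (vt (2 * n) v)"
proof -
  obtain U where U: "v = (2 * n, U)" "U \<in> P (2 * n)" using v by (auto simp: F0_def)
  have "vt (2 * n) v \<in> acarrier (A (2 * n))"
    unfolding A_iff range_sum_def using vt_vsum[of v "2 * n" "F0 P (2 * n)"] vt_in[of v "2 * n"] v by simp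
  moreover have "phi_at n (vt (2 * n) v) = indicator (Zset \<sigma> U 0 0 U)"
    using canonical U unfolding phi_at_def canonical_values_def by blast
  moreover have "represents (indicator (Zset \<sigma> U 0 0 U)) (ropp (vrel v))"
    by (rule repr_ropp[OF part_inj_vrel]) (auto simp: vrel_def Zset_def U(1))
  moreover have "rep n (vt (2 * n) v) = ropp (vrel v)" by (rule rep_vt) (use v in blast)
  ultimately show ?thesis by (simp add: represented_def)
qed

lemma represented_zero: "represented n \<zero>\<^bsub>L (2 * n)\<^esub>"
proof -
  interpret star_algebra "L (2 * n)" by (rule L_alg)
  note z = A_closed(1)[of "2 * n"]
  have "phi_at n (0 \<cdot>\<^bsub>L (2 * n)\<^esub> \<zero>\<^bsub>L (2 * n)\<^esub>) = 0 \<cdot>\<^bsub>ST\<^esub> phi_at n \<zero>\<^bsub>L (2 * n)\<^esub>"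
    by (rule phi_at_hom(4)[OF z])
  then have "phi_at n \<zero>\<^bsub>L (2 * n)\<^esub> = (\<lambda>_. 0)" by (simp add: st_ops)
  moreover have "rep n \<zero>\<^bsub>L (2 * n)\<^esub> = \<zero>\<^bsub>op_alg\<^esub>"
    by (rule star_hom_zero[OF rep_hom L_alg op_alg_star_algebra])
  ultimately show ?thesis using repr_zero z by (simp add: represented_def)
qed

text \<open>
  The values of \<open>\<phi>\<close> on \<open>e f\<^sup>*\<close> agree with the matrices of \<open>rep n\<close> in each of the four combinations of colours.
\<close>

lemma represented_edges:
  assumes e: "e \<in> F1 \<sigma> P (2 * n)" and f: "f \<in> F1 \<sigma> P (2 * n)" and s: "esource e = esource f"
  shows "represented n (ed (2 * n) e \<otimes>\<^bsub>L (2 * n)\<^esub> star\<^bsub>L (2 * n)\<^esub> (ed (2 * n) f))"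
proof -
  interpret star_algebra "L (2 * n)" by (rule L_alg)
  note in_L = ed_in[OF e] ed_in[OF f]
  have t: "range_sum (2 * n) \<in> acarrier (L (2 * n))" "star\<^bsub>L (2 * n)\<^esub> (range_sum (2 * n)) = range_sum (2 * n)"
    unfolding range_sum_def by (simp_all add: vsum_in vsum_star)
  have te: "range_sum (2 * n) \<otimes>\<^bsub>L (2 * n)\<^esub> ed (2 * n) h = ed (2 * n) h" if "h \<in> F1 \<sigma> P (2 * n)" for h
    unfolding range_sum_def using vsum_ed(1)[OF that, of "F0 P (2 * n)"] edge_ends(1)[OF that] by simp
  have tf: "star\<^bsub>L (2 * n)\<^esub> (ed (2 * n) f) \<otimes>\<^bsub>L (2 * n)\<^esub> range_sum (2 * n) = star\<^bsub>L (2 * n)\<^esub> (ed (2 * n) f)"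
    using star_mul[OF t(1) in_L(2)] te[OF f] t(2) by simp
  have "ed (2 * n) e \<otimes>\<^bsub>L (2 * n)\<^esub> star\<^bsub>L (2 * n)\<^esub> (ed (2 * n) f) \<in> acarrier (A (2 * n))"
    unfolding A_iff using in_L t(1) te[OF e] tf by (simp add: mul_assoc) (simp flip: mul_assoc)
  moreover have "phi_at n (ed (2 * n) e \<otimes>\<^bsub>L (2 * n)\<^esub> star\<^bsub>L (2 * n)\<^esub> (ed (2 * n) f)) = indicator (phi_support \<sigma> e f)"
    using canonical e f s unfolding phi_at_def canonical_values_def by blast
  moreover have "rep n (ed (2 * n) e \<otimes>\<^bsub>L (2 * n)\<^esub> star\<^bsub>L (2 * n)\<^esub> (ed (2 * n) f)) = ropp (erel e O (erel f)\<inverse>)"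
  proof -
    have pf: "part_inj ((erel f)\<inverse>)" using part_inj_erel[OF f] by simp
    have "rep n (ed (2 * n) e \<otimes>\<^bsub>L (2 * n)\<^esub> star\<^bsub>L (2 * n)\<^esub> (ed (2 * n) f)) =
        rep n (ed (2 * n) e) \<otimes>\<^bsub>op_alg\<^esub> star\<^bsub>op_alg\<^esub> (rep n (ed (2 * n) f))"
      using star_homD(3)[OF rep_hom in_L(1) star_in[OF in_L(2)]] star_homD(5)[OF rep_hom in_L(2)] by simp
    then show ?thesis by (simp only: rep_ed[OF e] rep_ed[OF f] ropp_star ropp_mul[OF part_inj_erel[OF e] pf])
  qed
  moreover have "represents (indicator (phi_support \<sigma> e f)) (ropp (erel e O (erel f)\<inverse>))"
  proof (rule repr_ropp)
    show "part_inj (erel e O (erel f)\<inverse>)"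
      by (rule part_inj_comp[OF part_inj_erel[OF e]]) (simp add: part_inj_erel[OF f])
    fix x k b y l c
    have lev: "elevel h = 2 * n" if "h \<in> F1 \<sigma> P (2 * n)" for h
      by (rule even_edge_cases[OF that]) simp_all
    obtain ce Z W cf Z' where ef: "e = Edge ce (2 * n) Z W" "f = Edge cf (2 * n) Z' W"
      using s lev[OF e] lev[OF f] by (cases e; cases f) (simp add: esource_def)
    show "((x, k, b), (y, l, c)) \<in> erel e O (erel f)\<inverse> \<longleftrightarrow> \<not> b \<and> \<not> c \<and> (x, k - l, y) \<in> phi_support \<sigma> e f"
    proof -
      have blue: "((x, k, b), (y, l, c)) \<in> erel (Edge Blue (2 * n) Z W) \<longleftrightarrow> \<not> b \<and> c \<and> y = x \<and> l = k \<and> x \<in> W"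
        and red: "((x, k, b), (y, l, c)) \<in> erel (Edge Red (2 * n) Z W) \<longleftrightarrow>
          \<not> b \<and> c \<and> y = \<sigma> x \<and> l = k - 1 \<and> x \<in> Z \<and> \<sigma> x \<in> W" for x k b y l c Z W
        by auto
      have "((x, k, b), (y, l, c)) \<in> erel e O (erel f)\<inverse> \<longleftrightarrow>
          (\<exists>z m d. ((x, k, b), (z, m, d)) \<in> erel e \<and> ((y, l, c), (z, m, d)) \<in> erel f)"
        by auto
      then show ?thesis
        unfolding ef by (cases ce; cases cf) (simp_all only: blue red phi_support.simps Zset_def, auto)
    qed
  qed
  ultimately show ?thesis by (simp add: represented_def)
qed

end


context diagram
begin

text \<open>
  The blue edge with source \<open>w\<close>; it is unique, as its range is the set of \<open>P n\<close> that contains \<open>snd w\<close>.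
\<close>

definition blue_into :: "nat \<Rightarrow> 'a vertex \<Rightarrow> 'a edge" where
  "blue_into n w = Edge Blue n (SOME Z. Z \<in> P n \<and> snd w \<subseteq> Z) (snd w)"

lemma blue_into_props:
  assumes "w \<in> F0 P (Suc n)"
  shows "blue_into n w \<in> F1 \<sigma> P n" "esource (blue_into n w) = w"
proof -
  obtain W where W: "w = (Suc n, W)" "W \<in> P (Suc n)" using assms by (auto simp: F0_def)
  have "\<exists>Z. Z \<in> P n \<and> snd w \<subseteq> Z" using refine_step[OF ref W(2), of n] W(1) by auto
  then have "(SOME Z. Z \<in> P n \<and> snd w \<subseteq> Z) \<in> P n \<and> snd w \<subseteq> (SOME Z. Z \<in> P n \<and> snd w \<subseteq> Z)" by (rule someI_ex)
  then show "blue_into n w \<in> F1 \<sigma> P n" "esource (blue_into n w) = w"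
    using W by (simp_all add: blue_into_def F1_def esource_def)
qed

text \<open>
  An element with \<open>l\<^sup>* l = u\<close> whose range lies in the corner \<open>A\<^sub>n\<close>: the vertex itself on the upper level, and
  a blue edge on the lower one.
\<close>

definition connector :: "nat \<Rightarrow> 'a vertex \<Rightarrow> 'a lelem" where
  "connector n u = (if u \<in> F0 P n then vt n u else ed n (blue_into n u))"

lemma connector_in: "u \<in> F0 P n \<union> F0 P (Suc n) \<Longrightarrow> connector n u \<in> acarrier (L n)"
  unfolding connector_def using vt_in[of u n] ed_in[OF blue_into_props(1)[of u n]] by auto

lemma vt_ed:
  assumes e: "e \<in> F1 \<sigma> P n" and w: "w \<in> F0 P n \<union> F0 P (Suc n)"
  shows "vt n w \<otimes>\<^bsub>L n\<^esub> ed n e = (if w = erange e then ed n e else \<zero>\<^bsub>L n\<^esub>)"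
    and "ed n e \<otimes>\<^bsub>L n\<^esub> vt n w = (if w = esource e then ed n e else \<zero>\<^bsub>L n\<^esub>)"
proof -
  have s: "{w} \<subseteq> F0 P n \<union> F0 P (Suc n)" using w by blast
  show "vt n w \<otimes>\<^bsub>L n\<^esub> ed n e = (if w = erange e then ed n e else \<zero>\<^bsub>L n\<^esub>)"
    using vsum_ed(1)[OF e s] unfolding vsum_single[OF w] by simp
  show "ed n e \<otimes>\<^bsub>L n\<^esub> vt n w = (if w = esource e then ed n e else \<zero>\<^bsub>L n\<^esub>)"
    using vsum_ed(2)[OF e s] unfolding vsum_single[OF w] by simp
qed

lemma connector_vt:
  assumes u: "u \<in> F0 P n \<union> F0 P (Suc n)" and w: "w \<in> F0 P n \<union> F0 P (Suc n)"
  shows "connector n u \<otimes>\<^bsub>L n\<^esub> vt n w = (if u = w then connector n u else \<zero>\<^bsub>L n\<^esub>)"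
proof (cases "u \<in> F0 P n")
  case True
  then show ?thesis using vt_mul[OF u w] by (auto simp: connector_def)
next
  case False
  then have "u \<in> F0 P (Suc n)" using u by blast
  from vt_ed(2)[OF blue_into_props(1)[OF this] w] blue_into_props(2)[OF this] show ?thesis
    using False by (auto simp: connector_def)
qed

lemma star_connector_connector:
  assumes u: "u \<in> F0 P n \<union> F0 P (Suc n)"
  shows "star\<^bsub>L n\<^esub> (connector n u) \<otimes>\<^bsub>L n\<^esub> connector n u = vt n u"
proof (cases "u \<in> F0 P n")
  case True
  then show ?thesis using famD(4)[of u n] vt_mul[OF u u] by (simp add: connector_def)
next
  case False
  then have u': "u \<in> F0 P (Suc n)" using u by blast
  let ?e = "blue_into n u"
  have e: "?e \<in> F1 \<sigma> P n" by (rule blue_into_props(1)[OF u'])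
  obtain Y where Y: "Y \<in> D_sep \<sigma> P (erange ?e)" "?e \<in> Y" by (rule D_sep_cover[OF e])
  have r: "erange ?e \<in> F0 P n" by (rule edge_ends(1)[OF e])
  then have "Y \<in> gsep (G n) (erange ?e)" using Y(1) unfolding gsep_iff by blast
  from leavitt_familyD(7)[OF fam _ this Y(2) Y(2)] r
  have "star\<^bsub>L n\<^esub> (ed n ?e) \<otimes>\<^bsub>L n\<^esub> ed n ?e = vt n (esource ?e)" by simp
  then show ?thesis using False blue_into_props(2)[OF u'] by (simp add: connector_def)
qed

end

context canonical_iso
begin

lemma represented_asum:
  assumes "finite I" "\<And>i. i \<in> I \<Longrightarrow> represented n (F i)"
  shows "represented n (asum (L (2 * n)) F I)"
  using assms
proof (induction I rule: finite_induct)
  case empty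
  interpret star_algebra "L (2 * n)" by (rule L_alg)
  show ?case using represented_zero by simp
next
  case (insert i I)
  interpret star_algebra "L (2 * n)" by (rule L_alg)
  have F: "F k \<in> acarrier (L (2 * n))" if "k \<in> insert i I" for k
    using insert.prems[OF that] A_in_L unfolding represented_def by blast
  have "asum (L (2 * n)) F (insert i I) = F i \<oplus>\<^bsub>L (2 * n)\<^esub> asum (L (2 * n)) F I"
    by (rule asum_insert[OF insert.hyps]) (use F in auto)
  also have "represented n \<dots>" by (rule represented_add) (use insert in auto)
  finally show ?case .
qed

text \<open>
  The corner is not closed under passing to factors, so an induction over terms of \<open>L\<^sub>2\<^sub>n\<close> has to leave it.
  The remedy is to move every element into the corner by connectors on both sides. A product is
  then split by inserting \<open>1 = \<Sum> l\<^sup>* l\<close> between its factors. For a generator all but one pair of connectors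
  give zero, and this pair gives a vertex or some \<open>e f\<^sup>*\<close>, for which \<open>\<phi>\<close> is prescribed.
\<close>

lemma represented_between:
  assumes a: "a \<in> acarrier (L (2 * n))"
    and "u \<in> F0 P (2 * n) \<union> F0 P (Suc (2 * n))" "w \<in> F0 P (2 * n) \<union> F0 P (Suc (2 * n))"
  shows "represented n (connector (2 * n) u \<otimes>\<^bsub>L (2 * n)\<^esub> (a \<otimes>\<^bsub>L (2 * n)\<^esub> star\<^bsub>L (2 * n)\<^esub> (connector (2 * n) w)))"
  using assms
proof (induction arbitrary: u w rule: leavitt_induct)
  interpret star_algebra "L (2 * n)" by (rule L_alg)
  let ?V = "F0 P (2 * n) \<union> F0 P (Suc (2 * n))" and ?M = "L (2 * n)"
  let ?l = "connector (2 * n)"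
  have l: "?l u \<in> acarrier ?M" if "u \<in> ?V" for u by (rule connector_in[OF that])
  note sl = star_in[OF l]
  have vt_star: "vt (2 * n) v \<otimes>\<^bsub>?M\<^esub> star\<^bsub>?M\<^esub> (?l w) = (if w = v then star\<^bsub>?M\<^esub> (?l w) else \<zero>\<^bsub>?M\<^esub>)"
    if v: "v \<in> ?V" and w: "w \<in> ?V" for v w
  proof -
    have "vt (2 * n) v \<otimes>\<^bsub>?M\<^esub> star\<^bsub>?M\<^esub> (?l w) = star\<^bsub>?M\<^esub> (?l w \<otimes>\<^bsub>?M\<^esub> vt (2 * n) v)"
      using star_mul[OF l[OF w] vt_in[OF v]] famD(4)[of v "2 * n"] v by simp
    then show ?thesis using connector_vt[OF w v] by simp
  qed
  { case (vtx v)
    then have v: "v \<in> ?V" and u: "u \<in> ?V" and w: "w \<in> ?V" by simp_all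
    show ?case
    proof (cases "u = v \<and> w = v")
      case False
      have "?l u \<otimes>\<^bsub>?M\<^esub> (vt (2 * n) v \<otimes>\<^bsub>?M\<^esub> star\<^bsub>?M\<^esub> (?l w)) = \<zero>\<^bsub>?M\<^esub>"
      proof (cases "w = v")
        case True
        then have "u \<noteq> v" using False by blast
        then have "?l u \<otimes>\<^bsub>?M\<^esub> vt (2 * n) v \<otimes>\<^bsub>?M\<^esub> star\<^bsub>?M\<^esub> (?l w) = \<zero>\<^bsub>?M\<^esub>"
          using connector_vt[OF u v] sl[OF w] by simp
        then show ?thesis using mul_assoc[OF l[OF u] vt_in[OF v] sl[OF w]] by simp
      qed (use vt_star[OF v w] l[OF u] in simp)
      then show ?thesis using represented_zero by simp
    next
      case True
      have eq: "?l u \<otimes>\<^bsub>?M\<^esub> (vt (2 * n) v \<otimes>\<^bsub>?M\<^esub> star\<^bsub>?M\<^esub> (?l w)) = ?l v \<otimes>\<^bsub>?M\<^esub> star\<^bsub>?M\<^esub> (?l v)"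
        using vt_star[OF v w] True by simp
      have "represented n (?l v \<otimes>\<^bsub>?M\<^esub> star\<^bsub>?M\<^esub> (?l v))"
      proof (cases "v \<in> F0 P (2 * n)")
        case True
        have "?l v \<otimes>\<^bsub>?M\<^esub> star\<^bsub>?M\<^esub> (?l v) = vt (2 * n) v"
          using True famD(4)[of v "2 * n"] vt_mul[OF v v] by (simp add: connector_def)
        then show ?thesis using represented_vt[OF True] by simp
      next
        case False
        then have v': "v \<in> F0 P (Suc (2 * n))" using v by blast
        have "?l v = ed (2 * n) (blue_into (2 * n) v)" using False by (simp add: connector_def)
        then show ?thesis using represented_edges[OF blue_into_props(1)[OF v'] blue_into_props(1)[OF v'] HOL.refl] by simp
      qed
      then show ?thesis unfolding eq .
    qed
  next
    case (edg e)
    then have e: "e \<in> F1 \<sigma> P (2 * n)" and u: "u \<in> ?V" and w: "w \<in> ?V" by simp_all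
    note ein = ed_in[OF e]
    have r: "erange e \<in> ?V" and s: "esource e \<in> ?V" using edge_ends[OF e] by blast+
    have re: "vt (2 * n) (erange e) \<otimes>\<^bsub>?M\<^esub> ed (2 * n) e = ed (2 * n) e"
      and se: "ed (2 * n) e \<otimes>\<^bsub>?M\<^esub> vt (2 * n) (esource e) = ed (2 * n) e"
      using vt_ed(1)[OF e r] vt_ed(2)[OF e s] by simp_all
    have left: "?l u \<otimes>\<^bsub>?M\<^esub> ed (2 * n) e = (if u = erange e then ed (2 * n) e else \<zero>\<^bsub>?M\<^esub>)"
    proof -
      have "?l u \<otimes>\<^bsub>?M\<^esub> ed (2 * n) e = ?l u \<otimes>\<^bsub>?M\<^esub> vt (2 * n) (erange e) \<otimes>\<^bsub>?M\<^esub> ed (2 * n) e"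
        using mul_assoc[OF l[OF u] vt_in[OF r] ein] re by simp
      then show ?thesis using connector_vt[OF u r] ein re edge_ends(1)[OF e] by (auto simp: connector_def)
    qed
    have right: "ed (2 * n) e \<otimes>\<^bsub>?M\<^esub> star\<^bsub>?M\<^esub> (?l w) =
        (if w = esource e then ed (2 * n) e \<otimes>\<^bsub>?M\<^esub> star\<^bsub>?M\<^esub> (ed (2 * n) (blue_into (2 * n) w)) else \<zero>\<^bsub>?M\<^esub>)"
    proof -
      have "ed (2 * n) e \<otimes>\<^bsub>?M\<^esub> star\<^bsub>?M\<^esub> (?l w) =
          ed (2 * n) e \<otimes>\<^bsub>?M\<^esub> (vt (2 * n) (esource e) \<otimes>\<^bsub>?M\<^esub> star\<^bsub>?M\<^esub> (?l w))"
        using mul_assoc[OF ein vt_in[OF s] sl[OF w]] se by simp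
      also have "\<dots> = (if w = esource e then ed (2 * n) e \<otimes>\<^bsub>?M\<^esub> star\<^bsub>?M\<^esub> (?l w) else \<zero>\<^bsub>?M\<^esub>)"
        unfolding vt_star[OF s w] using ein by simp
      also have "\<dots> = (if w = esource e then ed (2 * n) e \<otimes>\<^bsub>?M\<^esub> star\<^bsub>?M\<^esub> (ed (2 * n) (blue_into (2 * n) w)) else \<zero>\<^bsub>?M\<^esub>)"
        using F0_disjoint'[OF edge_ends(2)[OF e]] by (simp add: connector_def)
      finally show ?thesis .
    qed
    have eq: "?l u \<otimes>\<^bsub>?M\<^esub> (ed (2 * n) e \<otimes>\<^bsub>?M\<^esub> star\<^bsub>?M\<^esub> (?l w)) =
        (if u = erange e then ed (2 * n) e \<otimes>\<^bsub>?M\<^esub> star\<^bsub>?M\<^esub> (?l w) else \<zero>\<^bsub>?M\<^esub>)"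
      unfolding mul_assoc[OF l[OF u] ein sl[OF w], symmetric] left using sl[OF w] by simp
    have "represented n (ed (2 * n) e \<otimes>\<^bsub>?M\<^esub> star\<^bsub>?M\<^esub> (?l w))"
    proof (cases "w = esource e")
      case True
      then have w': "w \<in> F0 P (Suc (2 * n))" using edge_ends(2)[OF e] by simp
      have "represented n (ed (2 * n) e \<otimes>\<^bsub>?M\<^esub> star\<^bsub>?M\<^esub> (ed (2 * n) (blue_into (2 * n) w)))"
        by (rule represented_edges[OF e blue_into_props(1)[OF w']]) (use blue_into_props(2)[OF w'] True in simp)
      then show ?thesis using right True by simp
    next
      case False
      then show ?thesis using right represented_zero by simp
    qed
    then show ?case unfolding eq using represented_zero by simp
  next
    case zero
    then show ?case using represented_zero l sl by simp
  next
    case (add a b)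
    then have u: "u \<in> ?V" and w: "w \<in> ?V" by simp_all
    have "?l u \<otimes>\<^bsub>?M\<^esub> ((a \<oplus>\<^bsub>?M\<^esub> b) \<otimes>\<^bsub>?M\<^esub> star\<^bsub>?M\<^esub> (?l w)) =
        ?l u \<otimes>\<^bsub>?M\<^esub> (a \<otimes>\<^bsub>?M\<^esub> star\<^bsub>?M\<^esub> (?l w)) \<oplus>\<^bsub>?M\<^esub> ?l u \<otimes>\<^bsub>?M\<^esub> (b \<otimes>\<^bsub>?M\<^esub> star\<^bsub>?M\<^esub> (?l w))"
      using add.hyps l[OF u] sl[OF w] by (simp add: add_mul mul_add)
    then show ?case using represented_add[OF add.IH(1)[OF u w] add.IH(2)[OF u w]] by simp
  next
    case (mul a b)
    then have u: "u \<in> ?V" and w: "w \<in> ?V" and ab: "a \<in> acarrier ?M" "b \<in> acarrier ?M" by simp_all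
    let ?a = "?l u \<otimes>\<^bsub>?M\<^esub> a" and ?b = "b \<otimes>\<^bsub>?M\<^esub> star\<^bsub>?M\<^esub> (?l w)"
    have in_M: "?a \<in> acarrier ?M" "?b \<in> acarrier ?M" using ab l[OF u] sl[OF w] by simp_all
    have fin: "finite ?V" by simp
    have vtV: "vt (2 * n) \<in> ?V \<rightarrow> acarrier ?M" using vt_in by blast
    have "?l u \<otimes>\<^bsub>?M\<^esub> (a \<otimes>\<^bsub>?M\<^esub> b \<otimes>\<^bsub>?M\<^esub> star\<^bsub>?M\<^esub> (?l w)) = ?a \<otimes>\<^bsub>?M\<^esub> ?b"
      using ab l[OF u] sl[OF w] by (simp add: mul_assoc)
    also have "\<dots> = ?a \<otimes>\<^bsub>?M\<^esub> (unit_L (2 * n) \<otimes>\<^bsub>?M\<^esub> ?b)" using unit_L_unit(1)[OF in_M(2)] by simp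
    also have "\<dots> = asum ?M (\<lambda>v. ?a \<otimes>\<^bsub>?M\<^esub> (vt (2 * n) v \<otimes>\<^bsub>?M\<^esub> ?b)) ?V"
      unfolding unit_L_def vsum_def asum_mul[OF in_M(2) vtV]
      by (rule mul_asum[OF in_M(1)]) (use vt_in in_M(2) in auto)
    also have "\<dots> = asum ?M (\<lambda>v. (?l u \<otimes>\<^bsub>?M\<^esub> (a \<otimes>\<^bsub>?M\<^esub> star\<^bsub>?M\<^esub> (?l v))) \<otimes>\<^bsub>?M\<^esub> (?l v \<otimes>\<^bsub>?M\<^esub> ?b)) ?V"
    proof (rule asum_cong[OF HOL.refl])
      fix v assume v: "v \<in> ?V"
      show "?a \<otimes>\<^bsub>?M\<^esub> (vt (2 * n) v \<otimes>\<^bsub>?M\<^esub> ?b) =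
          (?l u \<otimes>\<^bsub>?M\<^esub> (a \<otimes>\<^bsub>?M\<^esub> star\<^bsub>?M\<^esub> (?l v))) \<otimes>\<^bsub>?M\<^esub> (?l v \<otimes>\<^bsub>?M\<^esub> ?b)"
        unfolding star_connector_connector[OF v, symmetric] using ab l[OF u] l[OF v] sl[OF v] in_M by (simp add: mul_assoc)
    qed (use ab l[OF u] l sl in_M(2) in auto)
    also have "represented n \<dots>"
      by (rule represented_asum[OF fin], rule represented_mul[OF mul.IH(1)[OF u] mul.IH(2)[OF _ w]])
    finally show ?case .
  next
    case (scale a k)
    then have u: "u \<in> ?V" and w: "w \<in> ?V" by simp_all
    have "?l u \<otimes>\<^bsub>?M\<^esub> ((k \<cdot>\<^bsub>?M\<^esub> a) \<otimes>\<^bsub>?M\<^esub> star\<^bsub>?M\<^esub> (?l w)) = k \<cdot>\<^bsub>?M\<^esub> (?l u \<otimes>\<^bsub>?M\<^esub> (a \<otimes>\<^bsub>?M\<^esub> star\<^bsub>?M\<^esub> (?l w)))"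
      using scale.hyps l[OF u] sl[OF w] by simp
    then show ?case using represented_scale[OF scale.IH[OF u w]] by simp
  next
    case (star a)
    then have u: "u \<in> ?V" and w: "w \<in> ?V" and a: "a \<in> acarrier ?M" by simp_all
    have "?l u \<otimes>\<^bsub>?M\<^esub> (star\<^bsub>?M\<^esub> a \<otimes>\<^bsub>?M\<^esub> star\<^bsub>?M\<^esub> (?l w)) = star\<^bsub>?M\<^esub> (?l w \<otimes>\<^bsub>?M\<^esub> (a \<otimes>\<^bsub>?M\<^esub> star\<^bsub>?M\<^esub> (?l u)))"
      using a l[OF u] l[OF w] sl[OF u] by (simp add: star_mul mul_assoc)
    then show ?case using represented_star[OF star.IH[OF w u]] by simp
  }
qed

text \<open>
  The sum of the upper vertices is the unit of the corner, so \<open>a\<close> is the sum of the \<open>v a w\<close>.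
\<close>

lemma represented_all: assumes a: "a \<in> acarrier (A (2 * n))" shows "represented n a"
proof -
  interpret star_algebra "L (2 * n)" by (rule L_alg)
  let ?M = "L (2 * n)" and ?F = "F0 P (2 * n)"
  have aL: "a \<in> acarrier ?M" and ta: "range_sum (2 * n) \<otimes>\<^bsub>?M\<^esub> a = a" and at: "a \<otimes>\<^bsub>?M\<^esub> range_sum (2 * n) = a"
    using a unfolding A_iff by blast+
  have v: "vt (2 * n) v \<in> acarrier ?M" if "v \<in> ?F" for v using vt_in[of v "2 * n"] that by blast
  have vF: "vt (2 * n) \<in> ?F \<rightarrow> acarrier ?M" using v by blast
  have "a = asum ?M (vt (2 * n)) ?F \<otimes>\<^bsub>?M\<^esub> (a \<otimes>\<^bsub>?M\<^esub> asum ?M (vt (2 * n)) ?F)"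
    using ta at unfolding range_sum_def vsum_def by simp
  also have "\<dots> = asum ?M (\<lambda>u. asum ?M (\<lambda>w. vt (2 * n) u \<otimes>\<^bsub>?M\<^esub> (a \<otimes>\<^bsub>?M\<^esub> vt (2 * n) w)) ?F) ?F"
  proof -
    have i: "(\<lambda>w. a \<otimes>\<^bsub>?M\<^esub> vt (2 * n) w) \<in> ?F \<rightarrow> acarrier ?M" using aL v by auto
    show ?thesis
      unfolding mul_asum[OF aL vF] asum_mul[OF asum_in[OF i] vF]
      by (rule asum_cong[OF HOL.refl]) (use mul_asum[OF v i] aL v in auto)
  qed
  also have "represented n \<dots>"
  proof (rule represented_asum[OF finite_F0], rule represented_asum[OF finite_F0])
    fix u w assume u: "u \<in> ?F" and w: "w \<in> ?F"
    have "connector (2 * n) u = vt (2 * n) u" "star\<^bsub>?M\<^esub> (connector (2 * n) w) = vt (2 * n) w"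
      using u w famD(4)[of w "2 * n"] by (simp_all add: connector_def)
    then show "represented n (vt (2 * n) u \<otimes>\<^bsub>?M\<^esub> (a \<otimes>\<^bsub>?M\<^esub> vt (2 * n) w))"
      using represented_between[OF aL, of u w] u w by simp
  qed
  finally show ?thesis .
qed

section \<open>Comparison of the norms\<close>

lemma seminorm_le_EN:
  assumes q: "cstar_seminorm ST q" and a: "a \<in> acarrier (A (2 * n))"
  shows "q (\<phi> (to_A_inf \<sigma> P n a)) \<le> EN (2 * n) a"
proof -
  interpret SQ: steinberg_seminorm X \<sigma> q
    unfolding steinberg_seminorm_def steinberg_seminorm_axioms_def
    using steinberg_algebra_axioms q injective_partition by blast
  have "represents (phi_at n a) (rep n a)" using represented_all[OF a] by (simp add: represented_def)
  from SQ.q_le_opnorm[OF phi_at_hom(1)[OF a] this] rep_le_EN[OF A_in_L[OF a]]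
  show ?thesis by (simp add: phi_at_def)
qed

text \<open>
  All representatives \<open>a\<^sub>k\<close> of \<open>x\<close> give the same \<open>\<phi>(x)\<close>, so the bound holds with the norm of each, and hence
  with their limit.
\<close>

lemma seminorm_le_B:
  assumes q: "cstar_seminorm ST q" and x: "x \<in> acarrier (A_inf \<sigma> P)"
  shows "q (\<phi> x) \<le> cnorm (B_inf \<sigma> P) (A_to_B \<sigma> P x)"
proof -
  interpret AS: star_system "\<lambda>n. A (2 * n)" "phi_A \<sigma> P" by (rule A_system)
  obtain n a where a: "a \<in> acarrier (A (2 * n))" "x = to_A_inf \<sigma> P n a" using x unfolding A_inf_carrier by blast
  have le: "q (\<phi> x) \<le> EN (2 * k) (transit (phi_A \<sigma> P) n k a)" if "n \<le> k" for k
  proof -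
    have "to_A_inf \<sigma> P k (transit (phi_A \<sigma> P) n k a) = x"
      unfolding a(2) to_A_inf_def by (rule AS.\<iota>_T[OF a(1) that])
    then show ?thesis using seminorm_le_EN[OF q AS.T_in[OF a(1) that]] by simp
  qed
  show ?thesis
    unfolding a(2)
    by (rule LIMSEQ_le_const[OF A_to_B_norm[OF a(1)]]) (use le a(2) in blast)
qed

text \<open>
  One inequality is the bound above for all \<open>C\<^sup>*\<close>-seminorms. For the other one the seminorm of \<open>B_inf\<close> is
  transported to the algebra of the groupoid along the inverse of \<open>\<phi>\<close>.
\<close>

lemma env_norm_phi:
  assumes x: "x \<in> acarrier (A_inf \<sigma> P)"
  shows "env_norm ST (\<phi> x) = cnorm (B_inf \<sigma> P) (A_to_B \<sigma> P x)"
proof (rule antisym)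
  show "env_norm ST (\<phi> x) \<le> cnorm (B_inf \<sigma> P) (A_to_B \<sigma> P x)"
    by (rule env_norm_least) (rule seminorm_le_B[OF _ x])
  interpret BI: cstar_algebra "B_inf \<sigma> P" by (rule B_inf_cstar)
  let ?k = "restrict (inv_into (acarrier (A_inf \<sigma> P)) \<phi>) (acarrier ST)"
  have k: "?k \<in> star_hom ST (A_inf \<sigma> P)" by (rule star_iso_inverse[OF A_inf_alg st iso])
  have kx: "?k (\<phi> x) = x"
    using iso x star_homD(1)[OF phi_hom x] by (simp add: star_iso_def bij_betw_def inv_into_f_f)
  have "cstar_seminorm (A_inf \<sigma> P) (\<lambda>y. cnorm (B_inf \<sigma> P) (A_to_B \<sigma> P y))"
    by (rule cstar_seminorm_pullback[OF A_to_B_hom BI.norm_cstar A_inf_alg])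
  from cstar_seminorm_pullback[OF k this st]
  have s: "cstar_seminorm ST (\<lambda>f. cnorm (B_inf \<sigma> P) (A_to_B \<sigma> P (?k f)))" .
  have "cnorm (B_inf \<sigma> P) (A_to_B \<sigma> P (?k (\<phi> x))) \<le> env_norm ST (\<phi> x)"
    by (rule env_norm_upper[OF _ s]) (rule seminorm_le_B[OF _ x])
  then show "cnorm (B_inf \<sigma> P) (A_to_B \<sigma> P x) \<le> env_norm ST (\<phi> x)" unfolding kx .
qed

lemma ST_seminormed: "cstar_seminormed ST (env_norm ST)"
proof -
  have "\<exists>K. \<forall>p. cstar_seminorm ST p \<longrightarrow> p f \<le> K" if "f \<in> acarrier ST" for f
  proof -
    have "f \<in> \<phi> ` acarrier (A_inf \<sigma> P)" using iso that by (simp add: star_iso_def bij_betw_def)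
    then obtain x where "x \<in> acarrier (A_inf \<sigma> P)" "f = \<phi> x" by blast
    then show ?thesis using seminorm_le_B by blast
  qed
  then have "cstar_seminorm ST (env_norm ST)" by (rule ST.env_norm_cstar_seminorm)
  then show ?thesis unfolding cstar_seminormed_def cstar_seminormed_axioms_def using st by blast
qed

lemma unique_extension:
  "\<exists>!\<psi>. \<psi> \<in> star_iso (B_inf \<sigma> P) (groupoid_cstar X \<sigma>) \<and>
    (\<forall>a\<in>acarrier (A_inf \<sigma> P). \<psi> (A_to_B \<sigma> P a) = to_groupoid_cstar X \<sigma> (\<phi> a))"
proof -
  interpret E: cstar_seminormed ST "env_norm ST" by (rule ST_seminormed)
  have GC: "groupoid_cstar X \<sigma> = completion ST (env_norm ST)" by (simp add: groupoid_cstar_def enveloping_def)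
  let ?i = "restrict (to_groupoid_cstar X \<sigma>) (acarrier ST)"
  let ?k = "restrict (?i \<circ> \<phi>) (acarrier (A_inf \<sigma> P))"
  have i: "?i \<in> star_hom ST (groupoid_cstar X \<sigma>)"
    unfolding GC to_enveloping_def by (rule E.to_completion_hom)
  have k: "?k \<in> star_hom (A_inf \<sigma> P) (groupoid_cstar X \<sigma>)"
    by (rule star_hom_comp[OF phi_hom i A_inf_alg])
  have k_eq: "?k x = to_groupoid_cstar X \<sigma> (\<phi> x)" if "x \<in> acarrier (A_inf \<sigma> P)" for x
    using that star_homD(1)[OF phi_hom that] by simp
  have dense: "dense_image (A_inf \<sigma> P) ?k (groupoid_cstar X \<sigma>)"
    unfolding dense_image_def
  proof (intro ballI allI impI)
    fix b and e :: real assume b: "b \<in> acarrier (groupoid_cstar X \<sigma>)" and e: "e > 0"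
    obtain f where f: "f \<in> acarrier ST" "cnorm (completion ST (env_norm ST)) (b \<ominus>\<^bsub>completion ST (env_norm ST)\<^esub> to_completion ST (env_norm ST) f) < e"
      using E.completion_dense[of b e] b e unfolding GC by blast
    have "f \<in> \<phi> ` acarrier (A_inf \<sigma> P)" using iso f(1) by (simp add: star_iso_def bij_betw_def)
    then obtain x where x: "x \<in> acarrier (A_inf \<sigma> P)" "f = \<phi> x" by blast
    have "?k x = to_completion ST (env_norm ST) f" using k_eq[OF x(1)] x(2) by (simp add: to_enveloping_def)
    then show "\<exists>a\<in>acarrier (A_inf \<sigma> P). cnorm (groupoid_cstar X \<sigma>) (b \<ominus>\<^bsub>groupoid_cstar X \<sigma>\<^esub> ?k a) < e"
      using f(2) x(1) unfolding GC by (intro bexI[of _ x]) simp_all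
  qed
  have norm: "cnorm (groupoid_cstar X \<sigma>) (?k x) = cnorm (B_inf \<sigma> P) (A_to_B \<sigma> P x)" if x: "x \<in> acarrier (A_inf \<sigma> P)" for x
  proof -
    have "cnorm (groupoid_cstar X \<sigma>) (to_groupoid_cstar X \<sigma> (\<phi> x)) = env_norm ST (\<phi> x)"
      unfolding GC to_enveloping_def by (rule E.cnorm_to_completion[OF star_homD(1)[OF phi_hom x]])
    then show ?thesis by (simp only: k_eq[OF x] env_norm_phi[OF x])
  qed
  have GCc: "cstar_algebra (groupoid_cstar X \<sigma>)" unfolding GC by (rule E.completion_cstar_algebra)
  have "\<exists>!\<psi>. \<psi> \<in> star_iso (B_inf \<sigma> P) (groupoid_cstar X \<sigma>) \<and> (\<forall>a\<in>acarrier (A_inf \<sigma> P). \<psi> (A_to_B \<sigma> P a) = ?k a)"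
    by (rule completions_unique_iso[OF A_inf_alg B_inf_cstar GCc A_to_B_hom A_to_B_dense k dense norm A_inf_unit])
  moreover have "(\<forall>a\<in>acarrier (A_inf \<sigma> P). \<psi> (A_to_B \<sigma> P a) = ?k a) \<longleftrightarrow>
      (\<forall>a\<in>acarrier (A_inf \<sigma> P). \<psi> (A_to_B \<sigma> P a) = to_groupoid_cstar X \<sigma> (\<phi> a))" for \<psi>
    by (rule ball_cong[OF HOL.refl]) (simp only: k_eq)
  ultimately show ?thesis by simp
qed

end

theorem theorem6p17:
  fixes X :: "'a::metric_space set"
    and \<sigma> :: "'a \<Rightarrow> 'a"
    and P :: "nat \<Rightarrow> 'a set set"
    and \<phi> :: "(nat \<times> 'a lelem) set \<Rightarrow> 'a arrow \<Rightarrow> complex"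
  assumes "compact X"
    and "\<forall>x\<in>X. connected_component_set X x = {x}"
    and "surj_local_homeo X \<sigma>"
    and "sigma_refined X \<sigma> P"
    and "\<phi> \<in> star_iso (A_inf \<sigma> P) (steinberg X \<sigma>)"
    and "canonical_values \<sigma> P \<phi>"
  shows "\<exists>!\<psi>. \<psi> \<in> star_iso (B_inf \<sigma> P) (groupoid_cstar X \<sigma>) \<and>
    (\<forall>a\<in>acarrier (A_inf \<sigma> P). \<psi> (A_to_B \<sigma> P a) = to_groupoid_cstar X \<sigma> (\<phi> a))"
proof -
  have "\<sigma> ` X = X" using assms(3) unfolding surj_local_homeo_def by (rule conjunct1)
  then interpret canonical_iso X \<sigma> P \<phi>
    using assms(4-6) by unfold_locales
  show ?thesis by (rule unique_extension)
qed

end
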